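(* Let $\zeta$ denote the Riemann zeta-function. For $\delta>0$, \begin{align*} (i)\quad & \inf_{T\in\mathbb{R},\ \sigma>1} \int_T^{T+\delta} |\zeta(\sigma+it)|\,dt = \frac{\pi^2 e^{-\gamma}}{24}\,\delta^2 + O(\delta^4),\\ (ii)\quad & \inf_{T\in\mathbb{R},\ \sigma>1} \int_T^{T+\delta} |\zeta(\sigma+it)|^{-1}\,dt = \frac{e^{-\gamma}}{4}\,\delta^2 + O(\delta^4). \end{align*} Moreover, both estimates remain valid if the infimum over $T$ is replaced by $\liminf_{T\to\infty}$.
   Context: $\gamma$ denotes Euler's constant. The implied constants in the $O$-terms do not depend on $\delta$. *)

theory Defs
  imports "HOL-Analysis.Analysis"
begin

(* The Dirichlet series, which is the Riemann zeta-function only on Re s > 1;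
   the statement evaluates it nowhere else. *)
definition zeta :: "complex \<Rightarrow> complex" where
  "zeta s = (\<Sum>n. 1 / of_nat (Suc n) powr s)"

definition zeta_integral :: "real \<Rightarrow> real \<Rightarrow> real \<Rightarrow> real" where
  "zeta_integral \<delta> T \<sigma> = integral {T..T + \<delta>} (\<lambda>t. norm (zeta (Complex \<sigma> t)))"

definition zeta_inv_integral :: "real \<Rightarrow> real \<Rightarrow> real \<Rightarrow> real" where
  "zeta_inv_integral \<delta> T \<sigma> = integral {T..T + \<delta>} (\<lambda>t. inverse (norm (zeta (Complex \<sigma> t))))"

(* f(d) = c d^2 + O(d^4) for d > 0, with the implied constant independent of d.
   Values are extended reals, so that Inf and Liminf need no boundedness conditions;
   the estimate itself forces f(d) to be finite. *)
definition quadratic_estimate :: "(real \<Rightarrow> ereal) \<Rightarrow> real \<Rightarrow> bool" where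
  "quadratic_estimate f c \<longleftrightarrow>
     (\<exists>C::real. \<forall>\<delta>>0. \<bar>f \<delta> - ereal (c * \<delta>^2)\<bar> \<le> ereal (C * \<delta>^4))"

end

theory Submission
  imports Defs "HOL-Complex_Analysis.Complex_Analysis" "HOL-Computational_Algebra.Computational_Algebra"
    "HOL-Real_Asymp.Real_Asymp" "HOL-Probability.Probability"
begin

text \<open>Let \<open>k = 1\<close> for \<open>|zeta|\<close>, \<open>k = -1\<close> for its inverse, and \<open>h = \<delta>/2\<close>.

Lower bound: by Jensen's inequality the integral of \<open>|zeta|^k\<close> is at least \<open>\<delta>\<close> times the exponential of the mean
of \<open>k ln |zeta|\<close>. In the Euler product every prime may be given its worst phase, which leaves
\<open>\<delta> exp (corr_sum k - S h)\<close> up to a factor \<open>1 + O(\<delta>^2)\<close>, where \<open>S h\<close> is the sum of \<open>|sin (h ln p)| / (h p ln p)\<close>.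

Evaluation of \<open>S h\<close>: write \<open>|sin|\<close> as \<open>sin\<close> plus twice its negative part. The \<open>sin\<close> part is an average of
\<open>ln zeta\<close> near \<open>1\<close>. The negative part lives on large primes and is smoothed by a kernel whose Fourier transform is
supported near \<open>0\<close>, so that again only \<open>zeta\<close> near \<open>1\<close> matters; no prime number theorem is needed. The
result is \<open>- ln h + ln 2 + \<gamma> + corr_sum (-1) + O(h^2)\<close>.

Upper bound: Jensen's inequality is sharp if the logarithm is nearly constant on the interval. With
\<open>p powr (-iT) = - k sgn (sin (h ln p))\<close> it would be constant. The square wave \<open>sgn sin\<close> is replaced by a
trigonometric polynomial (a primitive of a Jackson kernel) whose frequencies stay where \<open>ln zeta\<close> is known; its
values in \<open>[-1,1]\<close> are the means of random signs, some choice of signs is at least as good as the average,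
and Kronecker's theorem realises the signs for arbitrarily large \<open>T\<close>.\<close>

section \<open>Euler product and the prime zeta function near 1\<close>

text \<open>The relative error must be 1 + O(h^2), second order in h; this forces symmetric devices
  throughout: means over [-h, h], an even kernel, second differences. The polynomial replacing the
  square wave can have degree about 1/h, since ln zeta is known in a fixed disc only. That resolves
  the jumps, which lie at ln p = m pi / h, on the scale 1 in ln p; the damage at the m-th jump is
  O(h^2 / m^2), hence summable. A factor \<theta> in front of cos (t ln p) can be realised by a
  phase of p^(-iT) only for \<theta> = 1 and \<theta> = -1, while the polynomial takes values in
  between; hence the random signs. The loss in Jensen's inequality is quadratic in the oscillation
  of the logarithm, so an oscillation O(h) is good enough. Origin of the constants: exp (- S h) is
  about (h/2) exp (- \<gamma> - \<open>corr_sum (-1)\<close>), and h = \<delta>/2 gives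
  \<delta>^2/4. For k = 1 there remains \<open>corr_sum 1 - corr_sum (-1)\<close>, which is ln
  zeta(2) = ln (pi^2/6) and turns 1/4 into pi^2/24.\<close>

definition primes_upto :: "nat \<Rightarrow> nat set" where
 "primes_upto N = {p. p \<le> N \<and> prime p}"

lemma finite_primes_upto [simp, intro]: "finite (primes_upto N)"
 by (simp add: primes_upto_def)

lemma prime_of_primes_upto: "p \<in> primes_upto N ==> prime p"
 by (simp add: primes_upto_def)

lemma primes_upto_ge_2: "p \<in> primes_upto N ==> p \<ge> 2"
 by (simp add: primes_upto_def prime_ge_2_nat)

lemma sum_primes_upto:
 "sum f (primes_upto N) = (\<Sum>n<Suc N. if prime n then f n else 0)"
proof -
 have "primes_upto N = {n\<in>{..<Suc N}. prime n}"
  by (auto simp: primes_upto_def)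
 thus ?thesis
  by (simp only: sum.inter_filter finite_lessThan)
qed

lemma sums_primes_upto:
 assumes "(\<lambda>n. if prime n then f n else 0) sums s"
 shows "(\<lambda>N. sum f (primes_upto N)) \<longlonglongrightarrow> s"
 unfolding sum_primes_upto using assms unfolding sums_def
 by (rule filterlim_compose) (rule filterlim_Suc)

lemma norm_nat_powr: "n > 0 ==> norm (of_nat n powr (s::complex)) = real n powr Re s"
 by (simp add: norm_powr_real_powr)

section \<open>Absolute convergence and the Euler product by sieving\<close>

lemma summable_nat_powr_complex:
 assumes "Re s > 1"
 shows "summable (\<lambda>n. norm (of_nat n powr (-s) :: complex))"
proof (rule summable_comparison_test_ev)
 show "summable (\<lambda>n. real n powr (- Re s))"
  using assms by (simp add: summable_real_powr_iff)
 show "eventually (\<lambda>n. norm (norm (of_nat n powr (-s) :: complex)) \<le> real n powr (- Re s)) sequentially"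
  using eventually_gt_at_top[of "0::nat"] by eventually_elim (simp add: norm_nat_powr)
qed

lemma nat_powr_abs_summable:
 assumes "Re s > 1"
 shows "(\<lambda>n. norm (of_nat n powr (-s) :: complex)) summable_on A"
proof -
 have "(\<lambda>n. norm (of_nat n powr (-s) :: complex)) summable_on UNIV"
  using summable_nat_powr_complex[OF assms] by (intro norm_summable_imp_summable_on) auto
 thus ?thesis by (rule summable_on_subset_banach) simp
qed

lemma zeta_eq_suminf:
 assumes "Re s > 1"
 shows "(\<lambda>n. of_nat n powr (-s)) sums zeta s"
proof -
 have "summable (\<lambda>n. of_nat n powr (-s) :: complex)"
  using summable_nat_powr_complex[OF assms] by (rule summable_norm_cancel)
 hence "(\<lambda>n. of_nat (Suc n) powr (-s) :: complex) sums ((\<Sum>n. of_nat n powr (-s)) - 0)"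
  using sums_Suc_iff[of "\<lambda>n. of_nat n powr (-s) :: complex"] by (simp add: summable_sums)
 moreover have "(\<lambda>n. of_nat (Suc n) powr (-s) :: complex) = (\<lambda>n. 1 / of_nat (Suc n) powr s)"
  by (simp add: powr_minus_divide)
 ultimately have "zeta s = (\<Sum>n. of_nat n powr (-s))"
  unfolding zeta_def by (simp add: sums_iff)
 with \<open>summable _\<close> show ?thesis by (simp add: summable_sums)
qed

definition coprime_nats :: "nat set \<Rightarrow> nat set" where
 "coprime_nats F = {n. n > 0 \<and> (\<forall>p\<in>F. \<not> p dvd n)}"

text \<open>Sieving one prime at a time: the integers prime to \<open>F\<close> are those also prime
  to \<open>p\<close> together with \<open>p\<close> times all integers prime to \<open>F\<close>,
  so adjoining \<open>p\<close> multiplies the sum by 1 - p^-s.\<close>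

lemma infsum_coprime_nats:
 assumes "finite F" "\<And>p. p \<in> F ==> prime p" "Re s > 1"
 shows "infsum (\<lambda>n. of_nat n powr (-s) :: complex) (coprime_nats F)
      = zeta s * (\<Prod>p\<in>F. 1 - of_nat p powr (-s))"
 using assms(1,2)
proof (induction F rule: finite_induct)
 case empty
 have "((\<lambda>n. of_nat n powr (-s)) has_sum zeta s) (UNIV :: nat set)"
  using summable_nat_powr_complex[OF assms(3)] zeta_eq_suminf[OF assms(3)]
  by (intro norm_summable_imp_has_sum) auto
 hence "((\<lambda>n. of_nat n powr (-s)) has_sum zeta s) (coprime_nats {})"
  by (rule has_sum_cong_neutral[THEN iffD1, rotated -1]) (auto simp: coprime_nats_def)
 thus ?case by (simp add: infsumI)
next
 case (insert p F)
 let ?f = "\<lambda>n. of_nat n powr (-s) :: complex"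
 have p: "prime p" using insert by auto
 have split: "coprime_nats F = coprime_nats (insert p F) \<union> (\<lambda>n. p * n) ` coprime_nats F"
 proof (intro equalityI subsetI)
  fix n assume n: "n \<in> coprime_nats F"
  show "n \<in> coprime_nats (insert p F) \<union> (\<lambda>n. p * n) ` coprime_nats F"
  proof (cases "p dvd n")
   case True
   then obtain m where m: "n = p * m" by auto
   hence "m \<in> coprime_nats F" using n by (auto simp: coprime_nats_def)
   thus ?thesis using m by auto
  qed (use n in \<open>auto simp: coprime_nats_def\<close>)
 next
  fix n assume "n \<in> coprime_nats (insert p F) \<union> (\<lambda>n. p * n) ` coprime_nats F"
  thus "n \<in> coprime_nats F"
  proof
   assume "n \<in> (\<lambda>n. p * n) ` coprime_nats F"
   then obtain m where m: "n = p * m" "m \<in> coprime_nats F" by auto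
   have "\<not> q dvd n" if "q \<in> F" for q
   proof
    assume "q dvd n"
    moreover have "prime q" using that insert by auto
    ultimately have "q dvd p \<or> q dvd m" using m prime_dvd_multD by blast
    thus False
     using that m(2) insert.hyps(2) p \<open>prime q\<close> primes_dvd_imp_eq[of q p]
     by (auto simp: coprime_nats_def)
   qed
   thus ?thesis using m p by (auto simp: coprime_nats_def prime_gt_0_nat)
  qed (auto simp: coprime_nats_def)
 qed
 have disj: "coprime_nats (insert p F) \<inter> (\<lambda>n. p * n) ` coprime_nats F = {}"
  by (auto simp: coprime_nats_def)
 have sm: "?f summable_on A" for A
  by (rule Infinite_Sum.abs_summable_summable[OF nat_powr_abs_summable[OF assms(3)]])
 have inj: "inj_on (\<lambda>n. p * n) (coprime_nats F)"
  using p by (auto simp: inj_on_def prime_gt_0_nat)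
 have "infsum ?f ((\<lambda>n. p * n) ` coprime_nats F) = infsum (?f \<circ> (\<lambda>n. p * n)) (coprime_nats F)"
  by (rule infsum_reindex[OF inj])
 also have "?f \<circ> (\<lambda>n. p * n) = (\<lambda>n. ?f p * ?f n)"
  by (auto simp: fun_eq_iff powr_times_real)
 also have "infsum \<dots> (coprime_nats F) = ?f p * infsum ?f (coprime_nats F)"
  by (rule infsum_cmult_right')
 finally have "infsum ?f (coprime_nats F)
   = infsum ?f (coprime_nats (insert p F)) + ?f p * infsum ?f (coprime_nats F)"
  using infsum_Un_disjoint[OF sm sm disj] split by simp
 hence "infsum ?f (coprime_nats (insert p F)) = (1 - ?f p) * infsum ?f (coprime_nats F)"
  by (simp add: algebra_simps)
 thus ?case using insert by simp
qed

text \<open>Once the primes up to \<open>N\<close> are sieved out, only 1 and integers beyond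
  \<open>N\<close> survive, so the distance to 1 is at most a tail of the absolutely convergent
  series. In this form, with the product inverted, the non-vanishing of zeta is immediate.\<close>

lemma zeta_Euler_product:
 assumes "Re s > 1"
 shows "(\<lambda>N. zeta s * (\<Prod>p\<in>primes_upto N. 1 - of_nat p powr (-s))) \<longlonglongrightarrow> 1"
proof -
 let ?f = "\<lambda>n. of_nat n powr (-s) :: complex"
 have sm: "summable (\<lambda>n. norm (?f n))" by (rule summable_nat_powr_complex[OF assms])
 have smo: "(\<lambda>n. norm (?f n)) summable_on A" for A
  by (rule nat_powr_abs_summable[OF assms])
 have bound: "norm (zeta s * (\<Prod>p\<in>primes_upto N. 1 - ?f p) - 1) \<le> (\<Sum>n. norm (?f n)) - (\<Sum>n<Suc N. norm (?f n))"
  for N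
 proof -
  let ?C = "coprime_nats (primes_upto N)"
  have 1: "1 \<in> ?C" by (auto simp: coprime_nats_def dest: prime_of_primes_upto)
  have "zeta s * (\<Prod>p\<in>primes_upto N. 1 - ?f p) = infsum ?f ?C"
   by (rule infsum_coprime_nats[symmetric]) (auto intro: assms prime_of_primes_upto)
  also have "?C = insert 1 (?C - {1})" using 1 by auto
  also have "infsum ?f \<dots> = ?f 1 + infsum ?f (?C - {1})"
   by (rule infsum_insert[OF Infinite_Sum.abs_summable_summable[OF smo]]) simp
  finally have "norm (zeta s * (\<Prod>p\<in>primes_upto N. 1 - ?f p) - 1) = norm (infsum ?f (?C - {1}))"
   by simp
  also have "\<dots> \<le> infsum (\<lambda>n. norm (?f n)) (?C - {1})"
   by (rule norm_infsum_bound) (rule smo)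
  also have "\<dots> \<le> infsum (\<lambda>n. norm (?f n)) {Suc N..}"
  proof (rule infsum_mono_neutral)
   fix n assume n: "n \<in> (?C - {1}) - {Suc N..}"
   hence "n > 1" by (auto simp: coprime_nats_def)
   then obtain p where "prime p" "p dvd n" by (metis less_irrefl prime_factor_nat)
   hence "p \<in> primes_upto N"
    using n \<open>n > 1\<close> by (auto simp: primes_upto_def dest!: dvd_imp_le)
   thus "norm (?f n) \<le> 0" using n \<open>p dvd n\<close> by (auto simp: coprime_nats_def)
  qed (use smo in auto)
  also have "\<dots> = (\<Sum>n. norm (?f n)) - (\<Sum>n<Suc N. norm (?f n))"
  proof -
   have "((\<lambda>n. norm (?f n)) has_sum (\<Sum>n. norm (?f n))) UNIV"
    using sm by (intro norm_summable_imp_has_sum) (auto simp: summable_sums)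
   hence "((\<lambda>n. norm (?f n)) has_sum ((\<Sum>n. norm (?f n)) - (\<Sum>n<Suc N. norm (?f n)))) (UNIV - {..<Suc N})"
    by (intro has_sum_Diff has_sum_finite) auto
   moreover have "UNIV - {..<Suc N} = {Suc N..}" by auto
   ultimately show ?thesis by (simp add: infsumI)
  qed
  finally show ?thesis .
 qed
 have "(\<lambda>N. (\<Sum>n. norm (?f n)) - (\<Sum>n<Suc N. norm (?f n))) \<longlonglongrightarrow> (\<Sum>n. norm (?f n)) - (\<Sum>n. norm (?f n))"
  by (intro tendsto_intros filterlim_compose[OF summable_LIMSEQ[OF sm] filterlim_Suc])
 hence "(\<lambda>N. (\<Sum>n. norm (?f n)) - (\<Sum>n<Suc N. norm (?f n))) \<longlonglongrightarrow> 0" by simp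
 hence "(\<lambda>N. zeta s * (\<Prod>p\<in>primes_upto N. 1 - ?f p) - 1) \<longlonglongrightarrow> 0"
  by (rule Lim_null_comparison[OF always_eventually[OF allI[OF bound]]])
 thus ?thesis by (simp add: LIM_zero_iff)
qed

lemma zeta_nonzero: "Re s > 1 ==> zeta s \<noteq> 0"
 using zeta_Euler_product[of s] by (auto simp: LIMSEQ_const_iff)

lemma continuous_on_zeta_vertical:
 assumes "\<sigma> > 1"
 shows "continuous_on UNIV (\<lambda>t. zeta (Complex \<sigma> t))"
proof -
 have "uniform_limit UNIV (\<lambda>N t. \<Sum>n<N. of_nat n powr (- Complex \<sigma> t)) (\<lambda>t. \<Sum>n. of_nat n powr (- Complex \<sigma> t)) sequentially"
 proof (rule Weierstrass_m_test)
  show "norm (of_nat n powr (- Complex \<sigma> t) :: complex) \<le> real n powr (-\<sigma>)" for n t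
   by (cases "n = 0") (simp_all add: norm_nat_powr)
  show "summable (\<lambda>n. real n powr (-\<sigma>))"
   using assms by (simp add: summable_real_powr_iff)
 qed
 moreover have "(\<Sum>n. of_nat n powr (- Complex \<sigma> t)) = zeta (Complex \<sigma> t)" for t
  using zeta_eq_suminf[of "Complex \<sigma> t"] assms by (simp add: sums_iff)
 ultimately have ul: "uniform_limit UNIV (\<lambda>N t. \<Sum>n<N. of_nat n powr (- Complex \<sigma> t)) (\<lambda>t. zeta (Complex \<sigma> t)) sequentially"
  by simp
 have cont: "continuous_on UNIV (\<lambda>t. \<Sum>n<N. of_nat n powr (- Complex \<sigma> t) :: complex)" for N
 proof (intro continuous_on_sum)
  fix n
  have "continuous_on UNIV (\<lambda>t. - Complex \<sigma> t)"
   unfolding Complex_eq by (intro continuous_intros)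
  thus "continuous_on UNIV (\<lambda>t. of_nat n powr (- Complex \<sigma> t) :: complex)"
   by (cases "n = 0") (auto simp: powr_def intro!: continuous_intros)
 qed
 show ?thesis
  by (rule uniform_limit_theorem[OF always_eventually[OF allI[OF cont]] ul]) simp
qed

section \<open>The pole of zeta at 1\<close>

text \<open>The expression is s - 1 times the difference of a^-s and the integral of x^-s over
  [a, a + 1]. Two mean value bounds along a real segment gain one power of \<open>a\<close>, which
  carries the summation over \<open>a\<close> past the line Re s = 1.\<close>

lemma norm_powr_second_difference:
 fixes s :: complex and a :: real
 assumes "a \<ge> 1" "Re s > 0"
 shows "norm ((s-1) * of_real a powr (-s) + of_real (a+1) powr (1-s) - of_real a powr (1-s))
      \<le> norm (s-1) * norm s * a powr (-Re s - 1)"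
proof -
 define S where "S = closed_segment (complex_of_real a) (of_real (a+1))"
 have S: "\<exists>x. z = of_real x \<and> a \<le> x \<and> x \<le> a + 1" if "z \<in> S" for z
  using that by (auto simp: S_def closed_segment_of_real closed_segment_eq_real_ivl simp del: of_real_add)
 have nonpos: "z \<notin> \<real>\<^sub>\<le>\<^sub>0" "z \<noteq> 0" if "z \<in> S" for z
  using S[OF that] assms by auto
 have a_in: "of_real a \<in> S" "of_real (a+1) \<in> S" unfolding S_def by auto
 have 1: "norm (z powr (-s) - of_real a powr (-s)) \<le> norm s * a powr (-Re s - 1)" if z: "z \<in> S" for z
 proof -
  have "norm (z powr (-s) - of_real a powr (-s)) \<le> (norm s * a powr (-Re s - 1)) * norm (z - of_real a)"
  proof (rule field_differentiable_bound[where S = S and f' = "\<lambda>z. -s * z powr (-s-1)"])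
   show "convex S" by (simp add: S_def)
   show "((\<lambda>z. z powr (-s)) has_field_derivative - s * z powr (-s - 1)) (at z within S)" if "z \<in> S" for z
    using nonpos[OF that] by (auto intro!: derivative_eq_intros)
   show "norm (- s * z powr (-s-1)) \<le> norm s * a powr (-Re s - 1)" if z: "z \<in> S" for z
   proof -
    obtain x where x: "z = of_real x" "a \<le> x" using S[OF z] by auto
    hence "norm (z powr (-s-1)) = x powr (-Re s - 1)"
     using assms by (simp add: norm_powr_real_powr)
    also have "\<dots> \<le> a powr (-Re s - 1)"
     using assms x by (intro powr_mono2') auto
    finally show ?thesis by (simp add: norm_mult mult_left_mono)
   qed
  qed (use z a_in in auto)
  also have "\<dots> \<le> (norm s * a powr (-Re s - 1)) * 1"
   using S[OF z] by (intro mult_left_mono) (auto simp flip: of_real_diff)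
  finally show ?thesis by simp
 qed
 let ?\<phi> = "\<lambda>z. z powr (1-s) - (1-s) * z * of_real a powr (-s)"
 have "norm (?\<phi> (of_real (a+1)) - ?\<phi> (of_real a)) \<le> (norm (s-1) * norm s * a powr (-Re s - 1)) * norm (of_real (a+1) - complex_of_real a)"
 proof (rule field_differentiable_bound[where S = S and f' = "\<lambda>z. (1-s) * (z powr (-s) - of_real a powr (-s))"])
  show "(?\<phi> has_field_derivative (1-s) * (z powr (-s) - of_real a powr (-s))) (at z within S)" if "z \<in> S" for z
   using nonpos[OF that] by (auto intro!: derivative_eq_intros simp: algebra_simps)
  show "norm ((1-s) * (z powr (-s) - of_real a powr (-s))) \<le> norm (s-1) * norm s * a powr (-Re s - 1)" if z: "z \<in> S" for z
   using mult_left_mono[OF 1[OF z], of "norm (s-1)"] by (simp add: norm_mult norm_minus_commute mult_ac)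
 qed (use a_in in \<open>auto simp: S_def\<close>)
 also have "?\<phi> (of_real (a+1)) - ?\<phi> (of_real a) = (s-1) * of_real a powr (-s) + of_real (a+1) powr (1-s) - of_real a powr (1-s)"
  by (simp add: algebra_simps)
 finally show ?thesis by simp
qed

text \<open>The telescoping series of \<open>(n+1) powr (1-s) - n powr (1-s)\<close> removes the pole of zeta at 1.\<close>
lemma zeta_pole_removal:
 obtains Z where "Z holomorphic_on ball 1 (1/2)" "Z 1 = 1"
  "\<And>s. s \<in> ball 1 (1/2) ==> Re s > 1 ==> (s - 1) * zeta s = Z s"
proof -
 define z where "z = (\<lambda>n s. (s-1) * of_nat (Suc n) powr (-s) + of_nat (Suc (Suc n)) powr (1-s) - of_nat (Suc n) powr (1-s) :: complex)"
 define z' where "z' = (\<lambda>n s. deriv (z n) s)"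
 have der: "(z n has_field_derivative z' n s) (at s)" for n s
 proof -
  have "z n holomorphic_on UNIV" unfolding z_def
   by (intro holomorphic_intros)
  thus ?thesis unfolding z'_def using holomorphic_derivI open_UNIV by blast
 qed
 have bound: "norm (z n s) \<le> real (Suc n) powr (-3/2)" if "s \<in> ball 1 (1/2)" for n s
 proof -
  have s1: "norm (s - 1) < 1/2" using that by (simp add: dist_norm norm_minus_commute)
  have re: "Re s > 1/2" using s1 abs_Re_le_cmod[of "s-1"] by (simp add: abs_if split: if_splits)
  have ns: "norm s \<le> 2" using norm_triangle_ineq[of "s-1" 1] s1 by simp
  have "norm (z n s) \<le> norm (s-1) * norm s * real (Suc n) powr (-Re s - 1)"
   using norm_powr_second_difference[of "real (Suc n)" s] re by (simp add: z_def add_ac)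
  also have "\<dots> \<le> (1/2 * 2) * real (Suc n) powr (-3/2)"
   using s1 ns re by (intro mult_mono powr_mono) auto
  finally show ?thesis by simp
 qed
 have sm: "summable (\<lambda>n. real (Suc n) powr (-3/2))"
  by (subst summable_Suc_iff) (simp add: summable_real_powr_iff)
 have ev: "\<forall>\<^sub>F n in sequentially. \<forall>s\<in>ball 1 (1/2). norm (z n s) \<le> real (Suc n) powr (-3/2)"
  using bound by (intro always_eventually) blast
 obtain g g' where g: "\<And>s. s \<in> ball 1 (1/2) ==> (\<lambda>n. z n s) sums g s \<and> (\<lambda>n. z' n s) sums g' s \<and> (g has_field_derivative g' s) (at s)"
  by (rule series_and_derivative_comparison[OF open_ball sm der ev]) (rule that, erule bspec)
 show ?thesis
 \<comment> \<open>The telescoping part sums to -1, hence the added 1. Every term vanishes at s = 1,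
   so the value there is 1, the residue of zeta.\<close>
 proof (rule that[of "\<lambda>s. 1 + g s"])
  show "(\<lambda>s. 1 + g s) holomorphic_on ball 1 (1/2)"
  proof (intro holomorphic_intros)
   show "g holomorphic_on ball 1 (1/2)" using g unfolding holomorphic_on_open[OF open_ball] by blast
  qed
  have "(\<lambda>n. z n 1) sums g 1" using g by simp
  moreover have "z n 1 = 0" for n by (simp add: z_def del: of_nat_Suc)
  ultimately show "1 + g 1 = 1" by (simp add: sums_iff)
  fix s :: complex assume s: "s \<in> ball 1 (1/2)" "Re s > 1"
  have "(\<lambda>n. of_nat (Suc n) powr (-s)) sums zeta s"
   using sums_Suc_iff[of "\<lambda>n. of_nat n powr (-s)" "zeta s"] zeta_eq_suminf[OF s(2)] by simp
  hence 1: "(\<lambda>n. (s-1) * of_nat (Suc n) powr (-s)) sums ((s-1) * zeta s)"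
   by (rule sums_mult)
  have "((\<lambda>n. real n powr (Re (1-s))) \<longlongrightarrow> 0) at_top"
   using s by real_asymp
  hence "(\<lambda>n. norm (of_nat (Suc n) powr (1-s) :: complex)) \<longlonglongrightarrow> 0"
   by (subst norm_nat_powr) (auto intro: filterlim_compose[OF _ filterlim_Suc, of "\<lambda>n. real n powr _"] simp del: of_nat_Suc)
  hence "(\<lambda>n. of_nat (Suc n) powr (1-s) :: complex) \<longlonglongrightarrow> 0"
   by (rule tendsto_norm_zero_cancel)
  hence "(\<lambda>n. of_nat (Suc (Suc n)) powr (1-s) - of_nat (Suc n) powr (1-s)) sums (0 - of_nat (Suc 0) powr (1-s) :: complex)"
   by (rule telescope_sums)
  from sums_add[OF 1 this] have "(\<lambda>n. z n s) sums ((s-1) * zeta s - 1)"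
   by (simp add: z_def algebra_simps)
  moreover have "(\<lambda>n. z n s) sums g s" using g s by simp
  ultimately have "(s-1) * zeta s - 1 = g s" by (rule sums_unique2)
  thus "(s - 1) * zeta s = 1 + g s" by (simp add: algebra_simps)
 qed
qed

section \<open>The prime zeta function and its logarithmic singularity at 1\<close>

definition prime_zeta :: "complex \<Rightarrow> complex" where
 "prime_zeta s = (\<Sum>n. if prime n then of_nat n powr (-s) else 0)"

definition prime_log_zeta :: "complex \<Rightarrow> complex" where
 "prime_log_zeta s = (\<Sum>n. if prime n then of_real (ln (real n)) * of_nat n powr (-s) else 0)"

lemma prime_zeta_facts:
 assumes "Re s > 1"
 shows sums_prime_zeta: "(\<lambda>n. if prime n then of_nat n powr (-s) else 0) sums prime_zeta s"
  and sums_prime_log_zeta: "(\<lambda>n. if prime n then of_real (ln (real n)) * of_nat n powr (-s) else 0) sums prime_log_zeta s"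
  and has_field_derivative_prime_zeta: "(prime_zeta has_field_derivative - prime_log_zeta s) (at s)"
proof -
 define f where "f = (\<lambda>n s. if prime n then of_nat n powr (-s) else 0 :: complex)"
 define f' where "f' = (\<lambda>n s. - (if prime n then of_real (ln (real n)) * of_nat n powr (-s) else 0) :: complex)"
 have "\<exists>g g'. \<forall>s\<in>{s. Re s > 1}. ((\<lambda>n. f n s) sums g s) \<and> ((\<lambda>n. f' n s) sums g' s) \<and> (g has_field_derivative g' s) (at s)"
 proof (rule series_and_derivative_comparison_local)
  show "open {s. Re s > 1}" by (rule open_halfspace_Re_gt)
  show "(f n has_field_derivative f' n s) (at s)" if "s \<in> {s. Re s > 1}" for n s
  proof (cases "prime n")
   case True
   hence "n > 0" by (simp add: prime_gt_0_nat)
   hence "((\<lambda>s. of_nat n powr (-s)) has_field_derivative - (Ln (of_nat n) * of_nat n powr (-s))) (at s)"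
    by (intro DERIV_cong[OF DERIV_chain2[OF has_field_derivative_powr_right DERIV_minus[OF DERIV_ident]]]) auto
   moreover have "Ln (of_nat n) = of_real (ln (real n))"
    using \<open>n > 0\<close> by simp
   ultimately show ?thesis using True by (simp add: f_def f'_def)
  qed (simp add: f_def f'_def)
  show "\<exists>d h. 0 < d \<and> summable h \<and> (\<forall>\<^sub>F n in sequentially. \<forall>y\<in>ball x d \<inter> {s. Re s > 1}. norm (f n y) \<le> h n)"
   if x: "x \<in> {s. Re s > 1}" for x
  proof (intro exI conjI)
   show "0 < (Re x - 1) / 2" using x by simp
   show "summable (\<lambda>n. real n powr (- (Re x + 1) / 2))"
    using x by (simp add: summable_real_powr_iff field_simps)
   have "norm (f n y) \<le> real n powr (- (Re x + 1) / 2)" if "y \<in> ball x ((Re x - 1) / 2)" for n y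
   proof (cases "prime n")
    case True
    hence n: "n \<ge> 1" using prime_ge_1_nat by blast
    have "Re (x - y) \<le> norm (x - y)" by (rule complex_Re_le_cmod)
    hence "Re y \<ge> (Re x + 1) / 2" using that by (simp add: dist_norm field_simps)
    thus ?thesis using True n
     by (auto simp: f_def norm_nat_powr field_simps intro!: powr_mono)
   qed (simp add: f_def)
   thus "\<forall>\<^sub>F n in sequentially. \<forall>y\<in>ball x ((Re x - 1) / 2) \<inter> {s. Re s > 1}. norm (f n y) \<le> real n powr (- (Re x + 1) / 2)"
    by (intro always_eventually) auto
  qed
 qed
 then obtain g g' where g: "\<And>s. Re s > 1 ==> (\<lambda>n. f n s) sums g s"
   "\<And>s. Re s > 1 ==> (\<lambda>n. f' n s) sums g' s" "\<And>s. Re s > 1 ==> (g has_field_derivative g' s) (at s)"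
  by auto
 have gP: "g s = prime_zeta s" if "Re s > 1" for s
  using g(1)[OF that] by (simp add: f_def prime_zeta_def sums_iff)
 have gL: "- g' s = prime_log_zeta s" if "Re s > 1" for s
  using sums_minus[OF g(2)[OF that]] by (simp add: f'_def prime_log_zeta_def sums_iff)
 show "(\<lambda>n. if prime n then of_nat n powr (-s) else 0) sums prime_zeta s"
  using g(1)[OF assms] gP[OF assms] by (simp add: f_def)
 show "(\<lambda>n. if prime n then of_real (ln (real n)) * of_nat n powr (-s) else 0) sums prime_log_zeta s"
  using sums_minus[OF g(2)[OF assms]] gL[OF assms] by (simp add: f'_def)
 have "(prime_zeta has_field_derivative g' s) (at s)"
  by (rule has_field_derivative_transform_within_open[OF g(3)[OF assms], of "{s. Re s > 1}"])
    (use assms gP open_halfspace_Re_gt in auto)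
 moreover have "g' s = - prime_log_zeta s" using gL[OF assms] by (metis minus_minus)
 ultimately show "(prime_zeta has_field_derivative - prime_log_zeta s) (at s)" by simp
qed

text \<open>For Re s > 3/4 this keeps p^-s within 3/5 of 0, so that 1 - p^-s has positive real part
  and 1 - |p^-s| is at least 2/5. The proof compares fourth powers: 1/8 is below 81/625.\<close>

lemma two_powr_bound: "real n powr (-3/4) \<le> 3/5" if "n \<ge> 2"
proof -
 have "real n powr (-3/4) \<le> 2 powr (-3/4)" using that by (intro powr_mono2') auto
 also have "\<dots> \<le> 3/5"
 proof (rule power_le_imp_le_base[of _ 3])
  have "(2 powr (-3/4) :: real) ^ Suc 3 = 2 powr (-3)"
   by (subst powr_realpow[symmetric]) (auto simp: powr_powr)
  also have "\<dots> \<le> (3/5) ^ Suc 3" by (simp add: powr_minus power_numeral_reduce)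
  finally show "(2 powr (-3/4) :: real) ^ Suc 3 \<le> (3/5) ^ Suc 3" .
 qed simp
 finally show ?thesis .
qed

text \<open>\<open>Q\<close> carries the higher prime powers. With z = p^-s the term - Ln (1 - z) -
  z is O(|z|^2) = O(p^(-3/2)) for Re s > 3/4, so \<open>Q\<close> is holomorphic across the line Re
  s = 1 and the singularity of ln zeta at 1 stays in \<open>prime_zeta\<close>.\<close>

lemma log_Euler_product:
 obtains Q where "Q holomorphic_on ball 1 (1/4)"
  "\<And>s. s \<in> ball 1 (1/4) ==> (\<lambda>n. if prime n then - Ln (1 - of_nat n powr (-s)) - of_nat n powr (-s) else 0) sums Q s"
  "\<And>s. s \<in> ball 1 (1/4) ==> Re s > 1 ==> exp (prime_zeta s + Q s) = zeta s"
proof -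
 define q where "q = (\<lambda>n s. if prime n then - Ln (1 - of_nat n powr (-s)) - of_nat n powr (-s) else 0 :: complex)"
 define q' where "q' = (\<lambda>n s. deriv (q n) s)"
 have small: "norm (of_nat n powr (-s) :: complex) \<le> real n powr (-3/4)"
   if "s \<in> ball 1 (1/4)" "n \<ge> 2" for n s
 proof -
  have s1: "norm (s - 1) < 1/4" using that by (simp add: dist_norm norm_minus_commute)
  have re: "Re s > 3/4" using s1 abs_Re_le_cmod[of "s-1"] by (simp add: abs_if split: if_splits)
  show ?thesis using that re by (auto simp: norm_nat_powr intro!: powr_mono)
 qed
 have small': "norm (of_nat n powr (-s) :: complex) \<le> 3/5"
   if "s \<in> ball 1 (1/4)" "n \<ge> 2" for n s
  using small[OF that] two_powr_bound[OF that(2)] by linarith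
 have re: "1 - of_nat n powr (-s) \<notin> \<real>\<^sub>\<le>\<^sub>0" if "s \<in> ball 1 (1/4)" "n \<ge> 2" for n and s :: complex
 proof -
  have "Re (of_nat n powr (-s) :: complex) \<le> 3/5"
   using small'[OF that] complex_Re_le_cmod[of "of_nat n powr (-s)"] by linarith
  thus ?thesis by (auto simp: complex_nonpos_Reals_iff)
 qed
 have der: "(q n has_field_derivative q' n s) (at s)" if s: "s \<in> ball 1 (1/4)" for n s
 proof -
  have "q n holomorphic_on ball 1 (1/4)"
  proof (cases "prime n")
   case True
   hence "q n = (\<lambda>s. - Ln (1 - of_nat n powr (-s)) - of_nat n powr (-s))"
    by (simp add: q_def fun_eq_iff)
   moreover have "(\<lambda>s. - Ln (1 - of_nat n powr (-s)) - of_nat n powr (-s)) holomorphic_on ball 1 (1/4)"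
    using re prime_ge_2_nat[OF True] by (intro holomorphic_intros) auto
   ultimately show ?thesis by (simp only:)
  qed (simp add: q_def)
  thus ?thesis unfolding q'_def using holomorphic_derivI open_ball s by blast
 qed
 have bound: "norm (q n s) \<le> 5/2 * real n powr (-3/2)" if s: "s \<in> ball 1 (1/4)" for n s
 proof (cases "prime n")
  case True
  note n = prime_ge_2_nat[OF True]
  let ?z = "of_nat n powr (-s) :: complex"
  have z: "norm ?z \<le> 3/5" by (rule small'[OF s n])
  have "norm (Ln (1 + (-?z)) - (-?z)) \<le> norm (-?z)^2 / (1 - norm (-?z))"
   using z by (intro Ln_approx_linear) auto
  also have "\<dots> \<le> norm ?z ^ 2 / (2/5)"
   unfolding norm_minus_cancel using z by (intro divide_left_mono) auto
  also have "\<dots> \<le> (real n powr (-3/4))^2 / (2/5)"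
   using small[OF s n] by (intro divide_right_mono power_mono) auto
  also have "(real n powr (-3/4))^2 = real n powr (-3/2)"
   using n by (simp add: power2_eq_square flip: powr_add)
  finally have "norm (Ln (1 + (-?z)) - (-?z)) \<le> 5/2 * real n powr (-3/2)" by simp
  moreover have "q n s = - (Ln (1 + (-?z)) - (-?z))" using True by (simp add: q_def)
  ultimately show ?thesis by (metis norm_minus_cancel)
 qed (simp add: q_def)
 have sm: "summable (\<lambda>n. 5/2 * real n powr (-3/2))"
  by (intro summable_mult) (simp add: summable_real_powr_iff)
 have ev: "\<forall>\<^sub>F n in sequentially. \<forall>s\<in>ball 1 (1/4). norm (q n s) \<le> 5/2 * real n powr (-3/2)"
  using bound by (intro always_eventually) blast
 obtain Q Q' where Q: "\<And>s. s \<in> ball 1 (1/4) ==> (\<lambda>n. q n s) sums Q s \<and> (\<lambda>n. q' n s) sums Q' s \<and> (Q has_field_derivative Q' s) (at s)"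
  by (rule series_and_derivative_comparison[OF open_ball sm der ev]) (assumption, rule that, erule bspec)
 show ?thesis
 proof (rule that[of Q])
  show "Q holomorphic_on ball 1 (1/4)"
   using Q unfolding holomorphic_on_open[OF open_ball] by blast
  show "(\<lambda>n. if prime n then - Ln (1 - of_nat n powr (-s)) - of_nat n powr (-s) else 0) sums Q s"
   if "s \<in> ball 1 (1/4)" for s using Q[OF that] by (simp add: q_def)
  fix s :: complex assume s: "s \<in> ball 1 (1/4)" "Re s > 1"
  have "(\<lambda>n. (if prime n then of_nat n powr (-s) else 0) + q n s) sums (prime_zeta s + Q s)"
   using sums_prime_zeta[OF s(2)] Q[OF s(1)] by (intro sums_add) auto
  also have "(\<lambda>n. (if prime n then of_nat n powr (-s) else 0) + q n s) = (\<lambda>n. if prime n then - Ln (1 - of_nat n powr (-s)) else 0)"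
   by (auto simp: q_def)
  finally have "(\<lambda>N. \<Sum>p\<in>primes_upto N. - Ln (1 - of_nat p powr (-s))) \<longlonglongrightarrow> prime_zeta s + Q s"
   by (rule sums_primes_upto)
  hence 1: "(\<lambda>N. exp (\<Sum>p\<in>primes_upto N. - Ln (1 - of_nat p powr (-s)))) \<longlonglongrightarrow> exp (prime_zeta s + Q s)"
   by (rule tendsto_exp)
  have "exp (\<Sum>p\<in>primes_upto N. - Ln (1 - of_nat p powr (-s))) * (\<Prod>p\<in>primes_upto N. 1 - of_nat p powr (-s)) = 1" for N
  proof -
   have "exp (- Ln (1 - of_nat p powr (-s))) * (1 - of_nat p powr (-s)) = 1" if "p \<in> primes_upto N" for p
   proof -
    have "1 - of_nat p powr (-s) \<noteq> 0" using re[OF s(1), of p] primes_upto_ge_2[OF that] by auto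
    thus ?thesis by (simp add: exp_minus)
   qed
   thus ?thesis by (simp add: exp_sum flip: prod.distrib)
  qed
  hence eq: "exp (\<Sum>p\<in>primes_upto N. - Ln (1 - of_nat p powr (-s))) * (zeta s * (\<Prod>p\<in>primes_upto N. 1 - of_nat p powr (-s))) = zeta s" for N
   by (simp add: mult.left_commute)
  have "(\<lambda>N. zeta s) \<longlonglongrightarrow> exp (prime_zeta s + Q s) * 1"
   using tendsto_mult[OF 1 zeta_Euler_product[OF s(2)]] unfolding eq .
  thus "exp (prime_zeta s + Q s) = zeta s" by (simp add: LIMSEQ_const_iff)
 qed
qed

text \<open>On the real axis all four terms below are real, which fixes the branch of the logarithm.\<close>
lemma prime_zeta_near_1:
 obtains c A where "0 < c" "c \<le> 1/4" "A holomorphic_on ball 1 c"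
  "\<And>s. s \<in> ball 1 c ==> Re s > 1 ==> prime_zeta s = - Ln (s - 1) + A s"
  "(\<lambda>n. if prime n then 1 / real n + ln (1 - 1 / real n) else 0) sums Re (A 1)"
proof -
 obtain Z where Z: "Z holomorphic_on ball 1 (1/2)" "Z 1 = 1"
  "\<And>s. s \<in> ball 1 (1/2) ==> Re s > 1 ==> (s - 1) * zeta s = Z s"
  by (rule zeta_pole_removal) (rule that)
 obtain Q where Q: "Q holomorphic_on ball 1 (1/4)"
  "\<And>s. s \<in> ball 1 (1/4) ==> (\<lambda>n. if prime n then - Ln (1 - of_nat n powr (-s)) - of_nat n powr (-s) else 0) sums Q s"
  "\<And>s. s \<in> ball 1 (1/4) ==> Re s > 1 ==> exp (prime_zeta s + Q s) = zeta s"
  by (rule log_Euler_product) (rule that)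
 have "continuous (at 1) Z"
  using Z(1) by (intro field_differentiable_imp_continuous_at holomorphic_on_imp_differentiable_at[OF Z(1)]) auto
 then obtain d where d: "d > 0" "\<And>s. dist s 1 < d ==> dist (Z s) (Z 1) < 1"
  unfolding continuous_at_eps_delta by (metis zero_less_one)
 define c where "c = min d (1/4)"
 have c: "0 < c" "c \<le> 1/4" "c \<le> d" using d by (auto simp: c_def)
 have sub: "ball 1 c \<subseteq> ball (1::complex) (1/4)" "ball 1 c \<subseteq> ball (1::complex) (1/2)"
  using c by (auto intro!: subset_ball)
 have Zpos: "Z s \<notin> \<real>\<^sub>\<le>\<^sub>0" if "s \<in> ball 1 c" for s
 proof -
  have "norm (1 - Z s) < 1" using d(2)[of s] that c Z(2) by (auto simp: dist_commute dist_norm)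
  hence "Re (1 - Z s) < 1" using complex_Re_le_cmod[of "1 - Z s"] by linarith
  thus ?thesis by (auto simp: complex_nonpos_Reals_iff)
 qed
 define A where "A = (\<lambda>s. Ln (Z s) - Q s)"
 have holA: "A holomorphic_on ball 1 c" unfolding A_def
  using Zpos by (intro holomorphic_intros holomorphic_on_subset[OF Z(1)] holomorphic_on_subset[OF Q(1)] sub) auto
 define U where "U = ball 1 c \<inter> {s. Re s > 1}"
 have U: "open U" "convex U" unfolding U_def
  by (auto intro!: open_Int convex_Int open_halfspace_Re_gt convex_halfspace_Re_gt)
 \<comment> \<open>The defect of the claimed formula. As exp E = 1 on the convex set
   \<open>U\<close>, the derivative of \<open>E\<close> vanishes there and \<open>E\<close> is
   constant; one real point then shows that the constant is 0.\<close>
 define E where "E = (\<lambda>s. prime_zeta s + Ln (s - 1) - A s)"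
 have expE: "exp (E s) = 1" if "s \<in> U" for s
 proof -
  have s: "s \<in> ball 1 c" "Re s > 1" using that by (auto simp: U_def)
  have "s \<noteq> 1" using s by auto
  have "Z s \<noteq> 0" using Zpos[OF s(1)] by auto
  have "E s = (prime_zeta s + Q s) + Ln (s - 1) - Ln (Z s)" by (simp add: E_def A_def)
  hence "exp (E s) = zeta s * (s - 1) / Z s"
   using \<open>s \<noteq> 1\<close> \<open>Z s \<noteq> 0\<close> Q(3)[of s] s sub by (auto simp: exp_add exp_diff)
  thus ?thesis using Z(3)[of s] s sub \<open>Z s \<noteq> 0\<close> by (auto simp: mult.commute)
 qed
 have holE: "E holomorphic_on U" unfolding E_def
 proof (intro holomorphic_intros)
  show "prime_zeta holomorphic_on U"
   unfolding holomorphic_on_open[OF U(1)] using has_field_derivative_prime_zeta by (auto simp: U_def)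
  show "A holomorphic_on U" using holA holomorphic_on_subset by (force simp: U_def)
  show "s - 1 \<notin> \<real>\<^sub>\<le>\<^sub>0" if "s \<in> U" for s using that by (auto simp: U_def complex_nonpos_Reals_iff)
 qed
 have "(E has_field_derivative 0) (at s within U)" if "s \<in> U" for s
 proof -
  have "E field_differentiable at s" using holE U(1) that holomorphic_on_imp_differentiable_at by blast
  then obtain E' where E': "(E has_field_derivative E') (at s)"
   unfolding field_differentiable_def by (rule exE)
  from E' have "((\<lambda>s. exp (E s)) has_field_derivative exp (E s) * E') (at s)"
   by (rule DERIV_fun_exp)
  moreover have "((\<lambda>s. exp (E s)) has_field_derivative 0) (at s)"
   by (rule has_field_derivative_transform_within_open[OF DERIV_const[of 1] U(1) that]) (use expE in auto)
  ultimately have "exp (E s) * E' = 0" by (rule DERIV_unique)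
  thus ?thesis using E' has_field_derivative_at_within by force
 qed
 then obtain e where e: "\<And>s. s \<in> U ==> E s = e"
  using has_field_derivative_zero_constant[OF U(2)] by metis
 have "e = 0"
 proof -
  define x where "x = 1 + c / 2"
  define s where "s = complex_of_real x"
  have s: "s \<in> ball 1 c" "Re s > 1" "x > 1"
   using c by (auto simp: s_def x_def dist_norm)
  hence sU: "s \<in> U" by (simp add: U_def)
  have rp: "(of_nat n powr (-s) :: complex) = of_real (real n powr (-x))" for n
   by (simp add: s_def flip: powr_of_real of_real_minus)
  have 1: "prime_zeta s \<in> \<real>"
  proof -
   have "(\<lambda>n. Im (if prime n then of_nat n powr (-s) else 0)) sums Im (prime_zeta s)"
    using sums_Im[OF sums_prime_zeta[OF s(2)]] .
   moreover have "(\<lambda>n. Im (if prime n then of_nat n powr (-s) else 0)) = (\<lambda>n. 0)"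
    by (auto simp: rp)
   ultimately have "Im (prime_zeta s) = 0" by (simp add: sums_iff)
   thus ?thesis by (simp add: complex_is_Real_iff)
  qed
  have 2: "Q s \<in> \<real>"
  proof -
   have "(\<lambda>n. Im (if prime n then - Ln (1 - of_nat n powr (-s)) - of_nat n powr (-s) else 0)) sums Im (Q s)"
    using sums_Im[OF Q(2)[of s]] s sub by auto
   moreover have "Im (if prime n then - Ln (1 - of_nat n powr (-s)) - of_nat n powr (-s) else 0) = 0" for n
   proof (cases "prime n")
    case True
    hence "real n \<ge> 2" using prime_ge_2_nat by force
    hence "real n powr (-x) < 1" using s powr_less_one[of "real n" "-x"] by auto
    hence "Ln (1 - of_nat n powr (-s)) = of_real (ln (1 - real n powr (-x)))"
     unfolding rp by (subst Ln_of_real[symmetric]) auto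
    thus ?thesis by (simp add: rp)
   qed simp
   ultimately have "Im (Q s) = 0" by (simp add: sums_iff)
   thus ?thesis by (simp add: complex_is_Real_iff)
  qed
  obtain r where r: "prime_zeta s + Q s = of_real r" using 1 2 by (metis Reals_add Reals_cases)
  have "Z s = (s - 1) * exp (of_real r)"
   using Z(3)[of s] Q(3)[of s] s sub r by auto
  also have "\<dots> = of_real ((x - 1) * exp r)" by (simp add: s_def exp_of_real)
  finally have Zs: "Z s = of_real ((x - 1) * exp r)" .
  have "Ln (Z s) = of_real (ln ((x - 1) * exp r))"
   unfolding Zs using s by (intro Ln_of_real) auto
  moreover have "Ln (s - 1) = of_real (ln (x - 1))"
   using s Ln_of_real[of "x - 1"] by (simp add: s_def)
  ultimately have "E s = of_real (r + ln (x - 1) - ln ((x - 1) * exp r))"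
   using r by (simp add: E_def A_def algebra_simps)
  also have "ln ((x - 1) * exp r) = ln (x - 1) + r" using s by (simp add: ln_mult)
  finally have "E s = 0" by simp
  thus ?thesis using e[OF sU] by simp
 qed
 show ?thesis
 proof (rule that[OF c(1,2) holA])
  fix s assume "s \<in> ball 1 c" "Re s > 1"
  hence "E s = 0" using e \<open>e = 0\<close> by (simp add: U_def)
  thus "prime_zeta s = - Ln (s - 1) + A s" by (simp add: E_def algebra_simps)
 next
  \<comment> \<open>Since \<open>Z 1 = 1\<close>, the value \<open>A 1\<close> is
    \<open>- Q 1\<close>, a sum over primes. Its real part is the constant that reappears as
    \<open>corr_sum (-1)\<close>.\<close>
  have "(\<lambda>n. Re (if prime n then - Ln (1 - of_nat n powr (-1)) - of_nat n powr (-1) else 0)) sums Re (Q 1)"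
   using sums_Re[OF Q(2)[of 1]] by simp
  hence "(\<lambda>n. - Re (if prime n then - Ln (1 - of_nat n powr (-1)) - of_nat n powr (-1) else 0)) sums - Re (Q 1)"
   by (rule sums_minus)
  also have "- Re (Q 1) = Re (A 1)" by (simp add: A_def Z)
  also have "(\<lambda>n. - Re (if prime n then - Ln (1 - of_nat n powr (-1)) - of_nat n powr (-1) else 0))
    = (\<lambda>n. if prime n then 1 / real n + ln (1 - 1 / real n) else 0)"
  proof
   fix n :: nat
   show "- Re (if prime n then - Ln (1 - of_nat n powr (-1)) - of_nat n powr (-1) else 0)
     = (if prime n then 1 / real n + ln (1 - 1 / real n) else 0)"
   proof (cases "prime n")
    case True
    hence n: "real n \<ge> 2" using prime_ge_2_nat by force
    have p: "(of_nat n powr (-1) :: complex) = of_real (1 / real n)"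
     using n by (simp add: powr_minus_divide)
    have "Ln (1 - of_nat n powr (-1)) = of_real (ln (1 - 1 / real n))"
     unfolding p using n by (subst Ln_of_real[symmetric]) auto
    thus ?thesis using True p by simp
   qed simp
  qed
  finally show "(\<lambda>n. if prime n then 1 / real n + ln (1 - 1 / real n) else 0) sums Re (A 1)" .
 qed
qed

section \<open>Smoothed sums over primes\<close>

lemma integral_by_parts_oscillating:
 fixes f f' :: "real \<Rightarrow> complex"
 assumes "a \<le> b" "v \<noteq> 0" "f a = 0" "f b = 0"
  and der: "\<And>y. y \<in> {a..b} ==> (f has_vector_derivative f' y) (at y)"
 shows "integral {a..b} (\<lambda>y. f y * exp (\<i> * of_real (v * y))) = \<i> / of_real v * integral {a..b} (\<lambda>y. f' y * exp (\<i> * of_real (v * y)))"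
proof -
 let ?e = "\<lambda>y. exp (\<i> * of_real (v * y))"
 have e: "(?e has_vector_derivative \<i> * of_real v * ?e y) (at y)" for y
 proof -
  have "((\<lambda>z. exp (\<i> * (of_real v * z))) has_field_derivative \<i> * of_real v * exp (\<i> * (of_real v * of_real y))) (at (of_real y))"
   by (auto intro!: derivative_eq_intros)
  from has_vector_derivative_real_field[OF this] show ?thesis by simp
 qed
 have contf: "continuous_on {a..b} f"
  using der by (meson continuous_at_imp_continuous_on has_vector_derivative_continuous)
 have d: "((\<lambda>y. f y * ?e y) has_vector_derivative (f y * (\<i> * of_real v * ?e y) + f' y * ?e y)) (at y within {a..b})" if "y \<in> {a..b}" for y
  by (rule has_vector_derivative_at_within) (rule has_vector_derivative_mult[OF der[OF that] e])
 have "((\<lambda>y. f y * (\<i> * of_real v * ?e y) + f' y * ?e y) has_integral (f b * ?e b - f a * ?e a)) {a..b}"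
  by (rule fundamental_theorem_of_calculus[OF assms(1) d])
 hence tot: "((\<lambda>y. f y * (\<i> * of_real v * ?e y) + f' y * ?e y) has_integral 0) {a..b}"
  using assms by simp
 have int1: "(\<lambda>y. f y * ?e y) integrable_on {a..b}"
  by (intro integrable_continuous_real continuous_intros contf)
 hence "((\<lambda>y. (\<i> * of_real v) * (f y * ?e y)) has_integral (\<i> * of_real v) * integral {a..b} (\<lambda>y. f y * ?e y)) {a..b}"
  by (intro has_integral_mult_right) (simp add: has_integral_integral)
 from has_integral_diff[OF tot this]
 have "((\<lambda>y. f' y * ?e y) has_integral - ((\<i> * of_real v) * integral {a..b} (\<lambda>y. f y * ?e y))) {a..b}"
  by (simp add: algebra_simps)
 hence "integral {a..b} (\<lambda>y. f' y * ?e y) = - ((\<i> * of_real v) * integral {a..b} (\<lambda>y. f y * ?e y))"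
  by (rule integral_unique)
 thus ?thesis using assms(2) by (simp add: field_simps)
qed

text \<open>Two integrations by parts, each gaining 1/v; the boundary terms vanish because both
  \<open>f\<close> and its derivative \<open>g\<close> are 0 at the end points.\<close>

lemma norm_oscillating_integral_le:
 fixes f g h :: "real \<Rightarrow> complex"
 assumes "a \<le> b" "v \<noteq> 0" "f a = 0" "f b = 0" "g a = 0" "g b = 0"
  and "\<And>y. y \<in> {a..b} ==> (f has_vector_derivative g y) (at y)" "\<And>y. y \<in> {a..b} ==> (g has_vector_derivative h y) (at y)"
  and "continuous_on {a..b} h" "\<And>y. y \<in> {a..b} ==> norm (h y) \<le> M"
 shows "norm (integral {a..b} (\<lambda>y. f y * exp (\<i> * of_real (v * y)))) \<le> M * (b - a) / v^2"
proof -
 let ?e = "\<lambda>y. exp (\<i> * of_real (v * y))"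
 have "integral {a..b} (\<lambda>y. f y * ?e y) = \<i> / of_real v * (\<i> / of_real v * integral {a..b} (\<lambda>y. h y * ?e y))"
  using integral_by_parts_oscillating[OF assms(1,2,3,4,7)] integral_by_parts_oscillating[OF assms(1,2,5,6,8)] by simp
 hence "norm (integral {a..b} (\<lambda>y. f y * ?e y)) = norm (integral {a..b} (\<lambda>y. h y * ?e y)) / v^2"
  by (simp add: norm_mult norm_divide power2_eq_square abs_mult_self_eq)
 also have "\<dots> \<le> (M * (b - a)) / v^2"
  by (intro divide_right_mono integral_bound) (use assms in \<open>auto intro!: continuous_intros simp: norm_mult\<close>)
 finally show ?thesis by simp
qed

section \<open>The bump and the positive kernel built from it\<close>

text \<open>Vanishes to second order at b and -b, as two integrations by parts without boundary
  terms require; being a polynomial, it has explicit derivatives.\<close>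

definition bump :: "real \<Rightarrow> real \<Rightarrow> real" where
 "bump b y = (b^2 - y^2)^2"

definition bump_ft :: "real \<Rightarrow> real \<Rightarrow> complex" where
 "bump_ft b x = integral {-b..b} (\<lambda>y. of_real (bump b y) * exp (\<i> * of_real (x * y)))"

text \<open>A squared modulus of a Fourier transform: it is nonnegative, and its own Fourier
  transform, the autocorrelation of the bump, lives on [-2b, 2b]. Positivity allows terms of prime
  sums to be dropped; the small support confines the analysis to zeta near 1.\<close>

definition bump_kernel :: "real \<Rightarrow> real \<Rightarrow> real" where
 "bump_kernel b x = (norm (bump_ft b x))^2"

text \<open>Integration of \<open>F\<close> against the autocorrelation of the bump, kept as a
  double integral so that the autocorrelation need not be computed. The values of \<open>F\<close>
  on [-2b, 2b] determine it.\<close>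

definition bump2_integral :: "real \<Rightarrow> (real \<Rightarrow> complex) \<Rightarrow> complex" where
 "bump2_integral b F = integral {-b..b} (\<lambda>z. of_real (bump b z) * integral {-b..b} (\<lambda>y. of_real (bump b y) * F (y - z)))"

lemma continuous_on_bump [continuous_intros]: "continuous_on S f ==> continuous_on S (\<lambda>x. bump b (f x))"
 unfolding bump_def by (intro continuous_intros)

lemma bump_nonneg [simp]: "bump b y \<ge> 0"
 by (simp add: bump_def)

lemma bump_le: "y \<in> {-b..b} ==> bump b y \<le> b^4"
proof -
 assume "y \<in> {-b..b}"
 hence "y^2 \<le> b^2" by (intro abs_le_square_iff[THEN iffD1]) auto
 hence "(b^2 - y^2)^2 \<le> (b^2)^2" by (intro power_mono) auto
 thus ?thesis by (simp add: bump_def flip: power_mult)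
qed

lemma continuous_on_bump_inner:
 assumes "b \<ge> 0" "continuous_on {-2*b..2*b} F"
 shows "continuous_on {-b..b} (\<lambda>z. integral {-b..b} (\<lambda>y. of_real (bump b y) * (F (y - z) :: complex)))"
proof -
 have "continuous_on ({-b..b} \<times> cbox (-b) b) (\<lambda>(z, y). of_real (bump b y) * F (y - z))"
  unfolding case_prod_unfold
  by (intro continuous_intros continuous_on_compose2[OF assms(2)]) auto
 from integral_continuous_on_param[OF this] show ?thesis by simp
qed

lemma continuous_on_shift:
 fixes z :: real
 assumes "continuous_on {-2*b..2*b} F" "z \<in> {-b..b}"
 shows "continuous_on {-b..b} (\<lambda>y. F (y - z))"
 using assms by (intro continuous_intros continuous_on_compose2[OF assms(1)]) auto

lemma bump2_integral_add:
 assumes "b \<ge> 0" "continuous_on {-2*b..2*b} F" "continuous_on {-2*b..2*b} G"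
 shows "bump2_integral b (\<lambda>y. F y + G y) = bump2_integral b F + bump2_integral b G"
proof -
 have "integral {-b..b} (\<lambda>y. of_real (bump b y) * (F (y - z) + G (y - z))) =
   integral {-b..b} (\<lambda>y. of_real (bump b y) * F (y - z)) + integral {-b..b} (\<lambda>y. of_real (bump b y) * G (y - z))"
  if "z \<in> {-b..b}" for z
  unfolding distrib_left
  by (intro integral_add integrable_continuous_real continuous_intros continuous_on_shift[OF _ that] assms)
 hence "bump2_integral b (\<lambda>y. F y + G y) = integral {-b..b} (\<lambda>z. of_real (bump b z) * integral {-b..b} (\<lambda>y. of_real (bump b y) * F (y - z))
   + of_real (bump b z) * integral {-b..b} (\<lambda>y. of_real (bump b y) * G (y - z)))"
  unfolding bump2_integral_def by (intro integral_cong) (simp add: distrib_left)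
 also have "\<dots> = bump2_integral b F + bump2_integral b G"
  unfolding bump2_integral_def
  by (intro integral_add integrable_continuous_real continuous_intros continuous_on_bump_inner assms)
 finally show ?thesis .
qed

lemma bump2_integral_cmult:
 "bump2_integral b (\<lambda>y. c * F y) = c * bump2_integral b F"
proof -
 have "(\<lambda>y. of_real (bump b y) * (c * F (y - z))) = (\<lambda>y. c * (of_real (bump b y) * F (y - z)))" for z
  by (simp add: mult_ac)
 hence "bump2_integral b (\<lambda>y. c * F y) = integral {-b..b} (\<lambda>z. c * (of_real (bump b z) * integral {-b..b} (\<lambda>y. of_real (bump b y) * F (y - z))))"
  unfolding bump2_integral_def by (simp add: mult_ac)
 thus ?thesis by (simp add: bump2_integral_def)
qed

lemma bump2_integral_sum:
 assumes "b \<ge> 0" "finite S" "\<And>p. p \<in> S ==> continuous_on {-2*b..2*b} (F p)"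
 shows "bump2_integral b (\<lambda>y. \<Sum>p\<in>S. F p y) = (\<Sum>p\<in>S. bump2_integral b (F p))"
 using assms(2,3)
proof (induction S rule: finite_induct)
 case empty
 show ?case by (simp add: bump2_integral_def)
next
 case (insert p S)
 hence "bump2_integral b (\<lambda>y. \<Sum>p\<in>insert p S. F p y) = bump2_integral b (\<lambda>y. F p y + (\<Sum>p\<in>S. F p y))"
  by simp
 also have "\<dots> = bump2_integral b (F p) + bump2_integral b (\<lambda>y. \<Sum>p\<in>S. F p y)"
  by (rule bump2_integral_add) (use assms insert in \<open>auto intro!: continuous_on_sum\<close>)
 finally show ?case using insert by simp
qed

lemma norm_bump2_integral_le:
 assumes "b \<ge> 0" "continuous_on {-2*b..2*b} F"
  and "\<And>z. z \<in> {-b..b} ==> norm (integral {-b..b} (\<lambda>y. of_real (bump b y) * F (y - z))) \<le> M"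
 shows "norm (bump2_integral b F) \<le> 2 * b^5 * M"
proof -
 have M: "M \<ge> 0" using order_trans[OF norm_ge_zero assms(3)[of 0]] assms(1) by simp
 have "norm (bump2_integral b F) \<le> (b^4 * M) * (b - (-b))"
  unfolding bump2_integral_def
 proof (rule integral_bound)
  show "continuous_on {-b..b} (\<lambda>z. of_real (bump b z) * integral {-b..b} (\<lambda>y. of_real (bump b y) * F (y - z)))"
   by (intro continuous_intros continuous_on_bump_inner assms)
  show "norm (of_real (bump b z) * integral {-b..b} (\<lambda>y. of_real (bump b y) * F (y - z))) \<le> b^4 * M" if "z \<in> {-b..b}" for z
   using bump_le[of z b] that assms(3)[OF that] M by (simp add: norm_mult mult_mono)
 qed (use assms in auto)
 thus ?thesis by (simp add: power_numeral_reduce algebra_simps)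
qed

lemma norm_bump2_integral_le':
 assumes "b \<ge> 0" "continuous_on {-2*b..2*b} F" "\<And>y. y \<in> {-2*b..2*b} ==> norm (F y) \<le> M"
 shows "norm (bump2_integral b F) \<le> 2 * b^5 * (2 * b^5 * M)"
proof (rule norm_bump2_integral_le[OF assms(1,2)])
 fix z assume z: "z \<in> {-b..b}"
 have M: "M \<ge> 0" using order_trans[OF norm_ge_zero assms(3)[of 0]] assms(1) by simp
 have "norm (integral {-b..b} (\<lambda>y. of_real (bump b y) * F (y - z))) \<le> (b^4 * M) * (b - (-b))"
 proof (rule integral_bound)
  show "norm (of_real (bump b y) * F (y - z)) \<le> b^4 * M" if "y \<in> {-b..b}" for y
   using bump_le[of y b] that z assms(3)[of "y - z"] M by (simp add: norm_mult mult_mono)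
 qed (use assms z in \<open>auto intro!: continuous_intros continuous_on_shift\<close>)
 thus "norm (integral {-b..b} (\<lambda>y. of_real (bump b y) * F (y - z))) \<le> 2 * b^5 * M"
  by (simp add: power_numeral_reduce algebra_simps)
qed

lemma bump2_integral_exp:
 assumes "b \<ge> 0"
 shows "bump2_integral b (\<lambda>y. exp (\<i> * of_real (x * y))) = of_real (bump_kernel b x)"
proof -
 have 1: "integral {-b..b} (\<lambda>y. of_real (bump b y) * exp (\<i> * of_real (x * (y - z)))) = cnj (exp (\<i> * of_real (x * z))) * bump_ft b x" for z
 proof -
  have "(\<lambda>y. of_real (bump b y) * exp (\<i> * of_real (x * (y - z)))) = (\<lambda>y. exp (- (\<i> * of_real (x * z))) * (of_real (bump b y) * exp (\<i> * of_real (x * y))))"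
   by (simp add: algebra_simps flip: exp_add)
  thus ?thesis by (simp add: bump_ft_def exp_cnj)
 qed
 have "bump2_integral b (\<lambda>y. exp (\<i> * of_real (x * y))) = integral {-b..b} (\<lambda>z. bump_ft b x * cnj (of_real (bump b z) * exp (\<i> * of_real (x * z))))"
  unfolding bump2_integral_def 1 by (simp add: mult_ac)
 also have "\<dots> = bump_ft b x * integral {-b..b} (\<lambda>z. cnj (of_real (bump b z) * exp (\<i> * of_real (x * z))))"
  by simp
 also have "integral {-b..b} (\<lambda>z. cnj (of_real (bump b z) * exp (\<i> * of_real (x * z)))) = cnj (bump_ft b x)"
  unfolding bump_ft_def
  by (rule integral_linear[OF _ bounded_linear_cnj, unfolded o_def]) (intro integrable_continuous_real continuous_intros)
 finally show ?thesis by (simp only: bump_kernel_def complex_norm_square)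
qed

lemma continuous_on_bump_kernel: "continuous_on UNIV (bump_kernel b)"
proof -
 have "continuous_on (UNIV \<times> cbox (-b) b) (\<lambda>(x, y). of_real (bump b y) * exp (\<i> * of_real (x * y)))"
  unfolding case_prod_unfold by (intro continuous_intros)
 from integral_continuous_on_param[OF this] have "continuous_on UNIV (bump_ft b)"
  by (simp add: bump_ft_def[abs_def])
 thus ?thesis unfolding bump_kernel_def[abs_def] by (intro continuous_intros)
qed

lemma bump_kernel_nonneg: "bump_kernel b x \<ge> 0"
 by (simp add: bump_kernel_def)

lemma bump_kernel_minus: "bump_kernel b (- x) = bump_kernel b x"
proof -
 have "bump_ft b (-x) = cnj (bump_ft b x)"
 proof -
  have "cnj (bump_ft b x) = integral {-b..b} (\<lambda>z. cnj (of_real (bump b z) * exp (\<i> * of_real (x * z))))"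
   unfolding bump_ft_def
   by (rule integral_linear[OF _ bounded_linear_cnj, unfolded o_def, symmetric]) (intro integrable_continuous_real continuous_intros)
  thus ?thesis by (simp add: bump_ft_def exp_cnj)
 qed
 thus ?thesis by (simp add: bump_kernel_def)
qed

lemma bump_kernel_0_pos:
 assumes "b > 0"
 shows "bump_kernel b 0 > 0"
proof -
 have "integral {-b..b} (bump b) \<noteq> 0"
 proof
  assume "integral {-b..b} (bump b) = 0"
  hence "\<forall>x\<in>{-b..b}. bump b x = 0"
   using assms by (subst (asm) integral_eq_0_iff) (auto intro!: continuous_intros)
  hence "bump b 0 = 0" using assms by auto
  thus False using assms by (simp add: bump_def)
 qed
 moreover have "bump_ft b 0 = of_real (integral {-b..b} (bump b))"
  unfolding bump_ft_def
  by (simp add: integral_linear[OF _ bounded_linear_of_real, unfolded o_def, symmetric] integrable_continuous_real continuous_on_bump)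
 ultimately show ?thesis by (simp add: bump_kernel_def)
qed

lemma has_vector_derivative_of_real_poly:
 assumes "(f has_real_derivative f') (at y)"
 shows "((\<lambda>y. complex_of_real (f y)) has_vector_derivative of_real f') (at y)"
 using assms by (simp add: has_vector_derivative_of_real has_real_derivative_iff_has_vector_derivative)

text \<open>Two integrations by parts give x^-2 for the transform, and squaring gives x^-4; near 0
  the trivial bound serves.\<close>

lemma bump_kernel_decay:
 assumes "b > 0"
 obtains C where "C > 0" "\<And>x. bump_kernel b x \<le> C / (1 + x^2)^2"
proof -
 have 0: "norm (bump_ft b x) \<le> 2 * b^5" for x
 proof -
  have "norm (bump_ft b x) \<le> b^4 * (b - (-b))" unfolding bump_ft_def
   using assms bump_le[of _ b] by (intro integral_bound) (auto intro!: continuous_intros simp: norm_mult)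
  thus ?thesis by (simp add: power_numeral_reduce)
 qed
 have 2: "norm (bump_ft b x) \<le> (16 * b^2) * (b - (-b)) / x^2" if "x \<noteq> 0" for x
  unfolding bump_ft_def
 proof (rule norm_oscillating_integral_le[where g = "\<lambda>y. of_real (- 4 * y * (b^2 - y^2))" and h = "\<lambda>y. of_real (12 * y^2 - 4 * b^2)"])
  show "((\<lambda>y. complex_of_real (bump b y)) has_vector_derivative of_real (- 4 * y * (b^2 - y^2))) (at y)" for y
   unfolding bump_def
   by (rule has_vector_derivative_of_real_poly) (auto intro!: derivative_eq_intros simp: algebra_simps power2_eq_square)
  show "((\<lambda>y. complex_of_real (- 4 * y * (b^2 - y^2))) has_vector_derivative of_real (12 * y^2 - 4 * b^2)) (at y)" for y
   by (rule has_vector_derivative_of_real_poly) (auto intro!: derivative_eq_intros simp: algebra_simps power2_eq_square)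
  show "norm (complex_of_real (12 * y^2 - 4 * b^2)) \<le> 16 * b^2" if "y \<in> {-b..b}" for y
  proof -
   have "y^2 \<le> b^2" using that by (intro abs_le_square_iff[THEN iffD1]) auto
   moreover have "y^2 \<ge> 0" by simp
   ultimately have "\<bar>12 * y^2 - 4 * b^2\<bar> \<le> 16 * b^2" by linarith
   thus ?thesis by (metis norm_of_real real_norm_def)
  qed
 qed (use assms that in \<open>auto intro!: continuous_intros simp: bump_def\<close>)
 define D where "D = 2 * b^5 + 32 * b^3"
 have D: "D > 0" using assms by (simp add: D_def add_pos_pos)
 have "norm (bump_ft b x) * (1 + x^2) \<le> D" for x
 proof (cases "x = 0")
  case False
  have "norm (bump_ft b x) * x^2 \<le> 32 * b^3"
  proof -
   have "norm (bump_ft b x) * x^2 \<le> (16 * b^2) * (b - (-b))"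
    using 2[OF False] False by (subst (asm) pos_le_divide_eq) auto
   thus ?thesis by (simp add: power_numeral_reduce mult_ac)
  qed
  thus ?thesis using 0[of x] by (simp add: D_def algebra_simps)
 qed (use 0[of 0] assms in \<open>simp add: D_def add_increasing2\<close>)
 hence "norm (bump_ft b x) \<le> D / (1 + x^2)" for x
  by (subst pos_le_divide_eq) (auto simp: add_pos_nonneg)
 hence "bump_kernel b x \<le> (D / (1 + x^2))^2" for x
  unfolding bump_kernel_def by (intro power_mono) auto
 thus ?thesis using D by (intro that[of "D^2"]) (auto simp: power_divide)
qed

lemma bump2_integral_swap:
 fixes H :: "real \<Rightarrow> real \<Rightarrow> complex"
 assumes "b \<ge> 0" and H: "continuous_on UNIV (\<lambda>(w, y). H w y)"
 shows "integral {p..q} (\<lambda>w. bump2_integral b (H w)) = bump2_integral b (\<lambda>y. integral {p..q} (\<lambda>w. H w y))"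
proof -
 have H': "continuous_on S (\<lambda>x. H (f x) (g x))" if "continuous_on S f" "continuous_on S g" for S :: "'b::topological_space set" and f g
  using continuous_on_compose2[OF H continuous_on_Pair[OF that]] by simp
 define inner where "inner = (\<lambda>w z. integral {-b..b} (\<lambda>y. of_real (bump b y) * H w (y - z)))"
 have "continuous_on ((UNIV :: (real \<times> real) set) \<times> cbox (-b) b) (\<lambda>(x, y). of_real (bump b y) * H (fst x) (y - snd x))"
  unfolding case_prod_unfold by (intro continuous_intros H')
 from integral_continuous_on_param[OF this] have inner: "continuous_on S (\<lambda>x. inner (fst x) (snd x))" for S
  by (auto simp: inner_def intro: continuous_on_subset)
 have "integral {p..q} (\<lambda>w. bump2_integral b (H w)) = integral (cbox p q) (\<lambda>w. integral (cbox (-b) b) (\<lambda>z. of_real (bump b z) * inner w z))"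
  by (simp add: bump2_integral_def inner_def)
 also have "\<dots> = integral (cbox (-b) b) (\<lambda>z. integral (cbox p q) (\<lambda>w. of_real (bump b z) * inner w z))"
  by (rule integral_swap_continuous) (unfold case_prod_unfold, intro continuous_intros inner)
 also have "\<dots> = integral {-b..b} (\<lambda>z. of_real (bump b z) * integral {p..q} (\<lambda>w. inner w z))"
  by simp
 also have "\<dots> = integral {-b..b} (\<lambda>z. of_real (bump b z) * integral {-b..b} (\<lambda>y. of_real (bump b y) * integral {p..q} (\<lambda>w. H w (y - z))))"
 proof -
  have "integral {p..q} (\<lambda>w. inner w z) = integral {-b..b} (\<lambda>y. of_real (bump b y) * integral {p..q} (\<lambda>w. H w (y - z)))" for z
  proof -
   have "integral (cbox p q) (\<lambda>w. integral (cbox (-b) b) (\<lambda>y. of_real (bump b y) * H w (y - z))) =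
     integral (cbox (-b) b) (\<lambda>y. integral (cbox p q) (\<lambda>w. of_real (bump b y) * H w (y - z)))"
    by (rule integral_swap_continuous) (unfold case_prod_unfold, intro continuous_intros H')
   thus ?thesis by (simp add: inner_def)
  qed
  thus ?thesis by simp
 qed
 finally show ?thesis by (simp add: bump2_integral_def)
qed

lemma tendsto_bump2_integral:
 assumes "b \<ge> 0" and cont: "\<And>n. continuous_on {-2*b..2*b} (F n)" "continuous_on {-2*b..2*b} G"
  and lim: "uniform_limit {-2*b..2*b} F G L"
 shows "((\<lambda>n. bump2_integral b (F n)) \<longlongrightarrow> bump2_integral b G) L"
proof (rule tendstoI)
 fix e :: real assume "e > 0"
 define e' where "e' = e / (2 * (2 * b^5 * (2 * b^5)) + 1)"
 have pos: "2 * (2 * b^5 * (2 * b^5)) + 1 > 0" using assms(1) by (simp add: add_nonneg_pos)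
 have e': "e' > 0" using \<open>e > 0\<close> pos by (simp add: e'_def)
 have "\<forall>\<^sub>F n in L. \<forall>x\<in>{-2*b..2*b}. dist (F n x) (G x) < e'"
  using lim e' by (simp add: uniform_limit_iff)
 thus "\<forall>\<^sub>F n in L. dist (bump2_integral b (F n)) (bump2_integral b G) < e"
 proof eventually_elim
  case (elim n)
  have "bump2_integral b (F n) - bump2_integral b G = bump2_integral b (\<lambda>y. F n y + (-1) * G y)"
   by (subst bump2_integral_add, use assms in \<open>auto intro!: continuous_intros\<close>)
     (subst bump2_integral_cmult[of b "-1" G, simplified], simp)
  also have "norm \<dots> \<le> 2 * b^5 * (2 * b^5 * e')"
  proof (rule norm_bump2_integral_le')
   show "norm (F n y + (-1) * G y) \<le> e'" if "y \<in> {-2*b..2*b}" for y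
    using elim that by (auto simp: dist_norm intro: less_imp_le)
  qed (use assms in \<open>auto intro!: continuous_intros\<close>)
  also have "\<dots> < e" using \<open>e > 0\<close> pos e' assms(1)
  proof -
   have "2 * b^5 * (2 * b^5 * e') < (2 * (2 * b^5 * (2 * b^5)) + 1) * e'"
    using e' assms(1) zero_le_mult_iff[of e' "4 * b^10"] by (simp add: algebra_simps add_pos_nonneg)
   also have "\<dots> = e" using pos by (simp add: e'_def)
   finally show ?thesis .
  qed
  finally show ?case by (simp add: dist_norm)
 qed
qed

lemma integrable_bump_kernel:
 assumes "b > 0"
 shows "integrable lborel (bump_kernel b)"
proof -
 obtain C where C: "C > 0" "\<And>x. bump_kernel b x \<le> C / (1 + x^2)^2" by (rule bump_kernel_decay[OF assms]) (rule that)
 show ?thesis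
 proof (rule Bochner_Integration.integrable_bound)
  show "integrable lborel (\<lambda>x::real. C * inverse (1 + x^2))"
   using integrable_inverse_1_plus_square by (simp add: set_integrable_def)
  show "bump_kernel b \<in> borel_measurable lborel"
   using continuous_on_bump_kernel by (simp add: borel_measurable_continuous_onI)
  show "AE x in lborel. norm (bump_kernel b x) \<le> norm (C * inverse (1 + x^2))"
  proof (rule AE_I2)
   fix x :: real
   have "bump_kernel b x \<le> C / (1 + x^2)^2" by (rule C)
   also have "\<dots> \<le> C / (1 + x^2)"
   proof (intro divide_left_mono mult_pos_pos)
    have "1 + x^2 > 0" by (simp add: add_pos_nonneg)
    thus "1 + x^2 > 0" "(1 + x^2)^2 > 0" by simp_all
   qed (use C self_le_power[of "1 + x^2" 2] in auto)
   finally show "norm (bump_kernel b x) \<le> norm (C * inverse (1 + x^2))"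
    using bump_kernel_nonneg[of b x] C(1) by (simp add: field_simps)
  qed
 qed
qed

text \<open>Outside [-p, q] one factor 1/(1 + x^2) of the decay is replaced by its value at an end
  point, and the other integrates to pi. The resulting rate matches the error terms O(1/(1 + v^2))
  of the prime sums.\<close>

lemma bump_kernel_integral_interval:
 assumes "b > 0"
 obtains C where "C > 0" "\<And>p q. integral {p..q} (bump_kernel b) \<le> (LINT x|lborel. bump_kernel b x)"
  "\<And>p q. p \<ge> 0 ==> q \<ge> 0 ==> (LINT x|lborel. bump_kernel b x) - C * (1 / (1 + p^2) + 1 / (1 + q^2)) \<le> integral {-p..q} (bump_kernel b)"
proof -
 obtain C where C: "C > 0" "\<And>x. bump_kernel b x \<le> C / (1 + x^2)^2" by (rule bump_kernel_decay[OF assms]) (rule that)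
 have int: "set_integrable lborel {p..q} (bump_kernel b)" for p q
  unfolding set_integrable_def using integrable_bump_kernel[OF assms] by (intro integrable_mult_indicator) auto
 have eq: "integral {p..q} (bump_kernel b) = (LINT x|lborel. indicator {p..q} x * bump_kernel b x)" for p q
  using set_borel_integral_eq_integral(2)[OF int[of p q]] by (simp add: set_lebesgue_integral_def)
 have int': "integrable lborel (\<lambda>x. indicator {p..q} x * bump_kernel b x)" for p q
  using int[of p q] by (simp add: set_integrable_def)
 have intd: "integrable lborel (\<lambda>x::real. inverse (1 + x^2))"
  using integrable_inverse_1_plus_square by (simp add: set_integrable_def)
 have I0: "(LINT x|lborel. inverse (1 + x^2)) = pi"
  using LBINT_inverse_1_plus_square by (simp add: interval_lebesgue_integral_def set_lebesgue_integral_def)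
 show ?thesis
 proof (rule that[of "C * pi"])
  show "C * pi > 0" using C by simp
  show "integral {p..q} (bump_kernel b) \<le> (LINT x|lborel. bump_kernel b x)" for p q
   unfolding eq by (intro integral_mono int' integrable_bump_kernel assms) (auto simp: indicator_def bump_kernel_nonneg)
  fix p q :: real assume pq: "p \<ge> 0" "q \<ge> 0"
  let ?D = "C * (1 / (1 + p^2) + 1 / (1 + q^2))"
  have "(LINT x|lborel. bump_kernel b x) - integral {-p..q} (bump_kernel b) = (LINT x|lborel. bump_kernel b x - indicator {-p..q} x * bump_kernel b x)"
   unfolding eq by (rule Bochner_Integration.integral_diff[symmetric]) (intro int' integrable_bump_kernel assms)+
  also have "\<dots> \<le> (LINT x|lborel. ?D * inverse (1 + x^2))"
  proof (rule integral_mono)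
   fix x :: real
   show "bump_kernel b x - indicator {-p..q} x * bump_kernel b x \<le> ?D * inverse (1 + x^2)"
   proof (cases "x \<in> {-p..q}")
    case True
    thus ?thesis using C by (simp add: add_nonneg_nonneg)
   next
    case False
    have "1 / (1 + x^2) \<le> 1 / (1 + p^2) + 1 / (1 + q^2)"
    proof (cases "x < -p")
     case True
     hence "p^2 \<le> x^2" using pq by (intro abs_le_square_iff[THEN iffD1]) auto
     hence "1 / (1 + x^2) \<le> 1 / (1 + p^2)" by (intro divide_left_mono) (auto intro!: mult_pos_pos add_pos_nonneg)
     thus ?thesis by (simp add: add_increasing2)
    next
     case f: False
     hence "q^2 \<le> x^2" using pq False by (intro abs_le_square_iff[THEN iffD1]) auto
     hence "1 / (1 + x^2) \<le> 1 / (1 + q^2)" by (intro divide_left_mono) (auto intro!: mult_pos_pos add_pos_nonneg)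
     thus ?thesis by (simp add: add_increasing)
    qed
    hence "C * (1 / (1 + x^2)) * inverse (1 + x^2) \<le> ?D * inverse (1 + x^2)"
     using C by (intro mult_right_mono mult_left_mono) auto
    moreover have "bump_kernel b x \<le> C * (1 / (1 + x^2)) * inverse (1 + x^2)"
     using C(2)[of x] by (simp add: power2_eq_square[of "1 + x^2"] field_simps)
    ultimately show ?thesis using False by simp
   qed
  qed (intro Bochner_Integration.integrable_diff int' integrable_bump_kernel assms integrable_mult_right intd)+
  also have "\<dots> = ?D * pi" using I0 by simp
  finally show "(LINT x|lborel. bump_kernel b x) - C * pi * (1 / (1 + p^2) + 1 / (1 + q^2)) \<le> integral {-p..q} (bump_kernel b)"
   by (simp add: mult_ac)
 qed
qed

section \<open>A Tauberian computation: primes weighted by the kernel\<close>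

lemma has_vector_derivative_vertical:
 fixes B B' :: "complex \<Rightarrow> complex"
 assumes "(B has_field_derivative B' (\<sigma> - \<i> * of_real (y - z))) (at (\<sigma> - \<i> * of_real (y - z)))"
 shows "((\<lambda>y. B (\<sigma> - \<i> * of_real (y - z))) has_vector_derivative (- \<i> * B' (\<sigma> - \<i> * of_real (y - z)))) (at y)"
proof -
 have "((\<lambda>w. \<sigma> - \<i> * (w - of_real z)) has_field_derivative - \<i>) (at (of_real y))"
  by (auto intro!: derivative_eq_intros)
 from has_vector_derivative_real_field[OF this]
 have "((\<lambda>y. \<sigma> - \<i> * of_real (y - z)) has_vector_derivative - \<i>) (at y)" by simp
 from field_vector_diff_chain_at[OF this assms] show ?thesis by (simp add: o_def)
qed

text \<open>A holomorphic part of a Dirichlet series near 1 contributes O(1/(1 + v^2)), by two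
  integrations by parts. For \<sigma> in [1, 1 + b] and |y - z| at most 2b all points lie within 3b
  of 1, where B, B' and B'' are bounded by compactness; hence the bound is uniform down to \<sigma>
  = 1.\<close>

lemma bump_inner_oscillating_bound:
 fixes B :: "complex \<Rightarrow> complex"
 assumes "b > 0" "B holomorphic_on ball 1 (4 * b)"
 obtains M where "M > 0" "\<And>\<sigma> z v. 1 \<le> \<sigma> ==> \<sigma> \<le> 1 + b ==> z \<in> {-b..b} ==>
   norm (integral {-b..b} (\<lambda>y. of_real (bump b y) * (exp (- (\<i> * of_real (v * (y - z)))) * B (of_real \<sigma> - \<i> * of_real (y - z))))) \<le> M / (1 + v^2)"
proof -
 define B1 where "B1 = deriv B"
 define B2 where "B2 = deriv B1"
 have hol1: "B1 holomorphic_on ball 1 (4 * b)" unfolding B1_def using assms(2) by (intro holomorphic_deriv) auto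
 have hol2: "B2 holomorphic_on ball 1 (4 * b)" unfolding B2_def using hol1 by (intro holomorphic_deriv) auto
 have dB: "(B has_field_derivative B1 s) (at s)" if "s \<in> ball 1 (4 * b)" for s
  unfolding B1_def using assms(2) that by (intro holomorphic_derivI[of B "ball 1 (4*b)"]) auto
 have dB1: "(B1 has_field_derivative B2 s) (at s)" if "s \<in> ball 1 (4 * b)" for s
  unfolding B2_def using hol1 that by (intro holomorphic_derivI[of B1 "ball 1 (4*b)"]) auto
 have sub: "cball (1::complex) (3 * b) \<subseteq> ball 1 (4 * b)" using assms(1) by auto
 have bdd: "\<exists>M. \<forall>s\<in>cball 1 (3 * b). norm (f s) \<le> M" if "f holomorphic_on ball 1 (4 * b)" for f :: "complex \<Rightarrow> complex"
 proof -
  have "compact (f ` cball 1 (3 * b))"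
   using that sub by (intro compact_continuous_image holomorphic_on_imp_continuous_on holomorphic_on_subset[OF that]) auto
  thus ?thesis using compact_imp_bounded[of "f ` cball 1 (3*b)"] unfolding bounded_iff by auto
 qed
 obtain M0 M1 M2 where M: "\<And>s. s \<in> cball 1 (3 * b) ==> norm (B s) \<le> M0"
   "\<And>s. s \<in> cball 1 (3 * b) ==> norm (B1 s) \<le> M1" "\<And>s. s \<in> cball 1 (3 * b) ==> norm (B2 s) \<le> M2"
  using bdd[OF assms(2)] bdd[OF hol1] bdd[OF hol2] by metis
 have "1 \<in> cball (1::complex) (3 * b)" using assms(1) by simp
 hence Mpos: "M0 \<ge> 0" "M1 \<ge> 0" "M2 \<ge> 0"
  using order_trans[OF norm_ge_zero M(1)[of 1]] order_trans[OF norm_ge_zero M(2)[of 1]] order_trans[OF norm_ge_zero M(3)[of 1]] by auto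
 \<comment> \<open>Bounds the second derivative of the bump times \<open>B\<close>: 16 b^2, 4 b^3
   and b^4 bound the second derivative, the first derivative and the bump itself, and 2 is the
   binomial coefficient.\<close>
 define D where "D = 16 * b^2 * M0 + 2 * (4 * b * b^2 * M1) + b^4 * M2"
 have Dpos: "D \<ge> 0" using Mpos assms(1) by (simp add: D_def)
 define M' where "M' = 2 * b^5 * M0 + D * (2 * b) + 1"
 have M'pos: "M' > 0" using Mpos Dpos assms(1) by (simp add: M'_def add_nonneg_pos)
 have main: "norm (integral {-b..b} (\<lambda>y. of_real (bump b y) * (exp (- (\<i> * of_real (v * (y - z)))) * B (of_real \<sigma> - \<i> * of_real (y - z))))) \<le> M' / (1 + v^2)"
  (is "norm ?I \<le> _")
  if \<sigma>: "1 \<le> \<sigma>" "\<sigma> \<le> 1 + b" and z: "z \<in> {-b..b}" for \<sigma> z v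
 proof -
  let ?s = "\<lambda>y. of_real \<sigma> - \<i> * of_real (y - z) :: complex"
  have s_in: "?s y \<in> cball 1 (3 * b)" if "y \<in> {-b..b}" for y
  proof -
   have "norm (?s y - 1) = norm (of_real (\<sigma> - 1) - \<i> * of_real (y - z))" by (simp add: algebra_simps)
   also have "\<dots> \<le> norm (complex_of_real (\<sigma> - 1)) + norm (\<i> * complex_of_real (y - z))" by (rule norm_triangle_ineq4)
   also have "\<dots> = \<bar>\<sigma> - 1\<bar> + \<bar>y - z\<bar>" by (simp only: norm_mult norm_of_real norm_ii real_norm_def) simp
   also have "\<dots> \<le> 3 * b" using that z \<sigma> by auto
   finally show ?thesis by (simp add: dist_norm norm_minus_commute)
  qed
  have s_in': "?s y \<in> ball 1 (4 * b)" if "y \<in> {-b..b}" for y using s_in[OF that] sub by blast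
  have contB: "continuous_on {-b..b} (\<lambda>y. f (?s y))" if "f holomorphic_on ball 1 (4 * b)" for f :: "complex \<Rightarrow> complex"
   using s_in' by (intro continuous_on_compose2[OF holomorphic_on_imp_continuous_on[OF that]]) (auto intro!: continuous_intros)
  define f where "f = (\<lambda>y. of_real (bump b y) * B (?s y))"
  define g where "g = (\<lambda>y. of_real (- 4 * y * (b^2 - y^2)) * B (?s y) + of_real (bump b y) * (- \<i> * B1 (?s y)))"
  define h where "h = (\<lambda>y. of_real (12 * y^2 - 4 * b^2) * B (?s y) + 2 * (of_real (- 4 * y * (b^2 - y^2)) * (- \<i> * B1 (?s y))) + of_real (bump b y) * (- B2 (?s y)))"
  have r0: "((\<lambda>y. complex_of_real (bump b y)) has_vector_derivative of_real (- 4 * y * (b^2 - y^2))) (at y)" for y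
   unfolding bump_def
   by (rule has_vector_derivative_of_real_poly) (auto intro!: derivative_eq_intros simp: algebra_simps power2_eq_square)
  have r1: "((\<lambda>y. complex_of_real (- 4 * y * (b^2 - y^2))) has_vector_derivative of_real (12 * y^2 - 4 * b^2)) (at y)" for y
   by (rule has_vector_derivative_of_real_poly) (auto intro!: derivative_eq_intros simp: algebra_simps power2_eq_square)
  have d0: "((\<lambda>y. B (?s y)) has_vector_derivative - \<i> * B1 (?s y)) (at y)" if "y \<in> {-b..b}" for y
   by (rule has_vector_derivative_vertical[of B B1]) (rule dB[OF s_in'[OF that]])
  have d1: "((\<lambda>y. - \<i> * B1 (?s y)) has_vector_derivative - B2 (?s y)) (at y)" if "y \<in> {-b..b}" for y
  proof -
   have "((\<lambda>y. B1 (?s y)) has_vector_derivative - \<i> * B2 (?s y)) (at y)"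
    by (rule has_vector_derivative_vertical[of B1 B2]) (rule dB1[OF s_in'[OF that]])
   from has_vector_derivative_mult_right[OF this, of "-\<i>"] show ?thesis by simp
  qed
  have df: "(f has_vector_derivative g y) (at y)" if "y \<in> {-b..b}" for y
   unfolding f_def g_def using has_vector_derivative_mult[OF r0 d0[OF that]] by (simp add: algebra_simps)
  have dg: "(g has_vector_derivative h y) (at y)" if "y \<in> {-b..b}" for y
   unfolding g_def h_def
   using has_vector_derivative_add[OF has_vector_derivative_mult[OF r1 d0[OF that]] has_vector_derivative_mult[OF r0 d1[OF that]]]
   by (rule has_vector_derivative_eq_rhs) (simp add: algebra_simps)
  have h_bound: "norm (h y) \<le> D" if y: "y \<in> {-b..b}" for y
  proof -
   have y2: "y^2 \<le> b^2" using y by (intro abs_le_square_iff[THEN iffD1]) auto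
   have y20: "y^2 \<ge> 0" by simp
   have e1: "\<bar>12 * y^2 - 4 * b^2\<bar> \<le> 16 * b^2" using y2 y20 by linarith
   have "\<bar>- 4 * y * (b^2 - y^2)\<bar> = 4 * (\<bar>y\<bar> * (b^2 - y^2))" using y2 by (simp add: abs_mult)
   also have "\<dots> \<le> 4 * (b * b^2)" using y y2 y20 by (intro mult_left_mono mult_mono) auto
   finally have e2: "\<bar>- 4 * y * (b^2 - y^2)\<bar> \<le> 4 * b * b^2" by simp
   have "norm (h y) \<le> norm (of_real (12 * y^2 - 4 * b^2) * B (?s y)) + norm (2 * (of_real (- 4 * y * (b^2 - y^2)) * (- \<i> * B1 (?s y)))) + norm (of_real (bump b y) * (- B2 (?s y)))"
    unfolding h_def by (rule order_trans[OF norm_triangle_ineq add_right_mono[OF norm_triangle_ineq]])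
   also have "\<dots> = \<bar>12 * y^2 - 4 * b^2\<bar> * norm (B (?s y)) + 2 * (\<bar>- 4 * y * (b^2 - y^2)\<bar> * norm (B1 (?s y))) + \<bar>bump b y\<bar> * norm (B2 (?s y))"
    by (simp only: norm_mult norm_of_real norm_minus_cancel norm_ii real_norm_def) simp
   also have "\<dots> \<le> D" unfolding D_def
    using e1 e2 bump_le[OF y] M s_in[OF y] Mpos assms(1)
    by (intro add_mono mult_left_mono mult_mono) auto
   finally show ?thesis .
  qed
  have eqI: "?I = exp (\<i> * of_real (v * z)) * integral {-b..b} (\<lambda>y. f y * exp (\<i> * of_real (- v * y)))"
  proof -
   have "of_real (bump b y) * (exp (- (\<i> * of_real (v * (y - z)))) * B (?s y)) = exp (\<i> * of_real (v * z)) * (f y * exp (\<i> * of_real (- v * y)))" for y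
    by (simp add: f_def algebra_simps flip: exp_add)
   thus ?thesis by simp
  qed
  have n0: "norm ?I \<le> 2 * b^5 * M0"
  proof -
   have "norm ?I \<le> (b^4 * M0) * (b - (-b))"
   proof (rule integral_bound)
    show "continuous_on {-b..b} (\<lambda>y. of_real (bump b y) * (exp (- (\<i> * of_real (v * (y - z)))) * B (?s y)))"
     by (intro continuous_intros contB assms)
    show "norm (of_real (bump b y) * (exp (- (\<i> * of_real (v * (y - z)))) * B (?s y))) \<le> b^4 * M0" if "y \<in> {-b..b}" for y
    proof -
     have "norm (exp (- (\<i> * complex_of_real (v * (y - z))))) = 1" by simp
     thus ?thesis using bump_le[OF that] M(1)[OF s_in[OF that]] Mpos
      by (simp only: norm_mult) (auto intro!: mult_mono)
    qed
   qed (use assms in auto)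
   thus ?thesis by (simp add: power_numeral_reduce algebra_simps)
  qed
  have n2: "norm ?I * v^2 \<le> D * (2 * b)"
  proof (cases "v = 0")
   case False
   have "norm (integral {-b..b} (\<lambda>y. f y * exp (\<i> * of_real (- v * y)))) \<le> D * (b - (-b)) / (-v)^2"
   proof (rule norm_oscillating_integral_le[where g = g and h = h])
    show "continuous_on {-b..b} h" unfolding h_def by (intro continuous_intros contB assms hol1 hol2)
   qed (use assms(1) False df dg h_bound in \<open>auto simp: f_def g_def bump_def\<close>)
   hence "norm ?I \<le> D * (2 * b) / v^2" unfolding eqI by (simp add: norm_mult)
   thus ?thesis using False by (simp add: field_simps)
  qed (use Dpos assms(1) in simp)
  have "norm ?I * (1 + v^2) \<le> M'" using n0 n2 by (simp add: M'_def algebra_simps)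
  thus ?thesis by (subst pos_le_divide_eq) (auto simp: add_pos_nonneg)
 qed
 show ?thesis by (rule that[OF M'pos main])
qed

lemma prime_log_zeta_pole:
 assumes "c > 0" "A holomorphic_on ball 1 c"
  "\<And>s. s \<in> ball 1 c ==> Re s > 1 ==> prime_zeta s = - Ln (s - 1) + A s"
  and s: "s \<in> ball 1 c" "Re s > 1"
 shows "prime_log_zeta s = 1 / (s - 1) - deriv A s"
proof -
 have "((\<lambda>s. - Ln (s - 1) + A s) has_field_derivative - (1 / (s - 1)) + deriv A s) (at s)"
 proof (intro derivative_eq_intros)
  show "(A has_field_derivative deriv A s) (at s)"
   using assms s by (intro holomorphic_derivI[of A "ball 1 c"]) auto
  show "s - 1 \<notin> \<real>\<^sub>\<le>\<^sub>0" using s by (auto simp: complex_nonpos_Reals_iff)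
 qed (use s in \<open>auto simp: divide_inverse\<close>)
 moreover have "((\<lambda>s. - Ln (s - 1) + A s) has_field_derivative - prime_log_zeta s) (at s)"
 proof (rule has_field_derivative_transform_within_open[OF has_field_derivative_prime_zeta[OF s(2)]])
  show "open (ball 1 c \<inter> {s. Re s > 1})" by (intro open_Int open_halfspace_Re_gt) auto
 qed (use assms in auto)
 ultimately have "- (1 / (s - 1)) + deriv A s = - prime_log_zeta s" by (rule DERIV_unique)
 thus ?thesis by (simp add: algebra_simps)
qed

lemma nat_powr_shift:
 assumes "n > 0"
 shows "of_nat n powr (- (of_real \<sigma> - \<i> * of_real y)) = of_real (real n powr (-\<sigma>)) * exp (\<i> * of_real (ln (real n) * y))"
 using assms by (simp add: powr_def algebra_simps flip: exp_add exp_of_real)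

text \<open>Integrated against the autocorrelation of the bump, the Dirichlet series
  \<open>prime_log_zeta\<close> becomes the kernel sum. Its polar part 1/(s - 1), a Laplace
  transform, becomes the damped integral of the kernel over [-v, infinity); its holomorphic part is
  O(1/(1 + v^2)). No bound degenerates as \<sigma> tends to 1.\<close>

lemma smoothed_prime_sum_right:
 obtains b C where "b > 0" "C > 0"
  "\<And>\<sigma> v. 1 < \<sigma> ==> \<sigma> \<le> 1 + b ==>
    summable (\<lambda>n. if prime n then ln (real n) * real n powr (-\<sigma>) * bump_kernel b (ln (real n) - v) else 0)"
  "\<And>\<sigma> v. 1 < \<sigma> ==> \<sigma> \<le> 1 + b ==>
    (\<Sum>n. if prime n then ln (real n) * real n powr (-\<sigma>) * bump_kernel b (ln (real n) - v) else 0)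
     \<le> (LINT x|lborel. bump_kernel b x) + C / (1 + v^2)"
  "\<And>\<sigma> v R. 1 < \<sigma> ==> \<sigma> \<le> 1 + b ==> R \<ge> - v ==>
    (\<Sum>n. if prime n then ln (real n) * real n powr (-\<sigma>) * bump_kernel b (ln (real n) - v) else 0)
     \<ge> exp (- (\<sigma> - 1) * (R + v)) * integral {-v..R} (bump_kernel b) - C / (1 + v^2)"
proof -
 obtain c A where cA: "0 < c" "c \<le> 1/4" "A holomorphic_on ball 1 c"
  "\<And>s. s \<in> ball 1 c ==> Re s > 1 ==> prime_zeta s = - Ln (s - 1) + A s"
  "(\<lambda>n. if prime n then 1 / real n + ln (1 - 1 / real n) else 0) sums Re (A 1)"
  by (rule prime_zeta_near_1) (rule that)
 \<comment> \<open>With this choice the points \<sigma> - iy with \<sigma> at most 1 + b and |y| at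
   most 2b stay within 3b of 1, inside the disc of \<open>A\<close>.\<close>
 define b where "b = c / 4"
 have b: "b > 0" "4 * b = c" using cA by (auto simp: b_def)
 define B where "B = (\<lambda>s. - deriv A s)"
 have holB: "B holomorphic_on ball 1 (4 * b)"
  unfolding B_def b using cA by (intro holomorphic_intros holomorphic_deriv) auto
 obtain M where M: "M > 0" "\<And>\<sigma> z v. 1 \<le> \<sigma> ==> \<sigma> \<le> 1 + b ==> z \<in> {-b..b} ==>
   norm (integral {-b..b} (\<lambda>y. of_real (bump b y) * (exp (- (\<i> * of_real (v * (y - z)))) * B (of_real \<sigma> - \<i> * of_real (y - z))))) \<le> M / (1 + v^2)"
  by (rule bump_inner_oscillating_bound[OF b(1) holB]) (rule that)
 obtain Ck where Ck: "Ck > 0" "\<And>p q. integral {p..q} (bump_kernel b) \<le> (LINT x|lborel. bump_kernel b x)"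
  "\<And>p q. p \<ge> 0 ==> q \<ge> 0 ==> (LINT x|lborel. bump_kernel b x) - Ck * (1 / (1 + p^2) + 1 / (1 + q^2)) \<le> integral {-p..q} (bump_kernel b)"
  by (rule bump_kernel_integral_interval[OF b(1)]) (rule that)
 define C where "C = 2 * b^5 * M"
 have C: "C > 0" using M b by (simp add: C_def)
 let ?a = "\<lambda>\<sigma> v n. if prime n then ln (real n) * real n powr (-\<sigma>) * bump_kernel b (ln (real n) - v) else 0"
 have key: "\<exists>L E. ?a \<sigma> v sums (L + E) \<and> \<bar>E\<bar> \<le> C / (1 + v^2) \<and>
   ((\<lambda>R. integral {-v..R} (\<lambda>w. exp (- (\<sigma> - 1) * (w + v)) * bump_kernel b w)) \<longlongrightarrow> L) at_top"
  if \<sigma>: "1 < \<sigma>" "\<sigma> \<le> 1 + b" for \<sigma> v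
 proof -
  define \<epsilon> where "\<epsilon> = \<sigma> - 1"
  have \<epsilon>: "\<epsilon> > 0" using \<sigma> by (simp add: \<epsilon>_def)
  \<comment> \<open>The factor exp (-ivy) centres the kernel at \<open>v\<close>. \<open>G\<close>
    is the polar and \<open>H\<close> the holomorphic part of \<open>F\<close>.\<close>
  define F where "F = (\<lambda>y::real. exp (- (\<i> * of_real (v * y))) * prime_log_zeta (of_real \<sigma> - \<i> * of_real y))"
  define G where "G = (\<lambda>y::real. exp (- (\<i> * of_real (v * y))) / (of_real \<epsilon> - \<i> * of_real y))"
  define H where "H = (\<lambda>y::real. exp (- (\<i> * of_real (v * y))) * B (of_real \<sigma> - \<i> * of_real y))"
  have den: "of_real \<epsilon> - \<i> * of_real y \<noteq> (0::complex)" for y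
   using \<epsilon> by (auto simp: complex_eq_iff)
  have s_in: "of_real \<sigma> - \<i> * of_real y \<in> ball 1 c" if "y \<in> {-2*b..2*b}" for y
  proof -
   have "norm (of_real \<sigma> - \<i> * of_real y - 1) = norm (of_real (\<sigma> - 1) - \<i> * complex_of_real y)" by (simp add: algebra_simps)
   also have "\<dots> \<le> norm (complex_of_real (\<sigma> - 1)) + norm (\<i> * complex_of_real y)" by (rule norm_triangle_ineq4)
   also have "\<dots> = \<bar>\<sigma> - 1\<bar> + \<bar>y\<bar>" by (simp only: norm_mult norm_of_real norm_ii real_norm_def)
   also have "\<dots> < c" using that \<sigma> b by auto
   finally show ?thesis by (simp add: dist_norm norm_minus_commute)
  qed
  have FGH: "F y = G y + H y" if "y \<in> {-2*b..2*b}" for y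
  proof -
   have "prime_log_zeta (of_real \<sigma> - \<i> * of_real y) = 1 / (of_real \<sigma> - \<i> * of_real y - 1) + B (of_real \<sigma> - \<i> * of_real y)"
    using prime_log_zeta_pole[OF cA(1,3,4) s_in[OF that]] \<sigma> by (simp add: B_def)
   also have "of_real \<sigma> - \<i> * of_real y - 1 = of_real \<epsilon> - \<i> * of_real y" by (simp add: \<epsilon>_def)
   finally show ?thesis by (simp add: F_def G_def H_def algebra_simps)
  qed
  have contG: "continuous_on {-2*b..2*b} G" unfolding G_def using den by (intro continuous_intros) auto
  have contH: "continuous_on {-2*b..2*b} H" unfolding H_def
   using s_in b by (intro continuous_intros continuous_on_compose2[OF holomorphic_on_imp_continuous_on[OF holB]]) auto
  define f where "f = (\<lambda>n y. if prime n then of_real (ln (real n) * real n powr (-\<sigma>)) * exp (\<i> * of_real ((ln (real n) - v) * y)) else 0 :: complex)"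
  have contf: "continuous_on S (f n)" for n S
   unfolding f_def by (cases "prime n") (auto intro!: continuous_intros)
  have fF: "(\<lambda>n. f n y) sums F y" for y
  proof -
   have "(\<lambda>n. exp (- (\<i> * of_real (v * y))) * (if prime n then of_real (ln (real n)) * of_nat n powr (- (of_real \<sigma> - \<i> * of_real y)) else 0)) sums F y"
    unfolding F_def using sums_prime_log_zeta[of "of_real \<sigma> - \<i> * of_real y"] \<sigma> by (intro sums_mult) auto
   also have "(\<lambda>n. exp (- (\<i> * of_real (v * y))) * (if prime n then of_real (ln (real n)) * of_nat n powr (- (of_real \<sigma> - \<i> * of_real y)) else 0)) = (\<lambda>n. f n y)"
   proof
    fix n :: nat
    show "exp (- (\<i> * of_real (v * y))) * (if prime n then of_real (ln (real n)) * of_nat n powr (- (of_real \<sigma> - \<i> * of_real y)) else 0) = f n y"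
    proof (cases "prime n")
     case True
     have "exp (\<i> * complex_of_real ((ln (real n) - v) * y)) = exp (- (\<i> * of_real (v * y))) * exp (\<i> * of_real (ln (real n) * y))"
      by (simp add: algebra_simps flip: exp_add)
     thus ?thesis using True nat_powr_shift[of n \<sigma> y] prime_gt_0_nat[OF True] by (simp add: f_def mult_ac)
    qed (simp add: f_def)
   qed
   finally show ?thesis .
  qed
  have ul: "uniform_limit {-2*b..2*b} (\<lambda>N y. \<Sum>n<N. f n y) F sequentially"
  proof -
   have "uniform_limit {-2*b..2*b} (\<lambda>N y. \<Sum>n<N. f n y) (\<lambda>y. \<Sum>n. f n y) sequentially"
   proof (rule Weierstrass_m_test)
    show "norm (f n y) \<le> (if prime n then ln (real n) * real n powr (-\<sigma>) else 0)" for n y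
    proof (cases "prime n")
     case True
     hence "real n \<ge> 1" using prime_ge_1_nat by force
     moreover have "norm (exp (\<i> * complex_of_real ((ln (real n) - v) * y))) = 1" by (rule norm_exp_i_times)
     ultimately show ?thesis using True by (simp only: f_def norm_mult norm_of_real if_True) simp
    qed (simp add: f_def)
    have "(\<lambda>n. Re (if prime n then of_real (ln (real n)) * of_nat n powr (- of_real \<sigma>) else 0)) sums Re (prime_log_zeta (of_real \<sigma>))"
     by (rule sums_Re, rule sums_prime_log_zeta) (use \<sigma> in simp)
    moreover have "(\<lambda>n. Re (if prime n then of_real (ln (real n)) * of_nat n powr (- of_real \<sigma>) else 0)) = (\<lambda>n. if prime n then ln (real n) * real n powr (-\<sigma>) else 0)"
    proof
     fix n :: nat
     have "(of_nat n powr (- of_real \<sigma>) :: complex) = of_real (real n powr (-\<sigma>))"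
      by (simp flip: powr_of_real of_real_minus)
     thus "Re (if prime n then of_real (ln (real n)) * of_nat n powr (- of_real \<sigma>) else 0) = (if prime n then ln (real n) * real n powr (-\<sigma>) else 0)"
      by simp
    qed
    ultimately show "summable (\<lambda>n. if prime n then ln (real n) * real n powr (-\<sigma>) else 0)" by (simp add: sums_iff)
   qed
   moreover have "(\<Sum>n. f n y) = F y" for y using fF by (simp add: sums_iff)
   ultimately show ?thesis by simp
  qed
  have contF: "continuous_on {-2*b..2*b} F"
   by (subst continuous_on_cong[OF refl FGH]) (assumption, intro continuous_on_add contG contH)
  have "(\<lambda>N. bump2_integral b (\<lambda>y. \<Sum>n<N. f n y)) \<longlonglongrightarrow> bump2_integral b F"
   by (rule tendsto_bump2_integral[OF _ _ contF ul]) (use b in \<open>auto intro!: continuous_on_sum contf\<close>)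
  moreover have "bump2_integral b (\<lambda>y. \<Sum>n<N. f n y) = of_real (\<Sum>n<N. ?a \<sigma> v n)" for N
  proof -
   have "bump2_integral b (f n) = of_real (?a \<sigma> v n)" for n
   proof (cases "prime n")
    case True
    hence "bump2_integral b (f n) = bump2_integral b (\<lambda>y. of_real (ln (real n) * real n powr (-\<sigma>)) * exp (\<i> * of_real ((ln (real n) - v) * y)))"
     by (simp add: f_def)
    also have "\<dots> = of_real (?a \<sigma> v n)"
     using True b by (subst bump2_integral_cmult, subst bump2_integral_exp) auto
    finally show ?thesis .
   qed (simp add: f_def bump2_integral_def)
   thus ?thesis using b by (subst bump2_integral_sum) (auto intro: contf)
  qed
  ultimately have "(\<lambda>N. complex_of_real (\<Sum>n<N. ?a \<sigma> v n)) \<longlonglongrightarrow> bump2_integral b F" by simp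
  hence "(\<lambda>N. Re (complex_of_real (\<Sum>n<N. ?a \<sigma> v n))) \<longlonglongrightarrow> Re (bump2_integral b F)"
   by (rule tendsto_Re)
  hence sums: "?a \<sigma> v sums Re (bump2_integral b F)" unfolding sums_def Re_complex_of_real .
  have "bump2_integral b F = bump2_integral b (\<lambda>y. G y + H y)"
   unfolding bump2_integral_def using b FGH by (intro integral_cong arg_cong2[where f = "(*)"] refl) auto
  also have "\<dots> = bump2_integral b G + bump2_integral b H"
   using b by (intro bump2_integral_add contG contH) auto
  finally have IF: "bump2_integral b F = bump2_integral b G + bump2_integral b H" .
  have "norm (bump2_integral b H) \<le> 2 * b^5 * (M / (1 + v^2))"
   using b \<sigma> M(2)[of \<sigma>] by (intro norm_bump2_integral_le contH) (auto simp: H_def)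
  hence EH: "\<bar>Re (bump2_integral b H)\<bar> \<le> C / (1 + v^2)"
   using abs_Re_le_cmod[of "bump2_integral b H"] by (simp add: C_def)
  \<comment> \<open>\<open>GR R\<close> is the integral of exp (- \<epsilon> (w + v)) exp (iwy) over
    w in [-v, R], in closed form. The damping makes it tend to \<open>G\<close> uniformly as
    \<open>R\<close> grows, so integrals are exchanged over compact intervals only.\<close>
  define GR where "GR = (\<lambda>R y. (exp (- (\<i> * of_real (v * y))) - of_real (exp (- \<epsilon> * (R + v))) * exp (\<i> * of_real (R * y))) / (of_real \<epsilon> - \<i> * of_real y))"
  have IGR: "of_real (integral {-v..R} (\<lambda>w. exp (- \<epsilon> * (w + v)) * bump_kernel b w)) = bump2_integral b (GR R)" if "R \<ge> -v" for R
  proof -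
   let ?h = "\<lambda>w y. of_real (exp (- \<epsilon> * (w + v))) * exp (\<i> * complex_of_real (w * y))"
   have "integral {-v..R} (\<lambda>w. bump2_integral b (?h w)) = bump2_integral b (\<lambda>y. integral {-v..R} (\<lambda>w. ?h w y))"
    using b by (intro bump2_integral_swap) (auto simp: case_prod_unfold intro!: continuous_intros)
   moreover have "bump2_integral b (?h w) = of_real (exp (- \<epsilon> * (w + v)) * bump_kernel b w)" for w
    using b by (subst bump2_integral_cmult, subst bump2_integral_exp) auto
   moreover have "integral {-v..R} (\<lambda>w. ?h w y) = GR R y" for y
   proof (rule integral_unique)
    let ?k = "\<lambda>w. - (of_real (exp (- \<epsilon> * (w + v))) * exp (\<i> * complex_of_real (w * y))) / (of_real \<epsilon> - \<i> * of_real y)"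
    have "((\<lambda>w. ?h w y) has_integral (?k R - ?k (-v))) {-v..R}"
    proof (rule fundamental_theorem_of_calculus[OF that])
     fix w :: real
     let ?D = "of_real \<epsilon> - \<i> * of_real y :: complex"
     let ?E = "\<lambda>z. exp (- of_real \<epsilon> * (z + of_real v) + \<i> * (z * of_real y)) :: complex"
     have "(?E has_field_derivative ?E (of_real w) * (- ?D)) (at (of_real w))"
      by (rule derivative_eq_intros refl)+ (simp add: algebra_simps)
     from DERIV_cdivide[OF DERIV_minus[OF this], of ?D]
     have "((\<lambda>z. - ?E z / ?D) has_field_derivative ?E (of_real w)) (at (of_real w))"
      by (rule DERIV_cong) (simp only: mult_minus_right minus_minus nonzero_mult_div_cancel_right[OF den])
     from has_vector_derivative_real_field[OF this]
     have "((\<lambda>w. - ?E (of_real w) / ?D) has_vector_derivative ?E (of_real w)) (at w within {-v..R})" .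
     moreover have "?E (of_real x) = of_real (exp (- \<epsilon> * (x + v))) * exp (\<i> * complex_of_real (x * y))" for x
      unfolding exp_add by (simp flip: exp_of_real)
     ultimately show "(?k has_vector_derivative ?h w y) (at w within {-v..R})" by (simp only:)
    qed
    also have "?k R - ?k (-v) = GR R y"
     by (simp add: GR_def diff_divide_distrib)
    finally show "((\<lambda>w. ?h w y) has_integral GR R y) {-v..R}" .
   qed
   ultimately have "integral {-v..R} (\<lambda>w. complex_of_real (exp (- \<epsilon> * (w + v)) * bump_kernel b w)) = bump2_integral b (GR R)"
    by simp
   moreover have "integral {-v..R} (\<lambda>w. complex_of_real (exp (- \<epsilon> * (w + v)) * bump_kernel b w)) = of_real (integral {-v..R} (\<lambda>w. exp (- \<epsilon> * (w + v)) * bump_kernel b w))"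
    by (rule integral_linear[OF _ bounded_linear_of_real, unfolded o_def])
      (intro integrable_continuous_real continuous_intros continuous_on_subset[OF continuous_on_bump_kernel], auto)
   ultimately show ?thesis by simp
  qed
  have "((\<lambda>R. bump2_integral b (GR R)) \<longlongrightarrow> bump2_integral b G) at_top"
  proof (rule tendsto_bump2_integral)
   show "continuous_on {-2*b..2*b} (GR R)" for R
    unfolding GR_def using den by (intro continuous_intros) auto
   show "uniform_limit {-2*b..2*b} GR G at_top"
   proof (rule uniform_limitI)
    fix e :: real assume "e > 0"
    have "((\<lambda>R. exp (- \<epsilon> * (R + v)) / \<epsilon>) \<longlongrightarrow> 0) at_top"
     using \<epsilon> by real_asymp
    hence "\<forall>\<^sub>F R in at_top. exp (- \<epsilon> * (R + v)) / \<epsilon> < e"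
     using \<open>e > 0\<close> by (rule order_tendstoD)
    thus "\<forall>\<^sub>F R in at_top. \<forall>y\<in>{-2*b..2*b}. dist (GR R y) (G y) < e"
    proof eventually_elim
     case (elim R)
     have "dist (GR R y) (G y) < e" for y
     proof -
      have "GR R y - G y = - (of_real (exp (- \<epsilon> * (R + v))) * exp (\<i> * of_real (R * y))) / (of_real \<epsilon> - \<i> * of_real y)"
       by (simp add: GR_def G_def diff_divide_distrib)
      hence "dist (GR R y) (G y) = exp (- \<epsilon> * (R + v)) / norm (of_real \<epsilon> - \<i> * complex_of_real y)"
       by (simp only: dist_norm norm_divide norm_minus_cancel norm_mult norm_exp_i_times norm_of_real) simp
      also have "\<dots> \<le> exp (- \<epsilon> * (R + v)) / \<epsilon>"
       using \<epsilon> abs_Re_le_cmod[of "of_real \<epsilon> - \<i> * complex_of_real y"] den[of y]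
       by (intro divide_left_mono) auto
      finally show ?thesis using elim by simp
     qed
     thus ?case by simp
    qed
   qed
  qed (use b contG in auto)
  hence "((\<lambda>R. Re (bump2_integral b (GR R))) \<longlongrightarrow> Re (bump2_integral b G)) at_top" by (rule tendsto_Re)
  moreover have "\<forall>\<^sub>F R in at_top. Re (bump2_integral b (GR R)) = integral {-v..R} (\<lambda>w. exp (- \<epsilon> * (w + v)) * bump_kernel b w)"
   using eventually_ge_at_top[of "-v"]
  proof eventually_elim
   case (elim R)
   show ?case by (subst IGR[OF elim, symmetric]) simp
  qed
  ultimately have "((\<lambda>R. integral {-v..R} (\<lambda>w. exp (- \<epsilon> * (w + v)) * bump_kernel b w)) \<longlongrightarrow> Re (bump2_integral b G)) at_top"
   by (rule Lim_transform_eventually)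
  thus ?thesis using sums IF EH unfolding \<epsilon>_def
   by (intro exI[of _ "Re (bump2_integral b G)"] exI[of _ "Re (bump2_integral b H)"]) auto
 qed
 have int: "(\<lambda>w. exp (- \<epsilon> * (w + v)) * bump_kernel b w) integrable_on {p..q}" for \<epsilon> v p q
  by (intro integrable_continuous_real continuous_intros continuous_on_subset[OF continuous_on_bump_kernel]) auto
 have intk: "bump_kernel b integrable_on {p..q}" for p q
  by (intro integrable_continuous_real continuous_on_subset[OF continuous_on_bump_kernel]) auto
 show ?thesis
 proof (rule that[OF b(1) C])
  fix \<sigma> v assume \<sigma>: "1 < \<sigma>" "\<sigma> \<le> 1 + b"
  obtain L E where LE: "?a \<sigma> v sums (L + E)" "\<bar>E\<bar> \<le> C / (1 + v^2)"
   "((\<lambda>R. integral {-v..R} (\<lambda>w. exp (- (\<sigma> - 1) * (w + v)) * bump_kernel b w)) \<longlongrightarrow> L) at_top"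
   using key[OF \<sigma>] by blast
  show "summable (?a \<sigma> v)" using LE(1) by (simp add: sums_iff)
  have "L \<le> (LINT x|lborel. bump_kernel b x)"
  proof (rule tendsto_upperbound[OF LE(3)])
   show "\<forall>\<^sub>F R in at_top. integral {-v..R} (\<lambda>w. exp (- (\<sigma> - 1) * (w + v)) * bump_kernel b w) \<le> (LINT x|lborel. bump_kernel b x)"
   proof (rule always_eventually, rule allI)
    fix R
    have "integral {-v..R} (\<lambda>w. exp (- (\<sigma> - 1) * (w + v)) * bump_kernel b w) \<le> integral {-v..R} (bump_kernel b)"
    proof (rule integral_le[OF int intk])
     fix w assume "w \<in> {-v..R}"
     hence "exp (- (\<sigma> - 1) * (w + v)) \<le> 1" using \<sigma> by (auto intro!: mult_nonpos_nonneg)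
     thus "exp (- (\<sigma> - 1) * (w + v)) * bump_kernel b w \<le> bump_kernel b w"
      using bump_kernel_nonneg[of b w] by (simp add: mult_left_le_one_le)
    qed
    thus "integral {-v..R} (\<lambda>w. exp (- (\<sigma> - 1) * (w + v)) * bump_kernel b w) \<le> (LINT x|lborel. bump_kernel b x)"
     using Ck(2)[of "-v" R] by linarith
   qed
  qed simp
  thus "(\<Sum>n. ?a \<sigma> v n) \<le> (LINT x|lborel. bump_kernel b x) + C / (1 + v^2)"
   using LE(1,2) by (simp add: sums_iff)
  fix R assume R: "R \<ge> -v"
  have "exp (- (\<sigma> - 1) * (R + v)) * integral {-v..R} (bump_kernel b) \<le> L"
  proof (rule tendsto_lowerbound[OF LE(3)])
   show "\<forall>\<^sub>F R' in at_top. exp (- (\<sigma> - 1) * (R + v)) * integral {-v..R} (bump_kernel b) \<le> integral {-v..R'} (\<lambda>w. exp (- (\<sigma> - 1) * (w + v)) * bump_kernel b w)"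
    using eventually_ge_at_top[of R]
   proof eventually_elim
    case (elim R')
    have "exp (- (\<sigma> - 1) * (R + v)) * integral {-v..R} (bump_kernel b) = integral {-v..R} (\<lambda>w. exp (- (\<sigma> - 1) * (R + v)) * bump_kernel b w)"
     by simp
    also have "\<dots> \<le> integral {-v..R} (\<lambda>w. exp (- (\<sigma> - 1) * (w + v)) * bump_kernel b w)"
    proof (rule integral_le[OF _ int])
     show "(\<lambda>w. exp (- (\<sigma> - 1) * (R + v)) * bump_kernel b w) integrable_on {-v..R}"
      by (intro integrable_continuous_real continuous_intros continuous_on_subset[OF continuous_on_bump_kernel]) auto
     fix w assume "w \<in> {-v..R}"
     thus "exp (- (\<sigma> - 1) * (R + v)) * bump_kernel b w \<le> exp (- (\<sigma> - 1) * (w + v)) * bump_kernel b w"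
      using \<sigma> bump_kernel_nonneg[of b w] by (intro mult_right_mono) auto
    qed
    also have "\<dots> \<le> integral {-v..R'} (\<lambda>w. exp (- (\<sigma> - 1) * (w + v)) * bump_kernel b w)"
     using elim bump_kernel_nonneg by (intro integral_subset_le int) auto
    finally show ?case .
   qed
  qed simp
  thus "(\<Sum>n. ?a \<sigma> v n) \<ge> exp (- (\<sigma> - 1) * (R + v)) * integral {-v..R} (bump_kernel b) - C / (1 + v^2)"
   using LE(1,2) by (simp add: sums_iff)
 qed
qed

text \<open>At \<sigma> = 1 the weights are ln p / p. The terms are nonnegative, so the uniform
  upper bound passes to partial sums and yields convergence; they grow as \<sigma> decreases, so the
  lower bound passes as well, followed by \<open>R\<close> to infinity. The lower bound asks for v
  \<ge> 0 because logarithms of primes fill only the positive half-line.\<close>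

lemma smoothed_prime_sum:
 obtains b C where "b > 0" "C > 0"
  "\<And>v. summable (\<lambda>n. if prime n then ln (real n) / real n * bump_kernel b (ln (real n) - v) else 0)"
  "\<And>v. (\<Sum>n. if prime n then ln (real n) / real n * bump_kernel b (ln (real n) - v) else 0)
     \<le> (LINT x|lborel. bump_kernel b x) + C / (1 + v^2)"
  "\<And>v. v \<ge> 0 ==> (\<Sum>n. if prime n then ln (real n) / real n * bump_kernel b (ln (real n) - v) else 0)
     \<ge> (LINT x|lborel. bump_kernel b x) - C / (1 + v^2)"
proof -
 let ?a = "\<lambda>b \<sigma> v n. if prime n then ln (real n) * real n powr (-\<sigma>) * bump_kernel b (ln (real n) - v) else 0"
 obtain b C where b: "b > 0" "C > 0"
  and sm: "\<And>\<sigma> v. 1 < \<sigma> ==> \<sigma> \<le> 1 + b ==> summable (?a b \<sigma> v)"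
  and up: "\<And>\<sigma> v. 1 < \<sigma> ==> \<sigma> \<le> 1 + b ==> (\<Sum>n. ?a b \<sigma> v n) \<le> (LINT x|lborel. bump_kernel b x) + C / (1 + v^2)"
  and lo: "\<And>\<sigma> v R. 1 < \<sigma> ==> \<sigma> \<le> 1 + b ==> R \<ge> - v ==> (\<Sum>n. ?a b \<sigma> v n) \<ge> exp (- (\<sigma> - 1) * (R + v)) * integral {-v..R} (bump_kernel b) - C / (1 + v^2)"
  by (rule smoothed_prime_sum_right) (rule that)
 obtain Ck where Ck: "Ck > 0" "\<And>p q. integral {p..q} (bump_kernel b) \<le> (LINT x|lborel. bump_kernel b x)"
  "\<And>p q. p \<ge> 0 ==> q \<ge> 0 ==> (LINT x|lborel. bump_kernel b x) - Ck * (1 / (1 + p^2) + 1 / (1 + q^2)) \<le> integral {-p..q} (bump_kernel b)"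
  by (rule bump_kernel_integral_interval[OF b(1)]) (rule that)
 let ?k = "LINT x|lborel. bump_kernel b x"
 define c where "c = (\<lambda>v n. if prime n then ln (real n) / real n * bump_kernel b (ln (real n) - v) else 0)"
 define a where "a = ?a b"
 have sm: "summable (a \<sigma> v)" if "1 < \<sigma>" "\<sigma> \<le> 1 + b" for \<sigma> v
  using sm[OF that] unfolding a_def .
 have up: "(\<Sum>n. a \<sigma> v n) \<le> ?k + C / (1 + v^2)" if "1 < \<sigma>" "\<sigma> \<le> 1 + b" for \<sigma> v
  using up[OF that] unfolding a_def .
 have lo: "(\<Sum>n. a \<sigma> v n) \<ge> exp (- (\<sigma> - 1) * (R + v)) * integral {-v..R} (bump_kernel b) - C / (1 + v^2)"
  if "1 < \<sigma>" "\<sigma> \<le> 1 + b" "R \<ge> - v" for \<sigma> v R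
  using lo[OF that] unfolding a_def .
 have a1: "a 1 = c"
  by (intro ext) (auto simp: a_def c_def powr_minus_divide prime_gt_0_nat)
 have anonneg: "a \<sigma> v n \<ge> 0" for \<sigma> v n
 proof (cases "prime n")
  case True
  hence "real n \<ge> 1" using prime_ge_1_nat by force
  thus ?thesis using True bump_kernel_nonneg unfolding a_def by (auto intro!: mult_nonneg_nonneg)
 qed (simp add: a_def)
 have ev: "\<forall>\<^sub>F \<sigma> in at_right 1. 1 < \<sigma> \<and> \<sigma> \<le> 1 + b"
  using eventually_at_right_real[of 1 "1 + b"] b by (auto elim!: eventually_mono)
 have fin: "(\<Sum>n<N. a 1 v n) \<le> ?k + C / (1 + v^2)" for N v
 proof (rule tendsto_upperbound)
  show "((\<lambda>\<sigma>. \<Sum>n<N. a \<sigma> v n) \<longlongrightarrow> (\<Sum>n<N. a 1 v n)) (at_right 1)"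
  proof (intro tendsto_sum)
   fix n
   show "((\<lambda>\<sigma>. a \<sigma> v n) \<longlongrightarrow> a 1 v n) (at_right 1)"
   proof (cases "prime n")
    case True
    hence "real n \<noteq> 0" using prime_gt_0_nat by force
    thus ?thesis unfolding a_def if_P[OF True] by (intro tendsto_intros) auto
   qed (simp add: a_def)
  qed
  show "\<forall>\<^sub>F \<sigma> in at_right 1. (\<Sum>n<N. a \<sigma> v n) \<le> ?k + C / (1 + v^2)"
   using ev
  proof eventually_elim
   case (elim \<sigma>)
   have "(\<Sum>n<N. a \<sigma> v n) \<le> (\<Sum>n. a \<sigma> v n)"
    using sm[of \<sigma> v] elim anonneg by (intro sum_le_suminf) auto
   thus ?case using up[of \<sigma> v] elim by linarith
  qed
 qed simp
 have sm1: "summable (a 1 v)" for v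
  by (rule summableI_nonneg_bounded[OF anonneg fin])
 have up1: "(\<Sum>n. a 1 v n) \<le> ?k + C / (1 + v^2)" for v
  by (rule suminf_le_const[OF sm1 fin])
 have lo1: "(\<Sum>n. a 1 v n) \<ge> ?k - (Ck + C) / (1 + v^2)" if v: "v \<ge> 0" for v
 proof -
  have R0: "(\<Sum>n. a 1 v n) \<ge> integral {-v..R} (bump_kernel b) - C / (1 + v^2)" if R: "R \<ge> -v" for R
  proof (rule tendsto_upperbound)
   show "((\<lambda>\<sigma>. exp (- (\<sigma> - 1) * (R + v)) * integral {-v..R} (bump_kernel b) - C / (1 + v^2)) \<longlongrightarrow> integral {-v..R} (bump_kernel b) - C / (1 + v^2)) (at_right 1)"
    by (auto intro!: tendsto_eq_intros)
   show "\<forall>\<^sub>F \<sigma> in at_right 1. exp (- (\<sigma> - 1) * (R + v)) * integral {-v..R} (bump_kernel b) - C / (1 + v^2) \<le> (\<Sum>n. a 1 v n)"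
    using ev
   proof eventually_elim
    case (elim \<sigma>)
    have "(\<Sum>n. a \<sigma> v n) \<le> (\<Sum>n. a 1 v n)"
    proof (rule suminf_le)
     fix n
     show "a \<sigma> v n \<le> a 1 v n"
     proof (cases "prime n")
      case True
      hence n: "real n \<ge> 1" using prime_ge_1_nat by force
      hence "real n powr (-\<sigma>) \<le> real n powr (-1)" using elim by (intro powr_mono) auto
      from mult_right_mono[OF mult_left_mono[OF this ln_ge_zero[OF n]] bump_kernel_nonneg]
      show ?thesis unfolding a_def if_P[OF True] .
     qed (simp add: a_def)
    qed (use sm elim sm1 in auto)
    thus ?case using lo[of \<sigma> v R] elim R by linarith
   qed
  qed simp
  have *: "(\<Sum>n. a 1 v n) \<ge> ?k - Ck * (1 / (1 + v^2) + 1 / (1 + R^2)) - C / (1 + v^2)" if "R \<ge> 0" for R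
   using Ck(3)[OF v that] R0[of R] v that by linarith
  have "((\<lambda>R. ?k - Ck * (1 / (1 + v^2) + 1 / (1 + R^2)) - C / (1 + v^2)) \<longlongrightarrow> ?k - Ck * (1 / (1 + v^2) + 0) - C / (1 + v^2)) at_top"
   by (intro tendsto_intros) real_asymp
  hence "?k - Ck * (1 / (1 + v^2) + 0) - C / (1 + v^2) \<le> (\<Sum>n. a 1 v n)"
   by (rule tendsto_upperbound) (use * in \<open>auto intro!: eventually_mono[OF eventually_ge_at_top[of 0]]\<close>)
  thus ?thesis by (simp add: add_divide_distrib)
 qed
 have C': "C / (1 + v^2) \<le> (Ck + C) / (1 + v^2)" for v :: real
  using Ck by (intro divide_right_mono) auto
 have C0: "Ck + C > 0" using Ck b by simp
 have c1: "summable (c v)" for v using sm1 unfolding a1 .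
 have c2: "(\<Sum>n. c v n) \<le> ?k + (Ck + C) / (1 + v^2)" for v
  using up1[of v] C'[of v] unfolding a1 by linarith
 have c3: "(\<Sum>n. c v n) \<ge> ?k - (Ck + C) / (1 + v^2)" if "v \<ge> 0" for v
  using lo1[OF that] unfolding a1 .
 show ?thesis
  by (rule that[OF b(1) C0 c1[unfolded c_def] c2[unfolded c_def] c3[unfolded c_def]])
qed

section \<open>Chebyshev-type bounds for sums of ln p / p\<close>

text \<open>The kernel is at least \<open>k0\<close> near 0 and nonnegative elsewhere, so a window
  of fixed length in ln p is dominated by the smoothed sum centred at \<open>v\<close>.\<close>

lemma prime_log_window_bound:
 obtains r C where "r > 0" "C > 0"
  "\<And>v N. (\<Sum>p\<in>{p\<in>primes_upto N. \<bar>ln (real p) - v\<bar> \<le> r}. ln (real p) / real p) \<le> C"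
proof -
 let ?c = "\<lambda>b v n. if prime n then ln (real n) / real n * bump_kernel b (ln (real n) - v) else 0"
 obtain b C where b: "b > 0" "C > 0" and sm: "\<And>v. summable (?c b v)"
  and up: "\<And>v. (\<Sum>n. ?c b v n) \<le> (LINT x|lborel. bump_kernel b x) + C / (1 + v^2)"
  and lo: "\<And>v. v \<ge> 0 ==> (\<Sum>n. ?c b v n) \<ge> (LINT x|lborel. bump_kernel b x) - C / (1 + v^2)"
  by (rule smoothed_prime_sum) (rule that)
 let ?k = "LINT x|lborel. bump_kernel b x"
 have k: "?k \<ge> 0" by (intro integral_nonneg_AE) (auto simp: bump_kernel_nonneg)
 define k0 where "k0 = bump_kernel b 0 / 2"
 have k0: "k0 > 0" "k0 < bump_kernel b 0" using bump_kernel_0_pos[OF b(1)] by (auto simp: k0_def)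
 have "isCont (bump_kernel b) 0" using continuous_on_bump_kernel by (simp add: continuous_on_eq_continuous_at)
 then obtain d where d: "d > 0" "\<And>x. dist x 0 < d ==> dist (bump_kernel b x) (bump_kernel b 0) < k0"
  using k0 unfolding continuous_at_eps_delta by metis
 have kb: "bump_kernel b x \<ge> k0" if "\<bar>x\<bar> \<le> d / 2" for x
 proof -
  have "\<bar>bump_kernel b x - bump_kernel b 0\<bar> < k0" using d(2)[of x] that d(1) by (simp add: dist_real_def)
  thus ?thesis unfolding k0_def by linarith
 qed
 have "(\<Sum>p\<in>{p\<in>primes_upto N. \<bar>ln (real p) - v\<bar> \<le> d/2}. ln (real p) / real p) \<le> (?k + C) / k0" for v N
 proof -
  have nn: "?c b v n \<ge> 0" for n
  proof (cases "prime n")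
   case True
   hence "real n \<ge> 1" using prime_ge_1_nat by force
   thus ?thesis using bump_kernel_nonneg by (auto intro!: mult_nonneg_nonneg)
  qed simp
  have "k0 * (\<Sum>p\<in>{p\<in>primes_upto N. \<bar>ln (real p) - v\<bar> \<le> d/2}. ln (real p) / real p) = (\<Sum>p\<in>{p\<in>primes_upto N. \<bar>ln (real p) - v\<bar> \<le> d/2}. ln (real p) / real p * k0)"
   by (simp add: sum_distrib_left mult_ac)
  also have "\<dots> \<le> (\<Sum>p\<in>{p\<in>primes_upto N. \<bar>ln (real p) - v\<bar> \<le> d/2}. ?c b v p)"
  proof (rule sum_mono)
   fix p assume p: "p \<in> {p\<in>primes_upto N. \<bar>ln (real p) - v\<bar> \<le> d/2}"
   hence "prime p" by (auto dest: prime_of_primes_upto)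
   hence "real p \<ge> 1" using prime_ge_1_nat by force
   hence "ln (real p) / real p * k0 \<le> ln (real p) / real p * bump_kernel b (ln (real p) - v)"
    using kb p by (intro mult_left_mono) auto
   thus "ln (real p) / real p * k0 \<le> ?c b v p" unfolding if_P[OF \<open>prime p\<close>] .
  qed
  also have "\<dots> \<le> (\<Sum>p<Suc N. ?c b v p)"
   by (intro sum_mono2 nn) (auto simp: primes_upto_def)
  also have "\<dots> \<le> (\<Sum>p. ?c b v p)" using sm nn by (intro sum_le_suminf) auto
  also have "\<dots> \<le> ?k + C / (1 + v^2)" by (rule up)
  also have "C / (1 + v^2) \<le> C / 1" using b by (intro divide_left_mono) (auto intro: add_pos_nonneg)
  finally show ?thesis using k0 by (simp add: field_simps)
 qed
 thus ?thesis using d k0 k b by (intro that[of "d/2" "(?k + C) / k0"]) (auto intro!: divide_pos_pos add_nonneg_pos)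
qed

text \<open>Windows of length \<open>r\<close> carry bounded mass, so the sum is compared with
  increments of \<open>\<Phi>\<close> over grid cells, which telescope. Only the total variation hi
  - lo enters; hence \<open>\<Phi>\<close> may be rescaled freely, which makes the applications
  uniform in \<eta>.\<close>

lemma prime_log_sum_increments:
 obtains C where "C > 0"
  "\<And>\<Phi> lo hi w N. mono \<Phi> ==> (\<forall>x. lo \<le> \<Phi> x \<and> \<Phi> x \<le> hi) ==> w \<ge> (0::real) ==>
   (\<Sum>p\<in>primes_upto N. ln (real p) / real p * (\<Phi> (ln (real p) + w) - \<Phi> (ln (real p) - w))) \<le> C * (w + 1) * (hi - lo)"
proof -
 obtain r C where r: "r > 0" "C > 0"
  "\<And>v N. (\<Sum>p\<in>{p\<in>primes_upto N. \<bar>ln (real p) - v\<bar> \<le> r}. ln (real p) / real p) \<le> C"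
  by (rule prime_log_window_bound) (rule that)
 have "(\<Sum>p\<in>primes_upto N. ln (real p) / real p * (\<Phi> (ln (real p) + w) - \<Phi> (ln (real p) - w))) \<le> (C * (2 / r + 3)) * (w + 1) * (hi - lo)"
  if mono: "mono \<Phi>" and bd: "\<forall>x. lo \<le> \<Phi> x \<and> \<Phi> x \<le> hi" and w: "w \<ge> 0" for \<Phi> :: "real \<Rightarrow> real" and lo hi w N
 proof -
  define W where "W = nat \<lceil>w / r\<rceil>"
  have W: "w \<le> real W * r" "real W \<le> w / r + 1"
  proof -
   have "w / r \<ge> 0" using w r by simp
   hence "real W = of_int \<lceil>w / r\<rceil>" by (simp add: W_def)
   moreover have "w / r \<le> of_int \<lceil>w / r\<rceil>" "of_int \<lceil>w / r\<rceil> \<le> w / r + 1" by linarith+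
   ultimately show "real W \<le> w / r + 1" "w \<le> real W * r" using pos_divide_le_eq[OF r(1), of w "real W"] by simp_all
  qed
  have hilo: "hi \<ge> lo" using bd[rule_format, of 0] by linarith
  define j where "j = (\<lambda>p. nat \<lfloor>ln (real p) / r\<rfloor>)"
  define J where "J = j N"
  have jp: "real (j p) * r \<le> ln (real p)" "ln (real p) < (real (j p) + 1) * r" "j p \<le> J" if "p \<in> primes_upto N" for p
  proof -
   have p: "real p \<ge> 1" "p \<le> N" using that primes_upto_ge_2[OF that] by (auto simp: primes_upto_def)
   hence "ln (real p) / r \<ge> 0" using r by simp
   hence e: "real (j p) = of_int \<lfloor>ln (real p) / r\<rfloor>" by (simp add: j_def)
   have "of_int \<lfloor>ln (real p) / r\<rfloor> \<le> ln (real p) / r" "ln (real p) / r < of_int \<lfloor>ln (real p) / r\<rfloor> + 1" by linarith+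
   thus "real (j p) * r \<le> ln (real p)" "ln (real p) < (real (j p) + 1) * r"
    using e pos_le_divide_eq[OF r(1), of "real (j p)" "ln (real p)"] pos_divide_less_eq[OF r(1), of "ln (real p)" "real (j p) + 1"] by simp_all
   have "ln (real p) / r \<le> ln (real N) / r" using p r by (intro divide_right_mono) auto
   thus "j p \<le> J" unfolding j_def J_def by (intro nat_mono floor_mono)
  qed
  define a where "a = (\<lambda>i::int. \<Phi> (of_int i * r))"
  let ?g = "\<lambda>p. ln (real p) / real p * (\<Phi> (ln (real p) + w) - \<Phi> (ln (real p) - w))"
  have "sum ?g (primes_upto N) = (\<Sum>i\<in>{..J}. \<Sum>p\<in>{p\<in>primes_upto N. j p = i}. ?g p)"
   by (rule sum.group[symmetric]) (use jp(3) in auto)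
  also have "\<dots> \<le> (\<Sum>i\<in>{..J}. C * (a (int i + 1 + int W) - a (int i - int W)))"
  proof (rule sum_mono)
   fix i
   let ?D = "a (int i + 1 + int W) - a (int i - int W)"
   have D: "?D \<ge> 0" unfolding a_def using monoD[OF mono] r by (simp add: mult_right_mono)
   have "(\<Sum>p\<in>{p\<in>primes_upto N. j p = i}. ?g p) \<le> (\<Sum>p\<in>{p\<in>primes_upto N. j p = i}. ln (real p) / real p * ?D)"
   proof (rule sum_mono)
    fix p assume p: "p \<in> {p\<in>primes_upto N. j p = i}"
    hence p1: "real p \<ge> 1" using primes_upto_ge_2[of p N] by auto
    have "\<Phi> (ln (real p) + w) \<le> a (int i + 1 + int W)" unfolding a_def
     using jp(2)[of p] p W r by (intro monoD[OF mono]) (auto simp: algebra_simps)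
    moreover have "\<Phi> (ln (real p) - w) \<ge> a (int i - int W)" unfolding a_def
     using jp(1)[of p] p W r by (intro monoD[OF mono]) (auto simp: algebra_simps)
    ultimately show "?g p \<le> ln (real p) / real p * ?D" using p1 by (intro mult_left_mono) auto
   qed
   also have "\<dots> = (\<Sum>p\<in>{p\<in>primes_upto N. j p = i}. ln (real p) / real p) * ?D" by (simp add: sum_distrib_right)
   also have "\<dots> \<le> C * ?D"
   proof (rule mult_right_mono[OF _ D])
    have "(\<Sum>p\<in>{p\<in>primes_upto N. j p = i}. ln (real p) / real p) \<le> (\<Sum>p\<in>{p\<in>primes_upto N. \<bar>ln (real p) - real i * r\<bar> \<le> r}. ln (real p) / real p)"
    proof (rule sum_mono2)
     show "{p \<in> primes_upto N. j p = i} \<subseteq> {p \<in> primes_upto N. \<bar>ln (real p) - real i * r\<bar> \<le> r}"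
     proof
      fix p assume p: "p \<in> {p \<in> primes_upto N. j p = i}"
      hence "real i * r \<le> ln (real p)" "ln (real p) < (real i + 1) * r" using jp[of p] by auto
      hence "\<bar>ln (real p) - real i * r\<bar> \<le> r" by (simp add: algebra_simps)
      thus "p \<in> {p \<in> primes_upto N. \<bar>ln (real p) - real i * r\<bar> \<le> r}" using p by simp
     qed
     show "0 \<le> ln (real p) / real p" if "p \<in> {p \<in> primes_upto N. \<bar>ln (real p) - real i * r\<bar> \<le> r} - {p \<in> primes_upto N. j p = i}" for p
      using that primes_upto_ge_2[of p N] by auto
    qed auto
    thus "(\<Sum>p\<in>{p\<in>primes_upto N. j p = i}. ln (real p) / real p) \<le> C" using r(3)[where v = "real i * r" and N = N] by linarith
   qed
   finally show "(\<Sum>p\<in>{p\<in>primes_upto N. j p = i}. ?g p) \<le> C * ?D" .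
  qed
  also have "\<dots> = C * (\<Sum>i\<le>J. a (int i + 1 + int W) - a (int i - int W))" by (simp add: sum_distrib_left)
  \<comment> \<open>A cell widened by \<open>W\<close> cells on each side spans 2W + 1 unit
    increments. After the exchange of sums, each of the 2W + 1 shifts telescopes over
    \<open>i\<close> to at most hi - lo.\<close>
  also have "(\<Sum>i\<le>J. a (int i + 1 + int W) - a (int i - int W)) = (\<Sum>i\<le>J. \<Sum>l<2*W+1. a (int i - int W + int (Suc l)) - a (int i - int W + int l))"
   by (intro sum.cong refl, subst sum_lessThan_telescope) (simp add: algebra_simps)
  also have "\<dots> = (\<Sum>l<2*W+1. \<Sum>i\<le>J. a (int (Suc i) - int W + int l) - a (int i - int W + int l))"
   by (subst sum.swap) (simp add: algebra_simps)
  also have "\<dots> \<le> (\<Sum>l<2*W+1. hi - lo)"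
  proof (rule sum_mono)
   fix l
   have "(\<Sum>i\<le>J. a (int (Suc i) - int W + int l) - a (int i - int W + int l)) = a (int (Suc J) - int W + int l) - a (int 0 - int W + int l)"
    unfolding lessThan_Suc_atMost[symmetric] by (rule sum_lessThan_telescope)
   thus "(\<Sum>i\<le>J. a (int (Suc i) - int W + int l) - a (int i - int W + int l)) \<le> hi - lo"
    using bd[rule_format, of "of_int (int (Suc J) - int W + int l) * r"] bd[rule_format, of "of_int (int 0 - int W + int l) * r"]
    unfolding a_def by linarith
  qed
  also have "\<dots> = (2 * real W + 1) * (hi - lo)" by simp
  also have "\<dots> \<le> ((2 / r + 3) * (w + 1)) * (hi - lo)"
  proof (rule mult_right_mono)
   have "2 * real W + 1 \<le> 2 * (w / r) + 3" using W by linarith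
   also have "\<dots> \<le> (2 / r + 3) * (w + 1)" using w r by (simp add: algebra_simps add_divide_distrib)
   finally show "2 * real W + 1 \<le> (2 / r + 3) * (w + 1)" .
  qed (use hilo in simp)
  finally show ?thesis using r by (simp add: mult_ac mult_left_mono)
 qed
 thus ?thesis using r by (intro that[of "C * (2 / r + 3)"]) (auto intro!: mult_pos_pos add_pos_pos divide_pos_pos)
qed

text \<open>The Cauchy density at x is dominated by the increment of arctan over [x - 1, x + 1], so
  \<open>prime_log_sum_increments\<close> applies with \<Phi> x = arctan (x - v) and w = 1,
  uniformly in \<open>v\<close>.\<close>

lemma prime_log_sum_Cauchy:
 obtains C where "C > 0"
  "\<And>v N. (\<Sum>p\<in>primes_upto N. ln (real p) / real p * (1 / (1 + (ln (real p) - v)^2))) \<le> C"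
proof -
 obtain C where C: "C > 0"
  "\<And>\<Phi> lo hi w N. mono \<Phi> ==> (\<forall>x. lo \<le> \<Phi> x \<and> \<Phi> x \<le> hi) ==> w \<ge> (0::real) ==>
   (\<Sum>p\<in>primes_upto N. ln (real p) / real p * (\<Phi> (ln (real p) + w) - \<Phi> (ln (real p) - w))) \<le> C * (w + 1) * (hi - lo)"
  by (rule prime_log_sum_increments) (rule that)
 have at: "1 / (1 + x^2) \<le> 2 * (arctan (x + 1) - arctan (x - 1))" for x :: real
 proof -
  have "\<exists>z>x - 1. z < x + 1 \<and> arctan (x + 1) - arctan (x - 1) = ((x + 1) - (x - 1)) * (inverse (1 + z^2))"
   by (rule MVT2) (auto intro!: DERIV_arctan)
  then obtain z where z: "x - 1 < z" "z < x + 1" "arctan (x + 1) - arctan (x - 1) = 2 * inverse (1 + z^2)" by auto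
  have "\<bar>z\<bar> \<le> \<bar>x\<bar> + 1" using z by linarith
  hence "z^2 \<le> (\<bar>x\<bar> + 1)^2" by (intro abs_le_square_iff[THEN iffD1]) auto
  also have "\<dots> \<le> 2 * x^2 + 2" using sum_squares_bound[of "\<bar>x\<bar>" 1] by (simp add: power2_sum)
  finally have "1 + z^2 \<le> 3 + 2 * x^2" by simp
  also have "\<dots> \<le> 4 * (1 + x^2)" by simp
  finally have "1 + z^2 \<le> 4 * (1 + x^2)" .
  moreover have "1 / y \<le> 2 * (2 * inverse w)" if "y > 0" "w > 0" "w \<le> 4 * y" for y w :: real
   using that by (simp add: field_simps)
  ultimately show ?thesis unfolding z(3) by (simp add: add_pos_nonneg)
 qed
 have "(\<Sum>p\<in>primes_upto N. ln (real p) / real p * (1 / (1 + (ln (real p) - v)^2))) \<le> 2 * (C * (1 + 1) * (pi / 2 - (- pi / 2)))" for v N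
 proof -
  let ?\<Phi> = "\<lambda>x. arctan (x - v)"
  have "(\<Sum>p\<in>primes_upto N. ln (real p) / real p * (1 / (1 + (ln (real p) - v)^2))) \<le> (\<Sum>p\<in>primes_upto N. 2 * (ln (real p) / real p * (?\<Phi> (ln (real p) + 1) - ?\<Phi> (ln (real p) - 1))))"
  proof (rule sum_mono)
   fix p assume "p \<in> primes_upto N"
   hence "ln (real p) / real p \<ge> 0" using primes_upto_ge_2[of p N] by auto
   from mult_left_mono[OF at[of "ln (real p) - v"] this]
   show "ln (real p) / real p * (1 / (1 + (ln (real p) - v)^2)) \<le> 2 * (ln (real p) / real p * (?\<Phi> (ln (real p) + 1) - ?\<Phi> (ln (real p) - 1)))"
    by (simp add: algebra_simps)
  qed
  also have "\<dots> = 2 * (\<Sum>p\<in>primes_upto N. ln (real p) / real p * (?\<Phi> (ln (real p) + 1) - ?\<Phi> (ln (real p) - 1)))"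
   by (simp only: sum_distrib_left)
  also have "\<dots> \<le> 2 * (C * (1 + 1) * (pi / 2 - (- pi / 2)))"
  proof (intro mult_left_mono C(2))
   show "mono ?\<Phi>" by (auto simp: mono_def arctan_le_iff)
   show "\<forall>x. - pi / 2 \<le> ?\<Phi> x \<and> ?\<Phi> x \<le> pi / 2"
   proof
    fix x
    show "- pi / 2 \<le> ?\<Phi> x \<and> ?\<Phi> x \<le> pi / 2"
     using arctan_lbound[of "x - v"] arctan_ubound[of "x - v"] by linarith
   qed
  qed auto
  finally show ?thesis .
 qed
 thus ?thesis using C(1) by (intro that[of "2 * (C * (1 + 1) * (pi / 2 - (- pi / 2)))"]) (auto intro!: mult_pos_pos)
qed

section \<open>The negative part of the sine\<close>

text \<open>The negative part of sin y, divided by y^2, for y \<ge> pi, and continued by 0. On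
  [0, pi] the sine has no negative part; the clamp \<open>max y pi\<close> removes the singularity
  at 0 and keeps the function continuous.\<close>

definition neg_sine_part :: "real \<Rightarrow> real" where
 "neg_sine_part y = max 0 (- sin (max y pi)) / (max y pi)^2"

lemma neg_sine_part_nonneg: "neg_sine_part y \<ge> 0"
 by (simp add: neg_sine_part_def)

lemma neg_sine_part_eq_0: "y \<le> pi ==> neg_sine_part y = 0"
 by (simp add: neg_sine_part_def max_def)

lemma neg_sine_part_eq: "y \<ge> pi ==> neg_sine_part y = max 0 (- sin y) / y^2"
 by (simp add: neg_sine_part_def max_def)

lemma continuous_on_neg_sine_part: "continuous_on S neg_sine_part"
 unfolding neg_sine_part_def[abs_def]
 by (intro continuous_intros) (use pi_gt_zero in \<open>auto simp: max_def\<close>)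

lemma neg_sine_part_le: "neg_sine_part y \<le> 2 / (1 + y^2)"
proof (cases "y \<le> pi")
 case False
 hence y: "y \<ge> 1" using pi_ge_two by linarith
 have "max 0 (- sin y) \<le> 1" by (simp add: max_def)
 hence "neg_sine_part y \<le> 1 / y^2" using False by (auto simp: neg_sine_part_eq intro!: divide_right_mono)
 also have "\<dots> \<le> 2 / (1 + y^2)"
 proof -
  have "y^2 \<ge> 1" using y by simp
  thus ?thesis by (simp add: divide_simps)
 qed
 finally show ?thesis .
qed (simp add: neg_sine_part_eq_0 add_nonneg_nonneg)

lemma integrable_neg_sine_part: "integrable lborel neg_sine_part"
proof (rule Bochner_Integration.integrable_bound)
 show "integrable lborel (\<lambda>x::real. 2 * inverse (1 + x^2))"
  using integrable_inverse_1_plus_square by (simp add: set_integrable_def)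
 show "neg_sine_part \<in> borel_measurable lborel"
  using continuous_on_neg_sine_part by (simp add: borel_measurable_continuous_onI)
 show "AE x in lborel. norm (neg_sine_part x) \<le> norm (2 * inverse (1 + x^2))"
  using neg_sine_part_nonneg neg_sine_part_le by (intro AE_I2) (simp add: field_simps abs_of_nonneg add_nonneg_nonneg)
qed

lemma convex_supporting_line:
 fixes F F' F'' :: "real \<Rightarrow> real"
 assumes "\<And>x. x \<ge> l ==> (F has_real_derivative F' x) (at x)" "\<And>x. x \<ge> l ==> (F' has_real_derivative F'' x) (at x)"
  "\<And>x. x \<ge> l ==> F'' x \<ge> 0" "a \<ge> l" "y \<ge> l"
 shows "F y \<ge> F a + F' a * (y - a)"
proof -
 have "F' a * (y - a) \<le> F y - F a"
  by (rule f''_imp_f'[of "{l..}" F F' F'']) (use assms in auto)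
 thus ?thesis by simp
qed

lemma convex_derivative_mono:
 fixes F' F'' :: "real \<Rightarrow> real"
 assumes "\<And>x. x \<ge> l ==> (F' has_real_derivative F'' x) (at x)"
  "\<And>x. x \<ge> l ==> F'' x \<ge> 0" "l \<le> a" "a \<le> b"
 shows "F' a \<le> F' b"
 by (rule DERIV_nonneg_imp_nondecreasing[OF assms(4)]) (use assms in \<open>meson order_trans\<close>)

text \<open>Adding a convex function \<open>\<phi>\<close> with \<open>\<phi>'' = 22 / (1 + y^2)\<close> makes \<open>neg_sine_part\<close> convex,
 since its kinks are convex ones; \<open>m\<close> is a choice of supporting slopes.\<close>
lemma neg_sine_part_second_difference:
 obtains \<Phi> :: "real \<Rightarrow> real" where "mono \<Phi>" "\<forall>x. -100 \<le> \<Phi> x \<and> \<Phi> x \<le> 100"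
  "\<And>x w. w \<ge> 0 ==> \<bar>neg_sine_part (x + w) + neg_sine_part (x - w) - 2 * neg_sine_part x\<bar> \<le> w * (\<Phi> (x + w) - \<Phi> (x - w))"
proof -
 \<comment> \<open>For y \<ge> 1 the second derivative of sin y / y^2 is at most (1 + 4 + 6) / y^2
   in modulus, and 11 / y^2 \<le> 22 / (1 + y^2). So \<phi>'' = 22 / (1 + y^2) outweighs it, while
   \<phi>' stays bounded.\<close>
 define \<phi> where "\<phi> = (\<lambda>y::real. 22 * (y * arctan y) - 11 * ln (1 + y^2))"
 define \<phi>' where "\<phi>' = (\<lambda>y::real. 22 * arctan y)"
 have pos: "1 + y^2 > 0" for y :: real by (simp add: add_pos_nonneg)
 have d\<phi>: "(\<phi> has_real_derivative \<phi>' y) (at y)" for y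
 proof -
  have "(\<phi> has_real_derivative 22 * (1 * arctan y + inverse (1 + y^2) * y) - 11 * (2 * y / (1 + y^2))) (at y)"
   unfolding \<phi>_def using pos[of y] by (auto intro!: derivative_eq_intros)
  thus ?thesis by (rule DERIV_cong) (simp add: \<phi>'_def divide_inverse algebra_simps)
 qed
 have d\<phi>': "(\<phi>' has_real_derivative 22 * inverse (1 + y^2)) (at y)" for y
  unfolding \<phi>'_def by (auto intro!: derivative_eq_intros)
 have \<phi>_tan: "\<phi> y \<ge> \<phi> a + \<phi>' a * (y - a)" for a y
  by (rule convex_supporting_line[where l = "min a y" and F'' = "\<lambda>y. 22 * inverse (1 + y^2)"])
    (use d\<phi> d\<phi>' pos in \<open>auto intro: less_imp_le\<close>)
 define F where "F = (\<lambda>y. \<phi> y - sin y / y^2)"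
 define F' where "F' = (\<lambda>y. \<phi>' y - cos y / y^2 + 2 * sin y / y^3)"
 define F'' where "F'' = (\<lambda>y::real. 22 * inverse (1 + y^2) + sin y / y^2 + 4 * cos y / y^3 - 6 * sin y / y^4)"
 have dF: "(F has_real_derivative F' y) (at y)" if "y \<ge> pi" for y
 proof -
  have "y > 0" using that pi_gt_zero by linarith
  thus ?thesis unfolding F_def F'_def
   by (auto intro!: derivative_eq_intros d\<phi> simp: field_simps power_numeral_reduce)
 qed
 have dF': "(F' has_real_derivative F'' y) (at y)" if "y \<ge> pi" for y
 proof -
  have "y > 0" using that pi_gt_zero by linarith
  thus ?thesis unfolding F'_def F''_def
   by (auto intro!: derivative_eq_intros d\<phi>' simp: field_simps power_numeral_reduce)
 qed
 have F''pos: "F'' y \<ge> 0" if "y \<ge> pi" for y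
 proof -
  have y: "y \<ge> 1" using that pi_ge_two by linarith
  hence y2: "y^2 \<ge> 1" by simp
  have sc: "\<bar>sin y\<bar> \<le> 1" "\<bar>cos y\<bar> \<le> 1" by auto
  have "\<bar>sin y / y^2\<bar> \<le> 1 / y^2" using sc by (simp add: abs_divide divide_right_mono)
  moreover have "\<bar>4 * cos y / y^3\<bar> \<le> 4 / y^2"
  proof -
   have "\<bar>4 * cos y / y^3\<bar> = 4 * \<bar>cos y\<bar> / y^3" using y by (simp add: abs_mult abs_divide)
   also have "\<dots> \<le> 4 * 1 / y^2" using y sc by (intro frac_le mult_left_mono power_increasing) auto
   finally show ?thesis by simp
  qed
  moreover have "\<bar>6 * sin y / y^4\<bar> \<le> 6 / y^2"
  proof -
   have "\<bar>6 * sin y / y^4\<bar> = 6 * \<bar>sin y\<bar> / y^4" using y by (simp add: abs_mult abs_divide)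
   also have "\<dots> \<le> 6 * 1 / y^2" using y sc by (intro frac_le mult_left_mono power_increasing) auto
   finally show ?thesis by simp
  qed
  moreover have "11 / y^2 \<le> 22 * inverse (1 + y^2)"
  proof -
   have "11 / t \<le> 22 * inverse (1 + t)" if "t \<ge> 1" for t :: real using that by (simp add: field_simps)
   thus ?thesis using y2 by blast
  qed
  moreover have "11 / y^2 = 1 / y^2 + 4 / y^2 + 6 / y^2" by (simp add: add_divide_distrib[symmetric])
  ultimately show ?thesis unfolding F''_def by linarith
 qed
 define m where "m = (\<lambda>a. if a > pi \<and> sin a < 0 then F' a else \<phi>' a)"
 define f where "f = (\<lambda>y. \<phi> y + neg_sine_part y)"
 have support: "f y \<ge> f a + m a * (y - a)" for a y
 proof (cases "a > pi \<and> sin a < 0")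
  case False
  hence "neg_sine_part a = 0" by (auto simp: neg_sine_part_def max_def not_less)
  thus ?thesis using \<phi>_tan[of a y] neg_sine_part_nonneg[of y] False by (auto simp: f_def m_def)
 next
  case True
  hence fa: "f a = F a" by (simp add: f_def F_def neg_sine_part_eq)
  have tan: "F y \<ge> F a + F' a * (y - a)" if "y \<ge> pi" for y
   by (rule convex_supporting_line[OF dF dF' F''pos]) (use True that in auto)
  show ?thesis
  proof (cases "y \<ge> pi")
   case y: True
   have "- sin y / y^2 \<le> neg_sine_part y"
    unfolding neg_sine_part_eq[OF y] by (intro divide_right_mono) auto
   hence "f y \<ge> F y" by (simp add: f_def F_def)
   thus ?thesis using tan[OF y] fa True by (simp add: m_def)
  next
   \<comment> \<open>The kink at pi is convex: \<open>F' a\<close> is at least \<open>F' pi\<close>,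
     hence at least \<open>\<phi>' pi\<close>, so to the left of pi the supporting line at
     \<open>a\<close> runs below the tangent of \<open>\<phi>\<close> at pi.\<close>
   case y: False
   have "F' pi \<le> F' a" by (rule convex_derivative_mono[OF dF' F''pos]) (use True in auto)
   moreover have "F' pi \<ge> \<phi>' pi" by (simp add: F'_def)
   ultimately have "F' a \<ge> \<phi>' pi" by simp
   hence "F' a * (y - pi) \<le> \<phi>' pi * (y - pi)" using y by (intro mult_right_mono_neg) auto
   moreover have "\<phi> y \<ge> \<phi> pi + \<phi>' pi * (y - pi)" by (rule \<phi>_tan)
   moreover have "\<phi> pi \<ge> F a + F' a * (pi - a)" using tan[of pi] by (simp add: F_def)
   moreover have "f y = \<phi> y" using y by (simp add: f_def neg_sine_part_eq_0)
   ultimately show ?thesis using fa True by (simp add: m_def algebra_simps)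
  qed
 qed
 have m_mono: "m a \<le> m b" if "a \<le> b" for a b
 proof (cases "a = b")
  case False
  have "m a * (b - a) \<le> m b * (b - a)" using support[of a b] support[of b a] by (simp add: algebra_simps)
  thus ?thesis using False that by simp
 qed simp
 have \<phi>'_mono: "\<phi>' a \<le> \<phi>' b" if "a \<le> b" for a b using that by (simp add: \<phi>'_def arctan_le_iff)
 have \<phi>'_bd: "\<bar>\<phi>' a\<bar> \<le> 44" for a
  using arctan_bounded[of a] pi_less_4 by (auto simp: \<phi>'_def abs_if)
 have m_bd: "\<bar>m a\<bar> \<le> 50" for a
 proof (cases "a > pi \<and> sin a < 0")
  case True
  hence a: "a \<ge> 1" using pi_ge_two by linarith
  have "\<bar>cos a / a^2\<bar> \<le> 1 / 1"
   unfolding abs_divide using a by (intro frac_le) auto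
  moreover have "\<bar>2 * sin a / a^3\<bar> \<le> 2 / 1"
   unfolding abs_divide using a by (intro frac_le) (auto simp: abs_mult)
  ultimately have "\<bar>F' a\<bar> \<le> 50" using \<phi>'_bd[of a] unfolding F'_def by linarith
  thus ?thesis using True by (simp add: m_def)
 qed (use \<phi>'_bd[of a] in \<open>auto simp: m_def\<close>)
 show ?thesis
 \<comment> \<open>For a convex function with supporting slopes m the second difference lies between
   0 and w (m (x + w) - m (x - w)). As \<open>neg_sine_part\<close> is the difference of the convex
   functions \<open>f\<close> and \<open>\<phi>\<close>, the sum of both slopes works.\<close>
 proof (rule that[of "\<lambda>x. m x + \<phi>' x"])
  show "mono (\<lambda>x. m x + \<phi>' x)" by (intro monoI add_mono m_mono \<phi>'_mono)
  show "\<forall>x. -100 \<le> m x + \<phi>' x \<and> m x + \<phi>' x \<le> 100"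
  proof
   fix x show "-100 \<le> m x + \<phi>' x \<and> m x + \<phi>' x \<le> 100" using m_bd[of x] \<phi>'_bd[of x] by linarith
  qed
  fix x w :: real assume "w \<ge> 0"
  have 1: "0 \<le> f (x + w) + f (x - w) - 2 * f x"
   using support[of x "x + w"] support[of x "x - w"] by simp
  have 2: "f (x + w) + f (x - w) - 2 * f x \<le> w * (m (x + w) - m (x - w))"
   using support[of "x + w" x] support[of "x - w" x] by (simp add: algebra_simps)
  have 3: "0 \<le> \<phi> (x + w) + \<phi> (x - w) - 2 * \<phi> x"
   using \<phi>_tan[of x "x + w"] \<phi>_tan[of x "x - w"] by simp
  have 4: "\<phi> (x + w) + \<phi> (x - w) - 2 * \<phi> x \<le> w * (\<phi>' (x + w) - \<phi>' (x - w))"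
   using \<phi>_tan[of "x + w" x] \<phi>_tan[of "x - w" x] by (simp add: algebra_simps)
  have "neg_sine_part (x + w) + neg_sine_part (x - w) - 2 * neg_sine_part x =
    (f (x + w) + f (x - w) - 2 * f x) - (\<phi> (x + w) + \<phi> (x - w) - 2 * \<phi> x)" by (simp add: f_def)
  moreover have "w * (m (x + w) + \<phi>' (x + w) - (m (x - w) + \<phi>' (x - w))) = w * (m (x + w) - m (x - w)) + w * (\<phi>' (x + w) - \<phi>' (x - w))"
   by (simp add: algebra_simps)
  ultimately show "\<bar>neg_sine_part (x + w) + neg_sine_part (x - w) - 2 * neg_sine_part x\<bar> \<le> w * (m (x + w) + \<phi>' (x + w) - (m (x - w) + \<phi>' (x - w)))"
   using 1 2 3 4 by linarith
 qed
qed

text \<open>In the weight, |w| comes from the bound for second differences and |w| + 1 from the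
  number of windows in \<open>prime_log_sum_increments\<close>. The decay x^-4 of the kernel
  suffices for it.\<close>

lemma second_moment_bump_kernel:
 assumes "b > 0"
 shows "integrable lborel (\<lambda>w. \<bar>w\<bar> * (\<bar>w\<bar> + 1) * bump_kernel b w)"
proof -
 obtain C where C: "C > 0" "\<And>x. bump_kernel b x \<le> C / (1 + x^2)^2" by (rule bump_kernel_decay[OF assms]) (rule that)
 show ?thesis
 proof (rule Bochner_Integration.integrable_bound)
  show "integrable lborel (\<lambda>x::real. (2 * C) * inverse (1 + x^2))"
   using integrable_inverse_1_plus_square by (simp add: set_integrable_def)
  show "(\<lambda>w. \<bar>w\<bar> * (\<bar>w\<bar> + 1) * bump_kernel b w) \<in> borel_measurable lborel"
   using continuous_on_bump_kernel by (simp, intro borel_measurable_continuous_onI continuous_intros)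
  show "AE x in lborel. norm (\<bar>x\<bar> * (\<bar>x\<bar> + 1) * bump_kernel b x) \<le> norm ((2 * C) * inverse (1 + x^2))"
  proof (rule AE_I2)
   fix x :: real
   have pos: "1 + x^2 > 0" by (simp add: add_pos_nonneg)
   have "\<bar>x\<bar> * (\<bar>x\<bar> + 1) \<le> 2 * (1 + x^2)"
   proof -
    have "\<bar>x\<bar> * \<bar>x\<bar> = x^2" "\<bar>x\<bar> \<le> 1 + x^2"
     using sum_squares_bound[of "\<bar>x\<bar>" 1] by (auto simp: power2_eq_square)
    thus ?thesis by (simp add: algebra_simps)
   qed
   hence "\<bar>x\<bar> * (\<bar>x\<bar> + 1) * bump_kernel b x \<le> 2 * (1 + x^2) * (C / (1 + x^2)^2)"
    by (rule mult_mono[OF _ C(2)[of x]]) (use bump_kernel_nonneg[of b x] in auto)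
   also have "\<dots> = (2 * C) * inverse (1 + x^2)"
   proof -
    have "2 * t * (C / t^2) = (2 * C) * inverse t" if "t > 0" for t :: real
     using that by (simp add: power2_eq_square field_simps)
    thus ?thesis using pos by blast
   qed
   finally show "norm (\<bar>x\<bar> * (\<bar>x\<bar> + 1) * bump_kernel b x) \<le> norm ((2 * C) * inverse (1 + x^2))"
    using C(1) bump_kernel_nonneg[of b x] by (simp add: abs_mult)
  qed
 qed
qed

lemma integral_bump_kernel_pos:
 assumes "b > 0"
 shows "(LINT x|lborel. bump_kernel b x) > 0"
proof -
 obtain C where C: "C > 0" "\<And>p q. integral {p..q} (bump_kernel b) \<le> (LINT x|lborel. bump_kernel b x)"
  "\<And>p q. p \<ge> 0 ==> q \<ge> 0 ==> (LINT x|lborel. bump_kernel b x) - C * (1 / (1 + p^2) + 1 / (1 + q^2)) \<le> integral {-p..q} (bump_kernel b)"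
  by (rule bump_kernel_integral_interval[OF assms]) (rule that)
 have "integral {-1..1} (bump_kernel b) \<noteq> 0"
 proof
  assume "integral {-1..1} (bump_kernel b) = 0"
  hence "\<forall>x\<in>{-1..1}. bump_kernel b x = 0"
   by (subst (asm) integral_eq_0_iff) (auto simp: bump_kernel_nonneg intro: continuous_on_subset[OF continuous_on_bump_kernel])
  thus False using bump_kernel_0_pos[OF assms] by (auto dest!: bspec[of _ _ 0])
 qed
 moreover have "integral {-1..1} (bump_kernel b) \<ge> 0"
  by (intro integral_nonneg integrable_continuous_real continuous_on_subset[OF continuous_on_bump_kernel]) (auto simp: bump_kernel_nonneg)
 ultimately show ?thesis using C(2)[of "-1" 1] by linarith
qed

text \<open>Let g u = \<eta> neg_sine_part (\<eta> u). Replacing \<open>g\<close> by its average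
  against the kernel costs O(\<eta>^2), since the kernel is even and second differences of
  \<open>g\<close> are controlled by a monotone bounded function. The prime sum then becomes the
  integral of \<open>g\<close> against the smoothed density \<open>\<Psi>\<close>, which is k +
  O(1/(1 + v^2)), while \<open>g\<close> lives on v \<ge> pi/\<eta>.\<close>

lemma prime_sum_neg_sine_part:
 obtains C where "C > 0"
  "\<And>\<eta>. 0 < \<eta> ==> \<eta> \<le> 1 ==> summable (\<lambda>n. if prime n then ln (real n) / real n * (\<eta> * neg_sine_part (\<eta> * ln (real n))) else 0)"
  "\<And>\<eta>. 0 < \<eta> ==> \<eta> \<le> 1 ==>
    \<bar>(\<Sum>n. if prime n then ln (real n) / real n * (\<eta> * neg_sine_part (\<eta> * ln (real n))) else 0) - (LINT y|lborel. neg_sine_part y)\<bar> \<le> C * \<eta>^2"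
proof -
 obtain b CK where b: "b > 0" "CK > 0"
  and smK: "\<And>v. summable (\<lambda>n. if prime n then ln (real n) / real n * bump_kernel b (ln (real n) - v) else 0)"
  and upK: "\<And>v. (\<Sum>n. if prime n then ln (real n) / real n * bump_kernel b (ln (real n) - v) else 0) \<le> (LINT x|lborel. bump_kernel b x) + CK / (1 + v^2)"
  and loK: "\<And>v. v \<ge> 0 ==> (\<Sum>n. if prime n then ln (real n) / real n * bump_kernel b (ln (real n) - v) else 0) \<ge> (LINT x|lborel. bump_kernel b x) - CK / (1 + v^2)"
  by (rule smoothed_prime_sum) (rule that)
 obtain C1 where C1: "C1 > 0"
  "\<And>\<Phi> lo hi w N. mono \<Phi> ==> (\<forall>x. lo \<le> \<Phi> x \<and> \<Phi> x \<le> hi) ==> w \<ge> (0::real) ==>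
   (\<Sum>p\<in>primes_upto N. ln (real p) / real p * (\<Phi> (ln (real p) + w) - \<Phi> (ln (real p) - w))) \<le> C1 * (w + 1) * (hi - lo)"
  by (rule prime_log_sum_increments) (rule that)
 obtain \<Phi> :: "real \<Rightarrow> real" where \<Phi>: "mono \<Phi>" "\<forall>x. -100 \<le> \<Phi> x \<and> \<Phi> x \<le> 100"
  "\<And>x w. w \<ge> 0 ==> \<bar>neg_sine_part (x + w) + neg_sine_part (x - w) - 2 * neg_sine_part x\<bar> \<le> w * (\<Phi> (x + w) - \<Phi> (x - w))"
  by (rule neg_sine_part_second_difference) (rule that)
 define K where "K = bump_kernel b"
 define k where "k = (LINT x|lborel. K x)"
 define I where "I = (LINT y|lborel. neg_sine_part y)"
 define c where "c = (\<lambda>p. ln (real p) / real p)"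
 define \<Psi> where "\<Psi> = (\<lambda>v. \<Sum>n. if prime n then c n * K (ln (real n) - v) else 0)"
 have Kcont: "continuous_on S K" for S unfolding K_def by (rule continuous_on_subset[OF continuous_on_bump_kernel]) simp
 have Kpos: "K x \<ge> 0" for x by (simp add: K_def bump_kernel_nonneg)
 have Kint: "integrable lborel K" unfolding K_def by (rule integrable_bump_kernel[OF b(1)])
 have k: "k > 0" unfolding k_def K_def by (rule integral_bump_kernel_pos[OF b(1)])
 define M where "M = (LINT w|lborel. \<bar>w\<bar> * (\<bar>w\<bar> + 1) * K w)"
 have Mint: "integrable lborel (\<lambda>w. \<bar>w\<bar> * (\<bar>w\<bar> + 1) * K w)" unfolding K_def by (rule second_moment_bump_kernel[OF b(1)])
 have Mpos: "M \<ge> 0" unfolding M_def by (intro integral_nonneg_AE AE_I2 mult_nonneg_nonneg Kpos) auto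
 have Ipos: "I \<ge> 0" unfolding I_def by (intro integral_nonneg_AE AE_I2 neg_sine_part_nonneg)
 have cpos: "c p \<ge> 0" if "prime p" for p
  using prime_ge_1_nat[OF that] by (auto simp: c_def)
 define C where "C = (100 * C1 * M + CK * I) / k + 1"
 have C: "C > 0" using C1 Mpos b Ipos k by (auto simp: C_def intro!: add_nonneg_pos divide_nonneg_pos add_nonneg_nonneg mult_nonneg_nonneg)
 have sm\<Psi>: "summable (\<lambda>n. if prime n then c n * K (ln (real n) - v) else 0)" for v
  using smK[of v] unfolding c_def K_def .
 have up\<Psi>: "\<Psi> v \<le> k + CK / (1 + v^2)" for v using upK[of v] unfolding \<Psi>_def c_def K_def k_def .
 have lo\<Psi>: "\<Psi> v \<ge> k - CK / (1 + v^2)" if "v \<ge> 0" for v using loK[OF that] unfolding \<Psi>_def c_def K_def k_def .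
 define \<Psi>N where "\<Psi>N = (\<lambda>N v. \<Sum>p\<in>primes_upto N. c p * K (ln (real p) - v))"
 have \<Psi>N_lim: "(\<lambda>N. \<Psi>N N v) \<longlonglongrightarrow> \<Psi> v" for v
  unfolding \<Psi>N_def \<Psi>_def by (intro sums_primes_upto summable_sums sm\<Psi>)
 have \<Psi>N_nonneg: "\<Psi>N N v \<ge> 0" for N v
  unfolding \<Psi>N_def by (intro sum_nonneg mult_nonneg_nonneg cpos Kpos) (rule prime_of_primes_upto)
 have \<Psi>N_le: "\<Psi>N N v \<le> \<Psi> v" for N v
  unfolding \<Psi>N_def \<Psi>_def sum_primes_upto using cpos Kpos by (intro sum_le_suminf sm\<Psi>) auto
 have \<Psi>_le: "\<Psi> v \<le> k + CK" for v
 proof -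
  have "CK / (1 + v^2) \<le> CK / 1" using b by (intro divide_left_mono) (auto intro: add_pos_nonneg)
  thus ?thesis using up\<Psi>[of v] by simp
 qed
 have main: "(\<lambda>n. if prime n then c n * (\<eta> * neg_sine_part (\<eta> * ln (real n))) else 0) sums S ==> \<bar>S - I\<bar> \<le> C * \<eta>^2"
  and summ: "summable (\<lambda>n. if prime n then c n * (\<eta> * neg_sine_part (\<eta> * ln (real n))) else 0)"
  if \<eta>: "0 < \<eta>" "\<eta> \<le> 1" for \<eta> S
 proof -
  define g where "g = (\<lambda>u. \<eta> * neg_sine_part (\<eta> * u))"
  have gpos: "g u \<ge> 0" for u using \<eta> by (simp add: g_def neg_sine_part_nonneg)
  have gcont: "continuous_on S g" for S
   unfolding g_def by (intro continuous_intros continuous_on_compose2[OF continuous_on_neg_sine_part[of UNIV]]) auto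
  have gint: "integrable lborel g"
   unfolding g_def using lborel_integrable_real_affine[OF integrable_neg_sine_part, of \<eta> 0] \<eta> by simp
  have gI: "(LINT u|lborel. g u) = I"
   unfolding g_def I_def using lborel_integral_real_affine[of \<eta> neg_sine_part 0] \<eta> by simp
  have gbd: "g u \<le> 2" for u
  proof -
   have "2 / (1 + (\<eta> * u)^2) \<le> 2 / 1" by (intro divide_left_mono) (auto intro: add_pos_nonneg)
   hence "neg_sine_part (\<eta> * u) \<le> 2" using neg_sine_part_le[of "\<eta> * u"] by simp
   hence "\<eta> * neg_sine_part (\<eta> * u) \<le> 1 * 2" using \<eta> neg_sine_part_nonneg by (intro mult_mono) auto
   thus ?thesis by (simp add: g_def)
  qed
  \<comment> \<open>Minus the symmetric second difference. Because the kernel is even, the mean of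
    \<open>D\<close> against it is twice the smoothing error, and first-order terms cancel.\<close>
  define D where "D = (\<lambda>w u. 2 * g u - g (u - w) - g (u + w))"
  have Dcont: "continuous_on S (\<lambda>w. D w u)" for S u
   unfolding D_def by (intro continuous_intros continuous_on_compose2[OF gcont[of UNIV]]) auto
  have D_sum: "(\<Sum>p\<in>primes_upto N. c p * \<bar>D w (ln (real p))\<bar>) \<le> \<eta>^2 * (200 * C1) * (\<bar>w\<bar> * (\<bar>w\<bar> + 1))" for N w
  proof -
   have D_le: "\<bar>D w u\<bar> \<le> \<bar>w\<bar> * (\<eta>^2 * (\<Phi> (\<eta> * (u + \<bar>w\<bar>)) - \<Phi> (\<eta> * (u - \<bar>w\<bar>))))" for u
   proof -
    have "\<bar>D w u\<bar> = \<eta> * \<bar>neg_sine_part (\<eta> * u + \<eta> * \<bar>w\<bar>) + neg_sine_part (\<eta> * u - \<eta> * \<bar>w\<bar>) - 2 * neg_sine_part (\<eta> * u)\<bar>"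
    proof -
     have "D w u = - (\<eta> * (neg_sine_part (\<eta> * u + \<eta> * \<bar>w\<bar>) + neg_sine_part (\<eta> * u - \<eta> * \<bar>w\<bar>) - 2 * neg_sine_part (\<eta> * u)))"
      unfolding D_def g_def by (cases "w \<ge> 0") (auto simp: algebra_simps)
     thus ?thesis using \<eta> by (simp add: abs_mult)
    qed
    also have "\<dots> \<le> \<eta> * ((\<eta> * \<bar>w\<bar>) * (\<Phi> (\<eta> * u + \<eta> * \<bar>w\<bar>) - \<Phi> (\<eta> * u - \<eta> * \<bar>w\<bar>)))"
     using \<eta> by (intro mult_left_mono \<Phi>(3)) auto
    finally show ?thesis by (simp add: algebra_simps power2_eq_square)
   qed
   have "(\<Sum>p\<in>primes_upto N. c p * \<bar>D w (ln (real p))\<bar>) \<le> (\<Sum>p\<in>primes_upto N. (\<bar>w\<bar> * \<eta>^2) * (c p * (\<Phi> (\<eta> * (ln (real p) + \<bar>w\<bar>)) - \<Phi> (\<eta> * (ln (real p) - \<bar>w\<bar>)))))"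
   proof (rule sum_mono)
    fix p assume "p \<in> primes_upto N"
    hence "c p \<ge> 0" by (intro cpos prime_of_primes_upto)
    from mult_left_mono[OF D_le[of "ln (real p)"] this]
    show "c p * \<bar>D w (ln (real p))\<bar> \<le> (\<bar>w\<bar> * \<eta>^2) * (c p * (\<Phi> (\<eta> * (ln (real p) + \<bar>w\<bar>)) - \<Phi> (\<eta> * (ln (real p) - \<bar>w\<bar>))))"
     by (simp add: mult_ac)
   qed
   also have "\<dots> = (\<bar>w\<bar> * \<eta>^2) * (\<Sum>p\<in>primes_upto N. c p * (\<Phi> (\<eta> * (ln (real p) + \<bar>w\<bar>)) - \<Phi> (\<eta> * (ln (real p) - \<bar>w\<bar>))))"
    by (simp only: sum_distrib_left)
   also have "\<dots> \<le> (\<bar>w\<bar> * \<eta>^2) * (C1 * (\<bar>w\<bar> + 1) * (100 - (-100)))"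
   proof (rule mult_left_mono)
    have "mono (\<lambda>u. \<Phi> (\<eta> * u))" using \<eta> by (intro monoI monoD[OF \<Phi>(1)] mult_left_mono) auto
    from C1(2)[OF this, of "-100" 100 "\<bar>w\<bar>" N]
    show "(\<Sum>p\<in>primes_upto N. c p * (\<Phi> (\<eta> * (ln (real p) + \<bar>w\<bar>)) - \<Phi> (\<eta> * (ln (real p) - \<bar>w\<bar>)))) \<le> C1 * (\<bar>w\<bar> + 1) * (100 - (-100))"
     unfolding c_def using \<Phi>(2) by simp
   qed simp
   finally show ?thesis by (simp add: mult_ac)
  qed
  have gKint: "integrable lborel (\<lambda>w. g (u + s * w) * K w)" for u s
  proof (rule Bochner_Integration.integrable_bound)
   show "integrable lborel (\<lambda>w. 2 * K w)" using Kint by simp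
   show "(\<lambda>w. g (u + s * w) * K w) \<in> borel_measurable lborel"
    by (simp, intro borel_measurable_continuous_onI continuous_intros Kcont continuous_on_compose2[OF gcont[of UNIV]]) auto
   show "AE w in lborel. norm (g (u + s * w) * K w) \<le> norm (2 * K w)"
    using gpos gbd Kpos by (intro AE_I2) (simp add: abs_mult mult_right_mono)
  qed
  define gK where "gK = (\<lambda>u. LINT w|lborel. g (u - w) * K w)"
  have gK_plus: "(LINT w|lborel. g (u + w) * K w) = gK u" for u
   unfolding gK_def using lborel_integral_real_affine[of "-1" "\<lambda>w. g (u + w) * K w" 0]
   by (simp add: K_def bump_kernel_minus)
  have DKint: "integrable lborel (\<lambda>w. D w u * K w)" for u
   unfolding D_def left_diff_distrib
   using gKint[of u "-1"] gKint[of u 1] Kint by (intro Bochner_Integration.integrable_diff) auto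
  have DK: "(LINT w|lborel. D w u * K w) = 2 * (k * g u - gK u)" for u
  proof -
   have "(LINT w|lborel. D w u * K w) = (LINT w|lborel. 2 * g u * K w) - (LINT w|lborel. g (u - w) * K w) - (LINT w|lborel. g (u + w) * K w)"
    unfolding D_def left_diff_distrib using gKint[of u "-1"] gKint[of u 1] Kint
    by (subst Bochner_Integration.integral_diff Bochner_Integration.integral_diff; simp)+
   thus ?thesis unfolding gK_plus by (simp add: gK_def k_def algebra_simps)
  qed
  have absDKint: "integrable lborel (\<lambda>w. \<bar>D w u\<bar> * K w)" for u
   using integrable_abs[OF DKint[of u]] Kpos by (simp add: abs_mult)
  have step1: "\<bar>(\<Sum>p\<in>primes_upto N. c p * (k * g (ln (real p)))) - (\<Sum>p\<in>primes_upto N. c p * gK (ln (real p)))\<bar> \<le> 100 * C1 * M * \<eta>^2" for N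
  proof -
   have "\<bar>(\<Sum>p\<in>primes_upto N. c p * (k * g (ln (real p)))) - (\<Sum>p\<in>primes_upto N. c p * gK (ln (real p)))\<bar> = \<bar>\<Sum>p\<in>primes_upto N. c p * ((LINT w|lborel. D w (ln (real p)) * K w) / 2)\<bar>"
    unfolding DK by (simp add: sum_subtractf[symmetric] right_diff_distrib diff_divide_distrib)
   also have "\<dots> \<le> (\<Sum>p\<in>primes_upto N. c p * ((LINT w|lborel. \<bar>D w (ln (real p))\<bar> * K w) / 2))"
   proof (rule order_trans[OF sum_abs sum_mono])
    fix p assume "p \<in> primes_upto N"
    hence cp: "c p \<ge> 0" by (intro cpos prime_of_primes_upto)
    have "\<bar>LINT w|lborel. D w (ln (real p)) * K w\<bar> \<le> (LINT w|lborel. \<bar>D w (ln (real p)) * K w\<bar>)" by (rule integral_abs_bound)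
    also have "\<dots> = (LINT w|lborel. \<bar>D w (ln (real p))\<bar> * K w)" using Kpos by (simp add: abs_mult)
    finally have "\<bar>LINT w|lborel. D w (ln (real p)) * K w\<bar> / 2 \<le> (LINT w|lborel. \<bar>D w (ln (real p))\<bar> * K w) / 2" by simp
    from mult_left_mono[OF this cp]
    show "\<bar>c p * ((LINT w|lborel. D w (ln (real p)) * K w) / 2)\<bar> \<le> c p * ((LINT w|lborel. \<bar>D w (ln (real p))\<bar> * K w) / 2)"
     using cp by (simp add: abs_mult)
   qed
   also have "\<dots> = (LINT w|lborel. (\<Sum>p\<in>primes_upto N. c p * (\<bar>D w (ln (real p))\<bar> * K w / 2)))"
    using absDKint by (subst Bochner_Integration.integral_sum) auto
   also have "\<dots> \<le> (LINT w|lborel. (100 * C1 * \<eta>^2) * (\<bar>w\<bar> * (\<bar>w\<bar> + 1) * K w))"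
   proof (rule integral_mono)
    fix w
    have scale: "(e * (200 * a) * x) * (kap / 2) = (100 * a * e) * (x * kap)" for e a x kap :: real by simp
    have "(\<Sum>p\<in>primes_upto N. c p * (\<bar>D w (ln (real p))\<bar> * K w / 2)) = (\<Sum>p\<in>primes_upto N. c p * \<bar>D w (ln (real p))\<bar>) * (K w / 2)"
     by (simp add: sum_distrib_right mult.assoc)
    also have "\<dots> \<le> (\<eta>^2 * (200 * C1) * (\<bar>w\<bar> * (\<bar>w\<bar> + 1))) * (K w / 2)"
     using Kpos by (intro mult_right_mono D_sum) auto
    finally show "(\<Sum>p\<in>primes_upto N. c p * (\<bar>D w (ln (real p))\<bar> * K w / 2)) \<le> (100 * C1 * \<eta>^2) * (\<bar>w\<bar> * (\<bar>w\<bar> + 1) * K w)"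
     unfolding scale .
   qed (use absDKint Mint in auto)
   also have "\<dots> = (100 * C1 * \<eta>^2) * M" unfolding M_def by (rule integral_mult_right_zero)
   also have "\<dots> = 100 * C1 * M * \<eta>^2" by simp
   finally show ?thesis .
  qed
  have KgInt: "integrable lborel (\<lambda>v. g v * K (a - v))" for a
   using lborel_integrable_real_affine[OF gKint[of a "-1"], of "-1" a] by simp
  have step2: "(\<Sum>p\<in>primes_upto N. c p * gK (ln (real p))) = (LINT v|lborel. g v * \<Psi>N N v)" for N
  proof -
   have "gK a = (LINT v|lborel. g v * K (a - v))" for a
    unfolding gK_def using lborel_integral_real_affine[of "-1" "\<lambda>w. g (a - w) * K w" a] by simp
   hence "(\<Sum>p\<in>primes_upto N. c p * gK (ln (real p))) = (\<Sum>p\<in>primes_upto N. (LINT v|lborel. c p * (g v * K (ln (real p) - v))))" by simp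
   also have "\<dots> = (LINT v|lborel. (\<Sum>p\<in>primes_upto N. c p * (g v * K (ln (real p) - v))))"
    using KgInt by (subst Bochner_Integration.integral_sum) auto
   also have "\<dots> = (LINT v|lborel. g v * \<Psi>N N v)"
    by (simp add: \<Psi>N_def sum_distrib_left mult_ac)
   finally show ?thesis .
  qed
  have meas: "\<Psi>N N \<in> borel_measurable lborel" for N
   unfolding \<Psi>N_def by (simp, intro borel_measurable_continuous_onI continuous_intros continuous_on_compose2[OF Kcont[of UNIV]]) auto
  have gmeas: "g \<in> borel_measurable lborel" using gint by auto
  have \<Psi>meas: "\<Psi> \<in> borel_measurable lborel" by (rule borel_measurable_LIMSEQ_metric[OF meas \<Psi>N_lim])
  have dom: "integrable lborel (\<lambda>v. (k + CK) * g v)" using gint by simp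
  have step3: "(\<lambda>N. LINT v|lborel. g v * \<Psi>N N v) \<longlonglongrightarrow> (LINT v|lborel. g v * \<Psi> v)"
  proof (rule integral_dominated_convergence[OF _ _ dom])
   show "AE v in lborel. (\<lambda>N. g v * \<Psi>N N v) \<longlonglongrightarrow> g v * \<Psi> v" by (intro AE_I2 tendsto_intros \<Psi>N_lim)
   show "AE v in lborel. norm (g v * \<Psi>N N v) \<le> (k + CK) * g v" for N
   proof (rule AE_I2)
    fix v
    have "\<Psi>N N v \<le> k + CK" using \<Psi>N_le[of N v] \<Psi>_le[of v] by linarith
    from mult_left_mono[OF this gpos[of v]]
    show "norm (g v * \<Psi>N N v) \<le> (k + CK) * g v" using gpos[of v] \<Psi>N_nonneg[of N v] by (simp add: abs_mult mult_ac)
   qed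
  qed (use gmeas meas \<Psi>meas in measurable)
  have g\<Psi>int: "integrable lborel (\<lambda>v. g v * \<Psi> v)"
  proof (rule Bochner_Integration.integrable_bound[OF dom])
   show "AE v in lborel. norm (g v * \<Psi> v) \<le> norm ((k + CK) * g v)"
   proof (rule AE_I2)
    fix v
    have "\<Psi> v \<ge> 0" using \<Psi>N_nonneg[of 0 v] \<Psi>N_le[of 0 v] by linarith
    moreover have "g v * \<Psi> v \<le> g v * (k + CK)" by (rule mult_left_mono[OF \<Psi>_le gpos])
    ultimately show "norm (g v * \<Psi> v) \<le> norm ((k + CK) * g v)"
     using gpos[of v] k b by (simp add: abs_mult mult_ac)
   qed
  qed (use gmeas \<Psi>meas in measurable)
  \<comment> \<open>Where \<open>g\<close> is nonzero, \<eta> v exceeds pi, so 1/(1 + v^2) is below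
    \<eta>^2; the integral of \<open>g\<close> itself is \<open>I\<close>.\<close>
  have step4: "\<bar>(LINT v|lborel. g v * \<Psi> v) - k * I\<bar> \<le> CK * I * \<eta>^2"
  proof -
   have "(LINT v|lborel. g v * \<Psi> v) - k * I = (LINT v|lborel. g v * \<Psi> v - k * g v)"
    using g\<Psi>int gint by (simp add: Bochner_Integration.integral_diff gI)
   also have "\<bar>\<dots>\<bar> \<le> (LINT v|lborel. \<bar>g v * \<Psi> v - k * g v\<bar>)" by (rule integral_abs_bound)
   also have "\<dots> \<le> (LINT v|lborel. (CK * \<eta>^2) * g v)"
   proof (rule integral_mono)
    fix v
    show "\<bar>g v * \<Psi> v - k * g v\<bar> \<le> (CK * \<eta>^2) * g v"
    proof (cases "\<eta> * v \<le> pi")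
     case True
     thus ?thesis by (simp add: g_def neg_sine_part_eq_0)
    next
     case False
     hence v1: "\<eta> * v \<ge> 1" using pi_ge_two by linarith
     hence v: "v \<ge> 0" using \<eta> by (smt (verit) mult_nonneg_nonpos)
     have "\<bar>\<Psi> v - k\<bar> \<le> CK / (1 + v^2)" using up\<Psi>[of v] lo\<Psi>[OF v] by linarith
     also have "\<dots> \<le> CK * \<eta>^2"
     proof -
      have "(\<eta> * v)^2 \<ge> 1" using v1 by simp
      hence "1 \<le> \<eta>^2 * (1 + v^2)" by (simp add: power_mult_distrib algebra_simps add_increasing)
      hence "CK * 1 \<le> CK * (\<eta>^2 * (1 + v^2))" using b by (intro mult_left_mono) auto
      thus ?thesis by (simp add: pos_divide_le_eq add_pos_nonneg mult_ac)
     qed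
     finally have "\<bar>\<Psi> v - k\<bar> * g v \<le> CK * \<eta>^2 * g v" using gpos by (intro mult_right_mono) auto
     moreover have "g v * \<Psi> v - k * g v = (\<Psi> v - k) * g v" by (simp add: algebra_simps)
     ultimately show ?thesis using gpos[of v] by (simp add: abs_mult)
    qed
   qed (use g\<Psi>int gint in auto)
   also have "\<dots> = CK * I * \<eta>^2" by (simp add: gI mult_ac)
   finally show ?thesis .
  qed
  \<comment> \<open>Stated for partial sums, because the convergence of the prime series is itself
    to be derived from it.\<close>
  have partial: "\<bar>k * (\<Sum>p\<in>primes_upto N. c p * g (ln (real p))) - (LINT v|lborel. g v * \<Psi>N N v)\<bar> \<le> 100 * C1 * M * \<eta>^2" for N
   using step1[of N] unfolding step2 by (simp add: sum_distrib_left mult_ac)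
  have nonneg: "(if prime n then c n * g (ln (real n)) else 0) \<ge> 0" for n using cpos gpos by simp
  show summ: "summable (\<lambda>n. if prime n then c n * (\<eta> * neg_sine_part (\<eta> * ln (real n))) else 0)"
  proof -
   obtain B where B: "\<And>N. norm (LINT v|lborel. g v * \<Psi>N N v) \<le> B"
    using convergent_imp_Bseq[OF convergentI[OF step3]] by (auto simp: Bseq_def)
   have "(\<Sum>n<N. if prime n then c n * g (ln (real n)) else 0) \<le> (B + 100 * C1 * M * \<eta>^2) / k" for N
   proof -
    have "(\<Sum>n<N. if prime n then c n * g (ln (real n)) else 0) \<le> (\<Sum>n<Suc N. if prime n then c n * g (ln (real n)) else 0)"
     using nonneg by simp
    also have "\<dots> = (\<Sum>p\<in>primes_upto N. c p * g (ln (real p)))" by (rule sum_primes_upto[symmetric])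
    also have "\<dots> \<le> (B + 100 * C1 * M * \<eta>^2) / k"
    proof -
     have "k * (\<Sum>p\<in>primes_upto N. c p * g (ln (real p))) \<le> B + 100 * C1 * M * \<eta>^2"
      using partial[of N] B[of N] unfolding real_norm_def by linarith
     thus ?thesis using k by (simp add: pos_le_divide_eq mult_ac)
    qed
    finally show ?thesis .
   qed
   from summableI_nonneg_bounded[OF nonneg this] show ?thesis unfolding g_def .
  qed
  show "\<bar>S - I\<bar> \<le> C * \<eta>^2" if "(\<lambda>n. if prime n then c n * (\<eta> * neg_sine_part (\<eta> * ln (real n))) else 0) sums S"
  proof -
   have "(\<lambda>N. \<Sum>p\<in>primes_upto N. c p * g (ln (real p))) \<longlonglongrightarrow> S"
    using sums_primes_upto[OF that] unfolding g_def .
   hence "(\<lambda>N. \<bar>k * (\<Sum>p\<in>primes_upto N. c p * g (ln (real p))) - (LINT v|lborel. g v * \<Psi>N N v)\<bar>) \<longlonglongrightarrow> \<bar>k * S - (LINT v|lborel. g v * \<Psi> v)\<bar>"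
    by (intro tendsto_intros step3)
   hence "\<bar>k * S - (LINT v|lborel. g v * \<Psi> v)\<bar> \<le> 100 * C1 * M * \<eta>^2"
    by (rule tendsto_upperbound) (auto intro!: always_eventually partial)
   hence "\<bar>k * S - k * I\<bar> \<le> 100 * C1 * M * \<eta>^2 + CK * I * \<eta>^2" using step4 by linarith
   moreover have "\<bar>k * S - k * I\<bar> = k * \<bar>S - I\<bar>"
    using k by (simp add: abs_mult flip: right_diff_distrib)
   ultimately have "k * \<bar>S - I\<bar> \<le> (100 * C1 * M + CK * I) * \<eta>^2"
    by (simp add: algebra_simps)
   hence "\<bar>S - I\<bar> \<le> (100 * C1 * M + CK * I) / k * \<eta>^2" using k by (simp add: field_simps)
   also have "\<dots> \<le> C * \<eta>^2" by (intro mult_right_mono) (auto simp: C_def)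
   finally show ?thesis .
  qed
 qed
 show ?thesis
 proof (rule that[OF C])
  fix \<eta> :: real assume \<eta>: "0 < \<eta>" "\<eta> \<le> 1"
  show s: "summable (\<lambda>n. if prime n then ln (real n) / real n * (\<eta> * neg_sine_part (\<eta> * ln (real n))) else 0)"
   using summ[OF \<eta>] unfolding c_def .
  from summable_sums[OF this] main[OF \<eta>]
  show "\<bar>(\<Sum>n. if prime n then ln (real n) / real n * (\<eta> * neg_sine_part (\<eta> * ln (real n))) else 0) - (LINT y|lborel. neg_sine_part y)\<bar> \<le> C * \<eta>^2"
   unfolding c_def I_def by blast
 qed
qed

section \<open>An integral with value \<open>(ln 2 + \<gamma> - 1) / 2\<close>\<close>

lemma Gamma_reflection_real:
 fixes x :: real
 assumes "0 < x" "x < 1"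
 shows "Gamma x * Gamma (1 - x) * sin (pi * x) = pi"
proof -
 have "sin (pi * x) > 0" using assms by (intro sin_gt_zero) (auto simp: field_simps)
 moreover have "complex_of_real (Gamma x * Gamma (1 - x)) = of_real (pi / sin (pi * x))"
 proof -
  have "complex_of_real (Gamma x * Gamma (1 - x)) = Gamma (of_real x) * Gamma (1 - of_real x)"
   by (simp only: of_real_mult Gamma_complex_of_real[symmetric] of_real_diff of_real_1)
  also have "\<dots> = of_real pi / sin (of_real pi * of_real x)" by (rule Gamma_reflection_complex)
  also have "\<dots> = of_real (pi / sin (pi * x))"
   by (simp only: of_real_divide of_real_mult[symmetric] sin_of_real)
  finally show ?thesis .
 qed
 ultimately show ?thesis by (simp only: of_real_eq_iff) simp
qed

lemma nonpos_Ints_real: "(x::real) > 0 ==> x \<notin> \<int>\<^sub>\<le>\<^sub>0"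
 by (auto elim!: nonpos_Ints_cases)

lemma Digamma_reflection_real:
 fixes x :: real
 assumes "0 < x" "x < 1"
 shows "Digamma x - Digamma (1 - x) = - pi * cos (pi * x) / sin (pi * x)"
proof -
 let ?h = "\<lambda>x. Gamma x * Gamma (1 - x) * sin (pi * x)"
 have nz: "x \<notin> \<int>\<^sub>\<le>\<^sub>0" "1 - x \<notin> \<int>\<^sub>\<le>\<^sub>0" using assms by (auto intro!: nonpos_Ints_real)
 have s: "sin (pi * x) > 0" using assms by (intro sin_gt_zero) (auto simp: field_simps)
 have "(?h has_real_derivative ?h x * (Digamma x - Digamma (1 - x)) + Gamma x * Gamma (1 - x) * (cos (pi * x) * pi)) (at x)"
  using nz by (auto intro!: derivative_eq_intros simp: algebra_simps)
 moreover have "(?h has_real_derivative 0) (at x)"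
  by (rule has_field_derivative_transform_within_open[where f = "\<lambda>_. pi" and S = "{0<..<1}"])
    (use assms Gamma_reflection_real in auto)
 ultimately have "?h x * (Digamma x - Digamma (1 - x)) + Gamma x * Gamma (1 - x) * (cos (pi * x) * pi) = 0"
  by (rule DERIV_unique)
 hence eq: "(Gamma x * Gamma (1 - x)) * (sin (pi * x) * (Digamma x - Digamma (1 - x)) + cos (pi * x) * pi) = 0"
  by (simp add: algebra_simps)
 have "Gamma x * Gamma (1 - x) \<noteq> 0" using Gamma_reflection_real[OF assms] by auto
 hence "sin (pi * x) * (Digamma x - Digamma (1 - x)) + cos (pi * x) * pi = 0"
  using eq by (metis mult_eq_0_iff)
 thus ?thesis using s by (simp add: field_simps)
qed

text \<open>The derivative of the cotangent formula for \<open>Digamma\<close>. With both values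
  written as series it is the partial fraction expansion of pi^2 / sin^2 (pi x).\<close>

lemma Polygamma_1_reflection_real:
 fixes x :: real
 assumes "0 < x" "x < 1"
 shows "Polygamma 1 x + Polygamma 1 (1 - x) = pi^2 / (sin (pi * x))^2"
proof -
 have nz: "x \<notin> \<int>\<^sub>\<le>\<^sub>0" "1 - x \<notin> \<int>\<^sub>\<le>\<^sub>0" using assms by (auto intro!: nonpos_Ints_real)
 have s: "sin (pi * x) > 0" using assms by (intro sin_gt_zero) (auto simp: field_simps)
 have "((\<lambda>x. Digamma x - Digamma (1 - x)) has_real_derivative Polygamma 1 x + Polygamma 1 (1 - x)) (at x)"
  using nz by (auto intro!: derivative_eq_intros)
 moreover have "((\<lambda>x. Digamma x - Digamma (1 - x)) has_real_derivative pi^2 / (sin (pi * x))^2) (at x)"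
 proof (rule has_field_derivative_transform_within_open[where f = "\<lambda>x. - pi * cos (pi * x) / sin (pi * x)" and S = "{0<..<1}"])
  have "((\<lambda>x. - pi * cos (pi * x) / sin (pi * x)) has_real_derivative
    (pi * (sin (pi * x) * pi) * sin (pi * x) - (- pi * cos (pi * x)) * (cos (pi * x) * pi)) / (sin (pi * x) * sin (pi * x))) (at x)"
  proof (rule DERIV_divide)
   show "((\<lambda>x. - pi * cos (pi * x)) has_real_derivative pi * (sin (pi * x) * pi)) (at x)"
    by (auto intro!: derivative_eq_intros)
   show "((\<lambda>x. sin (pi * x)) has_real_derivative cos (pi * x) * pi) (at x)"
    by (auto intro!: derivative_eq_intros)
  qed (use s in simp)
  moreover have "pi * (sin (pi * x) * pi) * sin (pi * x) - (- pi * cos (pi * x)) * (cos (pi * x) * pi) = pi^2"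
  proof -
   have "p * (s * p) * s - (- p * c) * (c * p) = p^2 * (s^2 + c^2)" for p s c :: real
    by (simp add: power2_eq_square algebra_simps)
   from this[of pi "sin (pi * x)" "cos (pi * x)"] show ?thesis by (simp only: sin_cos_squared_add mult_1_right)
  qed
  ultimately show "((\<lambda>x. - pi * cos (pi * x) / sin (pi * x)) has_real_derivative pi^2 / (sin (pi * x))^2) (at x)"
   by (simp add: power2_eq_square)
 qed (use assms Digamma_reflection_real in auto)
 ultimately show ?thesis by (rule DERIV_unique)
qed

section \<open>The cosine integral along multiples of pi\<close>

text \<open>The cosine integral made regular at 0: Cin x = \<gamma> + ln x - Ci x for x > 0.\<close>

definition Cin :: "real \<Rightarrow> real" where
 "Cin x = integral {0..x} (\<lambda>t. (1 - cos t) / t)"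

lemma continuous_on_Cin_integrand: "continuous_on S (\<lambda>t::real. (1 - cos t) / t)"
proof -
 have "isCont (\<lambda>t::real. (1 - cos t) / t) t" for t
 proof (cases "t = 0")
  case True
  have "((\<lambda>t::real. (1 - cos t) / t) \<longlongrightarrow> 0) (at 0)" by real_asymp
  thus ?thesis using True by (simp add: isCont_def)
 qed (auto intro!: continuous_intros)
 thus ?thesis by (simp add: continuous_at_imp_continuous_on)
qed

lemma Cin_has_real_derivative:
 assumes "x > 0"
 shows "(Cin has_real_derivative (1 - cos x) / x) (at x)"
proof -
 have "(Cin has_real_derivative (1 - cos x) / x) (at x within {0..x+1})"
  unfolding Cin_def[abs_def]
  using assms by (intro integral_has_real_derivative[OF continuous_on_Cin_integrand]) auto
 hence "(Cin has_real_derivative (1 - cos x) / x) (at x within {0<..<x+1})"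
  by (rule DERIV_subset) auto
 thus ?thesis using assms by (simp add: at_within_open[of x "{0<..<x+1}"])
qed

lemma tendsto_Cin_0: "(Cin \<longlongrightarrow> 0) (at_right 0)"
proof -
 have "continuous_on {0..1} Cin" unfolding Cin_def[abs_def]
  by (intro indefinite_integral_continuous_1 integrable_continuous_real continuous_on_Cin_integrand)
 hence "(Cin \<longlongrightarrow> Cin 0) (at 0 within {0..1})" by (simp add: continuous_on)
 hence "(Cin \<longlongrightarrow> Cin 0) (at_right 0)"
  by (rule filterlim_mono) (auto simp: at_within_Icc_at_right)
 thus ?thesis by (simp add: Cin_def)
qed

text \<open>Equals Ci y - \<gamma> - sin y / y, a primitive of sin y / y^2 whose limit at infinity
  is - \<gamma>.\<close>

definition sine_primitive :: "real \<Rightarrow> real" where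
 "sine_primitive y = ln y - Cin y - sin y / y"

lemma sine_primitive_has_real_derivative:
 assumes "y > 0"
 shows "(sine_primitive has_real_derivative sin y / y^2) (at y)"
proof -
 have "(sine_primitive has_real_derivative inverse y - (1 - cos y) / y - (cos y * y - sin y * 1) / (y * y)) (at y)"
  unfolding sine_primitive_def[abs_def] using assms
  by (auto intro!: derivative_eq_intros Cin_has_real_derivative simp: inverse_eq_divide)
 thus ?thesis
  by (rule DERIV_cong) (use assms in \<open>simp add: field_simps power2_eq_square\<close>)
qed

lemma x_cos_le_sin:
 fixes x :: real
 assumes "0 \<le> x" "x \<le> pi"
 shows "x * cos x \<le> sin x"
proof -
 have "sin 0 - 0 * cos 0 \<le> sin x - x * cos x"
 proof (rule DERIV_nonneg_imp_nondecreasing[OF assms(1)])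
  fix y :: real assume y: "0 \<le> y" "y \<le> x"
  have "((\<lambda>y. sin y - y * cos y) has_real_derivative y * sin y) (at y)"
   by (auto intro!: derivative_eq_intros)
  moreover have "y * sin y \<ge> 0" using y assms by (intro mult_nonneg_nonneg sin_ge_zero) auto
  ultimately show "\<exists>d. ((\<lambda>y. sin y - y * cos y) has_real_derivative d) (at y) \<and> d \<ge> 0" by blast
 qed
 thus ?thesis by simp
qed

text \<open>The function \<open>cot (t/2) / 2 - 1/t\<close> on \<open>(0,\<pi>]\<close> has a bounded derivative, because \<open>sin x \<le> x \<le> tan x\<close>.\<close>
lemma cot_minus_inverse_oscillation:
 fixes N :: nat
 assumes "N > 0" "0 < a" "a \<le> pi"
 shows "\<bar>integral {a..pi} (\<lambda>t. (cos (t/2) / (2 * sin (t/2)) - 1 / t) * cos (real N * t))\<bar> \<le> 4 / real N"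
proof -
 define r where "r = (\<lambda>t::real. cos (t/2) / (2 * sin (t/2)) - 1 / t)"
 define r' where "r' = (\<lambda>t::real. 1 / t^2 - 1 / (4 * (sin (t/2))^2))"
 have sp: "sin (t/2) > 0" if "t \<in> {a..pi}" for t using that assms by (intro sin_gt_zero) auto
 have dr: "(r has_real_derivative r' t) (at t)" if t: "t \<in> {a..pi}" for t
 proof -
  have t0: "t > 0" using t assms by auto
  have "(r has_real_derivative ((- sin (t/2) * (1/2)) * (2 * sin (t/2)) - cos (t/2) * (2 * (cos (t/2) * (1/2)))) / ((2 * sin (t/2)) * (2 * sin (t/2))) - (0 * t - 1 * 1) / (t * t)) (at t)"
   unfolding r_def using sp[OF t] t0 by (auto intro!: derivative_eq_intros)
  thus ?thesis
  proof (rule DERIV_cong)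
   have "(- sin (t/2) * (1/2)) * (2 * sin (t/2)) - cos (t/2) * (2 * (cos (t/2) * (1/2))) = - ((sin (t/2))^2 + (cos (t/2))^2)"
    by (simp add: power2_eq_square)
   thus "((- sin (t/2) * (1/2)) * (2 * sin (t/2)) - cos (t/2) * (2 * (cos (t/2) * (1/2)))) / ((2 * sin (t/2)) * (2 * sin (t/2))) - (0 * t - 1 * 1) / (t * t) = r' t"
    unfolding r'_def by (simp only: sin_cos_squared_add) (simp add: power2_eq_square)
  qed
 qed
 have r'_bd: "\<bar>r' t\<bar> \<le> 1/4" if t: "t \<in> {a..pi}" for t
 proof -
  define x where "x = t / 2"
  have x: "0 < x" "x \<le> pi / 2" using t assms by (auto simp: x_def)
  have sx: "sin x > 0" using x by (intro sin_gt_zero) auto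
  have "sin x \<le> x" using x sin_x_le_x[of x] by simp
  hence "(sin x)^2 \<le> x^2" using sx by (intro power_mono) auto
  hence 1: "1 / x^2 \<le> 1 / (sin x)^2" using sx x by (intro divide_left_mono) auto
  have 2: "1 / (sin x)^2 \<le> 1 / x^2 + 1"
  proof -
   have "x * cos x \<le> sin x" using x by (intro x_cos_le_sin) auto
   moreover have "cos x \<ge> 0" using x by (intro cos_ge_zero) auto
   ultimately have "(x * cos x)^2 \<le> (sin x)^2" using x by (intro power_mono) auto
   hence "x^2 * (1 - (sin x)^2) \<le> (sin x)^2" by (simp add: power_mult_distrib cos_squared_eq)
   hence "x^2 \<le> (sin x)^2 + (sin x)^2 * x^2" by (simp add: algebra_simps)
   thus ?thesis using sx x by (simp add: field_simps)
  qed
  have "r' t = (1 / x^2 - 1 / (sin x)^2) / 4" by (simp add: r'_def x_def power_divide field_simps)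
  thus ?thesis using 1 2 by (simp add: abs_le_iff)
 qed
 have "\<bar>r a - r pi\<bar> \<le> 1/4 * \<bar>a - pi\<bar>"
 proof -
  have "norm (r a - r pi) \<le> 1/4 * norm (a - pi)"
  proof (rule field_differentiable_bound)
   show "(r has_real_derivative r' z) (at z within {a..pi})" if "z \<in> {a..pi}" for z
    using dr[OF that] by (rule has_field_derivative_at_within)
  qed (use assms r'_bd in auto)
  thus ?thesis by simp
 qed
 moreover have "r pi = - (1 / pi)" by (simp add: r_def)
 moreover have "1 / pi \<le> 1" "0 \<le> 1 / pi" "\<bar>a - pi\<bar> \<le> 4" using pi_ge_two pi_less_4 assms by auto
 moreover have "\<bar>x\<bar> \<le> 2" if "\<bar>x - y\<bar> \<le> 1/4 * d" "y = - q" "q \<le> 1" "0 \<le> q" "d \<le> 4" for x y q d :: real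
  using that by linarith
 ultimately have r_bd: "\<bar>r a\<bar> \<le> 2" by blast
 let ?n = "real N"
 have contr: "continuous_on {a..pi} r" using dr by (meson DERIV_isCont continuous_at_imp_continuous_on)
 have contr': "continuous_on {a..pi} r'" unfolding r'_def using less_imp_neq[OF sp] assms by (intro continuous_intros) force+
 have "((\<lambda>t. r' t * sin (?n * t) / ?n + r t * cos (?n * t)) has_integral (r pi * sin (?n * pi) / ?n - r a * sin (?n * a) / ?n)) {a..pi}"
 proof (rule fundamental_theorem_of_calculus[OF assms(3)])
  fix t assume t: "t \<in> {a..pi}"
  have "((\<lambda>t. r t * sin (?n * t) / ?n) has_real_derivative (r' t * sin (?n * t) + cos (?n * t) * ?n * r t) / ?n) (at t)"
   using dr[OF t] assms by (auto intro!: derivative_eq_intros)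
  hence "((\<lambda>t. r t * sin (?n * t) / ?n) has_real_derivative r' t * sin (?n * t) / ?n + r t * cos (?n * t)) (at t)"
   by (rule DERIV_cong) (use assms in \<open>simp add: field_simps\<close>)
  thus "((\<lambda>t. r t * sin (?n * t) / ?n) has_vector_derivative r' t * sin (?n * t) / ?n + r t * cos (?n * t)) (at t within {a..pi})"
   by (auto simp: has_real_derivative_iff_has_vector_derivative intro: has_vector_derivative_at_within)
 qed
 moreover have i1: "(\<lambda>t. r' t * sin (?n * t) / ?n) integrable_on {a..pi}" "(\<lambda>t. r t * cos (?n * t)) integrable_on {a..pi}"
  by (intro integrable_continuous_real continuous_intros contr contr'; use assms in simp)+
 ultimately have "integral {a..pi} (\<lambda>t. r' t * sin (?n * t) / ?n) + integral {a..pi} (\<lambda>t. r t * cos (?n * t)) = - r a * sin (?n * a) / ?n"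
  using integral_add[OF i1] by (simp add: integral_unique)
 moreover have "\<bar>integral {a..pi} (\<lambda>t. r' t * sin (?n * t) / ?n)\<bar> \<le> (1 / 4 / ?n) * (pi - a)"
 proof -
  have "norm (r' t * sin (?n * t) / ?n) \<le> 1 / 4 / ?n" if "t \<in> {a..pi}" for t
  proof -
   have "\<bar>r' t\<bar> * \<bar>sin (?n * t)\<bar> \<le> 1/4 * 1" using r'_bd[OF that] by (intro mult_mono) auto
   hence "\<bar>r' t\<bar> * \<bar>sin (?n * t)\<bar> / ?n \<le> 1 / 4 / ?n" by (intro divide_right_mono) auto
   thus ?thesis by (simp add: abs_mult)
  qed
  moreover have "continuous_on {a..pi} (\<lambda>t. r' t * sin (?n * t) / ?n)"
   using assms by (intro continuous_intros contr') auto
  ultimately have "norm (integral {a..pi} (\<lambda>t. r' t * sin (?n * t) / ?n)) \<le> (1 / 4 / ?n) * (pi - a)"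
   using assms by (intro integral_bound) auto
  thus ?thesis unfolding real_norm_def .
 qed
 moreover have "(1 / 4 / ?n) * (pi - a) \<le> (1 / 4 / ?n) * 4" using assms pi_less_4 by (intro mult_left_mono) auto
 moreover have "(1 / 4 / ?n) * 4 = 1 / ?n" by simp
 moreover have "\<bar>- r a * sin (?n * a) / ?n\<bar> \<le> 2 / ?n"
 proof -
  have "\<bar>r a\<bar> * \<bar>sin (?n * a)\<bar> \<le> 2 * 1" using r_bd by (intro mult_mono) auto
  thus ?thesis using assms by (simp add: abs_mult divide_right_mono)
 qed
 ultimately have "\<bar>integral {a..pi} (\<lambda>t. r t * cos (?n * t))\<bar> \<le> 1 / ?n + 2 / ?n" by linarith
 also have "\<dots> \<le> 4 / ?n" using assms by (simp add: field_simps)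
 finally show ?thesis by (simp add: r_def)
qed

text \<open>The conjugate Dirichlet sum in closed form, with the denominator 2 sin (t/2)
  cleared.\<close>

lemma sum_sin_cot:
 "(\<Sum>k<n. sin (real (Suc k) * t)) * (2 * sin (t/2)) = cos (t/2) * (1 - cos (real n * t)) + sin (t/2) * sin (real n * t)"
proof (induction n)
 case (Suc n)
 let ?a = "real n * t"
 have 1: "sin (real (Suc n) * t) = sin ?a * cos t + cos ?a * sin t"
  by (simp add: distrib_right sin_add add.commute)
 have 2: "cos (real (Suc n) * t) = cos ?a * cos t - sin ?a * sin t"
  by (simp add: distrib_right cos_add add.commute)
 have 3: "cos t = 1 - 2 * (sin (t/2))^2" using cos_double_sin[of "t/2"] by simp
 have 4: "sin t = 2 * sin (t/2) * cos (t/2)" using sin_double[of "t/2"] by simp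
 have 5: "(cos (t/2))^2 = 1 - (sin (t/2))^2" by (rule cos_squared_eq)
 have "(X + S1) * (2 * s) = c * (1 - C1) + s * S1"
  if "X * (2 * s) = c * (1 - C) + s * S" "S1 = S * ct + C * st" "C1 = C * ct - S * st" "ct = 1 - 2 * s^2" "st = 2 * s * c" "c^2 = 1 - s^2"
  for X S1 C1 S C s c st ct :: real
  using that by algebra
 from this[OF Suc.IH 1 2 3 4 5] show ?case by (simp only: sum.lessThan_Suc)
qed simp

text \<open>After scaling, 1/t in (1 - cos nt)/t on (0, pi] is replaced by cot (t/2)/2. By
  \<open>sum_sin_cot\<close> the new integrand is a sum of sines minus sin (nt)/2, with an
  elementary integral. The replacement costs the integral of cot (t/2)/2 - 1/t, which supplies ln pi
  - ln 2, and an oscillating term of size at most 4/n.\<close>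

lemma Cin_multiple_pi:
 assumes "n > 0"
 shows "\<bar>Cin (real n * pi) - ((\<Sum>k<n. (1 - (-1) ^ Suc k) / real (Suc k)) - (1 - (-1)^n) / (2 * real n) + ln pi - ln 2)\<bar> \<le> 4 / real n"
proof -
 let ?n = "real n"
 define R where "R = (\<lambda>t::real. ln (sin (t/2)) - ln t)"
 \<comment> \<open>The integral of (cot (t/2)/2 - 1/t) cos (nt) over [a, pi] in closed form. The
   uniform bound for it is used in the limit where \<open>a\<close> tends to 0.\<close>
 define f where "f = (\<lambda>a. Cin (?n * pi) - Cin (?n * a) - (\<Sum>k<n. (cos (real (Suc k) * a) - (-1) ^ Suc k) / real (Suc k)) + (cos (?n * a) - (-1)^n) / (2 * ?n) + R pi - R a)"
 have "\<bar>f a\<bar> \<le> 4 / ?n" if a: "0 < a" "a < pi" for a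
 proof -
  let ?r = "\<lambda>t. cos (t/2) / (2 * sin (t/2)) - 1 / t"
  have sp: "sin (t/2) > 0" if "t \<in> {a..pi}" for t using that a by (intro sin_gt_zero) auto
  define G where "G = (\<lambda>t. Cin (?n * t) - (\<Sum>k<n. - cos (real (Suc k) * t) / real (Suc k)) - cos (?n * t) / (2 * ?n) + R t)"
  have "((\<lambda>t. ?r t * cos (?n * t)) has_integral (G pi - G a)) {a..pi}"
  proof (rule fundamental_theorem_of_calculus)
   fix t assume t: "t \<in> {a..pi}"
   have t0: "t > 0" using t a by auto
   have dC: "((\<lambda>t. Cin (?n * t)) has_real_derivative (1 - cos (?n * t)) / (?n * t) * ?n) (at t)"
    by (rule DERIV_chain2[OF Cin_has_real_derivative]) (use t0 assms in \<open>auto intro!: derivative_eq_intros\<close>)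
   have dS: "((\<lambda>t. \<Sum>k<n. - cos (real (Suc k) * t) / real (Suc k)) has_real_derivative (\<Sum>k<n. sin (real (Suc k) * t))) (at t)"
    by (rule DERIV_sum) (auto intro!: derivative_eq_intros simp del: of_nat_Suc)
   have dc: "((\<lambda>t. cos (?n * t) / (2 * ?n)) has_real_derivative - sin (?n * t) / 2) (at t)"
    using assms by (auto intro!: derivative_eq_intros)
   have dR: "(R has_real_derivative (cos (t/2) / (2 * sin (t/2)) - 1 / t)) (at t)"
    unfolding R_def using sp[OF t] t0 by (auto intro!: derivative_eq_intros simp: field_simps)
   have "(G has_real_derivative (1 - cos (?n * t)) / (?n * t) * ?n - (\<Sum>k<n. sin (real (Suc k) * t)) - (- sin (?n * t) / 2) + (cos (t/2) / (2 * sin (t/2)) - 1 / t)) (at t)"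
    unfolding G_def by (intro DERIV_add DERIV_diff dC dS dc dR)
   note dG = this
   have e1: "(\<Sum>k<n. sin (real (Suc k) * t)) = cos (t/2) / (2 * sin (t/2)) * (1 - cos (?n * t)) + sin (?n * t) / 2"
    using sum_sin_cot[where n = n and t = t] sp[OF t] by (simp add: field_simps)
   have e2: "(1 - cos (?n * t)) / (?n * t) * ?n = (1 - cos (?n * t)) / t" using assms t0 by simp
   have eq: "(1 - C) / t - (q * (1 - C) + S / 2) - (- S / 2) + (q - 1 / t) = (q - 1 / t) * C" for C q S :: real
    by (simp add: algebra_simps diff_divide_distrib)
   have "(G has_real_derivative ?r t * cos (?n * t)) (at t)"
    by (rule DERIV_cong[OF dG]) (unfold e1 e2, rule eq)
   thus "(G has_vector_derivative ?r t * cos (?n * t)) (at t within {a..pi})"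
    by (auto simp: has_real_derivative_iff_has_vector_derivative intro: has_vector_derivative_at_within)
  qed (use a in auto)
  hence "integral {a..pi} (\<lambda>t. ?r t * cos (?n * t)) = G pi - G a" by (rule integral_unique)
  moreover have "G pi - G a = f a"
  proof -
   have c: "cos (real m * pi) = (-1)^m" for m :: nat by (simp add: mult.commute cos_npi)
   have "(\<Sum>k<n. (cos (real (Suc k) * a) - (-1) ^ Suc k) / real (Suc k)) = (\<Sum>k<n. - cos (real (Suc k) * pi) / real (Suc k)) - (\<Sum>k<n. - cos (real (Suc k) * a) / real (Suc k))"
    unfolding c by (simp add: sum_subtractf[symmetric] diff_divide_distrib add_divide_distrib add.commute)
   thus ?thesis unfolding G_def f_def c by (simp add: diff_divide_distrib)
  qed
  ultimately show ?thesis using cot_minus_inverse_oscillation[OF assms a(1)] a by simp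
 qed
 hence ev: "\<forall>\<^sub>F a in at_right 0. \<bar>f a\<bar> \<le> 4 / ?n"
  using eventually_at_right_real[of 0 pi] by (auto elim!: eventually_mono)
 have "(f \<longlongrightarrow> Cin (?n * pi) - 0 - (\<Sum>k<n. (cos (real (Suc k) * 0) - (-1) ^ Suc k) / real (Suc k)) + (cos (?n * 0) - (-1)^n) / (2 * ?n) + R pi - ln (1/2)) (at_right 0)"
  unfolding f_def
 proof (intro tendsto_intros)
  have "filterlim (\<lambda>a. ?n * a) (at_right 0) (at_right 0)" using assms by real_asymp
  thus "((\<lambda>a. Cin (?n * a)) \<longlongrightarrow> 0) (at_right 0)" by (rule filterlim_compose[OF tendsto_Cin_0])
  show "(R \<longlongrightarrow> ln (1/2)) (at_right 0)" unfolding R_def by real_asymp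
 qed (use assms in auto)
 hence "((\<lambda>a. \<bar>f a\<bar>) \<longlongrightarrow> \<bar>Cin (?n * pi) - 0 - (\<Sum>k<n. (cos (real (Suc k) * 0) - (-1) ^ Suc k) / real (Suc k)) + (cos (?n * 0) - (-1)^n) / (2 * ?n) + R pi - ln (1/2)\<bar>) (at_right 0)"
  by (rule tendsto_rabs)
 from tendsto_upperbound[OF this ev]
 have "\<bar>Cin (?n * pi) - 0 - (\<Sum>k<n. (cos (real (Suc k) * 0) - (-1) ^ Suc k) / real (Suc k)) + (cos (?n * 0) - (-1)^n) / (2 * ?n) + R pi - ln (1/2)\<bar> \<le> 4 / ?n"
  by simp
 moreover have "R pi = - ln pi" "ln (1/2) = - ln (2::real)" by (auto simp: R_def ln_div)
 ultimately show ?thesis by (simp add: algebra_simps)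
qed

lemma sum_odd_reciprocals: "(\<Sum>k<2*N. (1 - (-1) ^ Suc k) / real (Suc k)) = 2 * harm (2 * N) - harm N"
proof (induction N)
 case (Suc N)
 have "(\<Sum>k<2 * Suc N. (1 - (-1) ^ Suc k) / real (Suc k)) = (\<Sum>k<2*N. (1 - (-1) ^ Suc k) / real (Suc k)) + 2 / (2 * real N + 1)"
  by (simp add: field_simps)
 moreover have "harm (2 * Suc N) = harm (2 * N) + 1 / (2 * real N + 1) + 1 / (2 * real N + 2)"
  by (simp add: harm_Suc field_simps)
 moreover have "harm (Suc N) = harm N + 1 / (real N + 1)" by (simp add: harm_Suc field_simps)
 moreover have "2 * (1 / (2 * real N + 2)) = 1 / (real N + 1)" by (simp add: field_simps)
 ultimately show ?case using Suc by simp
qed (simp add: harm_def)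

text \<open>By \<open>sum_odd_reciprocals\<close> the sum is 2 harm (2N) - harm N, and the limit is
  2 \<gamma> - \<gamma>. Along even multiples of pi the term with (-1)^n vanishes.\<close>

lemma Cin_asymptotics: "(\<lambda>N. Cin (real (2 * N) * pi) - ln (real (2 * N) * pi)) \<longlonglongrightarrow> euler_mascheroni"
proof -
 define h where "h = (\<lambda>N. 2 * (harm (2 * N) - ln (real (2 * N))) - (harm N - ln (real N)))"
 have e: "(\<lambda>n. harm n - ln (real n)) \<longlonglongrightarrow> (euler_mascheroni :: real)" by (rule euler_mascheroni_LIMSEQ)
 have "(\<lambda>N. harm (2 * N) - ln (real (2 * N))) \<longlonglongrightarrow> (euler_mascheroni :: real)"
  by (rule filterlim_compose[OF e, of "\<lambda>N. 2 * N"]) (auto intro!: filterlim_subseq strict_monoI)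
 hence "h \<longlonglongrightarrow> 2 * euler_mascheroni - euler_mascheroni" unfolding h_def by (intro tendsto_intros e)
 hence h: "h \<longlonglongrightarrow> euler_mascheroni" by simp
 have "(\<lambda>N. (Cin (real (2 * N) * pi) - ln (real (2 * N) * pi)) - h N) \<longlonglongrightarrow> 0"
 proof (rule Lim_null_comparison)
  show "\<forall>\<^sub>F N in sequentially. norm ((Cin (real (2 * N) * pi) - ln (real (2 * N) * pi)) - h N) \<le> 4 / real (2 * N)"
   using eventually_gt_at_top[of 0]
  proof eventually_elim
   case (elim N)
   have "ln (real (2 * N) * pi) = ln 2 + ln (real N) + ln pi" "ln (real (2 * N)) = ln 2 + ln (real N)"
    using elim by (simp_all add: ln_mult)
   hence "Cin (real (2 * N) * pi) - ln (real (2 * N) * pi) - h N = Cin (real (2 * N) * pi) - (2 * harm (2 * N) - harm N + ln pi - ln 2)"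
    unfolding h_def by simp
   moreover have "\<bar>Cin (real (2 * N) * pi) - (2 * harm (2 * N) - harm N + ln pi - ln 2)\<bar> \<le> 4 / real (2 * N)"
    using Cin_multiple_pi[of "2 * N"] elim unfolding sum_odd_reciprocals by simp
   ultimately show ?case by (simp only: real_norm_def)
  qed
  show "(\<lambda>N. 4 / real (2 * N)) \<longlonglongrightarrow> 0" by real_asymp
 qed
 from tendsto_add[OF this h] show ?thesis by (simp only: diff_add_cancel add_0)
qed

section \<open>The integral of |sin t| / t^2 beyond pi\<close>

text \<open>The weights 1/t^2 on the m-th arch of |sin|, at the point over y and at its mirror image
  over pi - y, folded onto [0, pi].\<close>

definition abs_sine_term :: "nat \<Rightarrow> real \<Rightarrow> real" where
 "abs_sine_term m y = 1 / (y + real m * pi)^2 + 1 / (real (Suc m) * pi - y)^2"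

text \<open>The reflection formula for \<open>Polygamma 1\<close> at y/pi, without the term m = 0,
  which belongs to the arch before pi.\<close>

lemma sums_abs_sine_term:
 assumes "0 < y" "y < pi"
 shows "(\<lambda>k. abs_sine_term (Suc k) y) sums (1 / (sin y)^2 - 1 / y^2 - 1 / (pi - y)^2)"
proof -
 define x where "x = y / pi"
 have x: "0 < x" "x < 1" "y = pi * x" using assms by (auto simp: x_def field_simps)
 have a: "(\<lambda>k. inverse ((z + of_nat k)^2)) sums Polygamma 1 z" if "z > 0" for z :: real
  using Polygamma_LIMSEQ[of z 1] that by (simp add: numeral_2_eq_2)
 have "(\<lambda>k. inverse ((x + of_nat k)^2) + inverse (((1 - x) + of_nat k)^2)) sums (pi^2 / (sin (pi * x))^2)"
  using sums_add[OF a[of x] a[of "1 - x"]] x Polygamma_1_reflection_real[of x] by simp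
 hence "(\<lambda>k. (inverse ((x + of_nat k)^2) + inverse (((1 - x) + of_nat k)^2)) / pi^2) sums (pi^2 / (sin (pi * x))^2 / pi^2)"
  by (rule sums_divide)
 moreover have "(inverse ((x + of_nat k)^2) + inverse (((1 - x) + of_nat k)^2)) / pi^2 = abs_sine_term k y" for k
 proof -
  have "y + real k * pi = (x + real k) * pi" "real (Suc k) * pi - y = ((1 - x) + real k) * pi"
   by (auto simp: x algebra_simps)
  thus ?thesis unfolding abs_sine_term_def by (simp only: power_mult_distrib) (simp add: divide_inverse algebra_simps)
 qed
 ultimately have "(\<lambda>k. abs_sine_term k y) sums (1 / (sin y)^2)" by (simp add: x)
 hence "(\<lambda>k. abs_sine_term (Suc k) y) sums (1 / (sin y)^2 - abs_sine_term 0 y)"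
  by (subst sums_Suc_iff) simp
 thus ?thesis by (simp add: abs_sine_term_def diff_diff_eq)
qed

definition abs_sine_kernel :: "real \<Rightarrow> real" where
 "abs_sine_kernel y = (\<Sum>k. abs_sine_term (Suc k) y)"

lemma abs_sine_term_pos: "y \<in> {0..pi} ==> y + real (Suc k) * pi > 0" "y \<in> {0..pi} ==> real (Suc (Suc k)) * pi - y > 0"
proof -
 assume y: "y \<in> {0..pi}"
 show "y + real (Suc k) * pi > 0" using y by (intro add_nonneg_pos mult_pos_pos) auto
 have "1 * pi < real (Suc (Suc k)) * pi" by (intro mult_strict_right_mono) auto
 moreover have "y \<le> 1 * pi" using y by simp
 ultimately show "real (Suc (Suc k)) * pi - y > 0" by linarith
qed

lemma continuous_on_abs_sine_term: "continuous_on {0..pi} (abs_sine_term (Suc k))"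
 unfolding abs_sine_term_def[abs_def]
 by (intro continuous_intros) (use abs_sine_term_pos[of _ k] in \<open>force+\<close>)

lemma uniform_limit_abs_sine_kernel:
 "uniform_limit {0..pi} (\<lambda>n y. \<Sum>k<n. abs_sine_term (Suc k) y) abs_sine_kernel sequentially"
proof -
 have "uniform_limit {0..pi} (\<lambda>n y. \<Sum>k<n. abs_sine_term (Suc k) y) (\<lambda>y. \<Sum>k. abs_sine_term (Suc k) y) sequentially"
 proof (rule Weierstrass_m_test)
  show "summable (\<lambda>k. 2 * (1 / real (Suc k) ^ 2))"
   using sums_summable[OF inverse_squares_sums] by (intro summable_mult) (simp add: add.commute)
  fix k y assume y: "y \<in> {0..pi}"
  have s: "real (Suc k) \<le> real (Suc k) * pi" using pi_ge_two by simp
  have y': "0 \<le> y" "y \<le> pi" using y by auto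
  have 1: "real (Suc k) \<le> y + real (Suc k) * pi" using s y' by linarith
  have "real (Suc (Suc k)) * pi = real (Suc k) * pi + pi" by (simp add: algebra_simps)
  hence 2: "real (Suc k) \<le> real (Suc (Suc k)) * pi - y" using s y' by linarith
  have "1 / (y + real (Suc k) * pi)^2 \<le> 1 / (real (Suc k))^2"
   using 1 abs_sine_term_pos(1)[OF y, of k] by (intro divide_left_mono power_mono mult_pos_pos zero_less_power) auto
  moreover have "1 / (real (Suc (Suc k)) * pi - y)^2 \<le> 1 / (real (Suc k))^2"
   using 2 abs_sine_term_pos(2)[OF y, of k] by (intro divide_left_mono power_mono mult_pos_pos zero_less_power) auto
  ultimately show "norm (abs_sine_term (Suc k) y) \<le> 2 * (1 / real (Suc k) ^ 2)"
   unfolding abs_sine_term_def by (subst real_norm_def, subst abs_of_nonneg) (auto intro!: add_nonneg_nonneg)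
 qed
 thus ?thesis by (simp add: abs_sine_kernel_def[abs_def])
qed

lemma continuous_on_abs_sine_kernel: "continuous_on {0..pi} abs_sine_kernel"
 by (rule uniform_limit_theorem[OF _ uniform_limit_abs_sine_kernel])
   (auto intro!: always_eventually continuous_on_sum continuous_on_abs_sine_term)

lemma integral_reflect_0_pi:
 fixes f :: "real \<Rightarrow> real"
 shows "integral {0..pi} (\<lambda>y. f (pi - y)) = integral {0..pi} f"
proof -
 have "integral {0..pi} (\<lambda>y. f (pi - y)) = integral {-pi..0} (\<lambda>y. f (y + pi))"
  using Henstock_Kurzweil_Integration.integral_reflect_real[where b = pi and a = 0 and f = "\<lambda>y. f (pi - y)"]
  by (simp add: add.commute)
 also have "\<dots> = integral {0..pi} f" using integral_shift_real_ivl[of 0 pi pi f] by simp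
 finally show ?thesis .
qed

lemma integral_abs_sine_arc:
 "integral {real (Suc k) * pi..real (Suc (Suc k)) * pi} (\<lambda>t. \<bar>sin t\<bar> / t^2) = integral {0..pi} (\<lambda>y. sin y * abs_sine_term (Suc k) y) / 2"
proof -
 let ?c = "real (Suc k) * pi"
 let ?f = "\<lambda>y. sin y / (y + ?c)^2"
 have cf: "continuous_on {0..pi} ?f" using abs_sine_term_pos(1)[of _ k] by (intro continuous_intros) force+
 have s: "\<bar>sin (y + ?c)\<bar> = sin y" if "y \<in> {0..pi}" for y
 proof -
  have "\<bar>sin (y + ?c)\<bar> = \<bar>sin y\<bar>"
   by (simp only: sin_add sin_npi cos_npi) (simp add: abs_mult power_abs)
  thus ?thesis using sin_ge_zero[of y] that by simp
 qed
 have "integral {?c..real (Suc (Suc k)) * pi} (\<lambda>t. \<bar>sin t\<bar> / t^2) = integral {0..pi} (\<lambda>y. \<bar>sin (y + ?c)\<bar> / (y + ?c)^2)"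
  using integral_shift_real_ivl[of ?c ?c "real (Suc (Suc k)) * pi" "\<lambda>t. \<bar>sin t\<bar> / t^2"] by (simp add: algebra_simps)
 also have "\<dots> = integral {0..pi} ?f" by (intro integral_cong) (simp only: s)
 finally have 1: "integral {?c..real (Suc (Suc k)) * pi} (\<lambda>t. \<bar>sin t\<bar> / t^2) = integral {0..pi} ?f" .
 have "integral {0..pi} (\<lambda>y. sin y * abs_sine_term (Suc k) y) = integral {0..pi} (\<lambda>y. ?f y + ?f (pi - y))"
 proof (rule integral_cong)
  fix y
  have "pi - y + ?c = real (Suc (Suc k)) * pi - y" by (simp add: algebra_simps)
  thus "sin y * abs_sine_term (Suc k) y = ?f y + ?f (pi - y)"
   unfolding abs_sine_term_def by (simp only: distrib_left sin_pi_minus) simp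
 qed
 also have "\<dots> = integral {0..pi} ?f + integral {0..pi} (\<lambda>y. ?f (pi - y))"
  by (intro integral_add integrable_continuous_real cf continuous_on_compose2[OF cf]) (auto intro!: continuous_intros)
 also have "\<dots> = 2 * integral {0..pi} ?f" using integral_reflect_0_pi[of ?f] by simp
 finally show ?thesis using 1 by simp
qed

lemma integral_abs_sine_limit:
 "(\<lambda>n. integral {pi..real (Suc n) * pi} (\<lambda>t. \<bar>sin t\<bar> / t^2)) \<longlonglongrightarrow> integral {0..pi} (\<lambda>y. sin y * abs_sine_kernel y) / 2"
proof -
 have eq: "integral {pi..real (Suc n) * pi} (\<lambda>t. \<bar>sin t\<bar> / t^2) = integral {0..pi} (\<lambda>y. sin y * (\<Sum>k<n. abs_sine_term (Suc k) y)) / 2" for n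
 proof (induction n)
  case (Suc n)
  have "integral {pi..real (Suc (Suc n)) * pi} (\<lambda>t. \<bar>sin t\<bar> / t^2) = integral {pi..real (Suc n) * pi} (\<lambda>t. \<bar>sin t\<bar> / t^2) + integral {real (Suc n) * pi..real (Suc (Suc n)) * pi} (\<lambda>t. \<bar>sin t\<bar> / t^2)"
  proof (rule Henstock_Kurzweil_Integration.integral_combine[symmetric])
   show "(\<lambda>t. \<bar>sin t\<bar> / t^2) integrable_on {pi..real (Suc (Suc n)) * pi}"
    by (intro integrable_continuous_real continuous_intros) (auto dest: less_le_trans[OF pi_gt_zero])
  qed (auto simp: algebra_simps)
  also have "\<dots> = (integral {0..pi} (\<lambda>y. sin y * (\<Sum>k<n. abs_sine_term (Suc k) y)) + integral {0..pi} (\<lambda>y. sin y * abs_sine_term (Suc n) y)) / 2"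
   unfolding integral_abs_sine_arc Suc by simp
  also have "integral {0..pi} (\<lambda>y. sin y * (\<Sum>k<n. abs_sine_term (Suc k) y)) + integral {0..pi} (\<lambda>y. sin y * abs_sine_term (Suc n) y) = integral {0..pi} (\<lambda>y. sin y * (\<Sum>k<n. abs_sine_term (Suc k) y) + sin y * abs_sine_term (Suc n) y)"
   by (intro integral_add[symmetric] integrable_continuous_real continuous_intros continuous_on_abs_sine_term)
  finally show ?case by (simp add: distrib_left)
 qed simp
 have ul: "uniform_limit {0..pi} (\<lambda>n y. sin y * (\<Sum>k<n. abs_sine_term (Suc k) y)) (\<lambda>y. sin y * abs_sine_kernel y) sequentially"
 proof (rule uniform_limitI)
  fix e :: real assume "e > 0"
  from uniform_limitD[OF uniform_limit_abs_sine_kernel this]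
  show "\<forall>\<^sub>F n in sequentially. \<forall>y\<in>{0..pi}. dist (sin y * (\<Sum>k<n. abs_sine_term (Suc k) y)) (sin y * abs_sine_kernel y) < e"
  proof eventually_elim
   case (elim n)
   show ?case
   proof
    fix y assume "y \<in> {0..pi}"
    have "dist (sin y * (\<Sum>k<n. abs_sine_term (Suc k) y)) (sin y * abs_sine_kernel y) = \<bar>sin y\<bar> * dist (\<Sum>k<n. abs_sine_term (Suc k) y) (abs_sine_kernel y)"
     by (simp add: dist_real_def abs_mult flip: right_diff_distrib)
    also have "\<dots> \<le> 1 * dist (\<Sum>k<n. abs_sine_term (Suc k) y) (abs_sine_kernel y)" by (intro mult_right_mono) auto
    also have "\<dots> < e" using elim \<open>y \<in> {0..pi}\<close> by auto
    finally show "dist (sin y * (\<Sum>k<n. abs_sine_term (Suc k) y)) (sin y * abs_sine_kernel y) < e" .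
   qed
  qed
 qed
 obtain I J where IJ: "\<And>n. ((\<lambda>y. sin y * (\<Sum>k<n. abs_sine_term (Suc k) y)) has_integral I n) {0..pi}"
   "((\<lambda>y. sin y * abs_sine_kernel y) has_integral J) {0..pi}" "I \<longlonglongrightarrow> J"
  by (rule uniform_limit_integral[OF ul]) (auto intro!: continuous_intros continuous_on_abs_sine_term)
 have "integral {0..pi} (\<lambda>y. sin y * (\<Sum>k<n. abs_sine_term (Suc k) y)) = I n" for n using IJ(1) by (rule integral_unique)
 moreover have "integral {0..pi} (\<lambda>y. sin y * abs_sine_kernel y) = J" using IJ(2) by (rule integral_unique)
 ultimately show ?thesis unfolding eq using IJ(3) by (simp add: tendsto_divide)
qed

text \<open>By the partial fractions the integrand is 1/sin y minus sin y / y^2 and its mirror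
  image, with the primitive ln tan (y/2) - sine_primitive y + sine_primitive (pi - y). Symmetry
  reduces to [0, pi/2], at whose right end the primitive is 0; at 0 its logarithmic singularities
  cancel.\<close>

lemma integral_abs_sine_kernel:
 "integral {0..pi} (\<lambda>y. sin y * abs_sine_kernel y) = 2 * (ln 2 - ln pi - 1 + Cin pi)"
proof -
 let ?F = "\<lambda>y. sin y * abs_sine_kernel y"
 have cF: "continuous_on {0..pi} ?F" by (intro continuous_intros continuous_on_abs_sine_kernel)
 define P where "P = (\<lambda>y. (ln (sin (y/2)) - ln (cos (y/2))) - sine_primitive y + sine_primitive (pi - y))"
 have FTC: "integral {a..pi/2} ?F = P (pi/2) - P a" if a: "0 < a" "a \<le> pi/2" for a
 proof (rule integral_unique, rule fundamental_theorem_of_calculus[OF a(2)])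
  fix y assume y: "y \<in> {a..pi/2}"
  have y0: "0 < y" "y < pi" "y < pi" using y a by auto
  have sc: "sin (y/2) > 0" "cos (y/2) > 0" using y0 by (auto intro!: sin_gt_zero cos_gt_zero)
  have a1: "((\<lambda>y. ln (sin (y/2))) has_real_derivative 1 / sin (y/2) * (cos (y/2) * (1/2))) (at y)"
   by (rule DERIV_chain2[OF DERIV_ln_divide]) (use sc in \<open>auto intro!: derivative_eq_intros\<close>)
  have a2: "((\<lambda>y. ln (cos (y/2))) has_real_derivative 1 / cos (y/2) * (- sin (y/2) * (1/2))) (at y)"
   by (rule DERIV_chain2[OF DERIV_ln_divide]) (use sc in \<open>auto intro!: derivative_eq_intros\<close>)
  have "1 / s * (c * (1/2)) - 1 / c * (- s * (1/2)) = (s^2 + c^2) / (2 * s * c)" if "s > 0" "c > 0" for s c :: real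
   using that by (simp add: field_simps power2_eq_square)
  from this[OF sc] have "1 / sin (y/2) * (cos (y/2) * (1/2)) - 1 / cos (y/2) * (- sin (y/2) * (1/2)) = 1 / sin y"
   using sin_double[of "y/2"] by (simp only: sin_cos_squared_add) simp
  with DERIV_diff[OF a1 a2] have d1: "((\<lambda>y. ln (sin (y/2)) - ln (cos (y/2))) has_real_derivative 1 / sin y) (at y)" by (simp only:)
  have d2: "((\<lambda>y. sine_primitive (pi - y)) has_real_derivative (sin (pi - y) / (pi - y)^2) * (-1)) (at y)"
   by (rule DERIV_chain2[OF sine_primitive_has_real_derivative]) (use y0 in \<open>auto intro!: derivative_eq_intros\<close>)
  have "(P has_real_derivative 1 / sin y - sin y / y^2 + (sin (pi - y) / (pi - y)^2) * (-1)) (at y)"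
   unfolding P_def by (intro DERIV_add DERIV_diff d1 d2 sine_primitive_has_real_derivative y0)
  moreover have "1 / sin y - sin y / y^2 + (sin (pi - y) / (pi - y)^2) * (-1) = ?F y"
  proof -
   have "abs_sine_kernel y = 1 / (sin y)^2 - 1 / y^2 - 1 / (pi - y)^2"
    using sums_abs_sine_term[of y] y0 by (simp add: abs_sine_kernel_def sums_iff)
   moreover have "sin y > 0" using y0 by (intro sin_gt_zero) auto
   hence "sin y * (1 / (sin y)^2) = 1 / sin y" by (simp add: power2_eq_square)
   ultimately show ?thesis by (simp only: right_diff_distrib) simp
  qed
  ultimately show "(P has_vector_derivative ?F y) (at y within {a..pi/2})"
   by (auto simp: has_real_derivative_iff_has_vector_derivative intro: has_vector_derivative_at_within)
 qed
 have P0: "P (pi/2) = 0" by (simp add: P_def sin_45 cos_45)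
 have half: "integral {0..pi} ?F = 2 * integral {0..pi/2} ?F"
 proof -
  have sym: "?F (pi - y) = ?F y" for y
  proof -
   have "abs_sine_term (Suc k) (pi - y) = abs_sine_term (Suc k) y" for k
    unfolding abs_sine_term_def by (simp add: algebra_simps)
   thus ?thesis by (simp add: abs_sine_kernel_def)
  qed
  have "integral {pi/2..pi} ?F = integral {-(pi/2)..0} (\<lambda>y. ?F (y + pi))"
   using integral_shift_real_ivl[of "pi/2" pi pi ?F] by simp
  also have "\<dots> = integral {0..pi/2} (\<lambda>y. ?F (- y + pi))"
   using Henstock_Kurzweil_Integration.integral_reflect_real[where b = "pi/2" and a = 0 and f = "\<lambda>y. ?F (- y + pi)"] by simp
  also have "\<dots> = integral {0..pi/2} ?F" using sym by (simp only: uminus_add_conv_diff)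
  finally have "integral {pi/2..pi} ?F = integral {0..pi/2} ?F" .
  moreover have "integral {0..pi/2} ?F + integral {pi/2..pi} ?F = integral {0..pi} ?F"
   by (rule Henstock_Kurzweil_Integration.integral_combine) (auto intro!: integrable_continuous_real cF)
  ultimately show ?thesis by simp
 qed
 have lim1: "((\<lambda>a. integral {a..pi/2} ?F) \<longlongrightarrow> integral {0..pi/2} ?F) (at_right 0)"
 proof -
  have int: "?F integrable_on {0..pi/2}" by (intro integrable_continuous_real continuous_on_subset[OF cF]) auto
  have "continuous_on {0..pi/2} (\<lambda>a. integral {a..pi/2} ?F)" by (rule indefinite_integral_continuous_1'[OF int])
  hence "((\<lambda>a. integral {a..pi/2} ?F) \<longlongrightarrow> integral {0..pi/2} ?F) (at 0 within {0..pi/2})"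
   by (simp add: continuous_on)
  thus ?thesis by (simp add: at_within_Icc_at_right)
 qed
 have lim2: "((\<lambda>a. - P a) \<longlongrightarrow> - (ln (1/2) + 0 + 1 + sine_primitive (pi - 0))) (at_right 0)"
 proof (rule Lim_transform_eventually)
  have c: "isCont sine_primitive pi" using sine_primitive_has_real_derivative[of pi] by (intro DERIV_isCont) auto
  have "((\<lambda>a. pi - a) \<longlongrightarrow> pi - 0) (at_right 0)" by (intro tendsto_intros)
  hence "((\<lambda>a. sine_primitive (pi - a)) \<longlongrightarrow> sine_primitive (pi - 0)) (at_right 0)"
   using isCont_tendsto_compose[OF c, of "\<lambda>a. pi - a"] by simp
  moreover have "((\<lambda>a. (ln (sin (a/2)) - ln (cos (a/2))) - ln a) \<longlongrightarrow> ln (1/2)) (at_right (0::real))" by real_asymp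
  moreover have "((\<lambda>a. sin a / a) \<longlongrightarrow> 1) (at_right (0::real))" by real_asymp
  ultimately show "((\<lambda>a. - (((ln (sin (a/2)) - ln (cos (a/2))) - ln a) + Cin a + sin a / a + sine_primitive (pi - a))) \<longlongrightarrow> - (ln (1/2) + 0 + 1 + sine_primitive (pi - 0))) (at_right 0)"
   by (intro tendsto_intros tendsto_Cin_0)
  show "\<forall>\<^sub>F a in at_right 0. - (((ln (sin (a/2)) - ln (cos (a/2))) - ln a) + Cin a + sin a / a + sine_primitive (pi - a)) = - P a"
   by (simp add: P_def sine_primitive_def)
 qed
 have "\<forall>\<^sub>F a in at_right 0. - P a = integral {a..pi/2} ?F"
 proof -
  have "\<forall>\<^sub>F a in at_right 0. a \<in> {0<..<pi/2}" by (rule eventually_at_right_real) simp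
  thus ?thesis by eventually_elim (simp add: FTC P0)
 qed
 from Lim_transform_eventually[OF lim2 this] lim1
 have "integral {0..pi/2} ?F = - (ln (1/2) + 0 + 1 + sine_primitive (pi - 0))"
  using tendsto_unique[OF trivial_limit_at_right_real] by blast
 also have "\<dots> = ln 2 - ln pi - 1 + Cin pi" by (simp add: sine_primitive_def ln_div)
 finally show ?thesis using half by simp
qed

text \<open>The negative part is (|sin| - sin)/2. For |sin| the folded arches give a value
  containing Cin pi, for sin the primitive is known; Cin pi and ln pi cancel, and \<gamma> enters
  through the limit of \<open>sine_primitive\<close> at infinity.\<close>

theorem integral_neg_sine_part: "(LINT y|lborel. neg_sine_part y) = (ln 2 + euler_mascheroni - 1) / 2"
proof -
 have eq: "integral {pi..real (2 * N) * pi} neg_sine_part = (integral {pi..real (2 * N) * pi} (\<lambda>t. \<bar>sin t\<bar> / t^2) - (sine_primitive (real (2 * N) * pi) - sine_primitive pi)) / 2"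
  if "N > 0" for N
 proof -
  let ?X = "real (2 * N) * pi"
  have le: "pi \<le> ?X" using that by simp
  have "((\<lambda>t. sin t / t^2) has_integral (sine_primitive ?X - sine_primitive pi)) {pi..?X}"
  proof (rule fundamental_theorem_of_calculus[OF le])
   fix t assume "t \<in> {pi..?X}"
   hence "t > 0" using pi_gt_zero by (meson atLeastAtMost_iff less_le_trans)
   thus "(sine_primitive has_vector_derivative sin t / t^2) (at t within {pi..?X})"
    using sine_primitive_has_real_derivative[of t]
    by (auto simp: has_real_derivative_iff_has_vector_derivative intro: has_vector_derivative_at_within)
  qed
  moreover have "((\<lambda>t. \<bar>sin t\<bar> / t^2) has_integral integral {pi..?X} (\<lambda>t. \<bar>sin t\<bar> / t^2)) {pi..?X}"
   by (intro integrable_integral integrable_continuous_real continuous_intros) (auto dest: less_le_trans[OF pi_gt_zero])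
  ultimately have "((\<lambda>t. (\<bar>sin t\<bar> / t^2 - sin t / t^2) / 2) has_integral (integral {pi..?X} (\<lambda>t. \<bar>sin t\<bar> / t^2) - (sine_primitive ?X - sine_primitive pi)) / 2) {pi..?X}"
   by (intro has_integral_divide has_integral_diff)
  hence "(neg_sine_part has_integral (integral {pi..?X} (\<lambda>t. \<bar>sin t\<bar> / t^2) - (sine_primitive ?X - sine_primitive pi)) / 2) {pi..?X}"
  proof (rule has_integral_eq[rotated])
   fix t assume t: "t \<in> {pi..?X}"
   show "(\<bar>sin t\<bar> / t^2 - sin t / t^2) / 2 = neg_sine_part t"
    using t by (simp add: neg_sine_part_eq max_def abs_if flip: diff_divide_distrib)
  qed
  thus ?thesis by (rule integral_unique)
 qed
 have "(\<lambda>N. (integral {pi..real (2 * N) * pi} (\<lambda>t. \<bar>sin t\<bar> / t^2) - (sine_primitive (real (2 * N) * pi) - sine_primitive pi)) / 2)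
   \<longlonglongrightarrow> ((ln 2 - ln pi - 1 + Cin pi) - (- euler_mascheroni - sine_primitive pi)) / 2"
 proof (intro tendsto_intros)
  have "(\<lambda>n. integral {pi..real (Suc n) * pi} (\<lambda>t. \<bar>sin t\<bar> / t^2)) \<longlonglongrightarrow> ln 2 - ln pi - 1 + Cin pi"
   using integral_abs_sine_limit unfolding integral_abs_sine_kernel nonzero_mult_div_cancel_left[OF zero_neq_numeral[symmetric]] .
  hence "(\<lambda>n. integral {pi..real n * pi} (\<lambda>t. \<bar>sin t\<bar> / t^2)) \<longlonglongrightarrow> ln 2 - ln pi - 1 + Cin pi"
   by (subst (asm) filterlim_sequentially_Suc)
  thus "(\<lambda>N. integral {pi..real (2 * N) * pi} (\<lambda>t. \<bar>sin t\<bar> / t^2)) \<longlonglongrightarrow> ln 2 - ln pi - 1 + Cin pi"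
   by (rule filterlim_compose[of "\<lambda>n. integral {pi..real n * pi} (\<lambda>t. \<bar>sin t\<bar> / t^2)" _ _ "\<lambda>N. 2 * N"]) (auto intro!: filterlim_subseq strict_monoI)
  have "(\<lambda>N. - (Cin (real (2 * N) * pi) - ln (real (2 * N) * pi))) \<longlonglongrightarrow> - euler_mascheroni"
   by (intro tendsto_intros Cin_asymptotics)
  moreover have "- (Cin (real (2 * N) * pi) - ln (real (2 * N) * pi)) = sine_primitive (real (2 * N) * pi)" for N
  proof -
   have "sin (real (2 * N) * pi) = 0" by (rule sin_npi)
   thus ?thesis unfolding sine_primitive_def by simp
  qed
  ultimately show "(\<lambda>N. sine_primitive (real (2 * N) * pi)) \<longlonglongrightarrow> - euler_mascheroni" by simp
 qed simp
 hence lim: "(\<lambda>N. integral {pi..real (2 * N) * pi} neg_sine_part) \<longlonglongrightarrow> ((ln 2 - ln pi - 1 + Cin pi) - (- euler_mascheroni - sine_primitive pi)) / 2"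
  by (rule Lim_transform_eventually) (use eq in \<open>auto intro!: eventually_mono[OF eventually_gt_at_top[of 0]]\<close>)
 have "(\<lambda>N. integral {pi..real (2 * N) * pi} neg_sine_part) \<longlonglongrightarrow> (LINT y|lborel. neg_sine_part y)"
 proof -
  have "((\<lambda>y. LINT x|lborel. indicator {..y} x *\<^sub>R neg_sine_part x) \<longlongrightarrow> (LINT x|lborel. neg_sine_part x)) at_top"
   by (rule tendsto_integral_at_top) (auto simp: integrable_neg_sine_part)
  moreover have "filterlim (\<lambda>N. real (2 * N) * pi) at_top sequentially" by real_asymp
  ultimately have "(\<lambda>N. LINT x|lborel. indicator {..real (2 * N) * pi} x *\<^sub>R neg_sine_part x) \<longlonglongrightarrow> (LINT x|lborel. neg_sine_part x)"
   by (rule filterlim_compose)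
  moreover have "(LINT x|lborel. indicator {..b} x *\<^sub>R neg_sine_part x) = integral {pi..b} neg_sine_part" for b
  proof -
   have "integral {pi..b} neg_sine_part = (LINT x : {pi..b} | lborel. neg_sine_part x)"
    by (rule set_borel_integral_eq_integral(2)[symmetric]) (rule borel_integrable_atLeastAtMost'[OF continuous_on_neg_sine_part])
   also have "\<dots> = (LINT x|lborel. indicator {..b} x *\<^sub>R neg_sine_part x)"
    unfolding set_lebesgue_integral_def
    by (rule Bochner_Integration.integral_cong) (auto simp: indicator_def neg_sine_part_eq_0)
   finally show ?thesis by simp
  qed
  ultimately show ?thesis by simp
 qed
 from LIMSEQ_unique[OF this lim] show ?thesis by (simp add: sine_primitive_def)
qed

section \<open>The sinc sum over primes\<close>

text \<open>At 0 the value is 0 by the convention for division, not 1; for primes the argument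
  \<eta> ln p is positive.\<close>

definition sinq :: "real \<Rightarrow> real" where
 "sinq x = sin x / x"

lemma abs_sinq_le_1: "\<bar>sinq x\<bar> \<le> 1"
proof (cases "x = 0")
 case False
 thus ?thesis using abs_sin_x_le_abs_x[of x] by (simp add: sinq_def abs_divide)
qed (simp add: sinq_def)

lemma abs_sinq_le_inverse: "x > 0 ==> \<bar>sinq x\<bar> \<le> 1 / x"
 by (auto simp: sinq_def abs_divide intro!: divide_right_mono)

lemma one_minus_sinq_le:
 assumes "x > 0"
 shows "1 - \<bar>sinq x\<bar> \<le> x^2"
proof (cases "x \<ge> 1")
 case True
 hence "x^2 \<ge> 1" by simp
 thus ?thesis by (smt (verit) abs_ge_zero)
next
 case False
 have "x * cos x \<le> sin x" using assms False pi_ge_two by (intro x_cos_le_sin) auto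
 hence "cos x \<le> sinq x" using assms by (simp add: sinq_def field_simps)
 moreover have "cos x \<ge> 1 - x^2 / 2"
 proof -
  have "\<bar>sin (x/2)\<bar>^2 \<le> \<bar>x/2\<bar>^2" by (intro power_mono abs_sin_x_le_abs_x) auto
  hence "(sin (x/2))^2 \<le> (x/2)^2" by (simp only: power2_abs)
  thus ?thesis using cos_double_sin[of "x/2"] by (simp add: power_divide)
 qed
 moreover have "x^2 \<ge> 0" by simp
 ultimately show ?thesis using abs_ge_self[of "sinq x"] by linarith
qed

lemma ln_prime_ge:
 assumes "prime p"
 shows "ln (real p) \<ge> 2/3" "ln (real p) > 0" "real p \<ge> 2"
proof -
 show p: "real p \<ge> 2" using prime_ge_2_nat[OF assms] by simp
 have "ln 2 \<le> ln (real p)" using p by simp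
 thus "ln (real p) \<ge> 2/3" using ln2_ge_two_thirds by linarith
 thus "ln (real p) > 0" by linarith
qed

text \<open>The terms are 1/(p ln p). This is \<open>prime_log_sum_Cauchy\<close> with v = 0; as ln
  p \<ge> 2/3, a factor 4 absorbs the 1 in the denominator.\<close>

lemma summable_prime_log_inverse_square:
 "summable (\<lambda>n. if prime n then ln (real n) / real n * (1 / (ln (real n))^2) else 0)"
proof -
 obtain C where C: "C > 0" "\<And>v N. (\<Sum>p\<in>primes_upto N. ln (real p) / real p * (1 / (1 + (ln (real p) - v)^2))) \<le> C"
  by (rule prime_log_sum_Cauchy) (rule that)
 have nonneg: "(if prime n then ln (real n) / real n * (1 / (ln (real n))^2) else 0) \<ge> 0" for n
  using ln_prime_ge[of n] by auto
 have "(\<Sum>n<N. if prime n then ln (real n) / real n * (1 / (ln (real n))^2) else 0) \<le> 4 * C" for N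
 proof -
  have "(\<Sum>n<N. if prime n then ln (real n) / real n * (1 / (ln (real n))^2) else 0) \<le> (\<Sum>n<Suc N. if prime n then ln (real n) / real n * (1 / (ln (real n))^2) else 0)"
   using nonneg[of N] by simp
  also have "\<dots> = (\<Sum>p\<in>primes_upto N. ln (real p) / real p * (1 / (ln (real p))^2))" by (rule sum_primes_upto[symmetric])
  also have "\<dots> \<le> (\<Sum>p\<in>primes_upto N. 4 * (ln (real p) / real p * (1 / (1 + (ln (real p) - 0)^2))))"
  proof (rule sum_mono)
   fix p assume "p \<in> primes_upto N"
   hence p: "prime p" by (rule prime_of_primes_upto)
   have "(2/3)^2 \<le> (ln (real p))^2" using ln_prime_ge[OF p] by (intro power_mono) auto
   hence "1 / t \<le> 4 * (1 / (1 + t))" if "t = (ln (real p))^2" for t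
    using that by (simp add: power2_eq_square field_simps)
   hence "ln (real p) / real p * (1 / (ln (real p))^2) \<le> ln (real p) / real p * (4 * (1 / (1 + (ln (real p))^2)))"
    using ln_prime_ge[OF p] by (intro mult_left_mono) auto
   thus "ln (real p) / real p * (1 / (ln (real p))^2) \<le> 4 * (ln (real p) / real p * (1 / (1 + (ln (real p) - 0)^2)))"
    by (simp add: mult_ac)
  qed
  also have "\<dots> = 4 * (\<Sum>p\<in>primes_upto N. ln (real p) / real p * (1 / (1 + (ln (real p) - 0)^2)))" by (simp only: sum_distrib_left)
  also have "\<dots> \<le> 4 * C" using C(2)[where v = 0 and N = N] by simp
  finally show ?thesis .
 qed
 thus ?thesis by (rule summableI_nonneg_bounded[OF nonneg])
qed

definition sinc_prime_sum :: "real \<Rightarrow> real" where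
 "sinc_prime_sum \<eta> = (\<Sum>n. if prime n then \<bar>sinq (\<eta> * ln (real n))\<bar> / real n else 0)"

lemma sinc_prime_bound:
 assumes "prime p" "\<eta> > 0"
 shows "\<bar>sinq (\<eta> * ln (real p))\<bar> / real p \<le> (1 / \<eta>) * (ln (real p) / real p * (1 / (ln (real p))^2))"
proof -
 have l: "ln (real p) > 0" "real p \<ge> 2" using ln_prime_ge[OF assms(1)] by auto
 have "\<bar>sinq (\<eta> * ln (real p))\<bar> / real p \<le> (1 / (\<eta> * ln (real p))) / real p"
  using l assms by (intro divide_right_mono abs_sinq_le_inverse) auto
 also have "\<dots> = (1 / \<eta>) * (ln (real p) / real p * (1 / (ln (real p))^2))"
  using l assms by (simp add: power2_eq_square)
 finally show ?thesis .
qed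

lemma summable_abs_sinq_prime:
 assumes "\<eta> > 0"
 shows "summable (\<lambda>n. if prime n then \<bar>sinq (\<eta> * ln (real n))\<bar> / real n else 0)"
proof (rule summable_comparison_test'[of _ 0])
 show "summable (\<lambda>n. (1 / \<eta>) * (if prime n then ln (real n) / real n * (1 / (ln (real n))^2) else 0))"
  by (intro summable_mult summable_prime_log_inverse_square)
 show "norm (if prime n then \<bar>sinq (\<eta> * ln (real n))\<bar> / real n else 0) \<le> (1 / \<eta>) * (if prime n then ln (real n) / real n * (1 / (ln (real n))^2) else 0)" for n
  using sinc_prime_bound[OF _ assms, of n] by (cases "prime n") auto
qed

text \<open>A (s + w) + A (s - w) is even in w, so its derivative A' (s + w) - A' (s - w) is itself
  O(|w|), with a constant from A''. The radii c/2 and c/4 keep all points within 3c/4 of 1.\<close>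

lemma holomorphic_second_difference:
 assumes "c > 0" "A holomorphic_on ball 1 c"
 obtains M where "M > 0"
  "\<And>s h. norm (s - 1) \<le> c/2 ==> \<bar>h\<bar> \<le> c/4 ==> norm (A (s + \<i> * of_real h) + A (s - \<i> * of_real h) - 2 * A s) \<le> M * h^2"
proof -
 define A1 where "A1 = deriv A"
 define A2 where "A2 = deriv A1"
 have hol1: "A1 holomorphic_on ball 1 c" unfolding A1_def using assms(2) by (intro holomorphic_deriv) auto
 have hol2: "A2 holomorphic_on ball 1 c" unfolding A2_def using hol1 by (intro holomorphic_deriv) auto
 have dA: "(A has_field_derivative A1 s) (at s)" if "s \<in> ball 1 c" for s
  unfolding A1_def using assms(2) that by (intro holomorphic_derivI[of A "ball 1 c"]) auto
 have dA1: "(A1 has_field_derivative A2 s) (at s)" if "s \<in> ball 1 c" for s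
  unfolding A2_def using hol1 that by (intro holomorphic_derivI[of A1 "ball 1 c"]) auto
 have sub: "cball (1::complex) (3*c/4) \<subseteq> ball 1 c" using assms(1) by auto
 have "compact (A2 ` cball 1 (3*c/4))"
  using sub by (intro compact_continuous_image holomorphic_on_imp_continuous_on holomorphic_on_subset[OF hol2]) auto
 hence "bounded (A2 ` cball 1 (3*c/4))" by (rule compact_imp_bounded)
 then obtain M0 where "\<forall>w\<in>A2 ` cball 1 (3*c/4). norm w \<le> M0" unfolding bounded_iff by (rule exE)
 hence M0: "\<And>s. s \<in> cball 1 (3*c/4) ==> norm (A2 s) \<le> M0" by blast
 have M0pos: "M0 \<ge> 0" using order_trans[OF norm_ge_zero M0[of 1]] assms(1) by simp
 show ?thesis
 proof (rule that[of "2 * M0 + 1"])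
  show "2 * M0 + 1 > 0" using M0pos by simp
  fix s :: complex and h :: real assume s: "norm (s - 1) \<le> c/2" and h: "\<bar>h\<bar> \<le> c/4"
  define C where "C = cball (0::complex) \<bar>h\<bar>"
  have inb: "s + w \<in> cball 1 (3*c/4)" "s - w \<in> cball 1 (3*c/4)" if "w \<in> C" for w
  proof -
   have w: "norm w \<le> c/4" using that h by (simp add: C_def)
   have "norm (s + w - 1) \<le> norm (s - 1) + norm w" using norm_triangle_ineq[of "s - 1" w] by (simp add: algebra_simps)
   thus "s + w \<in> cball 1 (3*c/4)" using w s by (simp add: dist_norm norm_minus_commute)
   have "norm (s - w - 1) \<le> norm (s - 1) + norm w" using norm_triangle_ineq4[of "s - 1" w] by (simp add: algebra_simps)
   thus "s - w \<in> cball 1 (3*c/4)" using w s by (simp add: dist_norm norm_minus_commute)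
  qed
  have A1diff: "norm (A1 (s + w) - A1 (s - w)) \<le> 2 * M0 * \<bar>h\<bar>" if w: "w \<in> C" for w
  proof -
   have "norm (A1 (s + w) - A1 (s - w)) \<le> M0 * norm ((s + w) - (s - w))"
   proof (rule field_differentiable_bound[of "cball 1 (3*c/4)" A1 A2])
    show "(A1 has_field_derivative A2 z) (at z within cball 1 (3*c/4))" if "z \<in> cball 1 (3*c/4)" for z
    proof -
     have "z \<in> ball 1 c" using that sub by (rule rev_subsetD)
     thus ?thesis by (intro has_field_derivative_at_within[OF dA1])
    qed
   qed (use M0 inb[OF w] in auto)
   also have "norm ((s + w) - (s - w)) = 2 * norm w"
   proof -
    have "(s + w) - (s - w) = 2 * w" by simp
    thus ?thesis by (simp only: norm_mult norm_numeral)
   qed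
   also have "M0 * (2 * norm w) \<le> M0 * (2 * \<bar>h\<bar>)" using that M0pos by (intro mult_left_mono) (auto simp: C_def)
   finally show ?thesis by simp
  qed
  let ?F = "\<lambda>w. A (s + w) + A (s - w)"
  have "norm (?F (\<i> * of_real h) - ?F 0) \<le> (2 * M0 * \<bar>h\<bar>) * norm (\<i> * of_real h - (0::complex))"
  proof (rule field_differentiable_bound[of C ?F "\<lambda>w. A1 (s + w) - A1 (s - w)"])
   show "(?F has_field_derivative A1 (s + z) - A1 (s - z)) (at z within C)" if z: "z \<in> C" for z
   proof -
    have a: "s + z \<in> ball 1 c" "s - z \<in> ball 1 c" using inb[OF z] sub by auto
    have "((\<lambda>w. A (s + w)) has_field_derivative A1 (s + z) * 1) (at z)"
     by (rule DERIV_chain2[where f = A and g = "\<lambda>w. s + w", OF dA]) (use a in \<open>auto intro!: derivative_eq_intros\<close>)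
    moreover have "((\<lambda>w. A (s - w)) has_field_derivative A1 (s - z) * (-1)) (at z)"
     by (rule DERIV_chain2[where f = A and g = "\<lambda>w. s - w", OF dA]) (use a in \<open>auto intro!: derivative_eq_intros\<close>)
    ultimately have "(?F has_field_derivative A1 (s + z) * 1 + A1 (s - z) * (-1)) (at z)" by (rule DERIV_add)
    thus ?thesis by (simp add: has_field_derivative_at_within)
   qed
  qed (use A1diff in \<open>auto simp: C_def norm_mult\<close>)
  also have "\<dots> = 2 * M0 * h^2" by (simp add: norm_mult power2_eq_square)
  also have "\<dots> \<le> (2 * M0 + 1) * h^2" by (simp add: algebra_simps)
  finally show "norm (A (s + \<i> * of_real h) + A (s - \<i> * of_real h) - 2 * A s) \<le> (2 * M0 + 1) * h^2"
   by (simp add: algebra_simps)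
 qed
qed

lemma integral_cos_symmetric:
 assumes "u > 0" "\<eta> > 0"
 shows "((\<lambda>t. cos (t * u)) has_integral 2 * \<eta> * sinq (\<eta> * u)) {-\<eta>..\<eta>}"
proof -
 have "((\<lambda>t. cos (t * u)) has_integral (sin (\<eta> * u) / u - sin (- \<eta> * u) / u)) {-\<eta>..\<eta>}"
 proof (rule fundamental_theorem_of_calculus)
  fix t
  have "((\<lambda>t. sin (t * u) / u) has_real_derivative cos (t * u)) (at t)"
   using assms by (auto intro!: derivative_eq_intros)
  thus "((\<lambda>t. sin (t * u) / u) has_vector_derivative cos (t * u)) (at t within {-\<eta>..\<eta>})"
   by (auto simp: has_real_derivative_iff_has_vector_derivative intro: has_vector_derivative_at_within)
 qed (use assms in auto)
 moreover have "sin (\<eta> * u) / u - sin (- \<eta> * u) / u = 2 * \<eta> * sinq (\<eta> * u)"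
  using assms by (simp add: sinq_def)
 ultimately show ?thesis by simp
qed

lemma Re_nat_powr: "n > 0 ==> Re (of_nat n powr (- Complex \<sigma> t)) = real n powr (-\<sigma>) * cos (t * ln (real n))"
 by (simp add: powr_def Re_exp)

lemma sums_Re_prime_zeta:
 assumes "\<sigma> > 1"
 shows "(\<lambda>n. if prime n then real n powr (-\<sigma>) * cos (t * ln (real n)) else 0) sums Re (prime_zeta (Complex \<sigma> t))"
proof -
 have "(\<lambda>n. Re (if prime n then of_nat n powr (- Complex \<sigma> t) else 0)) sums Re (prime_zeta (Complex \<sigma> t))"
  by (rule sums_Re, rule sums_prime_zeta) (use assms in simp)
 moreover have "Re (if prime n then of_nat n powr (- Complex \<sigma> t) else 0) = (if prime n then real n powr (-\<sigma>) * cos (t * ln (real n)) else 0)" for n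
  using Re_nat_powr[of n \<sigma> t] prime_gt_0_nat[of n] by auto
 ultimately show ?thesis by simp
qed

abbreviation prime_cos_sum :: "(nat \<Rightarrow> real) \<Rightarrow> real \<Rightarrow> real \<Rightarrow> real" where
 "prime_cos_sum \<theta> \<sigma> t \<equiv> (\<Sum>n. if prime n then real n powr (-\<sigma>) * \<theta> n * cos (t * ln (real n)) else 0)"

section \<open>Means of prime sums over a symmetric interval\<close>

lemma summable_prime_powr:
 assumes "\<sigma> > 1"
 shows "summable (\<lambda>n. if prime n then real n powr (-\<sigma>) else 0)"
proof (rule summable_comparison_test'[of _ 0])
 show "summable (\<lambda>n. real n powr (-\<sigma>))" using assms by (simp add: summable_real_powr_iff)
qed auto

text \<open>Termwise, the mean of cos (t u) over [-\<eta>, \<eta>] is sinq (\<eta> u). The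
  coefficients \<open>\<theta>\<close> stay free, so that one identity serves both \<theta> = 1 and
  the sign pattern of the upper bound.\<close>

lemma sums_prime_average:
 assumes \<sigma>: "\<sigma> > 1" and \<eta>: "\<eta> > 0" and \<theta>: "\<And>n. \<bar>\<theta> n\<bar> \<le> 1"
 shows "(\<lambda>n. if prime n then real n powr (-\<sigma>) * \<theta> n * sinq (\<eta> * ln (real n)) else 0) sums
   (integral {-\<eta>..\<eta>} (prime_cos_sum \<theta> \<sigma>) / (2 * \<eta>))"
proof -
 let ?f = "\<lambda>n t. if prime n then real n powr (-\<sigma>) * \<theta> n * cos (t * ln (real n)) else 0"
 have ul: "uniform_limit {-\<eta>..\<eta>} (\<lambda>N t. \<Sum>n<N. ?f n t) (\<lambda>t. \<Sum>n. ?f n t) sequentially"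
 proof (rule Weierstrass_m_test[OF _ summable_prime_powr[OF \<sigma>]])
  fix n t
  have "\<bar>\<theta> n\<bar> * \<bar>cos (t * ln (real n))\<bar> \<le> 1 * 1" using \<theta> by (intro mult_mono) auto
  hence "real n powr (-\<sigma>) * (\<bar>\<theta> n\<bar> * \<bar>cos (t * ln (real n))\<bar>) \<le> real n powr (-\<sigma>) * (1 * 1)"
   by (intro mult_left_mono) auto
  thus "norm (?f n t) \<le> (if prime n then real n powr (-\<sigma>) else 0)" by (simp add: abs_mult mult.assoc)
 qed
 have cont: "continuous_on {-\<eta>..\<eta>} (\<lambda>t. \<Sum>n<N. ?f n t)" for N
 proof (intro continuous_on_sum)
  fix n show "continuous_on {-\<eta>..\<eta>} (?f n)" by (cases "prime n") (auto intro!: continuous_intros)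
 qed
 obtain I J where IJ: "\<And>N. ((\<lambda>t. \<Sum>n<N. ?f n t) has_integral I N) {-\<eta>..\<eta>}"
   "((\<lambda>t. \<Sum>n. ?f n t) has_integral J) {-\<eta>..\<eta>}" "I \<longlonglongrightarrow> J"
  by (rule uniform_limit_integral[OF ul cont]) auto
 have "((\<lambda>t. \<Sum>n<N. ?f n t) has_integral (\<Sum>n<N. if prime n then real n powr (-\<sigma>) * \<theta> n * (2 * \<eta> * sinq (\<eta> * ln (real n))) else 0)) {-\<eta>..\<eta>}" for N
 proof (intro has_integral_sum)
  fix n
  show "(?f n has_integral (if prime n then real n powr (-\<sigma>) * \<theta> n * (2 * \<eta> * sinq (\<eta> * ln (real n))) else 0)) {-\<eta>..\<eta>}"
  proof (cases "prime n")
   case True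
   from has_integral_mult_right[OF integral_cos_symmetric[OF ln_prime_ge(2)[OF True] \<eta>], of "real n powr (-\<sigma>) * \<theta> n"]
   show ?thesis using True by simp
  qed simp
 qed simp
 hence IN: "I N = (\<Sum>n<N. if prime n then real n powr (-\<sigma>) * \<theta> n * (2 * \<eta> * sinq (\<eta> * ln (real n))) else 0)" for N
  using IJ(1) has_integral_unique by blast
 hence "I = (\<lambda>N. \<Sum>n<N. if prime n then real n powr (-\<sigma>) * \<theta> n * (2 * \<eta> * sinq (\<eta> * ln (real n))) else 0)"
  by (rule ext)
 with IJ(3) have "(\<lambda>n. if prime n then real n powr (-\<sigma>) * \<theta> n * (2 * \<eta> * sinq (\<eta> * ln (real n))) else 0) sums J"
  unfolding sums_def by (simp only:)
 from sums_divide[OF this, of "2 * \<eta>"]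
 have "(\<lambda>n. (if prime n then real n powr (-\<sigma>) * \<theta> n * (2 * \<eta> * sinq (\<eta> * ln (real n))) else 0) / (2 * \<eta>)) sums (J / (2 * \<eta>))" .
 moreover have "(if prime n then real n powr (-\<sigma>) * \<theta> n * (2 * \<eta> * sinq (\<eta> * ln (real n))) else 0) / (2 * \<eta>) = (if prime n then real n powr (-\<sigma>) * \<theta> n * sinq (\<eta> * ln (real n)) else 0)" for n
  using \<eta> by simp
 moreover have "integral {-\<eta>..\<eta>} (\<lambda>t. \<Sum>n. ?f n t) = J" using IJ(2) by (rule integral_unique)
 ultimately show ?thesis by simp
qed

text \<open>The sum of 1/p diverges, so the decay of \<open>sinq\<close> is essential: 1/(\<eta> p
  ln p) is a summable majorant independent of \<sigma>, and dominated convergence for series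
  applies.\<close>

lemma tendsto_prime_sinc_sum:
 assumes \<eta>: "\<eta> > 0" and \<theta>: "\<And>n. \<bar>\<theta> n\<bar> \<le> 1"
 shows "((\<lambda>\<sigma>. \<Sum>n. if prime n then real n powr (-\<sigma>) * \<theta> n * sinq (\<eta> * ln (real n)) else 0) \<longlongrightarrow>
   (\<Sum>n. if prime n then \<theta> n * sinq (\<eta> * ln (real n)) / real n else 0)) (at_right 1)"
proof -
 let ?M = "\<lambda>n. (1 / \<eta>) * (if prime n then ln (real n) / real n * (1 / (ln (real n))^2) else 0)"
 have sm: "summable ?M" by (intro summable_mult summable_prime_log_inverse_square)
 have "((\<lambda>\<sigma>. if prime n then real n powr (-\<sigma>) * \<theta> n * sinq (\<eta> * ln (real n)) else 0) \<longlongrightarrow>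
   (if prime n then \<theta> n * sinq (\<eta> * ln (real n)) / real n else 0)) (at_right 1)" for n
 proof (cases "prime n")
  case True
  hence n: "real n \<noteq> 0" using ln_prime_ge by force
  hence "((\<lambda>\<sigma>. real n powr (-\<sigma>) * \<theta> n * sinq (\<eta> * ln (real n))) \<longlongrightarrow> real n powr (-1) * \<theta> n * sinq (\<eta> * ln (real n))) (at_right 1)"
   by (intro tendsto_intros) auto
  moreover have "real n powr (-1) = 1 / real n" using n by (simp add: powr_minus_divide)
  ultimately show ?thesis using True by simp
 qed simp
 moreover have "\<forall>\<^sub>F (n, \<sigma>) in at_top \<times>\<^sub>F at_right 1. norm (if prime n then real n powr (-\<sigma>) * \<theta> n * sinq (\<eta> * ln (real n)) else 0) \<le> ?M n"
 proof -
  have "\<forall>\<^sub>F \<sigma> in at_right 1. \<forall>n. norm (if prime n then real n powr (-\<sigma>) * \<theta> n * sinq (\<eta> * ln (real n)) else 0) \<le> ?M n"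
   using eventually_at_right_less
  proof eventually_elim
   case (elim \<sigma>)
   show ?case
   proof
    fix n
    show "norm (if prime n then real n powr (-\<sigma>) * \<theta> n * sinq (\<eta> * ln (real n)) else 0) \<le> ?M n"
    proof (cases "prime n")
     case True
     have n: "real n \<ge> 2" using ln_prime_ge[OF True] by auto
     have "real n powr (-\<sigma>) \<le> real n powr (-1)" using n elim by (intro powr_mono) auto
     hence r: "real n powr (-\<sigma>) \<le> 1 / real n" using n by (simp add: powr_minus_divide)
     have "real n powr (-\<sigma>) * (\<bar>\<theta> n\<bar> * \<bar>sinq (\<eta> * ln (real n))\<bar>) \<le> 1 / real n * (1 * \<bar>sinq (\<eta> * ln (real n))\<bar>)"
      using r \<theta>[of n] by (intro mult_mono) auto
     also have "\<dots> \<le> ?M n" using sinc_prime_bound[OF True \<eta>] True by simp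
     finally show ?thesis using True by (simp add: abs_mult mult.assoc)
    qed simp
   qed
  qed
  hence "\<forall>\<^sub>F x in at_top \<times>\<^sub>F at_right 1. \<forall>n. norm (if prime n then real n powr (-snd x) * \<theta> n * sinq (\<eta> * ln (real n)) else 0) \<le> ?M n"
   by (rule eventually_compose_filterlim[OF _ filterlim_snd])
  thus ?thesis by (rule eventually_mono) (unfold case_prod_unfold, erule allE)
 qed
 ultimately show ?thesis
  using tannerys_theorem[of "\<lambda>n \<sigma>. if prime n then real n powr (-\<sigma>) * \<theta> n * sinq (\<eta> * ln (real n)) else 0" "\<lambda>n. if prime n then \<theta> n * sinq (\<eta> * ln (real n)) / real n else 0" "at_right 1" ?M] sm
  by simp
qed

lemma integral_ln_norm:
 assumes "\<epsilon> > 0" "\<eta> > 0"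
 shows "((\<lambda>t. ln (\<epsilon>^2 + t^2) / 2) has_integral (\<eta> * ln (\<epsilon>^2 + \<eta>^2) - 2 * \<eta> + 2 * (\<epsilon> * arctan (\<eta> / \<epsilon>)))) {-\<eta>..\<eta>}"
proof -
 define Q where "Q = (\<lambda>t. t * ln (\<epsilon>^2 + t^2) / 2 - t + \<epsilon> * arctan (t / \<epsilon>))"
 have "((\<lambda>t. ln (\<epsilon>^2 + t^2) / 2) has_integral (Q \<eta> - Q (-\<eta>))) {-\<eta>..\<eta>}"
 proof (rule fundamental_theorem_of_calculus)
  fix t
  have pos: "\<epsilon>^2 + t^2 > 0" using assms by (simp add: add_pos_nonneg)
  have d1: "((\<lambda>t. ln (\<epsilon>^2 + t^2)) has_real_derivative 1 / (\<epsilon>^2 + t^2) * (2 * t)) (at t)"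
   by (rule DERIV_chain2[where f = ln and g = "\<lambda>t. \<epsilon>^2 + t^2", OF DERIV_ln_divide]) (use pos in \<open>auto intro!: derivative_eq_intros\<close>)
  have d2: "((\<lambda>t. arctan (t / \<epsilon>)) has_real_derivative inverse (1 + (t / \<epsilon>)^2) * (1 / \<epsilon>)) (at t)"
   by (rule DERIV_chain2[where f = arctan and g = "\<lambda>t. t / \<epsilon>", OF DERIV_arctan]) (use assms in \<open>auto intro!: derivative_eq_intros\<close>)
  have "(Q has_real_derivative (1 * ln (\<epsilon>^2 + t^2) + 1 / (\<epsilon>^2 + t^2) * (2 * t) * t) / 2 - 1 + inverse (1 + (t / \<epsilon>)^2) * (1 / \<epsilon>) * \<epsilon>) (at t)"
   unfolding Q_def
   by (intro DERIV_add DERIV_diff DERIV_cdivide DERIV_mult DERIV_ident d1)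
     (use DERIV_cmult[OF d2, of \<epsilon>] in \<open>simp add: mult_ac\<close>)
  moreover have "inverse (1 + (t / \<epsilon>)^2) * (1 / \<epsilon>) * \<epsilon> = \<epsilon>^2 / (\<epsilon>^2 + t^2)"
  proof -
   have "1 + (t / \<epsilon>)^2 = (\<epsilon>^2 + t^2) / \<epsilon>^2" using assms by (simp add: power_divide add_divide_distrib)
   thus ?thesis using assms by simp
  qed
  moreover have "1 / (\<epsilon>^2 + t^2) * (2 * t) * t / 2 = t^2 / (\<epsilon>^2 + t^2)"
  proof -
   have "1 / d * (2 * t) * t / 2 = t^2 / d" for d :: real by (simp add: power2_eq_square)
   thus ?thesis .
  qed
  moreover have "t^2 / (\<epsilon>^2 + t^2) + \<epsilon>^2 / (\<epsilon>^2 + t^2) = 1" using pos assms by (simp flip: add_divide_distrib add: add.commute)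
  moreover have "(1 * l + m) / 2 - 1 + q = l / 2" if "q = y" "m / 2 = x" "x + y = 1" for l m q x y :: real
   using that by (simp add: add_divide_distrib)
  ultimately have "(Q has_real_derivative ln (\<epsilon>^2 + t^2) / 2) (at t)"
   by (metis (no_types))
  thus "(Q has_vector_derivative ln (\<epsilon>^2 + t^2) / 2) (at t within {-\<eta>..\<eta>})"
   by (auto simp: has_real_derivative_iff_has_vector_derivative intro: has_vector_derivative_at_within)
 qed (use assms in auto)
 moreover have "Q \<eta> - Q (-\<eta>) = \<eta> * ln (\<epsilon>^2 + \<eta>^2) - 2 * \<eta> + 2 * (\<epsilon> * arctan (\<eta> / \<epsilon>))"
  by (simp add: Q_def arctan_minus)
 ultimately show ?thesis by (simp only:)
qed

text \<open>Without absolute values the sum is the mean over [-\<eta>, \<eta>] of Re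
  \<open>prime_zeta\<close> on the line Re s = 1, reached from the right. The mean of - ln |t| is 1
  - ln \<eta>, and the mean of Re A differs from Re (A 1) by O(\<eta>^2) only, because t and -t are
  averaged together.\<close>

lemma sinq_sum_asymptotics:
 assumes c: "0 < c" and A: "A holomorphic_on ball 1 c"
  "\<And>s. s \<in> ball 1 c ==> Re s > 1 ==> prime_zeta s = - Ln (s - 1) + A s"
 obtains M where "M > 0" "\<And>\<eta>. 0 < \<eta> ==> \<eta> \<le> c/4 ==>
  \<bar>(\<Sum>n. if prime n then sinq (\<eta> * ln (real n)) / real n else 0) - (1 - ln \<eta> + Re (A 1))\<bar> \<le> M * \<eta>^2"
proof -
 obtain M where M: "M > 0"
  "\<And>s h. norm (s - 1) \<le> c/2 ==> \<bar>h\<bar> \<le> c/4 ==> norm (A (s + \<i> * of_real h) + A (s - \<i> * of_real h) - 2 * A s) \<le> M * h^2"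
  by (rule holomorphic_second_difference[OF c A(1)]) (rule that)
 have main: "\<bar>(\<Sum>n. if prime n then sinq (\<eta> * ln (real n)) / real n else 0) - (1 - ln \<eta> + Re (A 1))\<bar> \<le> M * \<eta>^2"
  if \<eta>: "0 < \<eta>" "\<eta> \<le> c/4" for \<eta>
 proof -
  define S where "S = (\<lambda>\<sigma>. \<Sum>n. if prime n then real n powr (-\<sigma>) * 1 * sinq (\<eta> * ln (real n)) else 0)"
  define V where "V = (\<lambda>\<epsilon>. (\<eta> * ln (\<epsilon>^2 + \<eta>^2) - 2 * \<eta> + 2 * (\<epsilon> * arctan (\<eta> / \<epsilon>))) / (2 * \<eta>))"
  have fin: "\<bar>S \<sigma> + V (\<sigma> - 1) - Re (A (of_real \<sigma>))\<bar> \<le> M * \<eta>^2" if \<sigma>: "1 < \<sigma>" "\<sigma> < 1 + c/4" for \<sigma>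
  proof -
   define \<epsilon> where "\<epsilon> = \<sigma> - 1"
   have \<epsilon>: "\<epsilon> > 0" using \<sigma> by (simp add: \<epsilon>_def)
   have in_ball: "Complex \<sigma> t \<in> ball 1 c" if "t \<in> {-\<eta>..\<eta>}" for t
   proof -
    have "norm (Complex \<sigma> t - 1) \<le> \<bar>Re (Complex \<sigma> t - 1)\<bar> + \<bar>Im (Complex \<sigma> t - 1)\<bar>" by (rule cmod_le)
    also have "\<dots> \<le> c/4 + c/4" using that \<sigma> \<eta> by auto
    also have "\<dots> < c" using c by simp
    finally show ?thesis by (simp add: dist_norm norm_minus_commute)
   qed
   have RP: "Re (prime_zeta (Complex \<sigma> t)) = - (ln (\<epsilon>^2 + t^2) / 2) + Re (A (Complex \<sigma> t))" if "t \<in> {-\<eta>..\<eta>}" for t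
   proof -
    have nz: "Complex \<sigma> t - 1 \<noteq> 0" using \<sigma> by (auto simp: complex_eq_iff)
    have "Re (Ln (Complex \<sigma> t - 1)) = ln (norm (Complex \<sigma> t - 1))" using nz by (rule Re_Ln)
    also have "norm (Complex \<sigma> t - 1) = sqrt (\<epsilon>^2 + t^2)" by (simp add: cmod_def \<epsilon>_def)
    also have "ln (sqrt (\<epsilon>^2 + t^2)) = ln (\<epsilon>^2 + t^2) / 2" using \<epsilon> by (intro ln_sqrt) (simp add: add_pos_nonneg)
    finally show ?thesis using A(2)[OF in_ball[OF that]] \<sigma> by simp
   qed
   have contA: "continuous_on {-\<eta>..\<eta>} (\<lambda>t. Re (A (Complex \<sigma> t)))"
    using in_ball by (intro continuous_intros continuous_on_compose2[OF holomorphic_on_imp_continuous_on[OF A(1)]]) (auto simp: Complex_eq intro!: continuous_intros)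
   define IA where "IA = integral {-\<eta>..\<eta>} (\<lambda>t. Re (A (Complex \<sigma> t)))"
   have "S \<sigma> = integral {-\<eta>..\<eta>} (\<lambda>t. \<Sum>n. if prime n then real n powr (-\<sigma>) * 1 * cos (t * ln (real n)) else 0) / (2 * \<eta>)"
    unfolding S_def by (rule sums_unique[symmetric], rule sums_prime_average) (use \<sigma> \<eta> in auto)
   also have "integral {-\<eta>..\<eta>} (\<lambda>t. \<Sum>n. if prime n then real n powr (-\<sigma>) * 1 * cos (t * ln (real n)) else 0) = integral {-\<eta>..\<eta>} (\<lambda>t. - (ln (\<epsilon>^2 + t^2) / 2) + Re (A (Complex \<sigma> t)))"
   proof (rule integral_cong)
    fix t assume t: "t \<in> {-\<eta>..\<eta>}"
    have "(\<Sum>n. if prime n then real n powr (-\<sigma>) * 1 * cos (t * ln (real n)) else 0) = Re (prime_zeta (Complex \<sigma> t))"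
     using sums_Re_prime_zeta[OF \<sigma>(1), of t] unfolding mult_1_right by (rule sums_unique[symmetric])
    thus "(\<Sum>n. if prime n then real n powr (-\<sigma>) * 1 * cos (t * ln (real n)) else 0) = - (ln (\<epsilon>^2 + t^2) / 2) + Re (A (Complex \<sigma> t))"
     using RP[OF t] by simp
   qed
   also have "\<dots> = - (\<eta> * ln (\<epsilon>^2 + \<eta>^2) - 2 * \<eta> + 2 * (\<epsilon> * arctan (\<eta> / \<epsilon>))) + IA"
    unfolding IA_def
    by (rule integral_unique, intro has_integral_add has_integral_neg integral_ln_norm \<epsilon> \<eta>(1) integrable_integral integrable_continuous_real contA)
   finally have "S \<sigma> + V (\<sigma> - 1) = IA / (2 * \<eta>)"
    unfolding V_def \<epsilon>_def[symmetric] by (simp add: diff_divide_distrib add_divide_distrib)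
   moreover have "\<bar>IA / (2 * \<eta>) - Re (A (of_real \<sigma>))\<bar> \<le> M * \<eta>^2"
   proof -
    have refl: "integral {-\<eta>..\<eta>} (\<lambda>t. Re (A (Complex \<sigma> (-t)))) = IA"
     unfolding IA_def using Henstock_Kurzweil_Integration.integral_reflect_real[where a = "-\<eta>" and b = \<eta> and f = "\<lambda>t. Re (A (Complex \<sigma> t))"] by simp
    have contA': "continuous_on {-\<eta>..\<eta>} (\<lambda>t. Re (A (Complex \<sigma> (-t))))"
     by (rule continuous_on_compose2[OF contA]) (auto intro!: continuous_intros)
    let ?D = "\<lambda>t. Re (A (Complex \<sigma> t)) + Re (A (Complex \<sigma> (-t))) - 2 * Re (A (of_real \<sigma>))"
    have "integral {-\<eta>..\<eta>} ?D = IA + IA - 2 * Re (A (of_real \<sigma>)) * (2 * \<eta>)"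
    proof -
     have "(?D has_integral (IA + IA - (\<eta> - (- \<eta>)) *\<^sub>R (2 * Re (A (of_real \<sigma>))))) {-\<eta>..\<eta>}"
     proof (intro has_integral_diff has_integral_add)
      show "((\<lambda>t. Re (A (Complex \<sigma> t))) has_integral IA) {-\<eta>..\<eta>}" unfolding IA_def
       by (intro integrable_integral integrable_continuous_real contA)
      show "((\<lambda>t. Re (A (Complex \<sigma> (-t)))) has_integral IA) {-\<eta>..\<eta>}" unfolding refl[symmetric]
       by (intro integrable_integral integrable_continuous_real contA')
      show "((\<lambda>t. 2 * Re (A (of_real \<sigma>))) has_integral (\<eta> - (- \<eta>)) *\<^sub>R (2 * Re (A (of_real \<sigma>)))) {-\<eta>..\<eta>}"
       by (rule has_integral_const_real[THEN has_integral_eq_rhs]) (use \<eta> in auto)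
     qed
     thus ?thesis by (simp add: integral_unique)
    qed
    moreover have "norm (integral {-\<eta>..\<eta>} ?D) \<le> (M * \<eta>^2) * (\<eta> - (- \<eta>))"
    proof (rule integral_bound)
     fix t assume t: "t \<in> {-\<eta>..\<eta>}"
     have C: "Complex \<sigma> t = of_real \<sigma> + \<i> * of_real t" "Complex \<sigma> (-t) = of_real \<sigma> - \<i> * of_real t" by (simp_all add: Complex_eq)
     have "norm (complex_of_real \<sigma> - 1) = \<bar>\<sigma> - 1\<bar>" by (metis norm_of_real of_real_1 of_real_diff real_norm_def)
     hence "norm (A (of_real \<sigma> + \<i> * of_real t) + A (of_real \<sigma> - \<i> * of_real t) - 2 * A (of_real \<sigma>)) \<le> M * t^2"
      using t \<sigma> \<eta> by (intro M(2)) auto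
     also have "\<dots> \<le> M * \<eta>^2"
      using t M(1) by (intro mult_left_mono) (auto simp: abs_le_square_iff[symmetric])
     finally show "norm (?D t) \<le> M * \<eta>^2"
      using abs_Re_le_cmod[of "A (of_real \<sigma> + \<i> * of_real t) + A (of_real \<sigma> - \<i> * of_real t) - 2 * A (of_real \<sigma>)"] unfolding C by simp
    qed (use \<eta> contA contA' in \<open>auto intro!: continuous_intros\<close>)
    ultimately have "\<bar>2 * IA - 2 * Re (A (of_real \<sigma>)) * (2 * \<eta>)\<bar> \<le> (M * \<eta>^2) * (2 * \<eta>)" by (simp add: real_norm_def)
    hence le: "\<bar>2 * (2 * \<eta>) * (IA / (2 * \<eta>) - Re (A (of_real \<sigma>)))\<bar> \<le> (M * \<eta>^2) * (2 * \<eta>)"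
     using \<eta> by (simp add: right_diff_distrib mult_ac)
    have "(2 * \<eta>) * \<bar>IA / (2 * \<eta>) - Re (A (of_real \<sigma>))\<bar> \<le> \<bar>2 * (2 * \<eta>) * (IA / (2 * \<eta>) - Re (A (of_real \<sigma>)))\<bar>"
     using \<eta> by (simp add: abs_mult)
    also note le
    finally have "(2 * \<eta>) * \<bar>IA / (2 * \<eta>) - Re (A (of_real \<sigma>))\<bar> \<le> (2 * \<eta>) * (M * \<eta>^2)" by (simp add: mult_ac)
    thus ?thesis using \<eta> by (simp only: mult_le_cancel_left_pos)
   qed
   ultimately show ?thesis by simp
  qed
  have lim: "((\<lambda>\<sigma>. \<bar>S \<sigma> + V (\<sigma> - 1) - Re (A (of_real \<sigma>))\<bar>) \<longlongrightarrow> \<bar>(\<Sum>n. if prime n then 1 * sinq (\<eta> * ln (real n)) / real n else 0) + (ln \<eta> - 1) - Re (A (of_real 1))\<bar>) (at_right 1)"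
  proof (intro tendsto_intros)
   show "(S \<longlongrightarrow> (\<Sum>n. if prime n then 1 * sinq (\<eta> * ln (real n)) / real n else 0)) (at_right 1)"
    unfolding S_def by (rule tendsto_prime_sinc_sum) (use \<eta> in auto)
   have "(V \<longlongrightarrow> ln \<eta> - 1) (at_right 0)"
   proof -
    have "((\<lambda>\<epsilon>. \<epsilon> * arctan (\<eta> / \<epsilon>)) \<longlongrightarrow> 0) (at_right 0)" using \<eta> by real_asymp
    hence "(V \<longlongrightarrow> (\<eta> * ln (0^2 + \<eta>^2) - 2 * \<eta> + 2 * 0) / (2 * \<eta>)) (at_right 0)"
     unfolding V_def using \<eta> by (intro tendsto_intros) auto
    also have "(\<eta> * ln (0^2 + \<eta>^2) - 2 * \<eta> + 2 * 0) / (2 * \<eta>) = ln \<eta> - 1"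
     using \<eta> by (simp add: ln_realpow field_simps)
    finally show ?thesis .
   qed
   moreover have "filterlim (\<lambda>\<sigma>::real. \<sigma> - 1) (at_right 0) (at_right 1)" by real_asymp
   ultimately show "((\<lambda>\<sigma>. V (\<sigma> - 1)) \<longlongrightarrow> ln \<eta> - 1) (at_right 1)" by (rule filterlim_compose)
   have "isCont A (of_real 1)" using A(1) c
    by (intro field_differentiable_imp_continuous_at holomorphic_on_imp_differentiable_at[OF A(1)]) auto
   thus "((\<lambda>\<sigma>. A (of_real \<sigma>)) \<longlongrightarrow> A (of_real 1)) (at_right 1)"
    by (rule isCont_tendsto_compose) (intro tendsto_intros)
  qed
  have "\<bar>(\<Sum>n. if prime n then 1 * sinq (\<eta> * ln (real n)) / real n else 0) + (ln \<eta> - 1) - Re (A (of_real 1))\<bar> \<le> M * \<eta>^2"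
  proof (rule tendsto_upperbound[OF lim])
   have "\<forall>\<^sub>F \<sigma> in at_right 1. \<sigma> \<in> {1<..<1 + c/4}" using c by (intro eventually_at_right_real) auto
   thus "\<forall>\<^sub>F \<sigma> in at_right 1. \<bar>S \<sigma> + V (\<sigma> - 1) - Re (A (of_real \<sigma>))\<bar> \<le> M * \<eta>^2"
    by eventually_elim (use fin in auto)
  qed simp
  thus ?thesis unfolding mult_1 of_real_1 by (simp add: algebra_simps)
 qed
 show ?thesis by (rule that[OF M(1) main])
qed

text \<open>|sinq| is sinq plus twice its negative part, whose prime sum is
  \<open>prime_sum_neg_sine_part\<close>. The constants add up to ln 2 + \<gamma>: 1 from the signed
  sum and ln 2 + \<gamma> - 1 from twice the integral.\<close>

theorem sinc_prime_sum_asymptotics: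
 assumes c: "0 < c" and A: "A holomorphic_on ball 1 c"
  "\<And>s. s \<in> ball 1 c ==> Re s > 1 ==> prime_zeta s = - Ln (s - 1) + A s"
 obtains M where "M > 0" "\<And>\<eta>. 0 < \<eta> ==> \<eta> \<le> c/4 ==> \<eta> \<le> 1 ==>
  \<bar>sinc_prime_sum \<eta> - (- ln \<eta> + ln 2 + euler_mascheroni + Re (A 1))\<bar> \<le> M * \<eta>^2"
proof -
 obtain M where M: "M > 0" "\<And>\<eta>. 0 < \<eta> ==> \<eta> \<le> c/4 ==>
  \<bar>(\<Sum>n. if prime n then sinq (\<eta> * ln (real n)) / real n else 0) - (1 - ln \<eta> + Re (A 1))\<bar> \<le> M * \<eta>^2"
  by (rule sinq_sum_asymptotics[OF c A(1)]) (rule A(2), assumption, assumption, rule that)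
 obtain C where C: "C > 0"
  "\<And>\<eta>. 0 < \<eta> ==> \<eta> \<le> 1 ==> summable (\<lambda>n. if prime n then ln (real n) / real n * (\<eta> * neg_sine_part (\<eta> * ln (real n))) else 0)"
  "\<And>\<eta>. 0 < \<eta> ==> \<eta> \<le> 1 ==>
    \<bar>(\<Sum>n. if prime n then ln (real n) / real n * (\<eta> * neg_sine_part (\<eta> * ln (real n))) else 0) - (LINT y|lborel. neg_sine_part y)\<bar> \<le> C * \<eta>^2"
  by (rule prime_sum_neg_sine_part) (rule that)
 have main: "\<bar>sinc_prime_sum \<eta> - (- ln \<eta> + ln 2 + euler_mascheroni + Re (A 1))\<bar> \<le> (M + 2 * C) * \<eta>^2"
  if \<eta>: "0 < \<eta>" "\<eta> \<le> c/4" "\<eta> \<le> 1" for \<eta>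
 proof -
  let ?s = "\<lambda>n. if prime n then sinq (\<eta> * ln (real n)) / real n else 0"
  let ?g = "\<lambda>n. if prime n then ln (real n) / real n * (\<eta> * neg_sine_part (\<eta> * ln (real n))) else 0"
  have sm: "summable ?s"
  proof (rule summable_comparison_test'[OF summable_abs_sinq_prime[OF \<eta>(1)], of 0])
   show "norm (?s n) \<le> (if prime n then \<bar>sinq (\<eta> * ln (real n))\<bar> / real n else 0)" for n by (simp add: abs_divide)
  qed
  have split_abs: "(if prime n then \<bar>sinq (\<eta> * ln (real n))\<bar> / real n else 0) = ?s n + 2 * ?g n" for n
  proof (cases "prime n")
   case True
   define u where "u = ln (real n)"
   have u: "u > 0" "real n \<ge> 2" using ln_prime_ge[OF True] by (auto simp: u_def)
   define y where "y = \<eta> * u"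
   have y: "y > 0" using u \<eta> by (simp add: y_def)
   have "neg_sine_part y = max 0 (- sin y) / y^2"
   proof (cases "y \<ge> pi")
    case False
    hence "sin y \<ge> 0" using y by (intro sin_ge_zero) auto
    thus ?thesis using False by (simp add: neg_sine_part_eq_0)
   qed (rule neg_sine_part_eq)
   hence "u * (\<eta> * neg_sine_part y) = max 0 (- sin y) / y"
    using y u \<eta> by (simp add: y_def power2_eq_square)
   moreover have "\<bar>sinq y\<bar> = sinq y + 2 * (max 0 (- sin y) / y)"
   proof -
    have "\<bar>sinq y\<bar> = \<bar>sin y\<bar> / y" using y by (simp add: sinq_def abs_divide)
    also have "\<bar>sin y\<bar> = sin y + 2 * max 0 (- sin y)" by (simp add: max_def abs_if)
    finally show ?thesis by (simp add: sinq_def add_divide_distrib)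
   qed
   ultimately have "\<bar>sinq y\<bar> / real n = sinq y / real n + 2 * (u / real n * (\<eta> * neg_sine_part y))"
    by (simp add: add_divide_distrib)
   thus ?thesis using True by (simp add: y_def u_def)
  qed simp
  have "sinc_prime_sum \<eta> = (\<Sum>n. ?s n + 2 * ?g n)" unfolding sinc_prime_sum_def split_abs ..
  also have "\<dots> = (\<Sum>n. ?s n) + 2 * (\<Sum>n. ?g n)"
   using suminf_add[OF sm summable_mult[OF C(2)[OF \<eta>(1,3)], of 2]] suminf_mult[OF C(2)[OF \<eta>(1,3)], of 2] by simp
  finally have eq: "sinc_prime_sum \<eta> = (\<Sum>n. ?s n) + 2 * (\<Sum>n. ?g n)" .
  have "\<bar>(\<Sum>n. ?g n) - (ln 2 + euler_mascheroni - 1) / 2\<bar> \<le> C * \<eta>^2"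
   using C(3)[OF \<eta>(1,3)] unfolding integral_neg_sine_part .
  moreover have "\<bar>(\<Sum>n. ?s n) - (1 - ln \<eta> + Re (A 1))\<bar> \<le> M * \<eta>^2" by (rule M(2)[OF \<eta>(1,2)])
  moreover have "\<bar>(x + 2 * y) - (- l + t + e + a)\<bar> \<le> m1 + 2 * m2" if "\<bar>y - (t + e - 1) / 2\<bar> \<le> m2" "\<bar>x - (1 - l + a)\<bar> \<le> m1" for x y l t e a m1 m2 :: real
   using that unfolding abs_le_iff by argo
  ultimately have "\<bar>((\<Sum>n. ?s n) + 2 * (\<Sum>n. ?g n)) - (- ln \<eta> + ln 2 + euler_mascheroni + Re (A 1))\<bar> \<le> M * \<eta>^2 + 2 * (C * \<eta>^2)" by blast
  thus ?thesis unfolding eq by (simp add: algebra_simps)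
 qed
 show ?thesis by (rule that[OF _ main]) (use M C in auto)
qed

section \<open>Lower bound\<close>

abbreviation zeta_power :: "real \<Rightarrow> real \<Rightarrow> real \<Rightarrow> real" where
 "zeta_power k \<sigma> t \<equiv> exp (k * ln (norm (zeta (Complex \<sigma> t))))"

text \<open>Integrates the tangent of exp at the mean of \<open>f\<close>.\<close>

lemma exp_integral_Jensen:
 fixes f :: "real \<Rightarrow> real"
 assumes "a < b" "continuous_on {a..b} f"
 shows "(b - a) * exp (integral {a..b} f / (b - a)) \<le> integral {a..b} (\<lambda>t. exp (f t))"
proof -
 define m where "m = integral {a..b} f / (b - a)"
 have int: "f integrable_on {a..b}" using assms by (intro integrable_continuous_real)
 have "((\<lambda>t. exp m * (1 - m) + exp m * f t) has_integral ((b - a) *\<^sub>R (exp m * (1 - m)) + exp m * integral {a..b} f)) {a..b}"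
  using assms by (intro has_integral_add has_integral_mult_right integrable_integral int has_integral_const_real[THEN has_integral_eq_rhs]) auto
 moreover have "((\<lambda>t. exp (f t)) has_integral integral {a..b} (\<lambda>t. exp (f t))) {a..b}"
  using assms by (intro integrable_integral integrable_continuous_real continuous_intros)
 moreover have "exp m * (1 - m) + exp m * f t \<le> exp (f t)" for t
 proof -
  have "exp m * (1 + (f t - m)) \<le> exp m * exp (f t - m)" by (intro mult_left_mono exp_ge_add_one_self) auto
  also have "\<dots> = exp (f t)" by (simp flip: exp_add)
  finally show ?thesis by (simp add: algebra_simps)
 qed
 ultimately have "(b - a) *\<^sub>R (exp m * (1 - m)) + exp m * integral {a..b} f \<le> integral {a..b} (\<lambda>t. exp (f t))"
  by (rule has_integral_le)
 moreover have "integral {a..b} f = m * (b - a)" using assms by (simp add: m_def)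
 ultimately show ?thesis unfolding m_def[symmetric] by (simp add: algebra_simps)
qed

section \<open>Pointwise bounds for single Euler factors\<close>

definition euler_log :: "real \<Rightarrow> real \<Rightarrow> real \<Rightarrow> nat \<Rightarrow> real" where
 "euler_log k \<sigma> t p = - k * ln (norm (1 - of_nat p powr (- Complex \<sigma> t)))"

lemma norm_nat_powr_Complex: "n > 0 ==> norm (of_nat n powr (- Complex \<sigma> t)) = real n powr (-\<sigma>)"
 by (simp add: norm_nat_powr)

lemma prime_powr_bounds:
 assumes "prime p" "\<sigma> > 1"
 shows "0 < real p powr (-\<sigma>)" "real p powr (-\<sigma>) \<le> 1 / real p" "real p powr (-\<sigma>) \<le> 1/2" "real p powr (-\<sigma>) < 1/2"
proof -
 have p: "real p \<ge> 2" by (rule ln_prime_ge[OF assms(1)])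
 thus "0 < real p powr (-\<sigma>)" by simp
 have "real p powr (-\<sigma>) \<le> real p powr (-1)" using p assms by (intro powr_mono) auto
 thus *: "real p powr (-\<sigma>) \<le> 1 / real p" using p by (simp add: powr_minus_divide)
 have "1 / real p \<le> 1 / 2" using p by (intro divide_left_mono) auto
 with * show "real p powr (-\<sigma>) \<le> 1/2" by linarith
 have "real p powr (-\<sigma>) < real p powr (-1)" using p assms by (intro powr_less_mono) auto
 moreover have "real p powr (-1) = 1 / real p" using p by (simp add: powr_minus_divide)
 ultimately show "real p powr (-\<sigma>) < 1/2" using \<open>1 / real p \<le> 1 / 2\<close> by argo
qed

lemma one_minus_prime_powr_nonzero:
 assumes "prime p" "\<sigma> > 1"
 shows "1 - of_nat p powr (- Complex \<sigma> t) \<noteq> 0"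
proof
 assume "1 - of_nat p powr (- Complex \<sigma> t) = 0"
 hence "norm (of_nat p powr (- Complex \<sigma> t)) = 1" by simp
 thus False
  using norm_nat_powr_Complex[of p \<sigma> t] prime_powr_bounds[OF assms] prime_gt_0_nat[OF assms(1)] by simp
qed

lemma ln_norm_zeta_limit:
 assumes "\<sigma> > 1"
 shows "(\<lambda>N. \<Sum>p\<in>primes_upto N. euler_log k \<sigma> t p) \<longlonglongrightarrow> k * ln (norm (zeta (Complex \<sigma> t)))"
proof -
 let ?s = "Complex \<sigma> t"
 let ?e = "\<lambda>p. 1 - of_nat p powr (- ?s)"
 have s: "Re ?s > 1" using assms by simp
 have "(\<lambda>N. ln (norm (zeta ?s * (\<Prod>p\<in>primes_upto N. ?e p)))) \<longlonglongrightarrow> ln (norm (1::complex))"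
  by (intro tendsto_intros zeta_Euler_product s) simp
 moreover have "ln (norm (zeta ?s * (\<Prod>p\<in>primes_upto N. ?e p))) = ln (norm (zeta ?s)) + (\<Sum>p\<in>primes_upto N. ln (norm (?e p)))" for N
 proof -
  have nz: "norm (?e p) > 0" if "p \<in> primes_upto N" for p
   using one_minus_prime_powr_nonzero[OF prime_of_primes_upto[OF that] assms] by simp
  have "ln (norm (zeta ?s * (\<Prod>p\<in>primes_upto N. ?e p))) = ln (norm (zeta ?s) * (\<Prod>p\<in>primes_upto N. norm (?e p)))"
   by (simp add: norm_mult prod_norm)
  also have "\<dots> = ln (norm (zeta ?s)) + ln (\<Prod>p\<in>primes_upto N. norm (?e p))"
   using zeta_nonzero[OF s] nz by (intro ln_mult_pos prod_pos) auto
  also have "ln (\<Prod>p\<in>primes_upto N. norm (?e p)) = (\<Sum>p\<in>primes_upto N. ln (norm (?e p)))"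
   using nz by (intro ln_prod) auto
  finally show ?thesis .
 qed
 ultimately have "(\<lambda>N. ln (norm (zeta ?s)) + (\<Sum>p\<in>primes_upto N. ln (norm (?e p)))) \<longlonglongrightarrow> 0" by simp
 hence "(\<lambda>N. k * ln (norm (zeta ?s)) - k * (ln (norm (zeta ?s)) + (\<Sum>p\<in>primes_upto N. ln (norm (?e p))))) \<longlonglongrightarrow> k * ln (norm (zeta ?s)) - k * 0"
  by (intro tendsto_intros)
 thus ?thesis by (simp add: euler_log_def sum_distrib_left sum_negf algebra_simps)
qed

lemma euler_log_abs_le:
 assumes "prime p" "\<sigma> > 1" "k = 1 \<or> k = -1"
 shows "\<bar>euler_log k \<sigma> t p\<bar> \<le> 2 * real p powr (-\<sigma>)"
proof -
 let ?z = "- (of_nat p powr (- Complex \<sigma> t)) :: complex"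
 have n: "norm ?z = real p powr (-\<sigma>)" using norm_nat_powr_Complex[of p \<sigma> t] prime_gt_0_nat[OF assms(1)] by simp
 have "norm (Ln (1 + ?z)) \<le> 2 * norm ?z" using prime_powr_bounds[OF assms(1,2)] n by (intro norm_Ln_le) simp
 moreover have "\<bar>Re (Ln (1 + ?z))\<bar> \<le> norm (Ln (1 + ?z))" by (rule abs_Re_le_cmod)
 moreover have "Re (Ln (1 + ?z)) = ln (norm (1 + ?z))"
  using one_minus_prime_powr_nonzero[OF assms(1,2), of t] by (intro Re_Ln) simp
 ultimately show ?thesis using n assms(3) by (auto simp: euler_log_def)
qed

lemma euler_log_eq:
 assumes "prime p" "\<sigma> > 1"
 defines "r \<equiv> real p powr (-\<sigma>)"
 shows "euler_log k \<sigma> t p = - k * (ln (1 - 2 * r * cos (t * ln (real p)) + r^2) / 2)"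
  "1 - 2 * r * cos (t * ln (real p)) + r^2 > 0"
proof -
 let ?z = "of_nat p powr (- Complex \<sigma> t) :: complex"
 have p: "p > 0" using assms(1) by (rule prime_gt_0_nat)
 have "(norm (1 - ?z))^2 = 1 - 2 * Re ?z + (norm ?z)^2"
  unfolding cmod_power2 by (simp add: power2_eq_square algebra_simps)
 hence eq: "(norm (1 - ?z))^2 = 1 - 2 * r * cos (t * ln (real p)) + r^2"
  using Re_nat_powr[OF p, of \<sigma> t] norm_nat_powr_Complex[OF p, of \<sigma> t] by (simp add: r_def mult_ac)
 have pos: "norm (1 - ?z) > 0" using one_minus_prime_powr_nonzero[OF assms(1,2), of t] by simp
 show "1 - 2 * r * cos (t * ln (real p)) + r^2 > 0" using eq pos by (metis zero_less_power)
 have "ln (1 - 2 * r * cos (t * ln (real p)) + r^2) = 2 * ln (norm (1 - ?z))"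
  unfolding eq[symmetric] using pos by (simp add: ln_realpow)
 thus "euler_log k \<sigma> t p = - k * (ln (1 - 2 * r * cos (t * ln (real p)) + r^2) / 2)"
  by (simp add: euler_log_def)
qed

text \<open>Tangent (for \<open>k = 1\<close>) and chord (for \<open>k = -1\<close>) bounds for the logarithm as a function of the cosine.\<close>
lemma half_ln_quadratic_bounds:
 fixes r x :: real
 assumes "0 < r" "r \<le> 1/2" "-1 \<le> x" "x \<le> 1"
 shows "ln (1 - 2 * r * x + r^2) / 2 \<le> ln (1 + r) - r / (1 + r)^2 * (1 + x)"
  and "ln (1 - 2 * r * x + r^2) / 2 \<ge> ln (1 - r) + r / (1 + r)^2 * (1 - x)"
proof -
 have r1: "(1 + r)^2 > 0" "(1 - r)^2 > 0" using assms by (auto intro!: zero_less_power)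
 have pos: "1 - 2 * r * x + r^2 > 0"
 proof -
  have "2 * r * x \<le> 2 * r * 1" using assms by (intro mult_left_mono) auto
  hence "1 - 2 * r * x + r^2 \<ge> (1 - r)^2" by (simp add: power2_eq_square algebra_simps)
  thus ?thesis using r1 by linarith
 qed
 define y where "y = 2 * r * (1 + x) / (1 + r)^2"
 have e1: "1 - 2 * r * x + r^2 = (1 + r)^2 * (1 - y)"
 proof -
  have "(1 + r)^2 * y = 2 * r * (1 + x)" using r1 by (simp add: y_def)
  thus ?thesis by (simp add: right_diff_distrib) (simp add: power2_eq_square algebra_simps)
 qed
 have y: "1 - y > 0" using pos r1 unfolding e1 by (simp add: zero_less_mult_iff)
 have "ln (1 - 2 * r * x + r^2) = 2 * ln (1 + r) + ln (1 - y)"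
  unfolding e1 using y assms by (simp add: ln_mult ln_realpow)
 moreover have "ln (1 - y) \<le> - y" using ln_le_minus_one[OF y] by simp
 moreover have "y / 2 = r / (1 + r)^2 * (1 + x)" by (simp add: y_def)
 ultimately show "ln (1 - 2 * r * x + r^2) / 2 \<le> ln (1 + r) - r / (1 + r)^2 * (1 + x)" by argo
 define w where "w = 2 * r * (1 - x) / (1 - r)^2"
 have w0: "w \<ge> 0" using assms by (simp add: w_def)
 have e2: "1 - 2 * r * x + r^2 = (1 - r)^2 * (1 + w)"
 proof -
  have "(1 - r)^2 * w = 2 * r * (1 - x)" using r1 by (simp add: w_def)
  thus ?thesis by (simp add: distrib_left) (simp add: power2_eq_square algebra_simps)
 qed
 have "ln (1 - 2 * r * x + r^2) = 2 * ln (1 - r) + ln (1 + w)"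
  unfolding e2 using w0 assms by (simp add: ln_mult ln_realpow)
 moreover have "ln (1 + w) \<ge> 2 * (r / (1 + r)^2 * (1 - x))"
 proof -
  have "ln (inverse (1 + w)) \<le> inverse (1 + w) - 1" using w0 by (intro ln_le_minus_one) auto
  hence "ln (1 + w) \<ge> 1 - inverse (1 + w)" using w0 by (simp add: ln_inverse)
  also have "1 - inverse (1 + w) = w / (1 + w)" using w0 by (simp add: field_simps)
  finally have "ln (1 + w) \<ge> w / (1 + w)" .
  moreover have "w / (1 + w) = 2 * r * (1 - x) / (1 - 2 * r * x + r^2)"
   unfolding e2 using r1 w0 by (simp add: w_def)
  moreover have "2 * r * (1 - x) / (1 + r)^2 \<le> 2 * r * (1 - x) / (1 - 2 * r * x + r^2)"
  proof (rule divide_left_mono)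
   have "2 * r * (-x) \<le> 2 * r * 1" using assms by (intro mult_left_mono) auto
   thus "1 - 2 * r * x + r^2 \<le> (1 + r)^2" by (simp add: power2_eq_square algebra_simps)
  qed (use assms r1 pos in auto)
  moreover have "2 * r * (1 - x) / (1 + r)^2 = 2 * (r / (1 + r)^2 * (1 - x))" by simp
  ultimately show ?thesis by linarith
 qed
 ultimately show "ln (1 - 2 * r * x + r^2) / 2 \<ge> ln (1 - r) + r / (1 + r)^2 * (1 - x)" by argo
qed

text \<open>- k ln (1 + k r) is the least value of the factor, taken where the cosine is -k, and
  r/(1 + r)^2 is a slope that works for both signs of \<open>k\<close>. Being linear in the cosine,
  the bound can be averaged over t exactly.\<close>

lemma euler_log_lower:
 assumes "prime p" "\<sigma> > 1" "k = 1 \<or> k = -1"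
 defines "r \<equiv> real p powr (-\<sigma>)"
 shows "euler_log k \<sigma> t p \<ge> - k * ln (1 + k * r) + r / (1 + r)^2 * (1 + k * cos (t * ln (real p)))"
proof -
 have r: "0 < r" "r \<le> 1/2" using prime_powr_bounds[OF assms(1,2)] by (auto simp: r_def)
 have "-1 \<le> cos (t * ln (real p))" "cos (t * ln (real p)) \<le> 1" by auto
 note b = half_ln_quadratic_bounds[OF r this]
 note e = euler_log_eq(1)[OF assms(1,2), of k t, folded r_def]
 show ?thesis
  using assms(3)
 proof
  assume "k = 1"
  thus ?thesis using b(1) unfolding e by simp
 next
  assume "k = -1"
  thus ?thesis using b(2) unfolding e by simp
 qed
qed

text \<open>The logarithm of the p-factor in its worst phase, at \<sigma> = 1, is -1/p plus this
  O(p^-2) correction.\<close>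

definition prime_corr :: "real \<Rightarrow> nat \<Rightarrow> real" where
 "prime_corr k p = 1 / real p - k * ln (1 + k / real p)"

definition corr_sum :: "real \<Rightarrow> real" where
 "corr_sum k = (\<Sum>n. if prime n then prime_corr k n else 0)"

lemma abs_minus_ln_le:
 fixes k r :: real
 assumes "k = 1 \<or> k = -1" "0 \<le> r" "r \<le> 1/2"
 shows "\<bar>r - k * ln (1 + k * r)\<bar> \<le> 2 * r^2"
proof -
 have "\<bar>ln (1 + k * r) - k * r\<bar> \<le> 2 * (k * r)^2"
  using assms by (intro abs_ln_one_plus_x_minus_x_bound) auto
 moreover have "\<bar>r - k * ln (1 + k * r)\<bar> = \<bar>ln (1 + k * r) - k * r\<bar>" using assms(1) by auto
 moreover have "(k * r)^2 = r^2" using assms(1) by auto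
 ultimately show ?thesis by simp
qed

lemma summable_prime_corr:
 assumes "k = 1 \<or> k = -1"
 shows "summable (\<lambda>n. if prime n then prime_corr k n else 0)"
proof (rule summable_comparison_test'[of _ 0])
 show "summable (\<lambda>n. 2 * real n powr (-2))" by (intro summable_mult) (simp add: summable_real_powr_iff)
 show "norm (if prime n then prime_corr k n else 0) \<le> 2 * real n powr (-2)" for n
 proof (cases "prime n")
  case True
  have n: "real n \<ge> 2" using ln_prime_ge[OF True] by simp
  hence "\<bar>1 / real n - k * ln (1 + k * (1 / real n))\<bar> \<le> 2 * (1 / real n)^2"
   by (intro abs_minus_ln_le assms) auto
  moreover have "real n powr (-2) = (1 / real n)^2" using n by (simp add: powr_minus_divide power_divide)
  ultimately show ?thesis using True by (simp add: prime_corr_def)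
 qed simp
qed

definition log_square_sum :: real where
 "log_square_sum = (\<Sum>n. if prime n then (ln (real n))^2 / (real n)^2 else 0)"

lemma summable_log_square: "summable (\<lambda>n. if prime n then (ln (real n))^2 / (real n)^2 else 0)"
proof (rule summable_comparison_test_ev)
 show "summable (\<lambda>n. real n powr (-3/2))" by (simp add: summable_real_powr_iff)
 have "\<forall>\<^sub>F n in sequentially. (ln (real n))^2 / (real n)^2 \<le> real n powr (-3/2)" by real_asymp
 thus "\<forall>\<^sub>F n in sequentially. norm (if prime n then (ln (real n))^2 / (real n)^2 else 0) \<le> real n powr (-3/2)"
  by eventually_elim auto
qed

text \<open>Lets r = p^(-\<sigma>) be replaced by its value s = 1/p at \<sigma> = 1: the bound for
  one factor decreases in r, because for a \<le> 1 the logarithm falls at least as fast as the slope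
  term rises. So the lower bound becomes independent of \<sigma>.\<close>

lemma corr_monotone:
 fixes k r s a :: real
 assumes "k = 1 \<or> k = -1" "0 < r" "r \<le> s" "s \<le> 1/2" "0 \<le> a" "a \<le> 1"
 shows "- k * ln (1 + k * r) + r / (1 + r)^2 * a \<ge> - k * ln (1 + k * s) + s / (1 + s)^2 * a"
proof -
 have pos: "(1 + r)^2 > 0" "(1 + s)^2 > 0" using assms by (auto intro!: zero_less_power)
 have diff: "s / (1 + s)^2 - r / (1 + r)^2 \<le> (s - r) / (1 + s)"
 proof -
  have "s / (1 + s)^2 - r / (1 + r)^2 = (s - r) * (1 - r * s) / ((1 + r)^2 * (1 + s)^2)"
   using pos by (simp add: diff_frac_eq) (simp add: power2_eq_square algebra_simps)
  also have "\<dots> \<le> (s - r) * 1 / (1 * (1 + s))"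
  proof (intro frac_le mult_mono)
   have "1 + s \<le> (1 + s)^2" using self_le_power[of "1 + s" 2] assms by simp
   thus "1 + s \<le> (1 + s)^2" .
   show "1 \<le> (1 + r)^2" using assms by (simp add: power2_eq_square algebra_simps)
  qed (use assms mult_le_one[of r s] in auto)
  finally show ?thesis by simp
 qed
 have "(s / (1 + s)^2 - r / (1 + r)^2) * a \<le> (s - r) / (1 + s)"
 proof -
  have "(s / (1 + s)^2 - r / (1 + r)^2) * a \<le> (s - r) / (1 + s) * a" by (intro mult_right_mono diff assms)
  also have "\<dots> \<le> (s - r) / (1 + s) * 1" using assms by (intro mult_left_mono) auto
  finally show ?thesis by simp
 qed
 moreover have "(s - r) / (1 + s) \<le> k * ln (1 + k * s) - k * ln (1 + k * r)"
  using assms(1)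
 proof
  assume kap: "k = 1"
  have "ln ((1 + r) / (1 + s)) \<le> (1 + r) / (1 + s) - 1" using assms by (intro ln_le_minus_one) auto
  hence "ln (1 + r) - ln (1 + s) \<le> (1 + r) / (1 + s) - 1" using assms by (simp add: ln_div)
  moreover have "(1 + r) / (1 + s) - 1 = - ((s - r) / (1 + s))" using assms by (simp add: field_simps)
  ultimately show ?thesis using kap by simp
 next
  assume kap: "k = -1"
  have "ln ((1 - s) / (1 - r)) \<le> (1 - s) / (1 - r) - 1" using assms by (intro ln_le_minus_one) auto
  hence "ln (1 - s) - ln (1 - r) \<le> (1 - s) / (1 - r) - 1" using assms by (simp add: ln_div)
  moreover have "(1 - s) / (1 - r) - 1 = - ((s - r) / (1 - r))" using assms by (simp add: field_simps)
  moreover have "(s - r) / (1 + s) \<le> (s - r) / (1 - r)" using assms by (intro divide_left_mono mult_pos_pos) auto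
  ultimately show ?thesis using kap by simp
 qed
 ultimately show ?thesis by (simp add: algebra_simps)
qed

lemma integral_cos_interval:
 assumes "u > 0" "\<delta> > 0"
 shows "((\<lambda>t. cos (t * u)) has_integral \<delta> * (cos ((T + \<delta>/2) * u) * sinq (\<delta>/2 * u))) {T..T + \<delta>}"
proof -
 have "((\<lambda>t. cos (t * u)) has_integral (sin ((T + \<delta>) * u) / u - sin (T * u) / u)) {T..T + \<delta>}"
 proof (rule fundamental_theorem_of_calculus)
  fix t
  have "((\<lambda>t. sin (t * u) / u) has_real_derivative cos (t * u)) (at t)"
   using assms by (auto intro!: derivative_eq_intros)
  thus "((\<lambda>t. sin (t * u) / u) has_vector_derivative cos (t * u)) (at t within {T..T + \<delta>})"
   by (auto simp: has_real_derivative_iff_has_vector_derivative intro: has_vector_derivative_at_within)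
 qed (use assms in auto)
 moreover have "sin ((T + \<delta>) * u) / u - sin (T * u) / u = \<delta> * (cos ((T + \<delta>/2) * u) * sinq (\<delta>/2 * u))"
 proof -
  have "sin ((T + \<delta>) * u) - sin (T * u) = 2 * sin (((T + \<delta>) * u - T * u) / 2) * cos (((T + \<delta>) * u + T * u) / 2)"
   by (rule sin_diff_sin)
  also have "((T + \<delta>) * u - T * u) / 2 = \<delta>/2 * u" by (simp add: algebra_simps)
  also have "((T + \<delta>) * u + T * u) / 2 = (T + \<delta>/2) * u" by (simp add: algebra_simps add_divide_distrib)
  finally have "(sin ((T + \<delta>) * u) - sin (T * u)) / u = 2 * sin (\<delta>/2 * u) * cos ((T + \<delta>/2) * u) / u" by simp
  thus ?thesis using assms by (simp add: diff_divide_distrib sinq_def)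
 qed
 ultimately show ?thesis by simp
qed

lemma continuous_on_euler_log:
 assumes "prime p" "\<sigma> > 1"
 shows "continuous_on S (\<lambda>t. euler_log k \<sigma> t p)"
proof -
 define r u where "r = real p powr (-\<sigma>)" and "u = ln (real p)"
 have "1 - 2 * r * cos (t * u) + r^2 \<noteq> 0" for t
  using euler_log_eq(2)[OF assms, of t, folded r_def u_def] by linarith
 hence "continuous_on S (\<lambda>t. - k * (ln (1 - 2 * r * cos (t * u) + r^2) / 2))"
  by (intro continuous_on_mult_left continuous_on_divide continuous_on_ln ballI) (auto intro!: continuous_intros)
 thus ?thesis unfolding euler_log_eq(1)[OF assms] r_def u_def .
qed

lemma continuous_on_ln_norm_zeta:
 assumes "\<sigma> > 1"
 shows "continuous_on S (\<lambda>t. k * ln (norm (zeta (Complex \<sigma> t))))"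
proof -
 have "continuous_on S (\<lambda>t. zeta (Complex \<sigma> t))"
  by (rule continuous_on_subset[OF continuous_on_zeta_vertical[OF assms]]) simp
 moreover have "norm (zeta (Complex \<sigma> t)) \<noteq> 0" for t using zeta_nonzero[of "Complex \<sigma> t"] assms by simp
 ultimately show ?thesis by (intro continuous_on_mult_left continuous_on_ln continuous_on_norm ballI)
qed

section \<open>From finite products to zeta\<close>

lemma zeta_tail_bound:
 assumes "\<sigma> > 1" "k = 1 \<or> k = -1"
 shows "\<bar>k * ln (norm (zeta (Complex \<sigma> t))) - (\<Sum>p\<in>primes_upto N. euler_log k \<sigma> t p)\<bar>
   \<le> 2 * ((\<Sum>n. if prime n then real n powr (-\<sigma>) else 0) - (\<Sum>p\<in>primes_upto N. real p powr (-\<sigma>)))"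
proof (rule tendsto_upperbound)
 show "(\<lambda>M. \<bar>(\<Sum>p\<in>primes_upto M. euler_log k \<sigma> t p) - (\<Sum>p\<in>primes_upto N. euler_log k \<sigma> t p)\<bar>) \<longlonglongrightarrow> \<bar>k * ln (norm (zeta (Complex \<sigma> t))) - (\<Sum>p\<in>primes_upto N. euler_log k \<sigma> t p)\<bar>"
  by (intro tendsto_intros ln_norm_zeta_limit assms)
 show "\<forall>\<^sub>F M in sequentially. \<bar>(\<Sum>p\<in>primes_upto M. euler_log k \<sigma> t p) - (\<Sum>p\<in>primes_upto N. euler_log k \<sigma> t p)\<bar> \<le> 2 * ((\<Sum>n. if prime n then real n powr (-\<sigma>) else 0) - (\<Sum>p\<in>primes_upto N. real p powr (-\<sigma>)))"
  using eventually_ge_at_top[of N]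
 proof eventually_elim
  case (elim M)
  hence sub: "primes_upto N \<subseteq> primes_upto M" by (auto simp: primes_upto_def)
  have "\<bar>(\<Sum>p\<in>primes_upto M. euler_log k \<sigma> t p) - (\<Sum>p\<in>primes_upto N. euler_log k \<sigma> t p)\<bar> = \<bar>\<Sum>p\<in>primes_upto M - primes_upto N. euler_log k \<sigma> t p\<bar>"
   using sub by (simp add: sum_diff)
  also have "\<dots> \<le> (\<Sum>p\<in>primes_upto M - primes_upto N. 2 * real p powr (-\<sigma>))"
   by (intro order_trans[OF sum_abs] sum_mono euler_log_abs_le assms) (auto intro: prime_of_primes_upto)
  also have "\<dots> = 2 * ((\<Sum>p\<in>primes_upto M. real p powr (-\<sigma>)) - (\<Sum>p\<in>primes_upto N. real p powr (-\<sigma>)))"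
   using sub by (simp add: sum_diff flip: sum_distrib_left)
  also have "\<dots> \<le> 2 * ((\<Sum>n. if prime n then real n powr (-\<sigma>) else 0) - (\<Sum>p\<in>primes_upto N. real p powr (-\<sigma>)))"
  proof -
   have "(\<Sum>p\<in>primes_upto M. real p powr (-\<sigma>)) \<le> (\<Sum>n. if prime n then real n powr (-\<sigma>) else 0)"
    unfolding sum_primes_upto by (intro sum_le_suminf summable_prime_powr assms) auto
   thus ?thesis by simp
  qed
  finally show ?case .
 qed
qed simp

lemma prime_tail_tendsto_0:
 assumes "\<sigma> > 1"
 shows "(\<lambda>N. (\<Sum>n. if prime n then real n powr (-\<sigma>) else 0) - (\<Sum>p\<in>primes_upto N. real p powr (-\<sigma>))) \<longlonglongrightarrow> 0"
proof -
 have "(\<lambda>N. (\<Sum>n. if prime n then real n powr (-\<sigma>) else 0) - (\<Sum>p\<in>primes_upto N. real p powr (-\<sigma>))) \<longlonglongrightarrow> (\<Sum>n. if prime n then real n powr (-\<sigma>) else 0) - (\<Sum>n. if prime n then real n powr (-\<sigma>) else 0)"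
  by (intro tendsto_intros sums_primes_upto summable_sums summable_prime_powr assms)
 thus ?thesis by simp
qed

text \<open>The mean of one factor over the interval involves T only through the cosine at the
  midpoint, which is at worst 1 or -1 and yields -|sinq|. Jensen's inequality is applied to finite
  products, with a tail bound uniform in t subtracted; then \<open>N\<close> tends to
  infinity.\<close>

theorem zeta_power_integral_lower:
 assumes k: "k = 1 \<or> k = -1" and \<sigma>: "\<sigma> > 1" and \<delta>: "\<delta> > 0"
 shows "integral {T..T + \<delta>} (zeta_power k \<sigma>)
   \<ge> \<delta> * exp (corr_sum k - sinc_prime_sum (\<delta>/2) - 2 * log_square_sum * (\<delta>/2)^2)"
proof -
 define \<eta> where "\<eta> = \<delta>/2"
 have \<eta>: "\<eta> > 0" using \<delta> by (simp add: \<eta>_def)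
 define tail where "tail = (\<lambda>N. (\<Sum>n. if prime n then real n powr (-\<sigma>) else 0) - (\<Sum>p\<in>primes_upto N. real p powr (-\<sigma>)))"
 define b where "b = (\<lambda>p. prime_corr k p - \<bar>sinq (\<eta> * ln (real p))\<bar> / real p - 2 * \<eta>^2 * ((ln (real p))^2 / (real p)^2))"
 have avg: "integral {T..T + \<delta>} (\<lambda>t. euler_log k \<sigma> t p) \<ge> \<delta> * b p" if p: "prime p" for p
 proof -
  define r where "r = real p powr (-\<sigma>)"
  define u where "u = ln (real p)"
  have u: "u > 0" "real p \<ge> 2" using ln_prime_ge[OF p] by (auto simp: u_def)
  have r: "0 < r" "r \<le> 1 / real p" "r \<le> 1/2" using prime_powr_bounds[OF p \<sigma>] by (auto simp: r_def)
  \<comment> \<open>At \<sigma> = 1 the slope falls short of 1/p by at most 2/p^2. Since it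
    multiplies \<open>a\<close>, which is at most (\<eta> ln p)^2, the shortfall sums to
    O(\<eta>^2); this is where \<open>log_square_sum\<close> comes from.\<close>
  define a where "a = 1 - \<bar>sinq (\<eta> * u)\<bar>"
  have a: "0 \<le> a" "a \<le> 1" "a \<le> (\<eta> * u)^2"
   using abs_sinq_le_1[of "\<eta> * u"] one_minus_sinq_le[of "\<eta> * u"] u \<eta> by (auto simp: a_def)
  define q where "q = r / (1 + r)^2"
  have q: "q \<ge> 0" using r by (simp add: q_def)
  let ?g = "\<lambda>t. (- k * ln (1 + k * r) + q) + (q * k) * cos (t * u)"
  have "(?g has_integral ((T + \<delta> - T) *\<^sub>R (- k * ln (1 + k * r) + q) + (q * k) * (\<delta> * (cos ((T + \<delta>/2) * u) * sinq (\<delta>/2 * u))))) {T..T + \<delta>}"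
   using u \<delta> by (intro has_integral_add has_integral_mult_right integral_cos_interval has_integral_const_real[THEN has_integral_eq_rhs]) auto
  moreover have "((\<lambda>t. euler_log k \<sigma> t p) has_integral integral {T..T + \<delta>} (\<lambda>t. euler_log k \<sigma> t p)) {T..T + \<delta>}"
   by (intro integrable_integral integrable_continuous_real continuous_on_euler_log p \<sigma>)
  moreover have "?g t \<le> euler_log k \<sigma> t p" for t
   using euler_log_lower[OF p \<sigma> k, of t] unfolding r_def[symmetric] u_def[symmetric] q_def[symmetric] by (simp add: algebra_simps)
  ultimately have I: "(T + \<delta> - T) *\<^sub>R (- k * ln (1 + k * r) + q) + (q * k) * (\<delta> * (cos ((T + \<delta>/2) * u) * sinq (\<delta>/2 * u))) \<le> integral {T..T + \<delta>} (\<lambda>t. euler_log k \<sigma> t p)"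
   by (rule has_integral_le)
  have "- \<bar>sinq (\<eta> * u)\<bar> \<le> k * (cos ((T + \<delta>/2) * u) * sinq (\<eta> * u))"
  proof -
   have "\<bar>k * (cos ((T + \<delta>/2) * u) * sinq (\<eta> * u))\<bar> \<le> 1 * (1 * \<bar>sinq (\<eta> * u)\<bar>)"
    unfolding abs_mult using k by (intro mult_mono) auto
   thus ?thesis by (simp add: abs_le_iff)
  qed
  hence "q * (- \<bar>sinq (\<eta> * u)\<bar>) \<le> q * (k * (cos ((T + \<delta>/2) * u) * sinq (\<eta> * u)))" using q by (intro mult_left_mono) auto
  hence "- k * ln (1 + k * r) + q * a \<le> (- k * ln (1 + k * r) + q) + (q * k) * (cos ((T + \<delta>/2) * u) * sinq (\<eta> * u))"
   by (simp add: a_def algebra_simps)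
  moreover have "- k * ln (1 + k * r) + r / (1 + r)^2 * a \<ge> - k * ln (1 + k * (1 / real p)) + (1 / real p) / (1 + 1 / real p)^2 * a"
   using r u a by (intro corr_monotone k) auto
  moreover have "(1 / real p) / (1 + 1 / real p)^2 * a \<ge> (1 / real p - 2 * (1 / real p)^2) * a"
  proof (rule mult_right_mono)
   have H: "x / (1 + x)^2 \<ge> x - 2 * x^2" if "x > 0" for x :: real
   proof -
    have "(x - 2 * x^2) * (1 + x)^2 = x - (3 * x^3 + 2 * x^4)" by (simp add: power2_eq_square power_numeral_reduce algebra_simps)
    also have "\<dots> \<le> x" using zero_less_power[OF that, of 3] zero_less_power[OF that, of 4] by linarith
    finally show ?thesis using that by (simp add: pos_le_divide_eq)
   qed
   show "(1 / real p) / (1 + 1 / real p)^2 \<ge> 1 / real p - 2 * (1 / real p)^2" by (rule H) (use u in simp)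
  qed (rule a)
  moreover have "2 * (1 / real p)^2 * a \<le> 2 * \<eta>^2 * (u^2 / (real p)^2)"
  proof -
   have "2 * (1 / real p)^2 * a \<le> 2 * (1 / real p)^2 * (\<eta> * u)^2" using a by (intro mult_left_mono) auto
   thus ?thesis by (simp add: power_mult_distrib power_divide)
  qed
  moreover have "b p = - k * ln (1 + k * (1 / real p)) + (1 / real p) * a - 2 * \<eta>^2 * (u^2 / (real p)^2)"
   by (simp add: b_def prime_corr_def a_def u_def right_diff_distrib)
  ultimately have "b p \<le> (- k * ln (1 + k * r) + q) + (q * k) * (cos ((T + \<delta>/2) * u) * sinq (\<eta> * u))"
   unfolding q_def left_diff_distrib by argo
  hence "\<delta> * b p \<le> \<delta> * ((- k * ln (1 + k * r) + q) + (q * k) * (cos ((T + \<delta>/2) * u) * sinq (\<eta> * u)))"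
   using \<delta> by (intro mult_left_mono) auto
  also have "\<dots> = (T + \<delta> - T) *\<^sub>R (- k * ln (1 + k * r) + q) + (q * k) * (\<delta> * (cos ((T + \<delta>/2) * u) * sinq (\<delta>/2 * u)))"
   by (simp add: \<eta>_def algebra_simps)
  finally show ?thesis using I by linarith
 qed
 have fin: "\<delta> * exp ((\<Sum>p\<in>primes_upto N. b p) - 2 * tail N) \<le> integral {T..T + \<delta>} (zeta_power k \<sigma>)" for N
 proof -
  let ?X = "\<lambda>t. (\<Sum>p\<in>primes_upto N. euler_log k \<sigma> t p) - 2 * tail N"
  have ce: "continuous_on {T..T + \<delta>} (\<lambda>t. euler_log k \<sigma> t p)" if "p \<in> primes_upto N" for p
   by (intro continuous_on_euler_log prime_of_primes_upto[OF that] \<sigma>)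
  have cX: "continuous_on {T..T + \<delta>} ?X" by (intro continuous_intros ce)
  have "integral {T..T + \<delta>} ?X = (\<Sum>p\<in>primes_upto N. integral {T..T + \<delta>} (\<lambda>t. euler_log k \<sigma> t p)) - (T + \<delta> - T) *\<^sub>R (2 * tail N)"
  proof (rule integral_unique, intro has_integral_diff has_integral_sum)
   show "((\<lambda>t. 2 * tail N) has_integral (T + \<delta> - T) *\<^sub>R (2 * tail N)) {T..T + \<delta>}"
    by (rule has_integral_const_real[THEN has_integral_eq_rhs]) (use \<delta> in auto)
  qed (auto intro!: integrable_integral integrable_continuous_real ce)
  moreover have "(\<Sum>p\<in>primes_upto N. integral {T..T + \<delta>} (\<lambda>t. euler_log k \<sigma> t p)) \<ge> (\<Sum>p\<in>primes_upto N. \<delta> * b p)"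
   by (intro sum_mono avg prime_of_primes_upto)
  ultimately have "integral {T..T + \<delta>} ?X \<ge> \<delta> * ((\<Sum>p\<in>primes_upto N. b p) - 2 * tail N)"
   by (simp add: sum_distrib_left right_diff_distrib)
  hence "(\<Sum>p\<in>primes_upto N. b p) - 2 * tail N \<le> integral {T..T + \<delta>} ?X / \<delta>"
   using \<delta> by (simp add: pos_le_divide_eq mult.commute)
  hence "\<delta> * exp ((\<Sum>p\<in>primes_upto N. b p) - 2 * tail N) \<le> \<delta> * exp (integral {T..T + \<delta>} ?X / \<delta>)" using \<delta> by simp
  also have "\<dots> \<le> integral {T..T + \<delta>} (\<lambda>t. exp (?X t))"
   using exp_integral_Jensen[OF _ cX] \<delta> by simp
  also have "\<dots> \<le> integral {T..T + \<delta>} (zeta_power k \<sigma>)"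
  proof (rule integral_le)
   show "(\<lambda>t. exp (?X t)) integrable_on {T..T + \<delta>}" by (intro integrable_continuous_real continuous_on_exp cX)
   show "(zeta_power k \<sigma>) integrable_on {T..T + \<delta>}"
    by (intro integrable_continuous_real continuous_on_exp continuous_on_ln_norm_zeta \<sigma>)
   show "exp (?X t) \<le> zeta_power k \<sigma> t" for t
    using zeta_tail_bound[OF \<sigma> k, of t N] unfolding exp_le_cancel_iff tail_def abs_le_iff by argo
  qed
  finally show ?thesis .
 qed
 have "(\<lambda>N. (\<Sum>p\<in>primes_upto N. b p)) \<longlonglongrightarrow> corr_sum k - sinc_prime_sum \<eta> - 2 * \<eta>^2 * log_square_sum"
 proof -
  have "(\<lambda>N. (\<Sum>p\<in>primes_upto N. prime_corr k p) - (\<Sum>p\<in>primes_upto N. \<bar>sinq (\<eta> * ln (real p))\<bar> / real p) - 2 * \<eta>^2 * (\<Sum>p\<in>primes_upto N. (ln (real p))^2 / (real p)^2)) \<longlonglongrightarrow> corr_sum k - sinc_prime_sum \<eta> - 2 * \<eta>^2 * log_square_sum"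
   unfolding corr_sum_def sinc_prime_sum_def log_square_sum_def
   by (intro tendsto_intros sums_primes_upto summable_sums summable_prime_corr summable_abs_sinq_prime summable_log_square k \<eta>)
  thus ?thesis by (simp add: b_def sum_subtractf sum_distrib_left)
 qed
 hence "(\<lambda>N. \<delta> * exp ((\<Sum>p\<in>primes_upto N. b p) - 2 * tail N)) \<longlonglongrightarrow> \<delta> * exp (corr_sum k - sinc_prime_sum \<eta> - 2 * \<eta>^2 * log_square_sum - 2 * 0)"
  using prime_tail_tendsto_0[OF \<sigma>] unfolding tail_def by (intro tendsto_intros)
 hence "\<delta> * exp (corr_sum k - sinc_prime_sum \<eta> - 2 * \<eta>^2 * log_square_sum - 2 * 0) \<le> integral {T..T + \<delta>} (zeta_power k \<sigma>)"
  by (rule tendsto_upperbound) (auto intro!: always_eventually fin)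
 thus ?thesis by (simp add: \<eta>_def mult_ac)
qed

section \<open>Trigonometric approximation of the square wave\<close>

lemma sin_ge_half:
 fixes x :: real
 assumes "0 \<le> x" "x \<le> pi/2"
 shows "x / 2 \<le> sin x"
proof -
 have "\<bar>sin x - (\<Sum>m<3. sin_coeff m * x ^ m)\<bar> \<le> inverse (fact 3) * \<bar>x\<bar> ^ 3"
  by (rule Maclaurin_sin_bound)
 hence "\<bar>sin x - x\<bar> \<le> x^3 / 6"
  using assms by (simp add: sin_coeff_def eval_nat_numeral)
 hence "x - x^3 / 6 \<le> sin x" unfolding abs_le_iff by argo
 moreover have "x^3 \<le> x * 3"
 proof -
  have "pi / 2 \<le> 1.7" using pi_approx by simp
  hence "x \<le> 1.7" using assms by linarith
  hence "x * x \<le> 1.7 * 1.7" using assms by (intro mult_mono) auto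
  hence "x * (x * x) \<le> x * 3" using assms by (intro mult_left_mono) auto
  thus ?thesis by (simp add: power3_eq_cube mult.assoc)
 qed
 ultimately show ?thesis by linarith
qed

section \<open>The Dirichlet kernel and a primitive of Jackson type\<close>

text \<open>sin ((2n + 1) x) / sin x, as a cosine sum so that the zeros of the sine are
  included.\<close>

definition dirichlet_kernel :: "nat \<Rightarrow> real \<Rightarrow> real" where
 "dirichlet_kernel n x = 1 + (\<Sum>j<n. 2 * cos (2 * real (Suc j) * x))"

lemma sin_times_dirichlet_kernel: "sin x * dirichlet_kernel n x = sin (real (2 * n + 1) * x)"
proof (induction n)
 case (Suc n)
 have "sin x * (2 * cos (2 * real (Suc n) * x)) = sin (2 * real (Suc n) * x + x) - sin (2 * real (Suc n) * x - x)"
  by (simp add: sin_add sin_diff)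
 also have "2 * real (Suc n) * x + x = real (2 * Suc n + 1) * x" by (simp add: algebra_simps)
 also have "2 * real (Suc n) * x - x = real (2 * n + 1) * x" by (simp add: algebra_simps)
 finally show ?case using Suc by (simp add: dirichlet_kernel_def distrib_left)
qed (simp add: dirichlet_kernel_def)

lemma sum_cis_eq_dirichlet_kernel:
 "(\<Sum>j\<in>{-int n..int n}. cis (2 * real_of_int j * x)) = of_real (dirichlet_kernel n x)"
proof (induction n)
 case (Suc n)
 let ?a = "2 * real (Suc n) * x"
 have "{-int (Suc n)..int (Suc n)} = insert (int (Suc n)) (insert (-int (Suc n)) {-int n..int n})" by auto
 hence "(\<Sum>j\<in>{-int (Suc n)..int (Suc n)}. cis (2 * real_of_int j * x)) = cis ?a + (cis (-?a) + of_real (dirichlet_kernel n x))"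
  using Suc by (simp add: algebra_simps)
 also have "\<dots> = of_real (dirichlet_kernel (Suc n) x)"
  by (simp add: dirichlet_kernel_def complex_eq_iff)
 finally show ?case .
qed (simp add: dirichlet_kernel_def)

text \<open>Quadruples index the expansion of the fourth power of the exponential sum. Equal
  frequencies are not collected, so every term of the derivative has coefficient 1 and positivity is
  evident.\<close>

definition jackson_index :: "nat \<Rightarrow> (int \<times> int \<times> int \<times> int) set" where
 "jackson_index n = {-int n..int n} \<times> {-int n..int n} \<times> {-int n..int n} \<times> {-int n..int n}"

text \<open>2s + 1 up to sign, with s the sum of the quadruple. The odd shift stems from the factor
  cos x; odd frequencies make the wave change sign under x to x + pi, and they are never 0.\<close>

definition jackson_freq :: "int \<times> int \<times> int \<times> int \<Rightarrow> real" where
 "jackson_freq v = real_of_int \<bar>2 * (fst v + fst (snd v) + fst (snd (snd v)) + snd (snd (snd v))) + 1\<bar>"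

text \<open>A primitive of cos x times the fourth power of the Dirichlet kernel. That kernel is
  concentrated at the multiples of pi, with alternating signs, so the primitive approximates a
  multiple of the sign of sin x.\<close>

definition jackson :: "nat \<Rightarrow> real \<Rightarrow> real" where
 "jackson n x = (\<Sum>v\<in>jackson_index n. sin (jackson_freq v * x) / jackson_freq v)"

lemma finite_jackson_index: "finite (jackson_index n)"
 by (simp add: jackson_index_def)

lemma card_jackson_index: "real (card (jackson_index n)) = real (2 * n + 1) ^ 4"
proof -
 have "card {-int n..int n} = 2 * n + 1" by simp
 hence "card (jackson_index n) = (2 * n + 1) ^ 4"
  unfolding jackson_index_def card_cartesian_product by (simp only: power4_eq_xxxx mult.assoc)
 thus ?thesis by (simp only: of_nat_power)
qed

lemma jackson_freq_ge_1: "jackson_freq v \<ge> 1"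
proof -
 define s where "s = fst v + fst (snd v) + fst (snd (snd v)) + snd (snd (snd v))"
 have "\<bar>2 * s + 1\<bar> \<ge> 1" by presburger
 thus ?thesis unfolding jackson_freq_def s_def[symmetric] by linarith
qed

lemma jackson_freq_le: "v \<in> jackson_index n ==> jackson_freq v \<le> 8 * real n + 1"
proof -
 assume "v \<in> jackson_index n"
 hence "\<bar>2 * (fst v + fst (snd v) + fst (snd (snd v)) + snd (snd (snd v))) + 1\<bar> \<le> 8 * int n + 1"
  by (auto simp: jackson_index_def)
 thus ?thesis unfolding jackson_freq_def by linarith
qed

lemma cos_times_dirichlet_kernel_power4:
 "cos x * dirichlet_kernel n x ^ 4 = (\<Sum>v\<in>jackson_index n. cos (jackson_freq v * x))"
proof -
 let ?J = "{-int n..int n}"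
 let ?f = "\<lambda>j. cis (2 * real_of_int j * x)"
 have "complex_of_real (dirichlet_kernel n x ^ 4) = sum ?f ?J * (sum ?f ?J * (sum ?f ?J * sum ?f ?J))"
  unfolding sum_cis_eq_dirichlet_kernel by (simp add: power4_eq_xxxx)
 also have "\<dots> = (\<Sum>v\<in>jackson_index n. ?f (fst v) * (?f (fst (snd v)) * (?f (fst (snd (snd v))) * ?f (snd (snd (snd v))))))"
  unfolding jackson_index_def by (simp only: sum_product sum.cartesian_product case_prod_unfold)
 finally have "cis x * complex_of_real (dirichlet_kernel n x ^ 4) = (\<Sum>v\<in>jackson_index n. cis (2 * real_of_int (fst v + fst (snd v) + fst (snd (snd v)) + snd (snd (snd v))) * x + x))"
  by (simp add: sum_distrib_left cis_mult algebra_simps)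
 hence "Re (cis x * complex_of_real (dirichlet_kernel n x ^ 4)) = (\<Sum>v\<in>jackson_index n. cos (2 * real_of_int (fst v + fst (snd v) + fst (snd (snd v)) + snd (snd (snd v))) * x + x))"
  by simp
 moreover have "cos (2 * real_of_int s * x + x) = cos (real_of_int \<bar>2 * s + 1\<bar> * x)" for s
 proof -
  have "2 * real_of_int s * x + x = real_of_int (2 * s + 1) * x" by (simp add: algebra_simps)
  thus ?thesis by (cases "2 * s + 1 \<ge> 0") (auto simp only: abs_of_nonneg abs_of_neg not_le of_int_minus mult_minus_left cos_minus)
 qed
 ultimately have "Re (cis x * complex_of_real (dirichlet_kernel n x ^ 4)) = (\<Sum>v\<in>jackson_index n. cos (jackson_freq v * x))"
  unfolding jackson_freq_def by (simp only:)
 thus ?thesis by simp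
qed

lemma jackson_has_real_derivative:
 "(jackson n has_real_derivative cos x * dirichlet_kernel n x ^ 4) (at x)"
proof -
 have "((\<lambda>x. \<Sum>v\<in>jackson_index n. sin (jackson_freq v * x) / jackson_freq v) has_real_derivative (\<Sum>v\<in>jackson_index n. cos (jackson_freq v * x))) (at x)"
 proof (rule DERIV_sum)
  fix v
  have "jackson_freq v \<noteq> 0" using jackson_freq_ge_1[of v] by auto
  thus "((\<lambda>x. sin (jackson_freq v * x) / jackson_freq v) has_real_derivative cos (jackson_freq v * x)) (at x)"
   by (auto intro!: derivative_eq_intros)
 qed
 thus ?thesis unfolding cos_times_dirichlet_kernel_power4 jackson_def[abs_def] .
qed

lemma jackson_shift:
 "jackson n (real_of_int m * pi + y) = (if even m then 1 else -1) * jackson n y"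
proof -
 have "sin (jackson_freq v * (real_of_int m * pi + y)) = (if even m then 1 else -1) * sin (jackson_freq v * y)" for v
 proof -
  define k where "k = \<bar>2 * (fst v + fst (snd v) + fst (snd (snd v)) + snd (snd (snd v))) + 1\<bar>"
  have k: "odd k" by (simp add: k_def)
  have "jackson_freq v * (real_of_int m * pi + y) = pi * real_of_int (k * m) + jackson_freq v * y"
   by (simp add: jackson_freq_def k_def algebra_simps)
  thus ?thesis using k by (simp only: sin_add sin_npi_int cos_npi_int) simp
 qed
 thus ?thesis by (simp add: jackson_def sum_distrib_left)
qed

lemma jackson_minus: "jackson n (-y) = - jackson n y"
 by (simp add: jackson_def sum_negf)

lemma jackson_mono:
 assumes "0 \<le> x" "x \<le> y" "y \<le> pi/2"
 shows "jackson n x \<le> jackson n y"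
proof (rule DERIV_nonneg_imp_nondecreasing[OF assms(2)])
 fix z assume "x \<le> z" "z \<le> y"
 hence "cos z * dirichlet_kernel n z ^ 4 \<ge> 0" using assms by (intro mult_nonneg_nonneg cos_ge_zero) auto
 thus "\<exists>d. (jackson n has_real_derivative d) (at z) \<and> 0 \<le> d" using jackson_has_real_derivative by blast
qed

lemma jackson_0: "jackson n 0 = 0" by (simp add: jackson_def)

text \<open>On [0, 1/N] with N = 2n + 1 the cosine is at least 1/2 and the Dirichlet kernel at least
  N/2, so the primitive grows there at rate at least N^4/32.\<close>

lemma jackson_top_ge: "jackson n (pi/2) \<ge> real (2 * n + 1) ^ 3 / 32"
proof -
 define N where "N = real (2 * n + 1)"
 have N: "N \<ge> 1" by (simp add: N_def)
 have pi: "1 < pi/3" using pi_gt3 by simp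
 have N1: "1 / N \<le> 1" using N by simp
 define h where "h = (\<lambda>y. jackson n y - N ^ 4 / 32 * y)"
 have "h 0 \<le> h (1 / N)"
 proof (rule DERIV_nonneg_imp_nondecreasing[where f = h])
  fix y assume y: "0 \<le> y" "y \<le> 1 / N"
  have y1: "y \<le> 1" using y N1 by linarith
  have "cos (pi/3) \<le> cos y" using y y1 pi by (intro cos_monotone_0_pi_le) auto
  hence c: "cos y \<ge> 1/2" by (simp add: cos_60)
  have "dirichlet_kernel n y \<ge> N / 2"
  proof (cases "y = 0")
   case True
   thus ?thesis by (simp add: dirichlet_kernel_def N_def)
  next
   case False
   have Ny: "N * y \<le> 1" using y N by (simp add: field_simps)
   have "N * y / 2 \<le> sin (N * y)" using Ny y N pi by (intro sin_ge_half) auto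
   also have "\<dots> = sin y * dirichlet_kernel n y" by (simp add: sin_times_dirichlet_kernel N_def)
   finally have *: "N * y / 2 \<le> sin y * dirichlet_kernel n y" .
   have s: "0 < sin y" using False y y1 pi by (intro sin_gt_zero) auto
   have "0 < N * y / 2" using False y N by simp
   hence d: "dirichlet_kernel n y > 0" using * s by (metis less_le_trans zero_less_mult_pos)
   have "sin y * dirichlet_kernel n y \<le> y * dirichlet_kernel n y" using sin_x_le_x[of y] y d by (intro mult_right_mono) auto
   with * have "(N / 2) * y \<le> dirichlet_kernel n y * y" by (simp add: mult_ac)
   thus ?thesis using False y by simp
  qed
  hence "(N / 2) ^ 4 \<le> dirichlet_kernel n y ^ 4" using N by (intro power_mono) auto
  hence "(1/2) * (N / 2) ^ 4 \<le> cos y * dirichlet_kernel n y ^ 4" using c by (intro mult_mono) auto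
  hence "0 \<le> cos y * dirichlet_kernel n y ^ 4 - N ^ 4 / 32" by (simp add: power_divide)
  moreover have "(h has_real_derivative cos y * dirichlet_kernel n y ^ 4 - N ^ 4 / 32) (at y)"
   unfolding h_def by (auto intro!: derivative_eq_intros jackson_has_real_derivative)
  ultimately show "\<exists>d. (h has_real_derivative d) (at y) \<and> 0 \<le> d" by blast
 qed (use N in auto)
 moreover have "N ^ 4 / 32 * (1 / N) = N ^ 3 / 32" using N by (simp add: power_numeral_reduce)
 ultimately have "N ^ 3 / 32 \<le> jackson n (1 / N)" by (simp add: h_def jackson_0)
 also have "\<dots> \<le> jackson n (pi/2)"
 proof (rule jackson_mono)
  show "1 / N \<le> pi/2" using N1 pi_gt3 by linarith
 qed (use N in auto)
 finally show ?thesis by (simp add: N_def)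
qed

text \<open>The Dirichlet kernel is at most 1/sin in modulus, and cos/sin^4 has the primitive -1/(3
  sin^3). The fourth power thus gives cubic decay of the defect.\<close>

lemma jackson_defect:
 assumes "0 < x" "x \<le> pi/2"
 shows "jackson n (pi/2) - jackson n x \<le> 1 / (3 * sin x ^ 3)"
proof -
 define h where "h = (\<lambda>y. jackson n y + 1 / (3 * sin y ^ 3))"
 have "h (pi/2) \<le> h x"
 proof (rule DERIV_nonpos_imp_nonincreasing[OF assms(2)])
  fix y assume y: "x \<le> y" "y \<le> pi/2"
  have s: "sin y > 0" using y assms pi_gt_zero by (intro sin_gt_zero) linarith+
  have c: "cos y \<ge> 0" using y assms by (intro cos_ge_zero) auto
  have "(h has_real_derivative cos y * dirichlet_kernel n y ^ 4 - cos y / sin y ^ 4) (at y)"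
   unfolding h_def using s
   by (auto intro!: derivative_eq_intros jackson_has_real_derivative simp: field_simps power_numeral_reduce)
  moreover have "dirichlet_kernel n y ^ 4 \<le> 1 / sin y ^ 4"
  proof -
   have "(sin y * dirichlet_kernel n y) ^ 4 \<le> 1"
    unfolding sin_times_dirichlet_kernel using power_mono[OF abs_sin_le_one, of "real (2 * n + 1) * y" 4] by simp
   thus ?thesis using s by (simp add: power_mult_distrib field_simps)
  qed
  hence "cos y * dirichlet_kernel n y ^ 4 \<le> cos y * (1 / sin y ^ 4)" using c by (intro mult_left_mono)
  hence "cos y * dirichlet_kernel n y ^ 4 - cos y / sin y ^ 4 \<le> 0" by simp
  ultimately show "\<exists>d. (h has_real_derivative d) (at y) \<and> d \<le> 0" by blast
 qed
 thus ?thesis by (simp add: h_def)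
qed

section \<open>The normalised square wave and its defect\<close>

definition square_wave :: "nat \<Rightarrow> real \<Rightarrow> real" where
 "square_wave n x = jackson n x / jackson n (pi/2)"

lemma jackson_top_pos: "jackson n (pi/2) > 0"
proof -
 have "real (2 * n + 1) ^ 3 / 32 > 0" by simp
 thus ?thesis using jackson_top_ge[of n] by linarith
qed

text \<open>The defect 1/(3 sin^3) is divided by the top value, which is at least N^3/32; 32/3 is
  rounded up to 11.\<close>

lemma square_wave_bounds:
 assumes "0 \<le> y" "y \<le> pi/2"
 shows "0 \<le> square_wave n y" "square_wave n y \<le> 1"
  "(1 - square_wave n y) * (real (2 * n + 1) * sin y) ^ 3 \<le> 11"
proof -
 let ?Z = "jackson n (pi/2)" and ?N = "real (2 * n + 1)"
 show "0 \<le> square_wave n y" using jackson_mono[of 0 y n] assms jackson_top_pos[of n] by (simp add: square_wave_def jackson_0)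
 show "square_wave n y \<le> 1" using jackson_mono[of y "pi/2" n] assms jackson_top_pos[of n] by (simp add: square_wave_def)
 show "(1 - square_wave n y) * (?N * sin y) ^ 3 \<le> 11"
 proof (cases "y = 0")
  case False
  have s: "sin y > 0" using False assms pi_gt_zero by (intro sin_gt_zero) linarith+
  have "(?Z - jackson n y) * sin y ^ 3 \<le> 1/3"
   using jackson_defect[of y n] False assms s by (simp add: field_simps)
  moreover have "1 - square_wave n y = (?Z - jackson n y) / ?Z"
   using jackson_top_pos[of n] by (simp add: square_wave_def diff_divide_distrib)
  moreover have "(1 - square_wave n y) * (?N * sin y) ^ 3 = (?Z - jackson n y) * sin y ^ 3 * (?N ^ 3 / ?Z)" if "1 - square_wave n y = (?Z - jackson n y) / ?Z"
   unfolding that by (simp add: power_mult_distrib)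
  moreover have "?N ^ 3 / ?Z \<ge> 0" using jackson_top_pos[of n] by simp
  ultimately have "(1 - square_wave n y) * (?N * sin y) ^ 3 \<le> (1/3) * (?N ^ 3 / ?Z)"
   using mult_right_mono[of "(?Z - jackson n y) * sin y ^ 3" "1/3" "?N ^ 3 / ?Z"] by presburger
  also have "\<dots> = (1/3) * ?N ^ 3 / ?Z" by simp
  also have "\<dots> \<le> (1/3) * ?N ^ 3 / (?N ^ 3 / 32)"
   using jackson_top_ge[of n] jackson_top_pos[of n] by (intro divide_left_mono) auto
  also have "\<dots> \<le> 11" by simp
  finally show ?thesis .
 qed simp
qed

lemma square_wave_shift:
 "square_wave n (real_of_int m * pi + y) = (if even m then 1 else -1) * square_wave n y"
 by (simp add: square_wave_def jackson_shift)

lemma square_wave_minus: "square_wave n (-y) = - square_wave n y"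
 by (simp add: square_wave_def jackson_minus)

lemma pi_residue:
 fixes x :: real
 obtains m y where "x = real_of_int m * pi + y" "\<bar>y\<bar> \<le> pi/2" "m = round (x / pi)"
proof (rule that[of "round (x / pi)" "x - of_int (round (x / pi)) * pi"])
 let ?m = "round (x / pi)"
 have "\<bar>of_int ?m - x / pi\<bar> \<le> 1/2" by (rule of_int_round_abs_le)
 hence "\<bar>of_int ?m - x / pi\<bar> * pi \<le> 1/2 * pi" by (intro mult_right_mono) auto
 moreover have "\<bar>of_int ?m - x / pi\<bar> * pi = \<bar>(of_int ?m - x / pi) * pi\<bar>" by (simp add: abs_mult)
 moreover have "\<bar>(of_int ?m - x / pi) * pi\<bar> = \<bar>x - of_int ?m * pi\<bar>" by (simp add: left_diff_distrib abs_minus_commute)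
 ultimately show "\<bar>x - of_int ?m * pi\<bar> \<le> pi/2" by argo
qed auto

lemma abs_square_wave_le_1: "\<bar>square_wave n x\<bar> \<le> 1"
proof -
 obtain m y where y: "x = real_of_int m * pi + y" "\<bar>y\<bar> \<le> pi/2" by (rule pi_residue)
 have "\<bar>square_wave n y\<bar> = \<bar>square_wave n \<bar>y\<bar>\<bar>" by (simp add: abs_if square_wave_minus)
 also have "\<dots> \<le> 1" using square_wave_bounds[of "\<bar>y\<bar>" n] y by simp
 finally show ?thesis by (simp add: y square_wave_shift)
qed

text \<open>With q = N |sin y|, the factor (1 - wave) q is at most q and at most 11/q^2; 22/(1 +
  q^2) covers both ranges. This Cauchy form is chosen because sums over primes then fall under
  \<open>prime_log_sum_Cauchy\<close>.\<close>

lemma square_wave_defect: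
 assumes x: "x = real_of_int m * pi + y" and y: "\<bar>y\<bar> \<le> pi/2"
 shows "\<bar>sin x\<bar> - square_wave n x * sin x \<le> 22 / (real (2 * n + 1) * (1 + (real (2 * n + 1) * y / 2)^2))"
proof -
 define N where "N = real (2 * n + 1)"
 define z where "z = \<bar>y\<bar>"
 have N: "N \<ge> 1" by (simp add: N_def)
 have z: "0 \<le> z" "z \<le> pi/2" using y by (auto simp: z_def)
 note sw = square_wave_bounds[OF z, of n, folded N_def]
 define q where "q = N * sin z"
 have sinz: "z / 2 \<le> sin z" by (rule sin_ge_half[OF z])
 have q: "q \<ge> N * z / 2" using mult_left_mono[OF sinz, of N] N by (simp add: q_def)
 have q0: "q \<ge> 0" using q z N by (meson mult_nonneg_nonneg order_trans divide_nonneg_pos zero_less_numeral zero_le_one)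
 have sx: "sin x = (if even m then 1 else -1) * sin y"
  unfolding x by (simp only: sin_add mult.commute[of _ pi] sin_npi_int cos_npi_int mult_zero_left add_0_left)
 have "square_wave n x * sin x = square_wave n y * sin y"
  unfolding sx unfolding x square_wave_shift by simp
 also have "\<dots> = square_wave n z * sin z" by (simp add: z_def abs_if square_wave_minus)
 finally have 1: "square_wave n x * sin x = square_wave n z * sin z" .
 have "\<bar>sin x\<bar> = \<bar>sin z\<bar>" unfolding sx by (simp add: z_def abs_if)
 hence 2: "\<bar>sin x\<bar> = sin z" using sinz z by simp
 have "(1 - square_wave n z) * q \<le> 22 / (1 + q^2)"
 proof (cases "q \<le> 1")
  case True
  have "(1 - square_wave n z) * q \<le> 1 * 1" using sw True q0 by (intro mult_mono) auto
  also have "\<dots> \<le> 22 / (1 + q^2)" using True q0 power_mono[of q 1 2] by (simp add: pos_le_divide_eq add_pos_nonneg)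
  finally show ?thesis .
 next
  case False
  have "(1 - square_wave n z) * q * (1 + q^2) \<le> (1 - square_wave n z) * q * (2 * q^2)"
   using False sw by (intro mult_left_mono mult_nonneg_nonneg) (auto simp: self_le_power)
  also have "\<dots> = 2 * ((1 - square_wave n z) * q ^ 3)" by (simp add: power2_eq_square power3_eq_cube)
  also have "\<dots> \<le> 22" using sw(3) by (simp add: q_def)
  finally show ?thesis by (simp add: pos_le_divide_eq add_pos_nonneg)
 qed
 also have "\<dots> \<le> 22 / (1 + (N * z / 2)^2)"
  using q z N by (intro divide_left_mono add_left_mono power_mono mult_pos_pos add_pos_nonneg) auto
 finally have "(1 - square_wave n z) * sin z * N \<le> 22 / (1 + (N * z / 2)^2)" by (simp add: q_def mult_ac)
 hence "(1 - square_wave n z) * sin z \<le> 22 / (1 + (N * z / 2)^2) / N" using N by (subst pos_le_divide_eq) auto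
 moreover have "(N * z / 2)^2 = (N * y / 2)^2" by (simp add: z_def power_mult_distrib power_divide)
 ultimately show ?thesis unfolding 1 2 N_def[symmetric] by (simp add: algebra_simps)
qed

definition square_coeff :: "nat \<Rightarrow> int \<times> int \<times> int \<times> int \<Rightarrow> real" where
 "square_coeff n v = 1 / (jackson_freq v * jackson n (pi/2))"

lemma square_wave_eq_sum: "square_wave n x = (\<Sum>v\<in>jackson_index n. square_coeff n v * sin (jackson_freq v * x))"
 by (simp add: square_wave_def jackson_def square_coeff_def sum_divide_distrib)

lemma square_coeff_nonneg: "square_coeff n v \<ge> 0"
 using jackson_top_pos[of n] jackson_freq_ge_1[of v] by (simp add: square_coeff_def)

text \<open>Crude: N^4 coefficients of size at most 32/N^3. In use it multiplies second differences
  O(\<eta>^2) while N is of order 1/\<eta>, which leaves the desired O(\<eta>).\<close>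

lemma sum_square_coeff_le: "(\<Sum>v\<in>jackson_index n. square_coeff n v) \<le> 32 * real (2 * n + 1)"
proof -
 let ?N = "real (2 * n + 1)" and ?Z = "jackson n (pi/2)"
 have "square_coeff n v \<le> 1 / (?N ^ 3 / 32)" for v
 proof -
  have "?N ^ 3 / 32 \<le> 1 * ?Z" using jackson_top_ge[of n] by simp
  also have "\<dots> \<le> jackson_freq v * ?Z" using jackson_freq_ge_1[of v] jackson_top_pos[of n] by (intro mult_right_mono) auto
  finally show ?thesis unfolding square_coeff_def by (intro divide_left_mono mult_pos_pos) (use jackson_top_pos[of n] jackson_freq_ge_1[of v] in auto)
 qed
 hence "(\<Sum>v\<in>jackson_index n. square_coeff n v) \<le> of_nat (card (jackson_index n)) * (1 / (?N ^ 3 / 32))"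
  by (intro sum_bounded_above)
 also have "\<dots> = 32 * ?N" unfolding card_jackson_index by (simp add: power_numeral_reduce)
 finally show ?thesis .
qed

section \<open>Nearly constant prime sums\<close>

text \<open>The square wave vanishes at 0 and would spoil the small primes. For \<eta> ln p < pi/2
  the sine is positive and the exact sign 1 is taken; this concerns finitely many primes and costs a
  finite correction.\<close>

definition prime_sign :: "nat \<Rightarrow> real \<Rightarrow> nat \<Rightarrow> real" where
 "prime_sign n \<eta> p = (if \<eta> * ln (real p) < pi/2 then 1 else square_wave n (\<eta> * ln (real p)))"

lemma abs_prime_sign_le_1: "\<bar>prime_sign n \<eta> p\<bar> \<le> 1"
 using abs_square_wave_le_1 by (simp add: prime_sign_def)

text \<open>\<open>m\<close> pi is the multiple of pi nearest to \<eta> ln p, so the wave errs where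
  ln p is near m pi/\<eta>. The defect has a factor \<eta> from 1/N, and division by \<eta> p ln p
  leaves (ln p)^-2 beside the weight ln p / p; as ln p is at least m/\<eta>, this gives
  \<eta>^2/m^2. The constant 88 is 22 times 4.\<close>

lemma prime_sign_defect:
 assumes p: "prime p" and \<eta>: "\<eta> > 0" and a: "0 < a" "a \<le> 1" "a \<le> real (2 * n + 1) * \<eta>"
  and big: "\<eta> * ln (real p) \<ge> pi/2"
 defines "m \<equiv> nat (round (\<eta> * ln (real p) / pi))"
 shows "m \<ge> 1"
  "(\<bar>sinq (\<eta> * ln (real p))\<bar> - prime_sign n \<eta> p * sinq (\<eta> * ln (real p))) / real p
    \<le> 88 / a^3 * \<eta>^2 * (1 / (real m)^2) * (ln (real p) / real p * (1 / (1 + (ln (real p) - real m * pi / \<eta>)^2)))"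
proof -
 define u where "u = ln (real p)"
 define x where "x = \<eta> * u"
 define N where "N = real (2 * n + 1)"
 have u: "u > 0" "real p \<ge> 2" using ln_prime_ge[OF p] by (auto simp: u_def)
 have x: "x \<ge> pi/2" "x > 0" using big u \<eta> by (auto simp: x_def u_def)
 obtain k y where ky: "x = real_of_int k * pi + y" "\<bar>y\<bar> \<le> pi/2" "k = round (x / pi)" by (rule pi_residue)
 have "x / pi \<ge> 1/2" using x by (simp add: field_simps)
 hence "1 \<le> x / pi + 1/2" by argo
 hence k1: "k \<ge> 1" unfolding ky(3) round_def le_floor_iff by simp
 have km: "real_of_int k = real m" using k1 ky(3) by (simp add: m_def x_def u_def)
 thus m1: "m \<ge> 1" using k1 by linarith
 define d where "d = u - real m * pi / \<eta>"
 have yd: "y = \<eta> * d" using ky(1) km \<eta> by (simp add: d_def x_def algebra_simps)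
 have mu: "real m * pi / \<eta> \<le> 2 * u"
 proof -
  have "real m * pi \<le> 2 * x" using ky x km by (simp add: abs_le_iff) argo
  thus ?thesis using \<eta> by (simp add: x_def field_simps)
 qed
 have N: "N \<ge> 1" "a \<le> N * \<eta>" using a by (auto simp: N_def)
 have "\<bar>sin x\<bar> - square_wave n x * sin x \<le> 22 / (N * (1 + (N * y / 2)^2))"
  using square_wave_defect[OF ky(1,2), of n] by (simp add: N_def)
 also have "\<dots> \<le> 22 / ((a / \<eta>) * ((a / 2)^2 * (1 + d^2)))"
 proof (rule divide_left_mono)
  have "(a / 2)^2 \<le> 1" using a power_mono[of "a/2" 1 2] by simp
  moreover have "(a / 2)^2 * d^2 \<le> (N * \<eta> / 2)^2 * d^2" using a N by (intro mult_right_mono power_mono) auto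
  moreover have "(N * y / 2)^2 = (N * \<eta> / 2)^2 * d^2" by (simp add: yd power_mult_distrib power_divide)
  ultimately have "(a / 2)^2 * (1 + d^2) \<le> 1 + (N * y / 2)^2" unfolding distrib_left by argo
  moreover have "a / \<eta> \<le> N" using N \<eta> by (simp add: pos_divide_le_eq)
  ultimately show "(a / \<eta>) * ((a / 2)^2 * (1 + d^2)) \<le> N * (1 + (N * y / 2)^2)"
   using a \<eta> N by (intro mult_mono) auto
  have "N * (1 + (N * y / 2)^2) > 0" using N by (intro mult_pos_pos add_pos_nonneg) auto
  moreover have "(a / \<eta>) * ((a / 2)^2 * (1 + d^2)) > 0"
   using a \<eta> by (intro mult_pos_pos add_pos_nonneg divide_pos_pos zero_less_power) auto
  ultimately show "0 < N * (1 + (N * y / 2)^2) * (a / \<eta> * ((a / 2)^2 * (1 + d^2)))" by (rule mult_pos_pos)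
 qed simp
 also have "\<dots> = 88 / a^3 * \<eta> * (1 / (1 + d^2))"
  using a \<eta> by (simp add: power2_eq_square power3_eq_cube field_simps)
 finally have 1: "\<bar>sin x\<bar> - square_wave n x * sin x \<le> 88 / a^3 * \<eta> * (1 / (1 + d^2))" .
 have "(\<bar>sinq x\<bar> - prime_sign n \<eta> p * sinq x) / real p = (\<bar>sin x\<bar> - square_wave n x * sin x) * (1 / (x * real p))"
  using x big by (simp add: prime_sign_def sinq_def x_def u_def diff_divide_distrib)
 also have "\<dots> \<le> 88 / a^3 * \<eta> * (1 / (1 + d^2)) * (1 / (x * real p))"
  using 1 x by (intro mult_right_mono) auto
 also have "1 / (x * real p) = (u / real p) * (1 / (\<eta> * u^2))"
  using u \<eta> by (simp add: x_def power2_eq_square)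
 also have "88 / a^3 * \<eta> * (1 / (1 + d^2)) * ((u / real p) * (1 / (\<eta> * u^2))) = (88 / a^3 * (u / real p * (1 / (1 + d^2)))) * (1 / u^2)"
  using \<eta> by simp
 also have "\<dots> \<le> (88 / a^3 * (u / real p * (1 / (1 + d^2)))) * (\<eta>^2 * (1 / (real m)^2))"
 proof (rule mult_left_mono)
  have "real m / \<eta> \<le> u"
  proof -
   have "2 * (real m / \<eta>) \<le> pi * (real m / \<eta>)" using pi_gt3 \<eta> by (intro mult_right_mono) auto
   moreover have "pi * (real m / \<eta>) = real m * pi / \<eta>" by simp
   ultimately show ?thesis using mu by argo
  qed
  hence "(real m / \<eta>)^2 \<le> u^2" using \<eta> by (intro power_mono) auto
  hence "1 / u^2 \<le> 1 / (real m / \<eta>)^2" using m1 \<eta> u by (intro divide_left_mono mult_pos_pos zero_less_power) auto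
  thus "1 / u^2 \<le> \<eta>^2 * (1 / (real m)^2)" by (simp add: power_divide)
 qed (use a u in \<open>auto intro!: mult_nonneg_nonneg divide_nonneg_nonneg\<close>)
 finally show "(\<bar>sinq (\<eta> * ln (real p))\<bar> - prime_sign n \<eta> p * sinq (\<eta> * ln (real p))) / real p
    \<le> 88 / a^3 * \<eta>^2 * (1 / (real m)^2) * (ln (real p) / real p * (1 / (1 + (ln (real p) - real m * pi / \<eta>)^2)))"
  by (simp add: x_def u_def d_def mult_ac)
qed

text \<open>For each \<open>m\<close> the Cauchy sum over primes has one bound, whatever the centre
  m pi/\<eta>, and the factors \<eta>^2/m^2 sum to \<eta>^2 pi^2/6. So the wave loses only
  O(\<eta>^2) against the exact signs.\<close>

lemma prime_sign_mean:
 fixes a :: real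
 assumes a: "0 < a" "a \<le> 1"
 obtains C where "C > 0" "\<And>n \<eta>. 0 < \<eta> ==> a \<le> real (2 * n + 1) * \<eta> ==>
  sinc_prime_sum \<eta> - C * \<eta>^2 \<le> (\<Sum>p. if prime p then prime_sign n \<eta> p * sinq (\<eta> * ln (real p)) / real p else 0)"
proof -
 obtain D where D: "D > 0" "\<And>v N. (\<Sum>p\<in>primes_upto N. ln (real p) / real p * (1 / (1 + (ln (real p) - v)^2))) \<le> D"
  by (rule prime_log_sum_Cauchy) (rule that)
 define C where "C = 88 / a^3 * (pi^2 / 6) * D"
 show ?thesis
 proof (rule that[of C])
  show "C > 0" using a D by (simp add: C_def)
  fix n :: nat and \<eta> :: real
  assume \<eta>: "0 < \<eta>" and N: "a \<le> real (2 * n + 1) * \<eta>"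
  define s where "s = (\<lambda>p. sinq (\<eta> * ln (real p)))"
  define g where "g = (\<lambda>m p. 88 / a^3 * \<eta>^2 * (1 / (real m)^2) * (ln (real p) / real p * (1 / (1 + (ln (real p) - real m * pi / \<eta>)^2))))"
  have g0: "g m p \<ge> 0" if "prime p" for m p
   unfolding g_def using a ln_prime_ge[OF that] by (auto intro!: mult_nonneg_nonneg divide_nonneg_nonneg)
  have fin: "(\<Sum>p\<in>primes_upto P. \<bar>s p\<bar> / real p) - (\<Sum>p\<in>primes_upto P. prime_sign n \<eta> p * s p / real p) \<le> C * \<eta>^2" for P
  proof -
   define mm where "mm = (\<lambda>p. nat (round (\<eta> * ln (real p) / pi)))"
   define M where "M = (\<Sum>p\<in>primes_upto P. mm p)"
   have t: "(\<bar>s p\<bar> - prime_sign n \<eta> p * s p) / real p \<le> (\<Sum>m\<in>{1..M}. g m p)" if P: "p \<in> primes_upto P" for p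
   proof (cases "\<eta> * ln (real p) < pi/2")
    case True
    have p: "prime p" using P by (rule prime_of_primes_upto)
    have "\<eta> * ln (real p) \<le> pi" using True pi_gt_zero by linarith
    hence "sin (\<eta> * ln (real p)) \<ge> 0" using ln_prime_ge[OF p] \<eta> by (intro sin_ge_zero) auto
    hence "s p \<ge> 0" using \<eta> ln_prime_ge[OF p] by (simp add: s_def sinq_def)
    hence "(\<bar>s p\<bar> - prime_sign n \<eta> p * s p) / real p = 0" using True by (simp add: prime_sign_def)
    moreover have "(\<Sum>m\<in>{1..M}. g m p) \<ge> 0" by (intro sum_nonneg g0 p)
    ultimately show ?thesis by linarith
   next
    case False
    have p: "prime p" using P by (rule prime_of_primes_upto)
    have big: "\<eta> * ln (real p) \<ge> pi/2" using False by simp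
    note d = prime_sign_defect[OF p \<eta> a N big, folded mm_def]
    have m1: "mm p \<ge> 1" using d(1) by (simp add: mm_def)
    have "mm p \<le> M" unfolding M_def by (rule member_le_sum) (use P finite_primes_upto in auto)
    hence "g (mm p) p \<le> (\<Sum>m\<in>{1..M}. g m p)" using m1 g0[OF p] by (intro member_le_sum) auto
    moreover have "(\<bar>s p\<bar> - prime_sign n \<eta> p * s p) / real p \<le> g (mm p) p"
     using d(2) unfolding s_def g_def mm_def .
    ultimately show ?thesis by linarith
   qed
   have "(\<Sum>p\<in>primes_upto P. \<bar>s p\<bar> / real p) - (\<Sum>p\<in>primes_upto P. prime_sign n \<eta> p * s p / real p) = (\<Sum>p\<in>primes_upto P. (\<bar>s p\<bar> - prime_sign n \<eta> p * s p) / real p)"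
    by (simp add: sum_subtractf diff_divide_distrib)
   also have "\<dots> \<le> (\<Sum>p\<in>primes_upto P. \<Sum>m\<in>{1..M}. g m p)" by (intro sum_mono t)
   also have "\<dots> = (\<Sum>m\<in>{1..M}. \<Sum>p\<in>primes_upto P. g m p)" by (rule sum.swap)
   also have "\<dots> \<le> (\<Sum>m\<in>{1..M}. 88 / a^3 * \<eta>^2 * (1 / (real m)^2) * D)"
   proof (rule sum_mono)
    fix m
    have "(\<Sum>p\<in>primes_upto P. g m p) = 88 / a^3 * \<eta>^2 * (1 / (real m)^2) * (\<Sum>p\<in>primes_upto P. ln (real p) / real p * (1 / (1 + (ln (real p) - real m * pi / \<eta>)^2)))"
     unfolding g_def by (rule sum_distrib_left[symmetric])
    also have "\<dots> \<le> 88 / a^3 * \<eta>^2 * (1 / (real m)^2) * D" using a by (intro mult_left_mono D) auto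
    finally show "(\<Sum>p\<in>primes_upto P. g m p) \<le> 88 / a^3 * \<eta>^2 * (1 / (real m)^2) * D" .
   qed
   also have "\<dots> = 88 / a^3 * \<eta>^2 * D * (\<Sum>m\<in>{1..M}. 1 / (real m)^2)"
    unfolding sum_distrib_left by (intro sum.cong) (simp_all add: mult_ac)
   also have "(\<Sum>m\<in>{1..M}. 1 / (real m)^2) = (\<Sum>m<M. 1 / (real m + 1)^2)"
    by (rule sum.reindex_bij_witness[of _ "\<lambda>m. m + 1" "\<lambda>m. m - 1"]) (auto simp: of_nat_diff)
   also have "88 / a^3 * \<eta>^2 * D * (\<Sum>m<M. 1 / (real m + 1)^2) \<le> 88 / a^3 * \<eta>^2 * D * (pi^2 / 6)"
   proof (rule mult_left_mono)
    have S: "(\<lambda>m. 1 / (real m + 1)^2) sums (pi^2 / 6)" using inverse_squares_sums by (simp add: add.commute)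
    thus "(\<Sum>m<M. 1 / (real m + 1)^2) \<le> pi^2 / 6"
     using sum_le_suminf[of "\<lambda>m. 1 / (real m + 1)^2" "{..<M}"] by (auto simp: sums_iff)
   qed (use a D in auto)
   finally show ?thesis by (simp add: C_def mult_ac)
  qed
  have sm: "summable (\<lambda>p. if prime p then \<bar>s p\<bar> / real p else 0)" unfolding s_def by (rule summable_abs_sinq_prime[OF \<eta>])
  have sm2: "summable (\<lambda>p. if prime p then prime_sign n \<eta> p * s p / real p else 0)"
  proof (rule summable_comparison_test'[OF sm, of 0])
   fix p
   have "\<bar>prime_sign n \<eta> p\<bar> * \<bar>s p\<bar> / real p \<le> 1 * \<bar>s p\<bar> / real p"
    using abs_prime_sign_le_1 by (intro divide_right_mono mult_right_mono) auto
   thus "norm (if prime p then prime_sign n \<eta> p * s p / real p else 0) \<le> (if prime p then \<bar>s p\<bar> / real p else 0)"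
    by (simp add: abs_mult)
  qed
  have "(\<lambda>P. (\<Sum>p\<in>primes_upto P. \<bar>s p\<bar> / real p) - (\<Sum>p\<in>primes_upto P. prime_sign n \<eta> p * s p / real p)) \<longlonglongrightarrow> (\<Sum>p. if prime p then \<bar>s p\<bar> / real p else 0) - (\<Sum>p. if prime p then prime_sign n \<eta> p * s p / real p else 0)"
   by (intro tendsto_diff sums_primes_upto summable_sums sm sm2)
  hence "(\<Sum>p. if prime p then \<bar>s p\<bar> / real p else 0) - (\<Sum>p. if prime p then prime_sign n \<eta> p * s p / real p else 0) \<le> C * \<eta>^2"
   by (rule tendsto_upperbound) (auto intro!: always_eventually fin)
  thus "sinc_prime_sum \<eta> - C * \<eta>^2 \<le> (\<Sum>p. if prime p then prime_sign n \<eta> p * sinq (\<eta> * ln (real p)) / real p else 0)"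
   unfolding sinc_prime_sum_def s_def by argo
 qed
qed

section \<open>Near equality in Jensen's inequality\<close>

text \<open>Pointwise convergence is asked for in the open interval only: in the application an
  arctan may have argument 0 at an end point, where the limit then fails.\<close>

lemma bounded_convergence_interval:
 fixes f :: "nat \<Rightarrow> real \<Rightarrow> real"
 assumes "\<eta> > 0" "\<And>j. continuous_on {-\<eta>..\<eta>} (f j)" "\<And>j t. \<bar>t\<bar> \<le> \<eta> ==> \<bar>f j t\<bar> \<le> B"
  and "\<And>t. \<bar>t\<bar> < \<eta> ==> (\<lambda>j. f j t) \<longlonglongrightarrow> l"
 shows "(\<lambda>j. integral {-\<eta>..\<eta>} (f j)) \<longlonglongrightarrow> 2 * \<eta> * l"
proof -
 have "(\<lambda>j. integral {-\<eta><..<\<eta>} (f j)) \<longlonglongrightarrow> integral {-\<eta><..<\<eta>} (\<lambda>t. l)"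
 proof (rule dominated_convergence(2)[where h = "\<lambda>t. B"])
  show "f j integrable_on {-\<eta><..<\<eta>}" for j
   using integrable_continuous_real[OF assms(2)] by (simp add: integrable_on_open_interval_real)
  show "(\<lambda>t. B) integrable_on {-\<eta><..<\<eta>}" by (simp add: integrable_on_open_interval_real integrable_const_ivl)
 qed (use assms in \<open>auto simp: abs_less_iff\<close>)
 hence "(\<lambda>j. integral {-\<eta>..\<eta>} (f j)) \<longlonglongrightarrow> integral {-\<eta>..\<eta>} (\<lambda>t. l)" by (simp only: integral_open_interval_real)
 thus ?thesis using assms(1) by simp
qed

lemma exp_le_quadratic:
 fixes x :: real
 assumes "\<bar>x\<bar> \<le> 1"
 shows "exp x \<le> 1 + x + x^2"
proof (cases "x \<ge> 0")
 case True
 thus ?thesis using assms exp_bound[of x] by simp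
next
 case False
 have "1 + - x \<le> exp (- x)" by (rule exp_ge_add_one_self)
 hence "exp x \<le> 1 / (1 - x)" using False by (simp add: exp_minus field_simps)
 also have "\<dots> \<le> 1 + x + x^2"
 proof -
  have "(1 + x + x^2) * (1 - x) = 1 - x ^ 3" by (simp add: power2_eq_square power3_eq_cube algebra_simps)
  moreover have "x ^ 3 \<le> 0" using False by (simp add: power_less_zero_eq less_imp_le)
  ultimately show ?thesis using False by (simp add: pos_divide_le_eq)
 qed
 finally show ?thesis .
qed

text \<open>For h = mean of \<open>G\<close> minus \<open>G\<close>, exp h \<le> 1 + h + h^2, and h
  has integral 0, so an oscillation \<Gamma> costs only 4 \<Gamma>^2. \<open>E\<close> becomes
  constant in the limit, and its value \<open>e\<close> drops out because only the mean
  \<open>m\<close> of the whole sum matters.\<close>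

lemma exp_integral_perturbed:
 fixes E G :: "nat \<Rightarrow> real \<Rightarrow> real"
 assumes \<eta>: "\<eta> > 0" and cE: "\<And>j. continuous_on {-\<eta>..\<eta>} (E j)" and cG: "\<And>j. continuous_on {-\<eta>..\<eta>} (G j)"
  and \<Gamma>: "\<And>j t. \<bar>t\<bar> \<le> \<eta> ==> \<bar>G j t - G j 0\<bar> \<le> \<Gamma>" "\<Gamma> \<le> 1/2"
  and B: "\<And>j t. \<bar>t\<bar> \<le> \<eta> ==> \<bar>E j t\<bar> \<le> B" and lim: "\<And>t. \<bar>t\<bar> < \<eta> ==> (\<lambda>j. E j t) \<longlonglongrightarrow> e"
  and m: "(\<lambda>j. integral {-\<eta>..\<eta>} (\<lambda>t. E j t + G j t) / (2 * \<eta>)) \<longlonglongrightarrow> m" and \<epsilon>: "\<epsilon> > 0"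
 shows "\<forall>\<^sub>F j in sequentially. integral {-\<eta>..\<eta>} (\<lambda>t. exp (- (E j t + G j t))) \<le> 2 * \<eta> * exp (- m + 4 * \<Gamma>^2 + \<epsilon>)"
proof -
 let ?I = "{-\<eta>..\<eta>}"
 define g where "g = (\<lambda>j. integral ?I (G j) / (2 * \<eta>))"
 define R where "R = (\<lambda>j. integral ?I (\<lambda>t. \<bar>exp (- E j t) - exp (- e)\<bar>))"
 have iE: "E j integrable_on ?I" and iG: "G j integrable_on ?I" for j
  using cE cG by (auto intro: integrable_continuous_real)
 have "(\<lambda>j. integral ?I (E j)) \<longlonglongrightarrow> 2 * \<eta> * e"
  by (rule bounded_convergence_interval[OF \<eta> cE B lim])
 hence "(\<lambda>j. integral ?I (E j) / (2 * \<eta>)) \<longlonglongrightarrow> 2 * \<eta> * e / (2 * \<eta>)" using \<eta> by (intro tendsto_divide tendsto_const) auto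
 hence "(\<lambda>j. integral ?I (\<lambda>t. E j t + G j t) / (2 * \<eta>) - integral ?I (E j) / (2 * \<eta>)) \<longlonglongrightarrow> m - e"
  using \<eta> by (intro tendsto_diff m) simp
 moreover have "integral ?I (\<lambda>t. E j t + G j t) / (2 * \<eta>) - integral ?I (E j) / (2 * \<eta>) = g j" for j
  using Henstock_Kurzweil_Integration.integral_add[OF iE iG, of j j] by (simp add: g_def add_divide_distrib)
 ultimately have glim: "g \<longlonglongrightarrow> m - e" by simp
 have "R \<longlonglongrightarrow> 2 * \<eta> * 0"
  unfolding R_def
 proof (rule bounded_convergence_interval[OF \<eta>])
  show "continuous_on ?I (\<lambda>t. \<bar>exp (- E j t) - exp (- e)\<bar>)" for j by (intro continuous_intros cE)
  show "\<bar>\<bar>exp (- E j t) - exp (- e)\<bar>\<bar> \<le> exp B + exp (- e)" if "\<bar>t\<bar> \<le> \<eta>" for j t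
  proof -
   have "exp (- E j t) \<le> exp B" using B[OF that, of j] by simp
   moreover have "exp (- E j t) > 0" "exp (-e) > 0" by auto
   ultimately show ?thesis unfolding abs_idempotent abs_le_iff by linarith
  qed
  show "(\<lambda>j. \<bar>exp (- E j t) - exp (- e)\<bar>) \<longlonglongrightarrow> 0" if "\<bar>t\<bar> < \<eta>" for t
  proof -
   have "(\<lambda>j. \<bar>exp (- E j t) - exp (- e)\<bar>) \<longlonglongrightarrow> \<bar>exp (- e) - exp (- e)\<bar>" by (intro tendsto_intros lim that)
   thus ?thesis by simp
  qed
 qed
 hence Rlim: "R \<longlonglongrightarrow> 0" by simp
 have bound: "integral ?I (\<lambda>t. exp (- (E j t + G j t))) \<le> exp (- g j) * (2 * \<eta> * exp (- e + 4 * \<Gamma>^2) + exp 1 * R j)" for j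
 proof -
  have \<Gamma>0: "\<Gamma> \<ge> 0" using \<Gamma>(1)[of 0 j] \<eta> by simp
  have gj: "\<bar>g j - G j 0\<bar> \<le> \<Gamma>"
  proof -
   have "integral ?I (\<lambda>t. G j t) \<le> integral ?I (\<lambda>t. G j 0 + \<Gamma>)"
    using \<Gamma>(1) by (intro integral_le iG integrable_const_ivl) (auto simp: abs_le_iff algebra_simps)
   moreover have "integral ?I (\<lambda>t. G j 0 - \<Gamma>) \<le> integral ?I (\<lambda>t. G j t)"
    using \<Gamma>(1) by (intro integral_le iG integrable_const_ivl) (auto simp: abs_le_iff algebra_simps)
   ultimately have "integral ?I (G j) \<le> 2 * \<eta> * (G j 0 + \<Gamma>)" "2 * \<eta> * (G j 0 - \<Gamma>) \<le> integral ?I (G j)" using \<eta> by auto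
   hence "g j \<le> G j 0 + \<Gamma>" "G j 0 - \<Gamma> \<le> g j"
    unfolding g_def using \<eta> by (auto simp: pos_divide_le_eq pos_le_divide_eq mult_ac)
   thus ?thesis unfolding abs_le_iff by argo
  qed
  define h where "h = (\<lambda>t. g j - G j t)"
  have h: "\<bar>h t\<bar> \<le> 2 * \<Gamma>" if "\<bar>t\<bar> \<le> \<eta>" for t
   using gj \<Gamma>(1)[OF that, of j] unfolding h_def abs_le_iff by argo
  have ih: "(h has_integral 0) ?I"
  proof -
   have "(h has_integral ((\<eta> - (-\<eta>)) *\<^sub>R g j - integral ?I (G j))) ?I"
    unfolding h_def using \<eta> by (intro has_integral_diff integrable_integral iG has_integral_const_real[THEN has_integral_eq_rhs]) auto
   thus ?thesis using \<eta> by (simp add: g_def)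
  qed
  have q: "((\<lambda>t. exp (-e) * (1 + 4 * \<Gamma>^2) + exp (-e) * h t + exp 1 * \<bar>exp (- E j t) - exp (- e)\<bar>) has_integral
    ((\<eta> - (-\<eta>)) *\<^sub>R (exp (-e) * (1 + 4 * \<Gamma>^2)) + exp (-e) * 0 + exp 1 * R j)) ?I"
   unfolding R_def using \<eta>
   by (intro has_integral_add has_integral_mult_right ih integrable_integral integrable_continuous_real continuous_intros cE
     has_integral_const_real[THEN has_integral_eq_rhs]) auto
  have p: "((\<lambda>t. exp (- E j t) * exp (h t)) has_integral integral ?I (\<lambda>t. exp (- E j t) * exp (h t))) ?I"
   unfolding h_def by (intro integrable_integral integrable_continuous_real continuous_intros cE cG)
  have "integral ?I (\<lambda>t. exp (- E j t) * exp (h t)) \<le> (\<eta> - (-\<eta>)) *\<^sub>R (exp (-e) * (1 + 4 * \<Gamma>^2)) + exp (-e) * 0 + exp 1 * R j"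
  proof (rule has_integral_le[OF p q])
   fix t assume "t \<in> ?I"
   hence ht: "\<bar>h t\<bar> \<le> 2 * \<Gamma>" by (intro h) auto
   hence h1: "\<bar>h t\<bar> \<le> 1" using \<Gamma>(2) by linarith
   have "exp (h t) \<le> 1 + h t + (h t)^2" by (rule exp_le_quadratic[OF h1])
   also have "(h t)^2 \<le> 4 * \<Gamma>^2" using power_mono[OF ht, of 2] by (simp add: power_mult_distrib)
   finally have e1: "exp (h t) \<le> 1 + h t + 4 * \<Gamma>^2" by simp
   have "exp (- E j t) * exp (h t) = exp (-e) * exp (h t) + (exp (- E j t) - exp (-e)) * exp (h t)" by (simp add: algebra_simps)
   also have "\<dots> \<le> exp (-e) * (1 + h t + 4 * \<Gamma>^2) + \<bar>exp (- E j t) - exp (-e)\<bar> * exp 1"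
   proof (intro add_mono mult_left_mono e1)
    have "(exp (- E j t) - exp (-e)) * exp (h t) \<le> \<bar>exp (- E j t) - exp (-e)\<bar> * exp (h t)" by (intro mult_right_mono) auto
    also have "\<dots> \<le> \<bar>exp (- E j t) - exp (-e)\<bar> * exp 1" using h1 by (intro mult_left_mono) auto
    finally show "(exp (- E j t) - exp (-e)) * exp (h t) \<le> \<bar>exp (- E j t) - exp (-e)\<bar> * exp 1" .
   qed simp
   finally show "exp (- E j t) * exp (h t) \<le> exp (-e) * (1 + 4 * \<Gamma>^2) + exp (-e) * h t + exp 1 * \<bar>exp (- E j t) - exp (- e)\<bar>"
    by (simp add: algebra_simps)
  qed
  also have "\<dots> = 2 * \<eta> * (exp (-e) * (1 + 4 * \<Gamma>^2)) + exp 1 * R j" by simp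
  also have "\<dots> \<le> 2 * \<eta> * (exp (-e) * exp (4 * \<Gamma>^2)) + exp 1 * R j"
   using \<eta> exp_ge_add_one_self[of "4 * \<Gamma>^2"] by (intro add_right_mono mult_left_mono) auto
  finally have "integral ?I (\<lambda>t. exp (- E j t) * exp (h t)) \<le> 2 * \<eta> * exp (- e + 4 * \<Gamma>^2) + exp 1 * R j"
   by (simp only: exp_add)
  hence "exp (- g j) * integral ?I (\<lambda>t. exp (- E j t) * exp (h t)) \<le> exp (- g j) * (2 * \<eta> * exp (- e + 4 * \<Gamma>^2) + exp 1 * R j)"
   by (intro mult_left_mono) auto
  moreover have "exp (- g j) * integral ?I (\<lambda>t. exp (- E j t) * exp (h t)) = integral ?I (\<lambda>t. exp (- (E j t + G j t)))"
   unfolding integral_mult_right[symmetric] h_def by (simp flip: exp_add add: algebra_simps)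
  ultimately show ?thesis by simp
 qed
 have "(\<lambda>j. exp (- g j) * (2 * \<eta> * exp (- e + 4 * \<Gamma>^2) + exp 1 * R j)) \<longlonglongrightarrow> exp (- (m - e)) * (2 * \<eta> * exp (- e + 4 * \<Gamma>^2) + exp 1 * 0)"
  by (intro tendsto_intros glim Rlim)
 moreover have "exp (- (m - e)) * (2 * \<eta> * exp (- e + 4 * \<Gamma>^2) + exp 1 * 0) < 2 * \<eta> * exp (- m + 4 * \<Gamma>^2 + \<epsilon>)"
 proof -
  have "exp (- (m - e)) * (2 * \<eta> * exp (- e + 4 * \<Gamma>^2) + exp 1 * 0) = 2 * \<eta> * exp (- m + 4 * \<Gamma>^2)" by (simp flip: exp_add)
  thus ?thesis using \<eta> \<epsilon> by simp
 qed
 ultimately have "\<forall>\<^sub>F j in sequentially. exp (- g j) * (2 * \<eta> * exp (- e + 4 * \<Gamma>^2) + exp 1 * R j) < 2 * \<eta> * exp (- m + 4 * \<Gamma>^2 + \<epsilon>)"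
  by (rule order_tendstoD)
 thus ?thesis by eventually_elim (use bound in \<open>meson order_trans less_imp_le\<close>)
qed

text \<open>The sine sum is minus the imaginary part of \<open>prime_zeta\<close>, so its main part
  is the argument of s - 1. As \<sigma> tends to 1 this tends to pi/2 for every y > 0; here the
  constancy originates.\<close>

lemma sums_prime_sin:
 assumes A: "\<And>s. s \<in> ball 1 c ==> Re s > 1 ==> prime_zeta s = - Ln (s - 1) + A s"
  and \<sigma>: "\<sigma> > 1" and b: "Complex \<sigma> y \<in> ball 1 c"
 shows "(\<lambda>n. if prime n then real n powr (-\<sigma>) * sin (y * ln (real n)) else 0) sums
  (arctan (y / (\<sigma> - 1)) - Im (A (Complex \<sigma> y)))"
proof -
 have "Complex \<sigma> y - 1 = Complex (\<sigma> - 1) y" by (simp add: complex_eq_iff)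
 moreover have "Im (Ln (Complex (\<sigma> - 1) y)) = arctan (y / (\<sigma> - 1))"
  using \<sigma> by (subst Im_Ln_eq) (auto simp: complex_eq_iff)
 ultimately have P: "Im (prime_zeta (Complex \<sigma> y)) = - (arctan (y / (\<sigma> - 1)) - Im (A (Complex \<sigma> y)))"
  using A[OF b] \<sigma> by simp
 have "(\<lambda>n. - Im (if prime n then of_nat n powr (- Complex \<sigma> y) else 0)) sums - Im (prime_zeta (Complex \<sigma> y))"
  using \<sigma> by (intro sums_minus sums_Im sums_prime_zeta) simp
 moreover have "- Im (if prime n then of_nat n powr (- Complex \<sigma> y) else 0) = (if prime n then real n powr (-\<sigma>) * sin (y * ln (real n)) else 0)" for n
  using prime_gt_0_nat[of n] by (simp add: powr_def Im_exp)
 ultimately show ?thesis unfolding P by simp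
qed

lemma one_minus_cos_le: "1 - cos x \<le> x^2 / 2" for x :: real
proof -
 have "\<bar>sin (x/2)\<bar> \<le> \<bar>x/2\<bar>" by (rule abs_sin_x_le_abs_x)
 hence "(sin (x/2))^2 \<le> (x/2)^2" by (simp only: abs_le_square_iff)
 moreover have "cos x = 1 - 2 * (sin (x/2))^2" using cos_double_sin[of "x/2"] by simp
 ultimately show ?thesis by (simp add: power_divide)
qed

text \<open>By 2 sin a cos b = sin (a + b) + sin (a - b), the prime sum with square wave
  coefficients is a combination of sine sums at K + t and K - t, with K running through the
  frequencies. All K are at least \<eta>, so for |t| < \<eta> both arguments are positive and the
  arctan parts become constant. The rest, a holomorphic part and the correction at small primes,
  oscillates by O(\<eta>).\<close>

theorem nearly_constant_prime_sum:
 assumes c: "0 < c" "c \<le> 1/4" and hol: "A holomorphic_on ball 1 c"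
  and A: "\<And>s. s \<in> ball 1 c ==> Re s > 1 ==> prime_zeta s = - Ln (s - 1) + A s"
 obtains C \<eta>0 where "C > 0" "\<eta>0 > 0" "\<forall>\<eta>. 0 < \<eta> \<and> \<eta> \<le> \<eta>0 \<longrightarrow> (\<exists>\<theta>. (\<forall>n. \<bar>\<theta> n\<bar> \<le> 1) \<and> (\<forall>n. \<theta> n = 1 \<or> 1 \<le> \<eta> * ln (real n)) \<and>
  (\<forall>\<epsilon>>0. \<forall>\<^sub>F j in sequentially. integral {-\<eta>..\<eta>} (\<lambda>t. exp (- prime_cos_sum \<theta> (1 + c/4 / real (Suc j)) t))
   \<le> 2 * \<eta> * exp (- sinc_prime_sum \<eta> + C * \<eta>^2 + \<epsilon>)))"
proof -
 obtain M where M: "M > 0"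
  "\<And>s h. norm (s - 1) \<le> c/2 ==> \<bar>h\<bar> \<le> c/4 ==> norm (A (s + \<i> * of_real h) + A (s - \<i> * of_real h) - 2 * A s) \<le> M * h^2"
  by (rule holomorphic_second_difference[OF c(1) hol]) (rule that)
 define a where "a = c / 40"
 have a: "0 < a" "a \<le> 1" using c by (auto simp: a_def)
 obtain Cm where Cm: "Cm > 0" "\<And>n \<eta>. 0 < \<eta> ==> a \<le> real (2 * n + 1) * \<eta> ==>
  sinc_prime_sum \<eta> - Cm * \<eta>^2 \<le> (\<Sum>p. if prime p then prime_sign n \<eta> p * sinq (\<eta> * ln (real p)) / real p else 0)"
  by (rule prime_sign_mean[OF a]) (rule that)
 define w where "w = (\<lambda>n. if prime n then ln (real n) / real n * (1 / (ln (real n))^2) else 0)"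
 define S0 where "S0 = suminf w"
 have w0: "w n \<ge> 0" for n using ln_prime_ge[of n] by (auto simp: w_def)
 have sw: "summable w" using summable_prime_log_inverse_square unfolding w_def .
 have S0: "S0 \<ge> 0" unfolding S0_def by (rule suminf_nonneg[OF sw w0])
 \<comment> \<open>16 M bounds the oscillation of the holomorphic part and 44/a^3 S0 that of the
   small primes, both per unit of \<eta>. The definition of \<open>\<eta>0\<close> then keeps the
   total at most 1/2, as \<open>exp_integral_perturbed\<close> requires.\<close>
 define \<Gamma>0 where "\<Gamma>0 = 16 * M + 44 / a^3 * S0"
 have \<Gamma>0: "\<Gamma>0 > 0" using M a S0 by (auto simp: \<Gamma>0_def intro!: add_pos_nonneg)
 define \<eta>0 where "\<eta>0 = min (c/40) (1 / (2 * \<Gamma>0))"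
 show ?thesis
 proof (rule that[of "Cm + 4 * \<Gamma>0^2" \<eta>0], goal_cases)
  case 1 show ?case using Cm by (simp add: add_pos_nonneg)
 next
  case 2 show ?case using c \<Gamma>0 by (simp add: \<eta>0_def)
 next
  case 3
  show ?case
  proof (intro allI impI)
   fix \<eta> assume "0 < \<eta> \<and> \<eta> \<le> \<eta>0"
   hence \<eta>: "0 < \<eta>" "\<eta> \<le> c/40" "\<Gamma>0 * \<eta> \<le> 1/2" using \<Gamma>0 by (auto simp: \<eta>0_def field_simps)
   \<comment> \<open>The largest degree with n \<eta> at most c/40. All frequencies are then at most
     (8n + 1) \<eta> \<le> c/4, inside the disc, while (2n + 1) \<eta> \<ge> a keeps the wave sharp
     on the scale 1 in ln p.\<close>
   define n where "n = nat \<lfloor>c / (40 * \<eta>)\<rfloor>"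
   have n: "real n \<le> c / (40 * \<eta>)" "c / (40 * \<eta>) < real n + 1"
    using c \<eta> unfolding n_def by (auto simp: of_nat_nat floor_le_iff)
   have n': "real n * \<eta> \<le> c / 40" "c / 40 < real n * \<eta> + \<eta>"
    using n \<eta> by (auto simp: field_simps)
   define N where "N = real (2 * n + 1)"
   have N: "a \<le> N * \<eta>" "N * \<eta> \<le> 1" "(8 * real n + 1) * \<eta> \<le> c/4" "N \<ge> 1"
    using n' \<eta> c by (auto simp: N_def a_def algebra_simps)
   define \<theta> where "\<theta> = prime_sign n \<eta>"
   define \<sigma> where "\<sigma> = (\<lambda>j. 1 + c/4 / real (Suc j))"
   have \<sigma>: "\<sigma> j > 1" "\<sigma> j - 1 \<le> c/4" for j
    using c by (auto simp: \<sigma>_def divide_le_eq)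
   define V where "V = jackson_index n"
   define b where "b = square_coeff n"
   define K where "K = (\<lambda>v. jackson_freq v * \<eta>)"
   have b0: "b v \<ge> 0" for v by (simp add: b_def square_coeff_nonneg)
   have K: "\<eta> \<le> K v" for v using jackson_freq_ge_1[of v] \<eta> mult_right_mono[of 1 "jackson_freq v" \<eta>] by (simp add: K_def)
   have K2: "K v \<le> c/4" if "v \<in> V" for v
   proof -
    have "K v \<le> (8 * real n + 1) * \<eta>" unfolding K_def using that \<eta> jackson_freq_le[of v n] by (intro mult_right_mono) (auto simp: V_def)
    thus ?thesis using N by linarith
   qed
   have finV: "finite V" by (simp add: V_def finite_jackson_index)
   define Q where "Q = {p. prime p \<and> \<eta> * ln (real p) < pi/2}"
   have finQ: "finite Q"
   proof (rule finite_subset)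
    show "Q \<subseteq> {..nat \<lceil>exp (pi / (2 * \<eta>))\<rceil>}"
    proof
     fix p assume "p \<in> Q"
     hence p: "prime p" "\<eta> * ln (real p) < pi/2" by (auto simp: Q_def)
     hence "ln (real p) < pi / (2 * \<eta>)" using \<eta> by (simp add: field_simps)
     hence "exp (ln (real p)) < exp (pi / (2 * \<eta>))" by simp
     hence "real p < exp (pi / (2 * \<eta>))" using prime_gt_0_nat[OF p(1)] by simp
     hence "real p \<le> real_of_int \<lceil>exp (pi / (2 * \<eta>))\<rceil>" by linarith
     thus "p \<in> {..nat \<lceil>exp (pi / (2 * \<eta>))\<rceil>}" by (simp add: le_nat_iff)
    qed
   qed simp
   define W where "W = (\<lambda>p. 1 - square_wave n (\<eta> * ln (real p)))"
   \<comment> \<open>\<open>E\<close> holds the arctan parts. \<open>H\<close> puts the sign 1 in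
     place of the wave at the primes of \<open>Q\<close>, and \<open>G\<close> joins it to the
     holomorphic parts.\<close>
   define E where "E = (\<lambda>j t. \<Sum>v\<in>V. b v / 2 * (arctan ((K v + t) / (\<sigma> j - 1)) + arctan ((K v - t) / (\<sigma> j - 1))))"
   define H where "H = (\<lambda>j t. \<Sum>p\<in>Q. real p powr (- \<sigma> j) * W p * cos (t * ln (real p)))"
   define G where "G = (\<lambda>j t. H j t - (\<Sum>v\<in>V. b v / 2 * (Im (A (Complex (\<sigma> j) (K v + t))) + Im (A (Complex (\<sigma> j) (K v - t))))))"
   define D where "D = (\<lambda>j t. \<Sum>m. if prime m then real m powr (- \<sigma> j) * \<theta> m * cos (t * ln (real m)) else 0)"
   have nrm: "norm (Complex (\<sigma> j) y - 1) \<le> c/4 + \<bar>y\<bar>" for j y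
   proof -
    have "norm (Complex (\<sigma> j) y - 1) \<le> \<bar>Re (Complex (\<sigma> j) y - 1)\<bar> + \<bar>Im (Complex (\<sigma> j) y - 1)\<bar>" by (rule cmod_le)
    thus ?thesis using \<sigma>[of j] by simp
   qed
   have inb: "Complex (\<sigma> j) (K v + t) \<in> ball 1 c" "Complex (\<sigma> j) (K v - t) \<in> ball 1 c" if "v \<in> V" "\<bar>t\<bar> \<le> \<eta>" for j v t
   proof -
    have "\<bar>K v + t\<bar> \<le> c/4 + c/40" "\<bar>K v - t\<bar> \<le> c/4 + c/40" using K2[OF that(1)] K[of v] that(2) \<eta> unfolding abs_le_iff by argo+
    hence "norm (Complex (\<sigma> j) (K v + t) - 1) < c" "norm (Complex (\<sigma> j) (K v - t) - 1) < c"
     using nrm[of j "K v + t"] nrm[of j "K v - t"] c by argo+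
    thus "Complex (\<sigma> j) (K v + t) \<in> ball 1 c" "Complex (\<sigma> j) (K v - t) \<in> ball 1 c"
     by (simp_all add: dist_norm norm_minus_commute)
   qed
   have dec: "D j t = E j t + G j t" if t: "\<bar>t\<bar> \<le> \<eta>" for j t
   proof -
    let ?r = "\<lambda>m. real m powr (- \<sigma> j)" and ?u = "\<lambda>m. ln (real m)"
    have s1: "(\<lambda>m. \<Sum>v\<in>V. b v / 2 * ((if prime m then ?r m * sin ((K v + t) * ?u m) else 0) + (if prime m then ?r m * sin ((K v - t) * ?u m) else 0)))
     sums (\<Sum>v\<in>V. b v / 2 * ((arctan ((K v + t) / (\<sigma> j - 1)) - Im (A (Complex (\<sigma> j) (K v + t)))) + (arctan ((K v - t) / (\<sigma> j - 1)) - Im (A (Complex (\<sigma> j) (K v - t))))))"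
    proof (intro sums_sum sums_mult sums_add)
     fix v assume v: "v \<in> V"
     show "(\<lambda>m. if prime m then ?r m * sin ((K v + t) * ?u m) else 0) sums (arctan ((K v + t) / (\<sigma> j - 1)) - Im (A (Complex (\<sigma> j) (K v + t))))"
      by (rule sums_prime_sin[OF A \<sigma>(1) inb(1)[OF v t]])
     show "(\<lambda>m. if prime m then ?r m * sin ((K v - t) * ?u m) else 0) sums (arctan ((K v - t) / (\<sigma> j - 1)) - Im (A (Complex (\<sigma> j) (K v - t))))"
      by (rule sums_prime_sin[OF A \<sigma>(1) inb(2)[OF v t]])
    qed
    have s2: "(\<lambda>m. if m \<in> Q then ?r m * W m * cos (t * ?u m) else 0) sums H j t"
     unfolding H_def by (rule sums_If_finite_set[OF finQ])
    have eq: "(\<Sum>v\<in>V. b v / 2 * ((if prime m then ?r m * sin ((K v + t) * ?u m) else 0) + (if prime m then ?r m * sin ((K v - t) * ?u m) else 0)))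
      + (if m \<in> Q then ?r m * W m * cos (t * ?u m) else 0) = (if prime m then ?r m * \<theta> m * cos (t * ?u m) else 0)" for m
    proof (cases "prime m")
     case True
     have "b v / 2 * (?r m * sin ((K v + t) * ?u m) + ?r m * sin ((K v - t) * ?u m)) = ?r m * cos (t * ?u m) * (square_coeff n v * sin (jackson_freq v * (\<eta> * ?u m)))" for v
     proof -
      have "sin ((K v + t) * ?u m) + sin ((K v - t) * ?u m) = 2 * sin (K v * ?u m) * cos (t * ?u m)"
       by (simp add: distrib_right left_diff_distrib sin_add sin_diff)
      moreover have "b v / 2 * (?r m * sin ((K v + t) * ?u m) + ?r m * sin ((K v - t) * ?u m)) = b v / 2 * ?r m * (sin ((K v + t) * ?u m) + sin ((K v - t) * ?u m))"
       by (simp add: algebra_simps)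
      ultimately show ?thesis by (simp add: b_def K_def mult_ac)
     qed
     hence "(\<Sum>v\<in>V. b v / 2 * ((if prime m then ?r m * sin ((K v + t) * ?u m) else 0) + (if prime m then ?r m * sin ((K v - t) * ?u m) else 0))) = ?r m * cos (t * ?u m) * square_wave n (\<eta> * ?u m)"
      using True by (simp add: square_wave_eq_sum sum_distrib_left V_def)
     thus ?thesis using True by (simp add: Q_def W_def \<theta>_def prime_sign_def algebra_simps)
    qed (simp add: Q_def)
    from sums_add[OF s1 s2] have "D j t = (\<Sum>v\<in>V. b v / 2 * ((arctan ((K v + t) / (\<sigma> j - 1)) - Im (A (Complex (\<sigma> j) (K v + t)))) + (arctan ((K v - t) / (\<sigma> j - 1)) - Im (A (Complex (\<sigma> j) (K v - t)))))) + H j t"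
     unfolding eq D_def by (rule sums_unique[symmetric])
    also have "\<dots> = E j t + G j t"
     unfolding E_def G_def by (simp add: algebra_simps sum.distrib sum_subtractf)
    finally show ?thesis .
   qed
   \<comment> \<open>The cubic decay of the defect beats the factor (ln p)^2 coming from the cosine
     and leaves 1/ln p; with the weight 1/p the convergent sum of 1/(p ln p) appears.\<close>
   have W: "0 \<le> W p" "W p * (ln (real p))^2 \<le> 88 / a^3 * (1 / ln (real p))" if "p \<in> Q" for p
   proof -
    define u where "u = ln (real p)"
    have p: "prime p" "\<eta> * u < pi/2" using that by (auto simp: Q_def u_def)
    have u: "u > 0" using ln_prime_ge[OF p(1)] by (simp add: u_def)
    have x: "0 \<le> \<eta> * u" "\<eta> * u \<le> pi/2" using p u \<eta> by auto
    note sq = square_wave_bounds[OF x, of n, folded N_def]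
    show W0: "0 \<le> W p" using sq by (simp add: W_def u_def)
    have "a * u / 2 \<le> N * \<eta> * u / 2" using N u by (intro divide_right_mono mult_right_mono) auto
    also have "\<dots> = N * (\<eta> * u / 2)" by simp
    also have "\<dots> \<le> N * sin (\<eta> * u)" using N sin_ge_half[OF x] by (intro mult_left_mono) auto
    finally have "(a * u / 2) ^ 3 \<le> (N * sin (\<eta> * u)) ^ 3" using a u by (intro power_mono) auto
    hence "W p * (a * u / 2) ^ 3 \<le> W p * (N * sin (\<eta> * u)) ^ 3" using W0 by (intro mult_left_mono)
    also have "\<dots> \<le> 11" using sq by (simp add: W_def u_def)
    finally have "W p * (a * u / 2) ^ 3 \<le> 11" .
    thus "W p * (ln (real p))^2 \<le> 88 / a^3 * (1 / ln (real p))"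
     unfolding u_def[symmetric] using a u by (simp add: field_simps power2_eq_square power3_eq_cube)
   qed
   have HG: "\<bar>H j t - H j 0\<bar> \<le> 44 / a^3 * S0 * \<eta>" if t: "\<bar>t\<bar> \<le> \<eta>" for j t
   proof -
    have t2: "t^2 \<le> \<eta>^2" using t \<eta> by (simp add: abs_le_square_iff[symmetric])
    have "\<bar>H j t - H j 0\<bar> = \<bar>\<Sum>p\<in>Q. real p powr (- \<sigma> j) * W p * (cos (t * ln (real p)) - 1)\<bar>"
     unfolding H_def by (simp add: sum_subtractf right_diff_distrib)
    also have "\<dots> \<le> (\<Sum>p\<in>Q. \<bar>real p powr (- \<sigma> j) * W p * (cos (t * ln (real p)) - 1)\<bar>)" by (rule sum_abs)
    also have "\<dots> \<le> (\<Sum>p\<in>Q. 44 / a^3 * \<eta>^2 * w p)"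
    proof (rule sum_mono)
     fix p assume pQ: "p \<in> Q"
     define u where "u = ln (real p)"
     have p: "prime p" using pQ by (simp add: Q_def)
     have u: "u > 0" "real p \<ge> 2" using ln_prime_ge[OF p] by (auto simp: u_def)
     have "\<bar>cos (t * u) - 1\<bar> \<le> (t * u)^2 / 2" using one_minus_cos_le[of "t * u"] cos_le_one[of "t * u"] zero_le_power2[of "t * u"] unfolding abs_le_iff by argo
     also have "\<dots> \<le> \<eta>^2 * u^2 / 2" using t2 by (simp add: power_mult_distrib mult_right_mono)
     finally have c1: "\<bar>cos (t * u) - 1\<bar> \<le> \<eta>^2 * u^2 / 2" .
     have "\<bar>real p powr (- \<sigma> j) * W p * (cos (t * u) - 1)\<bar> = real p powr (- \<sigma> j) * W p * \<bar>cos (t * u) - 1\<bar>"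
      using W(1)[OF pQ] by (simp add: abs_mult)
     also have "\<dots> \<le> (1 / real p) * W p * (\<eta>^2 * u^2 / 2)"
      using W(1)[OF pQ] prime_powr_bounds[OF p \<sigma>(1)[of j]] c1 by (intro mult_mono mult_right_mono mult_nonneg_nonneg) auto
     also have "\<dots> = (\<eta>^2 / 2 / real p) * (W p * u^2)" by (simp add: mult_ac)
     also have "\<dots> \<le> (\<eta>^2 / 2 / real p) * (88 / a^3 * (1 / u))" using W(2)[OF pQ] by (intro mult_left_mono) (auto simp: u_def)
     also have "\<dots> = 44 / a^3 * \<eta>^2 * w p" using p u by (simp add: w_def u_def[symmetric] power2_eq_square)
     finally show "\<bar>real p powr (- \<sigma> j) * W p * (cos (t * ln (real p)) - 1)\<bar> \<le> 44 / a^3 * \<eta>^2 * w p" by (simp add: u_def)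
    qed
    also have "\<dots> = 44 / a^3 * \<eta>^2 * sum w Q" by (simp add: sum_distrib_left)
    also have "\<dots> \<le> 44 / a^3 * \<eta> * S0"
    proof (rule mult_mono)
     have "\<eta> \<le> 1" using \<eta> c by linarith
     hence "\<eta> * \<eta> \<le> 1 * \<eta>" using \<eta> by (intro mult_right_mono) auto
     thus "44 / a^3 * \<eta>^2 \<le> 44 / a^3 * \<eta>" using a by (intro mult_left_mono) (auto simp: power2_eq_square)
     show "sum w Q \<le> S0" unfolding S0_def by (rule sum_le_suminf[OF sw finQ]) (use w0 in auto)
    qed (use a \<eta> w0 in \<open>auto intro: sum_nonneg\<close>)
    finally show ?thesis by (simp add: mult_ac)
   qed
   have \<Gamma>: "\<bar>G j t - G j 0\<bar> \<le> \<Gamma>0 * \<eta>" if t: "\<bar>t\<bar> \<le> \<eta>" for j t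
   proof -
    have t2: "t^2 \<le> \<eta>^2" using t \<eta> by (simp add: abs_le_square_iff[symmetric])
    define d where "d = (\<lambda>v. Im (A (Complex (\<sigma> j) (K v + t))) + Im (A (Complex (\<sigma> j) (K v - t))) - 2 * Im (A (Complex (\<sigma> j) (K v))))"
    have d: "\<bar>d v\<bar> \<le> M * \<eta>^2" if v: "v \<in> V" for v
    proof -
     have "norm (Complex (\<sigma> j) (K v) - 1) \<le> c/2" using nrm[of j "K v"] K2[OF v] K[of v] \<eta> by simp
     moreover have "\<bar>t\<bar> \<le> c/4" using t \<eta> c by linarith
     ultimately have "norm (A (Complex (\<sigma> j) (K v) + \<i> * of_real t) + A (Complex (\<sigma> j) (K v) - \<i> * of_real t) - 2 * A (Complex (\<sigma> j) (K v))) \<le> M * t^2"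
      by (rule M(2))
     moreover have "Complex (\<sigma> j) (K v) + \<i> * of_real t = Complex (\<sigma> j) (K v + t)" "Complex (\<sigma> j) (K v) - \<i> * of_real t = Complex (\<sigma> j) (K v - t)"
      by (simp_all add: complex_eq_iff)
     moreover have "\<bar>d v\<bar> \<le> norm (A (Complex (\<sigma> j) (K v + t)) + A (Complex (\<sigma> j) (K v - t)) - 2 * A (Complex (\<sigma> j) (K v)))"
      using abs_Im_le_cmod[of "A (Complex (\<sigma> j) (K v + t)) + A (Complex (\<sigma> j) (K v - t)) - 2 * A (Complex (\<sigma> j) (K v))"] by (simp add: d_def)
     moreover have "M * t^2 \<le> M * \<eta>^2" using t2 M by (intro mult_left_mono) auto
     ultimately show ?thesis by simp
    qed
    have "G j t - G j 0 = (H j t - H j 0) - (\<Sum>v\<in>V. b v / 2 * d v)"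
     unfolding G_def d_def by (simp add: algebra_simps sum.distrib sum_subtractf)
    moreover have "\<bar>\<Sum>v\<in>V. b v / 2 * d v\<bar> \<le> 16 * M * \<eta>"
    proof -
     have "\<bar>\<Sum>v\<in>V. b v / 2 * d v\<bar> \<le> (\<Sum>v\<in>V. b v / 2 * (M * \<eta>^2))"
     proof (rule order_trans[OF sum_abs sum_mono])
      fix v assume "v \<in> V"
      thus "\<bar>b v / 2 * d v\<bar> \<le> b v / 2 * (M * \<eta>^2)" unfolding abs_mult using b0[of v] d by (intro mult_mono) auto
     qed
     also have "\<dots> = sum b V * (M * \<eta>^2 / 2)" by (simp add: sum_distrib_right)
     also have "\<dots> \<le> (32 * N) * (M * \<eta>^2 / 2)"
      using sum_square_coeff_le[of n] M by (intro mult_right_mono) (auto simp: b_def V_def N_def)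
     also have "\<dots> = 16 * M * \<eta> * (N * \<eta>)" by (simp add: power2_eq_square)
     also have "\<dots> \<le> 16 * M * \<eta> * 1" using M \<eta> N by (intro mult_left_mono) auto
     finally show ?thesis by simp
    qed
    ultimately show ?thesis using HG[OF t, of j] unfolding \<Gamma>0_def distrib_right abs_le_iff by argo
   qed
   have cE: "continuous_on {-\<eta>..\<eta>} (E j)" for j
    unfolding E_def using \<sigma>(1)[of j] by (intro continuous_intros) auto
   have cG: "continuous_on {-\<eta>..\<eta>} (G j)" for j
   proof -
    have cA: "continuous_on (ball 1 c) A" using hol by (rule holomorphic_on_imp_continuous_on)
    have "continuous_on {-\<eta>..\<eta>} (\<lambda>t. A (Complex (\<sigma> j) (K v + t)))" "continuous_on {-\<eta>..\<eta>} (\<lambda>t. A (Complex (\<sigma> j) (K v - t)))" if v: "v \<in> V" for v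
    proof -
     have "Complex (\<sigma> j) y = of_real (\<sigma> j) + \<i> * of_real y" for y by (simp add: complex_eq_iff)
     hence "continuous_on {-\<eta>..\<eta>} (\<lambda>t. Complex (\<sigma> j) (K v + t))" "continuous_on {-\<eta>..\<eta>} (\<lambda>t. Complex (\<sigma> j) (K v - t))"
      by (auto intro!: continuous_intros)
     thus "continuous_on {-\<eta>..\<eta>} (\<lambda>t. A (Complex (\<sigma> j) (K v + t)))" "continuous_on {-\<eta>..\<eta>} (\<lambda>t. A (Complex (\<sigma> j) (K v - t)))"
      using inb[OF v] by (auto intro!: continuous_on_compose2[OF cA] simp: abs_le_iff)
    qed
    thus ?thesis unfolding G_def H_def by (intro continuous_intros)
   qed
   have B: "\<bar>E j t\<bar> \<le> (\<Sum>v\<in>V. b v / 2 * (pi/2 + pi/2))" for j t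
    unfolding E_def
   proof (rule order_trans[OF sum_abs sum_mono])
    fix v
    have at: "\<bar>arctan x\<bar> \<le> pi/2" for x using arctan_bounded[of x] by (auto simp: abs_le_iff)
    have "\<bar>arctan ((K v + t) / (\<sigma> j - 1)) + arctan ((K v - t) / (\<sigma> j - 1))\<bar> \<le> pi/2 + pi/2"
     by (rule order_trans[OF abs_triangle_ineq add_mono[OF at at]])
    thus "\<bar>b v / 2 * (arctan ((K v + t) / (\<sigma> j - 1)) + arctan ((K v - t) / (\<sigma> j - 1)))\<bar> \<le> b v / 2 * (pi/2 + pi/2)"
     unfolding abs_mult using b0[of v] by (intro mult_mono) auto
   qed
   have lim: "(\<lambda>j. E j t) \<longlonglongrightarrow> (\<Sum>v\<in>V. b v / 2 * (pi/2 + pi/2))" if t: "\<bar>t\<bar> < \<eta>" for t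
   proof -
    have at: "(\<lambda>j. arctan (y / (\<sigma> j - 1))) \<longlonglongrightarrow> pi/2" if "y > 0" for y
    proof (rule filterlim_compose[OF tendsto_arctan_at_top])
     have "filterlim (\<lambda>j. (4 * y / c) * real (Suc j)) at_top sequentially"
      using that c by (intro filterlim_tendsto_pos_mult_at_top[OF tendsto_const] filterlim_compose[OF filterlim_real_sequentially filterlim_Suc]) auto
     thus "filterlim (\<lambda>j. y / (\<sigma> j - 1)) at_top sequentially" by (simp add: \<sigma>_def mult_ac)
    qed
    show ?thesis unfolding E_def
    proof (intro tendsto_sum tendsto_mult tendsto_add tendsto_const at)
     fix v show "K v + t > 0" "K v - t > 0" using K[of v] t by (auto simp: abs_less_iff)
    qed
   qed
   define m where "m = (\<Sum>p. if prime p then \<theta> p * sinq (\<eta> * ln (real p)) / real p else 0)"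
   have \<theta>1: "\<bar>\<theta> p\<bar> \<le> 1" for p by (simp add: \<theta>_def abs_prime_sign_le_1)
   have mlim: "(\<lambda>j. integral {-\<eta>..\<eta>} (\<lambda>t. E j t + G j t) / (2 * \<eta>)) \<longlonglongrightarrow> m"
   proof -
    have "filterlim \<sigma> (at_right 1) sequentially"
     unfolding filterlim_at
    proof
     show "\<sigma> \<longlonglongrightarrow> 1" unfolding \<sigma>_def by real_asymp
     show "\<forall>\<^sub>F j in sequentially. \<sigma> j \<in> {1<..} \<and> \<sigma> j \<noteq> 1" using \<sigma>(1) by (intro always_eventually) (metis greaterThan_iff less_irrefl)
    qed
    from filterlim_compose[OF tendsto_prime_sinc_sum[where \<theta> = \<theta>, OF \<eta>(1) \<theta>1] this]
    have "(\<lambda>j. \<Sum>n. if prime n then real n powr (- \<sigma> j) * \<theta> n * sinq (\<eta> * ln (real n)) else 0) \<longlonglongrightarrow> m" unfolding m_def .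
    moreover have "(\<Sum>n. if prime n then real n powr (- \<sigma> j) * \<theta> n * sinq (\<eta> * ln (real n)) else 0) = integral {-\<eta>..\<eta>} (\<lambda>t. E j t + G j t) / (2 * \<eta>)" for j
    proof -
     have "integral {-\<eta>..\<eta>} (D j) = integral {-\<eta>..\<eta>} (\<lambda>t. E j t + G j t)" by (rule integral_cong) (auto intro!: dec)
     thus ?thesis using sums_unique[OF sums_prime_average[where \<theta> = \<theta>, OF \<sigma>(1)[of j] \<eta>(1) \<theta>1]] by (simp add: D_def)
    qed
    ultimately show ?thesis by simp
   qed
   have mle: "- m + 4 * (\<Gamma>0 * \<eta>)^2 + \<epsilon> \<le> - sinc_prime_sum \<eta> + (Cm + 4 * \<Gamma>0^2) * \<eta>^2 + \<epsilon>" for \<epsilon>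
   proof -
    have "sinc_prime_sum \<eta> - Cm * \<eta>^2 \<le> m" unfolding m_def \<theta>_def using N by (intro Cm \<eta>) (simp add: N_def)
    thus ?thesis by (simp add: distrib_right power_mult_distrib)
   qed
   have "\<forall>\<^sub>F j in sequentially. integral {-\<eta>..\<eta>} (\<lambda>t. exp (- D j t)) \<le> 2 * \<eta> * exp (- sinc_prime_sum \<eta> + (Cm + 4 * \<Gamma>0^2) * \<eta>^2 + \<epsilon>)" if \<epsilon>: "\<epsilon> > 0" for \<epsilon>
   proof -
    have "\<forall>\<^sub>F j in sequentially. integral {-\<eta>..\<eta>} (\<lambda>t. exp (- (E j t + G j t))) \<le> 2 * \<eta> * exp (- m + 4 * (\<Gamma>0 * \<eta>)^2 + \<epsilon>)"
     by (rule exp_integral_perturbed[OF \<eta>(1) cE cG \<Gamma> \<eta>(3) B lim mlim \<epsilon>])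
    thus ?thesis
    proof eventually_elim
     case (elim j)
     have "integral {-\<eta>..\<eta>} (\<lambda>t. exp (- D j t)) = integral {-\<eta>..\<eta>} (\<lambda>t. exp (- (E j t + G j t)))"
     proof (rule integral_cong)
      fix t assume "t \<in> {-\<eta>..\<eta>}"
      thus "exp (- D j t) = exp (- (E j t + G j t))" by (subst dec) (auto simp: abs_le_iff)
     qed
     also have "\<dots> \<le> 2 * \<eta> * exp (- m + 4 * (\<Gamma>0 * \<eta>)^2 + \<epsilon>)" by (rule elim)
     also have "\<dots> \<le> 2 * \<eta> * exp (- sinc_prime_sum \<eta> + (Cm + 4 * \<Gamma>0^2) * \<eta>^2 + \<epsilon>)"
      using mle \<eta> by (intro mult_left_mono) auto
     finally show ?case .
    qed
   qed
   moreover have "\<theta> p = 1 \<or> 1 \<le> \<eta> * ln (real p)" for p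
    using pi_gt3 by (auto simp: \<theta>_def prime_sign_def)
   ultimately show "\<exists>\<theta>. (\<forall>n. \<bar>\<theta> n\<bar> \<le> 1) \<and> (\<forall>n. \<theta> n = 1 \<or> 1 \<le> \<eta> * ln (real n)) \<and>
    (\<forall>\<epsilon>>0. \<forall>\<^sub>F j in sequentially. integral {-\<eta>..\<eta>} (\<lambda>t. exp (- prime_cos_sum \<theta> (1 + c/4 / real (Suc j)) t))
     \<le> 2 * \<eta> * exp (- sinc_prime_sum \<eta> + (Cm + 4 * \<Gamma>0^2) * \<eta>^2 + \<epsilon>))"
    using \<theta>1 unfolding D_def \<sigma>_def by blast
  qed
 qed
qed

section \<open>Euler factors with prescribed signs\<close>

definition factor_log :: "real \<Rightarrow> real \<Rightarrow> real \<Rightarrow> real" where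
 "factor_log k r x = - k * (ln (1 - 2 * r * x + r^2) / 2)"

lemma euler_log_eq_factor_log:
 assumes "prime p" "\<sigma> > 1"
 shows "euler_log k \<sigma> t p = factor_log k (real p powr (-\<sigma>)) (cos (t * ln (real p)))"
 using euler_log_eq(1)[OF assms] by (simp add: factor_log_def)

lemma quadratic_ge:
 fixes r x :: real
 assumes "0 < r" "r \<le> 1/2" "\<bar>x\<bar> \<le> 1"
 shows "(1 - r)^2 \<le> 1 - 2 * r * x + r^2" "1/4 \<le> (1 - r)^2"
proof -
 have "2 * r * x \<le> 2 * r * 1" using assms by (intro mult_left_mono) auto
 thus "(1 - r)^2 \<le> 1 - 2 * r * x + r^2" by (simp add: power2_eq_square algebra_simps)
 have "(1/2)^2 \<le> (1 - r)^2" using assms by (intro power_mono) auto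
 thus "1/4 \<le> (1 - r)^2" by (simp add: power_divide)
qed

text \<open>For r \<le> 1/2 the quadratic is at least 1/4, so half its logarithm has slope at most 2
  in the cosine. This absorbs the error of approximate phases.\<close>

lemma factor_log_Lipschitz:
 assumes k: "k = 1 \<or> k = -1" and r: "0 < r" "r \<le> 1/2" and x: "\<bar>x\<bar> \<le> 1" "\<bar>y\<bar> \<le> 1"
 shows "\<bar>factor_log k r x - factor_log k r y\<bar> \<le> 2 * \<bar>x - y\<bar>"
proof -
 have one: "ln (1 - 2 * r * x + r^2) - ln (1 - 2 * r * y + r^2) \<le> 4 * \<bar>x - y\<bar>" if x: "\<bar>x\<bar> \<le> 1" "\<bar>y\<bar> \<le> 1" for x y
 proof -
  let ?q = "1 - 2 * r * x + r^2" and ?q' = "1 - 2 * r * y + r^2"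
  have q: "?q \<ge> 1/4" "?q' \<ge> 1/4" using quadratic_ge[OF r x(1)] quadratic_ge[OF r x(2)] by linarith+
  hence q0: "?q > 0" "?q' > 0" by linarith+
  have "ln ?q - ln ?q' = ln (?q / ?q')" using q0 by (simp add: ln_div)
  also have "\<dots> \<le> ?q / ?q' - 1" using q0 by (intro ln_le_minus_one divide_pos_pos)
  also have "\<dots> = (?q - ?q') / ?q'" unfolding diff_divide_distrib[of ?q ?q' ?q'] using q0 by (subst divide_self) auto
  also have "\<dots> \<le> \<bar>x - y\<bar> / ?q'"
  proof (rule divide_right_mono)
   have "?q - ?q' = 2 * r * (y - x)" by (simp add: algebra_simps)
   also have "\<dots> \<le> 2 * r * \<bar>x - y\<bar>" using r by (intro mult_left_mono) auto
   also have "\<dots> \<le> 1 * \<bar>x - y\<bar>" using r by (intro mult_right_mono) auto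
   finally show "?q - ?q' \<le> \<bar>x - y\<bar>" by simp
  qed (use q0 in simp)
  also have "\<dots> \<le> \<bar>x - y\<bar> / (1/4)" using q by (intro divide_left_mono) auto
  finally show ?thesis by simp
 qed
 have "\<bar>factor_log k r x - factor_log k r y\<bar> = \<bar>ln (1 - 2 * r * x + r^2) - ln (1 - 2 * r * y + r^2)\<bar> / 2"
 proof -
  have "\<bar>- k * (a / 2) - - k * (b / 2)\<bar> = \<bar>a - b\<bar> / 2" for a b
  proof -
   have "- k * (a / 2) - - k * (b / 2) = - k * (a - b) / 2" by (simp add: algebra_simps)
   thus ?thesis using k by (auto simp: abs_minus_commute)
  qed
  thus ?thesis by (simp only: factor_log_def)
 qed
 thus ?thesis using one[OF x] one[OF x(2,1)] unfolding abs_minus_commute[of y x] abs_le_iff by argo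
qed

lemma factor_log_approx:
 assumes k: "k = 1 \<or> k = -1" and r: "0 < r" "r \<le> 1/8" and x: "\<bar>x\<bar> \<le> 1"
 shows "\<bar>factor_log k r x - k * r * x\<bar> \<le> 10 * r^2"
proof -
 define z where "z = - 2 * r * x + r^2"
 have r2: "r^2 \<le> r / 8" using r by (simp add: power2_eq_square)
 have "\<bar>r * x\<bar> \<le> r * 1" unfolding abs_mult using r x by (intro mult_mono) auto
 moreover have "z = - 2 * (r * x) + r^2" by (simp add: z_def)
 ultimately have z: "\<bar>z\<bar> \<le> 3 * r" "\<bar>z\<bar> \<le> 1/2" using r2 r zero_le_power2[of r] unfolding abs_le_iff by argo+
 have "\<bar>ln (1 + z) - z\<bar> \<le> 2 * z^2" by (rule abs_ln_one_plus_x_minus_x_bound[OF z(2)])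
 also have "z^2 \<le> (3 * r)^2" using power_mono[OF z(1), of 2] by simp
 finally have b: "\<bar>ln (1 + z) - z\<bar> \<le> 18 * r^2" by (simp add: power_mult_distrib)
 have "factor_log k r x - k * r * x = - k * ((ln (1 + z) - z + r^2) / 2)"
  by (simp add: factor_log_def z_def algebra_simps add_divide_distrib)
 hence "\<bar>factor_log k r x - k * r * x\<bar> = \<bar>ln (1 + z) - z + r^2\<bar> / 2" using k by auto
 moreover have "\<bar>ln (1 + z) - z + r^2\<bar> \<le> 19 * r^2" using b zero_le_power2[of r] unfolding abs_le_iff by argo
 ultimately show ?thesis using zero_le_power2[of r] by argo
qed

text \<open>The left side is the mean of the Euler factor over a random sign of mean \<open>\<theta>\<close>.\<close>
lemma factor_mixture_bound:
 fixes r x \<theta> y :: real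
 assumes k: "k = 1 \<or> k = -1" and r: "0 < r" "r \<le> 1/2" and x: "\<bar>x\<bar> \<le> 1" and \<theta>: "\<bar>\<theta>\<bar> \<le> 1"
  and alt: "\<theta> = 1 \<and> 1 - x \<le> y \<or> r \<le> 1/8 \<and> 1 \<le> y"
 shows "(1 + \<theta>) / 2 * exp (factor_log k r (- k * x)) + (1 - \<theta>) / 2 * exp (factor_log k r (k * x))
   \<le> exp (r - k * ln (1 + k * r) - r * \<theta> * x + 21 * r^2 * y)"
 using alt
proof
 \<comment> \<open>The sign is certain here, and the error has to vanish with 1 - x: the factor is
   therefore compared with its extreme value at x = 1 and not with a Taylor polynomial.\<close>
 assume h: "\<theta> = 1 \<and> 1 - x \<le> y"
 have f: "factor_log k r (- k * x) \<le> - k * ln (1 + k * r) + r * (1 - x) / (1 - r)^2"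
  using k
 proof
  assume kap: "k = 1"
  let ?q = "1 + 2 * r * x + r^2"
  have q: "(1 - r)^2 \<le> ?q" "?q > 0" using quadratic_ge[OF r, of "-x"] x by auto
  have "2 * ln (1 + r) - ln ?q = ln ((1 + r)^2 / ?q)" using q r by (simp add: ln_div ln_realpow)
  also have "\<dots> \<le> (1 + r)^2 / ?q - 1" using q r by (intro ln_le_minus_one divide_pos_pos) auto
  also have "\<dots> = ((1 + r)^2 - ?q) / ?q" using q by (simp add: diff_divide_distrib)
  also have "(1 + r)^2 - ?q = 2 * (r * (1 - x))" by (simp add: power2_eq_square algebra_simps)
  also have "2 * (r * (1 - x)) / ?q \<le> 2 * (r * (1 - x)) / (1 - r)^2"
   using q r x by (intro divide_left_mono mult_nonneg_nonneg mult_pos_pos) auto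
  finally have "2 * ln (1 + r) - ln ?q \<le> 2 * (r * (1 - x) / (1 - r)^2)" by simp
  thus ?thesis using kap by (simp add: factor_log_def)
 next
  assume kap: "k = -1"
  let ?q = "1 - 2 * r * x + r^2"
  have q: "(1 - r)^2 \<le> ?q" "(1 - r)^2 > 0" "?q > 0" using quadratic_ge[OF r x] r by auto
  have "ln ?q - 2 * ln (1 - r) = ln (?q / (1 - r)^2)" using q r by (simp add: ln_div ln_realpow)
  also have "\<dots> \<le> ?q / (1 - r)^2 - 1" using q r by (intro ln_le_minus_one divide_pos_pos) auto
  also have "\<dots> = (?q - (1 - r)^2) / (1 - r)^2" using r by (simp add: diff_divide_distrib)
  also have "?q - (1 - r)^2 = 2 * (r * (1 - x))" by (simp add: power2_eq_square algebra_simps)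
  also have "2 * (r * (1 - x)) / (1 - r)^2 = 2 * (r * (1 - x) / (1 - r)^2)" by simp
  finally have "ln ?q / 2 \<le> ln (1 - r) + r * (1 - x) / (1 - r)^2" by argo
  thus ?thesis using kap by (simp add: factor_log_def)
 qed
 have "r * (1 - x) / (1 - r)^2 \<le> r * (1 - x) + 21 * r^2 * y"
 proof -
  have "1 \<le> (1 + 8 * r) * (1 - r)^2"
  proof -
   have "(1 + 8 * r) * (1 - r)^2 = 1 + r * ((1/2 - r) * (11 - 8 * r) + 1/2)" by (simp add: power2_eq_square algebra_simps)
   moreover have "r * ((1/2 - r) * (11 - 8 * r) + 1/2) \<ge> 0" using r by (intro mult_nonneg_nonneg add_nonneg_nonneg) auto
   ultimately show ?thesis by simp
  qed
  moreover have "r * (1 - x) \<ge> 0" using r x by auto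
  ultimately have "r * (1 - x) * 1 \<le> r * (1 - x) * ((1 + 8 * r) * (1 - r)^2)" by (intro mult_left_mono)
  hence "r * (1 - x) / (1 - r)^2 \<le> r * (1 - x) * (1 + 8 * r)"
   using r by (subst pos_divide_le_eq) (auto simp: mult_ac)
  also have "\<dots> = r * (1 - x) + 8 * r^2 * (1 - x)" by (simp add: power2_eq_square algebra_simps)
  also have "8 * r^2 * (1 - x) \<le> 21 * r^2 * y" using h x by (intro mult_mono) auto
  finally show ?thesis by simp
 qed
 hence "factor_log k r (- k * x) \<le> r - k * ln (1 + k * r) - r * \<theta> * x + 21 * r^2 * y"
  using f h by (simp add: algebra_simps)
 thus ?thesis using h by simp
next
 \<comment> \<open>Here y \<ge> 1, so any O(r^2) error is allowed: 10 r^2 from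
   \<open>factor_log_approx\<close>, 9 r^2 from the exponential and 2 r^2 from r - k ln (1 + k r)
   make up the 21. The mean of the sign enters through the linear terms.\<close>
 assume h: "r \<le> 1/8 \<and> 1 \<le> y"
 hence r8: "r \<le> 1/8" by simp
 have kx: "\<bar>- k * x\<bar> \<le> 1" "\<bar>k * x\<bar> \<le> 1" using k x by auto
 have kk: "k * r * (- k * x) = - (r * x)" "k * r * (k * x) = r * x" using k by auto
 define L1 where "L1 = factor_log k r (- k * x)"
 define L2 where "L2 = factor_log k r (k * x)"
 have a: "\<bar>L1 + r * x\<bar> \<le> 10 * r^2" "\<bar>L2 - r * x\<bar> \<le> 10 * r^2"
  using factor_log_approx[OF k r(1) r8 kx(1)] factor_log_approx[OF k r(1) r8 kx(2)] unfolding kk L1_def L2_def by auto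
 have "\<bar>r * x\<bar> \<le> r * 1" unfolding abs_mult using r x by (intro mult_mono) auto
 moreover have "10 * r^2 \<le> 2 * r" using r r8 by (simp add: power2_eq_square)
 ultimately have L: "\<bar>L1\<bar> \<le> 3 * r" "\<bar>L2\<bar> \<le> 3 * r" using a unfolding abs_le_iff by argo+
 have e: "exp l \<le> 1 + l + 9 * r^2" if "\<bar>l\<bar> \<le> 3 * r" for l
 proof -
  have "exp l \<le> 1 + l + l^2" using that r8 by (intro exp_le_quadratic) simp
  also have "l^2 \<le> (3 * r)^2" using power_mono[OF that, of 2] by simp
  finally show ?thesis by (simp add: power_mult_distrib)
 qed
 have e1: "exp L1 \<le> 1 - r * x + 19 * r^2" and e2: "exp L2 \<le> 1 + r * x + 19 * r^2"
  using e[OF L(1)] e[OF L(2)] a unfolding abs_le_iff by argo+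
 have "(1 + \<theta>) / 2 * exp L1 + (1 - \<theta>) / 2 * exp L2 \<le> (1 + \<theta>) / 2 * (1 - r * x + 19 * r^2) + (1 - \<theta>) / 2 * (1 + r * x + 19 * r^2)"
  using \<theta> e1 e2 by (intro add_mono mult_left_mono) (auto simp: abs_le_iff)
 also have "\<dots> = 1 + (- r * \<theta> * x + 19 * r^2)" by (simp add: field_simps)
 also have "\<dots> \<le> exp (- r * \<theta> * x + 19 * r^2)" by (rule exp_ge_add_one_self)
 also have "- r * \<theta> * x + 19 * r^2 \<le> r - k * ln (1 + k * r) - r * \<theta> * x + 21 * r^2 * y"
 proof -
  have "\<bar>r - k * ln (1 + k * r)\<bar> \<le> 2 * r^2" using r by (intro abs_minus_ln_le k) auto
  moreover have "21 * r^2 * 1 \<le> 21 * r^2 * y" using h by (intro mult_left_mono) auto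
  ultimately show ?thesis unfolding abs_le_iff by argo
 qed
 finally show ?thesis by (simp add: L1_def L2_def)
qed

text \<open>The method of conditional expectations: the signs are fixed one prime at a time.\<close>
lemma integral_prod_derandomize:
 fixes F :: "real \<Rightarrow> 'i \<Rightarrow> real \<Rightarrow> real"
 assumes "finite P" "\<And>p. p \<in> P ==> continuous_on {a..b} (F 1 p)" "\<And>p. p \<in> P ==> continuous_on {a..b} (F (-1) p)"
  "\<And>p. p \<in> P ==> \<bar>\<theta> p\<bar> \<le> 1" "continuous_on {a..b} h"
 shows "\<exists>e. (\<forall>p. e p = 1 \<or> e p = -1) \<and> integral {a..b} (\<lambda>t. h t * (\<Prod>p\<in>P. F (e p) p t))
   \<le> integral {a..b} (\<lambda>t. h t * (\<Prod>p\<in>P. (1 + \<theta> p) / 2 * F 1 p t + (1 - \<theta> p) / 2 * F (-1) p t))"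
 using assms
proof (induction P arbitrary: h rule: finite_induct)
 case empty
 show ?case by (rule exI[of _ "\<lambda>_. 1"]) simp
next
 case (insert q P)
 define mix where "mix = (\<lambda>t. \<Prod>p\<in>P. (1 + \<theta> p) / 2 * F 1 p t + (1 - \<theta> p) / 2 * F (-1) p t)"
 have cmix: "continuous_on {a..b} mix" unfolding mix_def using insert.prems by (intro continuous_intros) auto
 have c: "continuous_on {a..b} (F 1 q)" "continuous_on {a..b} (F (-1) q)" using insert.prems by auto
 let ?X = "\<lambda>s. integral {a..b} (\<lambda>t. (h t * F s q t) * mix t)"
 have X: "((\<lambda>t. (h t * F s q t) * mix t) has_integral ?X s) {a..b}" if "s = 1 \<or> s = -1" for s
  using that c cmix insert.prems by (auto intro!: integrable_integral integrable_continuous_real continuous_intros)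
 have "((\<lambda>t. (1 + \<theta> q) / 2 * ((h t * F 1 q t) * mix t) + (1 - \<theta> q) / 2 * ((h t * F (-1) q t) * mix t)) has_integral ((1 + \<theta> q) / 2 * ?X 1 + (1 - \<theta> q) / 2 * ?X (-1))) {a..b}"
  by (intro has_integral_add has_integral_mult_right X) auto
 moreover have "(1 + \<theta> q) / 2 * ((h t * F 1 q t) * mix t) + (1 - \<theta> q) / 2 * ((h t * F (-1) q t) * mix t) = h t * (\<Prod>p\<in>insert q P. (1 + \<theta> p) / 2 * F 1 p t + (1 - \<theta> p) / 2 * F (-1) p t)" for t
  using insert.hyps by (simp add: mix_def algebra_simps)
 ultimately have R: "integral {a..b} (\<lambda>t. h t * (\<Prod>p\<in>insert q P. (1 + \<theta> p) / 2 * F 1 p t + (1 - \<theta> p) / 2 * F (-1) p t)) = (1 + \<theta> q) / 2 * ?X 1 + (1 - \<theta> q) / 2 * ?X (-1)"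
  by (simp add: integral_unique)
 obtain s where s: "s = 1 \<or> s = -1" "?X s \<le> (1 + \<theta> q) / 2 * ?X 1 + (1 - \<theta> q) / 2 * ?X (-1)"
 proof (cases "?X 1 \<le> ?X (-1)")
  case True
  hence "(1 - \<theta> q) / 2 * ?X 1 \<le> (1 - \<theta> q) / 2 * ?X (-1)" using insert.prems(3)[of q] by (intro mult_left_mono) (auto simp: abs_le_iff)
  moreover have "?X 1 = (1 + \<theta> q) / 2 * ?X 1 + (1 - \<theta> q) / 2 * ?X 1" by (simp add: field_simps)
  ultimately show ?thesis using that[of 1] by linarith
 next
  case False
  hence "(1 + \<theta> q) / 2 * ?X (-1) \<le> (1 + \<theta> q) / 2 * ?X 1" using insert.prems(3)[of q] by (intro mult_left_mono) (auto simp: abs_le_iff)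
  moreover have "?X (-1) = (1 + \<theta> q) / 2 * ?X (-1) + (1 - \<theta> q) / 2 * ?X (-1)" by (simp add: field_simps)
  ultimately show ?thesis using that[of "-1"] by linarith
 qed
 have "continuous_on {a..b} (\<lambda>t. h t * F s q t)" using s(1) c insert.prems by (auto intro!: continuous_intros)
 then obtain e where e: "\<forall>p. e p = 1 \<or> e p = -1"
  "integral {a..b} (\<lambda>t. (h t * F s q t) * (\<Prod>p\<in>P. F (e p) p t)) \<le> ?X s"
  using insert.IH[of "\<lambda>t. h t * F s q t"] insert.prems unfolding mix_def by auto
 have "h t * (\<Prod>p\<in>insert q P. F ((e(q := s)) p) p t) = (h t * F s q t) * (\<Prod>p\<in>P. F (e p) p t)" for t
 proof -
  have "(\<Prod>p\<in>P. F ((e(q := s)) p) p t) = (\<Prod>p\<in>P. F (e p) p t)" using insert.hyps by (intro prod.cong) auto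
  thus ?thesis using insert.hyps by simp
 qed
 hence "integral {a..b} (\<lambda>t. h t * (\<Prod>p\<in>insert q P. F ((e(q := s)) p) p t)) \<le> integral {a..b} (\<lambda>t. h t * (\<Prod>p\<in>insert q P. (1 + \<theta> p) / 2 * F 1 p t + (1 - \<theta> p) / 2 * F (-1) p t))"
  unfolding R using order_trans[OF e(2) s(2)] by (simp only:)
 moreover have "\<forall>p. (e(q := s)) p = 1 \<or> (e(q := s)) p = -1" using e(1) s(1) by simp
 ultimately show ?case by blast
qed

lemma abs_cos_diff_le: "\<bar>cos (y + d) - cos y\<bar> \<le> \<bar>d\<bar>" for y d :: real
proof -
 have "cos (y + d) - cos y = - 2 * (sin (y + d/2) * sin (d/2))"
  by (simp add: cos_diff_cos add_divide_distrib)
 moreover have "\<bar>sin (y + d/2) * sin (d/2)\<bar> \<le> 1 * \<bar>d/2\<bar>"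
  unfolding abs_mult by (intro mult_mono abs_sin_x_le_abs_x) auto
 ultimately show ?thesis by (simp add: abs_mult)
qed

section \<open>Prescribed phases by Kronecker's theorem\<close>

text \<open>Unique factorisation: the positive and the negative coefficients give two products of
  prime powers with equal logarithms, hence with equal multiplicities.\<close>

lemma log_primes_independent:
 fixes k :: "nat \<Rightarrow> int"
 assumes P: "finite P" "\<And>p. p \<in> P ==> prime p" and 0: "(\<Sum>p\<in>P. real_of_int (k p) * ln (real p)) = 0"
  and q: "q \<in> P"
 shows "k q = 0"
proof -
 define f g where "f = (\<lambda>p. nat (k p))" and "g = (\<lambda>p. nat (- k p))"
 have lnp: "ln (real (\<Prod>p\<in>P. p ^ f p)) = (\<Sum>p\<in>P. real (f p) * ln (real p))" for f :: "nat \<Rightarrow> nat"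
 proof -
  have "ln (real (\<Prod>p\<in>P. p ^ f p)) = ln (\<Prod>p\<in>P. real p ^ f p)" by simp
  also have "\<dots> = (\<Sum>p\<in>P. ln (real p ^ f p))" using P prime_gt_0_nat by (intro ln_prod) auto
  also have "\<dots> = (\<Sum>p\<in>P. real (f p) * ln (real p))" using P prime_gt_0_nat by (intro sum.cong) (auto simp: ln_realpow)
  finally show ?thesis .
 qed
 have "real (f p) - real (g p) = real_of_int (k p)" for p by (auto simp: f_def g_def)
 hence "(\<Sum>p\<in>P. real (f p) * ln (real p)) - (\<Sum>p\<in>P. real (g p) * ln (real p)) = 0"
  using 0 by (simp flip: sum_subtractf left_diff_distrib)
 hence "ln (real (\<Prod>p\<in>P. p ^ f p)) = ln (real (\<Prod>p\<in>P. p ^ g p))" unfolding lnp by simp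
 moreover have "(\<Prod>p\<in>P. p ^ f p) > 0" "(\<Prod>p\<in>P. p ^ g p) > 0" using P prime_gt_0_nat by (auto intro!: prod_pos)
 ultimately have "real (\<Prod>p\<in>P. p ^ f p) = real (\<Prod>p\<in>P. p ^ g p)" by (metis ln_inj_iff of_nat_0_less_iff)
 hence "(\<Prod>p\<in>P. p ^ f p) = (\<Prod>p\<in>P. p ^ g p)" by (simp only: of_nat_eq_iff)
 hence "multiplicity q (\<Prod>p\<in>P. p ^ f p) = multiplicity q (\<Prod>p\<in>P. p ^ g p)" by simp
 hence "f q = g q" using P q by (simp add: multiplicity_prod_prime_powers)
 thus ?thesis by (auto simp: f_def g_def)
qed

text \<open>Kronecker's theorem, applicable since the ln p are linearly independent over the
  integers, yields some \<open>t\<close> without control of its size. A simultaneous Dirichlet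
  approximation supplies large almost periods, by which \<open>t\<close> is moved beyond
  \<open>T0\<close>.\<close>

lemma prime_phases:
 fixes \<alpha> :: "nat \<Rightarrow> real"
 assumes P: "finite P" "\<And>p. p \<in> P ==> prime p" and e: "e > 0"
 shows "\<exists>T\<ge>T0. \<forall>p\<in>P. \<exists>h::int. \<bar>T * ln (real p) / (2 * pi) - of_int h - \<alpha> p\<bar> < e"
proof -
 interpret Modules.module "(\<lambda>r. (*) (real_of_int r))"
  by (simp add: Modules.module.intro distrib_left mult.commute)
 define n where "n = card P"
 obtain f where f: "bij_betw f {0..<n} P" using ex_bij_betw_nat_finite[OF P(1)] unfolding n_def by blast
 have fP: "f i \<in> P" if "i < n" for i using f that by (auto simp: bij_betw_def)
 define l where "l = (\<lambda>p. ln (real p) / (2 * pi))"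
 define \<theta> where "\<theta> = (\<lambda>i. l (f i))"
 have injl: "inj_on l P"
 proof (rule inj_onI)
  fix p q assume "p \<in> P" "q \<in> P" "l p = l q"
  thus "p = q" using P(2) prime_gt_0_nat by (simp add: l_def)
 qed
 have inj: "inj_on \<theta> {..<n}"
  using comp_inj_on[of f "{..<n}" l] f injl by (auto simp: \<theta>_def bij_betw_def atLeast0LessThan comp_def)
 have img: "\<theta> ` {..<n} = l ` P" using f by (auto simp: \<theta>_def bij_betw_def atLeast0LessThan image_image[symmetric])
 have indep: "independent (\<theta> ` {..<n})"
  unfolding img
 proof
  assume "dependent (l ` P)"
  then obtain u where u: "\<exists>v\<in>l ` P. u v \<noteq> 0" "(\<Sum>v\<in>l ` P. real_of_int (u v) * v) = 0"
   using dependent_finite[of "l ` P"] P(1) by auto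
  then obtain q where q: "q \<in> P" "u (l q) \<noteq> 0" by auto
  have "(\<Sum>p\<in>P. real_of_int (u (l p)) * l p) = 0" using u(2) by (simp add: sum.reindex[OF injl])
  hence "(\<Sum>p\<in>P. real_of_int (u (l p)) * ln (real p)) / (2 * pi) = 0" by (simp add: l_def sum_divide_distrib)
  hence "(\<Sum>p\<in>P. real_of_int (u (l p)) * ln (real p)) = 0" by simp
  thus False using log_primes_independent[OF P, of "\<lambda>p. u (l p)" q] q by simp
 qed
 obtain t h where th: "\<And>i. i < n ==> \<bar>t * \<theta> i - of_int (h i) - \<alpha> (f i)\<bar> < e/2"
  using Kronecker_thm_1[OF indep inj, of "e/2" "\<lambda>i. \<alpha> (f i)"] e by auto
 define N where "N = nat \<lceil>2 / e\<rceil>"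
 have N: "2 / e \<le> real N" unfolding N_def by (rule real_nat_ceiling_ge)
 have N0: "N > 0" using N e by (metis divide_pos_pos gr0I less_le_not_le of_nat_0 zero_less_numeral)
 have Ne: "1 / real N \<le> e/2" using N e N0 by (simp add: field_simps)
 \<comment> \<open>With this \<open>M\<close> already q = 1 would carry \<open>t\<close> past
   \<open>T0\<close>, and the multiple q M is almost a common period of all the phases.\<close>
 define M where "M = \<bar>T0\<bar> + \<bar>t\<bar>"
 obtain q m where qm: "0 < q" "\<And>i. i < n ==> \<bar>of_int q * (M * \<theta> i) - of_int (m i)\<bar> < 1 / real N"
  by (rule Dirichlet_approx_simult[OF N0, where n = n and \<theta> = "\<lambda>i. M * \<theta> i"]) auto
 define T where "T = t + of_int q * M"
 have "1 * M \<le> of_int q * M" using qm(1) by (intro mult_right_mono) (auto simp: M_def)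
 moreover have "T0 \<le> t + M" unfolding M_def by linarith
 ultimately have "T \<ge> T0" unfolding T_def by linarith
 moreover have "\<exists>h::int. \<bar>T * ln (real p) / (2 * pi) - of_int h - \<alpha> p\<bar> < e" if pP: "p \<in> P" for p
 proof -
  obtain i where i: "i < n" "f i = p" using f pP by (auto simp: bij_betw_def)
  have "T * ln (real p) / (2 * pi) - of_int (h i + m i) - \<alpha> p = (t * \<theta> i - of_int (h i) - \<alpha> (f i)) + (of_int q * (M * \<theta> i) - of_int (m i))"
   using i by (simp add: T_def \<theta>_def l_def add_divide_distrib distrib_right mult.assoc)
  thus ?thesis using th[OF i(1)] qm(2)[OF i(1)] Ne by (intro exI[of _ "h i + m i"]) linarith
 qed
 ultimately show ?thesis by blast
qed

section \<open>Assembling the upper bound\<close>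

definition corr_sum_at :: "real \<Rightarrow> real \<Rightarrow> real" where
 "corr_sum_at k \<sigma> = (\<Sum>n. if prime n then real n powr (-\<sigma>) - k * ln (1 + k * real n powr (-\<sigma>)) else 0)"

lemma prime_corr_at_bound:
 assumes "k = 1 \<or> k = -1" "\<sigma> > 1"
 shows "norm (if prime n then real n powr (-\<sigma>) - k * ln (1 + k * real n powr (-\<sigma>)) else 0) \<le> 2 * real n powr (-2)"
proof (cases "prime n")
 case True
 have n: "real n \<ge> 2" using ln_prime_ge[OF True] by simp
 note b = prime_powr_bounds[OF True assms(2)]
 have "\<bar>real n powr (-\<sigma>) - k * ln (1 + k * real n powr (-\<sigma>))\<bar> \<le> 2 * (real n powr (-\<sigma>))^2"
  using b by (intro abs_minus_ln_le assms) auto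
 also have "\<dots> \<le> 2 * (1 / real n)^2" using b by (intro mult_left_mono power_mono) auto
 also have "(1 / real n)^2 = real n powr (-2)" using n by (simp add: powr_minus_divide power_divide)
 finally show ?thesis using True by simp
qed simp

lemma summable_double_inverse_square: "summable (\<lambda>n. 2 * real n powr (-2))"
 by (intro summable_mult) (simp add: summable_real_powr_iff)

lemma summable_corr_at:
 assumes "k = 1 \<or> k = -1" "\<sigma> > 1"
 shows "summable (\<lambda>n. if prime n then real n powr (-\<sigma>) - k * ln (1 + k * real n powr (-\<sigma>)) else 0)"
 by (rule summable_comparison_test'[OF summable_double_inverse_square, of 0]) (rule prime_corr_at_bound[OF assms])

lemma tendsto_corr_sum_at:
 assumes k: "k = 1 \<or> k = -1" and s: "\<And>j. s j > 1" "s \<longlonglongrightarrow> 1"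
 shows "(\<lambda>j. corr_sum_at k (s j)) \<longlonglongrightarrow> corr_sum k"
proof -
 let ?f = "\<lambda>n j. if prime n then real n powr (- s j) - k * ln (1 + k * real n powr (- s j)) else 0"
 have "(?f n) \<longlonglongrightarrow> (if prime n then prime_corr k n else 0)" for n
 proof (cases "prime n")
  case True
  have n: "real n \<ge> 2" using ln_prime_ge[OF True] by simp
  have "(\<lambda>j. real n powr (- s j)) \<longlonglongrightarrow> real n powr (- 1)" using n by (intro tendsto_intros s) auto
  moreover have "real n powr (-1) = 1 / real n" using n by (simp add: powr_minus_divide)
  ultimately have l: "(\<lambda>j. real n powr (- s j)) \<longlonglongrightarrow> 1 / real n" by simp
  have "1 + k * (1 / real n) \<noteq> 0" using k n by (auto simp: field_simps)
  hence "(\<lambda>j. real n powr (- s j) - k * ln (1 + k * real n powr (- s j))) \<longlonglongrightarrow> 1 / real n - k * ln (1 + k * (1 / real n))"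
   by (intro tendsto_intros l)
  thus ?thesis using True by (simp add: prime_corr_def)
 qed simp
 moreover have "\<forall>\<^sub>F (n, j) in at_top \<times>\<^sub>F sequentially. norm (?f n j) \<le> 2 * real n powr (-2)"
  by (intro always_eventually) (auto simp only: case_prod_unfold intro!: prime_corr_at_bound[OF k s(1)])
 ultimately show ?thesis
  using tannerys_theorem[of ?f "\<lambda>n. if prime n then prime_corr k n else 0" sequentially "\<lambda>n. 2 * real n powr (-2)"] summable_double_inverse_square
  unfolding corr_sum_at_def corr_sum_def by simp
qed

lemma prime_cos_sum_facts:
 assumes \<sigma>: "\<sigma> > 1" and \<theta>: "\<And>n. \<bar>\<theta> n\<bar> \<le> (1::real)"
 shows summable_prime_cos_sum: "summable (\<lambda>n. if prime n then real n powr (-\<sigma>) * \<theta> n * cos (t * ln (real n)) else 0)"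
  and continuous_on_prime_cos_sum: "continuous_on S (prime_cos_sum \<theta> \<sigma>)"
proof -
 let ?f = "\<lambda>n t. if prime n then real n powr (-\<sigma>) * \<theta> n * cos (t * ln (real n)) else 0"
 have b: "norm (?f n t) \<le> (if prime n then real n powr (-\<sigma>) else 0)" for n t
 proof -
  have "\<bar>\<theta> n\<bar> * \<bar>cos (t * ln (real n))\<bar> \<le> 1 * 1" using \<theta> by (intro mult_mono) auto
  hence "real n powr (-\<sigma>) * (\<bar>\<theta> n\<bar> * \<bar>cos (t * ln (real n))\<bar>) \<le> real n powr (-\<sigma>) * (1 * 1)"
   by (intro mult_left_mono) auto
  thus ?thesis by (simp add: abs_mult mult.assoc)
 qed
 show "summable (\<lambda>n. ?f n t)" by (rule summable_comparison_test'[OF summable_prime_powr[OF \<sigma>], of 0]) (rule b)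
 have ul: "uniform_limit S (\<lambda>N t. \<Sum>n<N. ?f n t) (\<lambda>t. \<Sum>n. ?f n t) sequentially"
  by (rule Weierstrass_m_test[OF b summable_prime_powr[OF \<sigma>]])
 have "continuous_on S (?f n)" for n by (cases "prime n") (auto intro!: continuous_intros)
 hence "continuous_on S (\<lambda>t. \<Sum>n<N. ?f n t)" for N by (intro continuous_on_sum)
 thus "continuous_on S (\<lambda>t. \<Sum>n. ?f n t)" by (intro uniform_limit_theorem[OF _ ul] always_eventually allI) auto
qed

lemma continuous_on_factor_log:
 assumes "0 < r" "r \<le> 1/2" "\<bar>k\<bar> \<le> 1"
 shows "continuous_on S (\<lambda>t. exp (factor_log s r (k * cos (t * u))))"
proof -
 have "1 - 2 * r * (k * cos (t * u)) + r^2 \<noteq> 0" for t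
 proof -
  have "\<bar>k * cos (t * u)\<bar> \<le> 1 * 1" unfolding abs_mult using assms by (intro mult_mono) auto
  thus ?thesis using quadratic_ge[OF assms(1,2), of "k * cos (t * u)"] by linarith
 qed
 hence "continuous_on S (\<lambda>t. ln (1 - 2 * r * (k * cos (t * u)) + r^2))"
  by (intro continuous_on_ln ballI) (auto intro!: continuous_intros)
 thus ?thesis unfolding factor_log_def
  by (intro continuous_on_exp continuous_on_mult_left continuous_on_divide continuous_on_const) auto
qed

text \<open>The mean over independent signs of the product is the product of the mixtures, bounded
  factor by factor by \<open>factor_mixture_bound\<close>. Derandomisation picks definite signs
  \<open>e\<close>; then a point \<open>T'\<close> is found where p^(-iT') is close to - k e p for
  every prime p up to \<open>N\<close>, so that near \<open>T'\<close> the Euler factors have these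
  signs.\<close>

lemma zeta_power_integral_upper_fixed:
 assumes k: "k = 1 \<or> k = -1" and \<sigma>: "\<sigma> > 1" and \<eta>: "0 < \<eta>" "\<eta> \<le> 1/3"
  and \<theta>: "\<And>n. \<bar>\<theta> n\<bar> \<le> 1" "\<And>n. \<theta> n = 1 \<or> 1 \<le> \<eta> * ln (real n)" and \<epsilon>: "\<epsilon> > 0"
 shows "\<exists>T\<ge>T0. integral {T..T + 2 * \<eta>} (zeta_power k \<sigma>)
  \<le> exp (corr_sum_at k \<sigma> + 21 * log_square_sum * \<eta>^2 + \<epsilon>) *
    integral {-\<eta>..\<eta>} (\<lambda>t. exp (- prime_cos_sum \<theta> \<sigma> t))"
proof -
 define r u where "r = (\<lambda>p. real p powr (-\<sigma>))" and "u = (\<lambda>p. ln (real p))"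
 define D where "D = (\<lambda>t. \<Sum>n. if prime n then r n * \<theta> n * cos (t * u n) else 0)"
 define cp where "cp = (\<lambda>p. r p - k * ln (1 + k * r p))"
 \<comment> \<open>Five shares: one for the tail and one for the partial sum of corrections in
   \<open>B\<close>, two for the tail in the passage to zeta, one for the phases.\<close>
 define \<epsilon>' where "\<epsilon>' = \<epsilon> / 5"
 have \<epsilon>': "\<epsilon>' > 0" using \<epsilon> by (simp add: \<epsilon>'_def)
 have rb: "0 < r p" "r p \<le> 1/2" "r p \<le> 1 / real p" if "prime p" for p
  using prime_powr_bounds[OF that \<sigma>] by (auto simp: r_def)
 define R where "R = (\<Sum>n. if prime n then r n else 0)"
 define tail where "tail = (\<lambda>N. R - (\<Sum>p\<in>primes_upto N. r p))"
 have "tail \<longlonglongrightarrow> 0" using prime_tail_tendsto_0[OF \<sigma>] unfolding tail_def R_def r_def .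
 hence ev1: "\<forall>\<^sub>F N in sequentially. tail N < \<epsilon>'" using \<epsilon>' by (rule order_tendstoD)
 have "(\<lambda>N. \<Sum>p\<in>primes_upto N. cp p) \<longlonglongrightarrow> corr_sum_at k \<sigma>"
  unfolding corr_sum_at_def cp_def r_def by (intro sums_primes_upto summable_sums summable_corr_at k \<sigma>)
 hence ev2: "\<forall>\<^sub>F N in sequentially. (\<Sum>p\<in>primes_upto N. cp p) < corr_sum_at k \<sigma> + \<epsilon>'" using \<epsilon>' by (intro order_tendstoD) auto
 obtain N where N: "tail N < \<epsilon>'" "(\<Sum>p\<in>primes_upto N. cp p) < corr_sum_at k \<sigma> + \<epsilon>'"
  using eventually_conj[OF ev1 ev2] by (auto simp: eventually_sequentially)
 define P where "P = primes_upto N"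
 have P: "finite P" "\<And>p. p \<in> P ==> prime p" by (auto simp: P_def finite_primes_upto prime_of_primes_upto)
 define F where "F = (\<lambda>e p t. exp (factor_log k (r p) (- k * e * cos (t * u p))))"
 have cF: "continuous_on {-\<eta>..\<eta>} (F e p)" if "p \<in> P" "e = 1 \<or> e = -1" for e p
  unfolding F_def using k that(2) rb[OF P(2)[OF that(1)]] by (intro continuous_on_factor_log) auto
 obtain e where e: "\<And>p. e p = 1 \<or> e p = -1"
  "integral {-\<eta>..\<eta>} (\<lambda>t. 1 * (\<Prod>p\<in>P. F (e p) p t)) \<le> integral {-\<eta>..\<eta>} (\<lambda>t. 1 * (\<Prod>p\<in>P. (1 + \<theta> p) / 2 * F 1 p t + (1 - \<theta> p) / 2 * F (-1) p t))"
  using integral_prod_derandomize[of P "-\<eta>" \<eta> F \<theta> "\<lambda>_. 1"] P(1) cF \<theta>(1) by auto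
 define B where "B = corr_sum_at k \<sigma> + 21 * log_square_sum * \<eta>^2 + 2 * \<epsilon>'"
 have mix: "(\<Prod>p\<in>P. (1 + \<theta> p) / 2 * F 1 p t + (1 - \<theta> p) / 2 * F (-1) p t) \<le> exp B * exp (- D t)" if t: "\<bar>t\<bar> \<le> \<eta>" for t
 proof -
  have "(\<Prod>p\<in>P. (1 + \<theta> p) / 2 * F 1 p t + (1 - \<theta> p) / 2 * F (-1) p t) \<le> (\<Prod>p\<in>P. exp (cp p - r p * \<theta> p * cos (t * u p) + 21 * (r p)^2 * (\<eta> * u p)^2))"
  proof (rule prod_mono, rule conjI)
   fix p assume "p \<in> P"
   hence p: "prime p" by (rule P(2))
   show "0 \<le> (1 + \<theta> p) / 2 * F 1 p t + (1 - \<theta> p) / 2 * F (-1) p t"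
    using \<theta>(1)[of p] by (auto simp: F_def abs_le_iff intro!: add_nonneg_nonneg mult_nonneg_nonneg)
   have up: "u p > 0" using ln_prime_ge[OF p] by (simp add: u_def)
   have "\<theta> p = 1 \<and> 1 - cos (t * u p) \<le> (\<eta> * u p)^2 \<or> r p \<le> 1/8 \<and> 1 \<le> (\<eta> * u p)^2"
   proof (cases "\<theta> p = 1")
    case True
    have "(t * u p)^2 \<le> (\<eta> * u p)^2" unfolding power_mult_distrib using t by (intro mult_right_mono) (auto simp: abs_le_square_iff[symmetric])
    thus ?thesis using True one_minus_cos_le[of "t * u p"] zero_le_power2[of "\<eta> * u p"] by linarith
   next
    case False
    hence 1: "1 \<le> \<eta> * u p" using \<theta>(2)[of p] by (simp add: u_def)
    also have "\<dots> \<le> 1/3 * u p" using \<eta> up by (intro mult_right_mono) auto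
    finally have "3 \<le> u p" by simp
    hence "exp 3 \<le> exp (u p)" by simp
    moreover have "exp (u p) = real p" using prime_gt_0_nat[OF p] by (simp add: u_def)
    moreover have "exp 3 \<ge> (8::real)"
    proof -
     have "(2::real) \<le> exp 1" using exp_ge_add_one_self[of 1] by simp
     hence "(2::real) ^ 3 \<le> exp 1 ^ 3" by (intro power_mono) auto
     thus ?thesis by (simp flip: exp_of_nat_mult)
    qed
    ultimately have "real p \<ge> 8" by linarith
    hence "1 / real p \<le> 1 / 8" by (intro divide_left_mono) auto
    moreover have "1 \<le> (\<eta> * u p)^2" using 1 by (simp add: one_le_power)
    ultimately show ?thesis using rb[OF p] by auto
   qed
   thus "(1 + \<theta> p) / 2 * F 1 p t + (1 - \<theta> p) / 2 * F (-1) p t \<le> exp (cp p - r p * \<theta> p * cos (t * u p) + 21 * (r p)^2 * (\<eta> * u p)^2)"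
    using factor_mixture_bound[OF k rb(1,2)[OF p], of "cos (t * u p)" "\<theta> p" "(\<eta> * u p)^2"] \<theta>(1)[of p]
    by (simp add: F_def cp_def)
  qed
  also have "\<dots> = exp ((\<Sum>p\<in>P. cp p) - (\<Sum>p\<in>P. r p * \<theta> p * cos (t * u p)) + (\<Sum>p\<in>P. 21 * (r p)^2 * (\<eta> * u p)^2))"
   using P(1) by (simp add: exp_sum[symmetric] sum.distrib sum_subtractf)
  also have "\<dots> \<le> exp (B - D t)"
  proof -
   have "(\<Sum>p\<in>P. 21 * (r p)^2 * (\<eta> * u p)^2) \<le> (\<Sum>p\<in>P. 21 * \<eta>^2 * ((u p)^2 / (real p)^2))"
   proof (rule sum_mono)
    fix p assume "p \<in> P"
    hence p: "prime p" by (rule P(2))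
    have "(r p)^2 \<le> (1 / real p)^2" using rb[OF p] by (intro power_mono) auto
    hence "(21 * (\<eta> * u p)^2) * (r p)^2 \<le> (21 * (\<eta> * u p)^2) * (1 / real p)^2" by (intro mult_left_mono) auto
    thus "21 * (r p)^2 * (\<eta> * u p)^2 \<le> 21 * \<eta>^2 * ((u p)^2 / (real p)^2)" by (simp add: power_mult_distrib power_divide mult_ac)
   qed
   also have "\<dots> = 21 * \<eta>^2 * (\<Sum>p\<in>P. (u p)^2 / (real p)^2)" by (simp add: sum_distrib_left)
   also have "\<dots> \<le> 21 * \<eta>^2 * log_square_sum"
   proof (rule mult_left_mono)
    show "(\<Sum>p\<in>P. (u p)^2 / (real p)^2) \<le> log_square_sum"
     unfolding P_def sum_primes_upto log_square_sum_def u_def by (intro sum_le_suminf summable_log_square) auto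
   qed simp
   finally have 1: "(\<Sum>p\<in>P. 21 * (r p)^2 * (\<eta> * u p)^2) \<le> 21 * log_square_sum * \<eta>^2" by (simp add: mult_ac)
   have 2: "D t \<le> tail N + (\<Sum>p\<in>P. r p * \<theta> p * cos (t * u p))"
   proof -
    let ?g = "\<lambda>n. (if prime n then r n else 0) - (if prime n then r n * \<theta> n * cos (t * u n) else 0)"
    have s1: "summable (\<lambda>n. if prime n then r n else 0)" unfolding r_def by (rule summable_prime_powr[OF \<sigma>])
    have s2: "summable (\<lambda>n. if prime n then r n * \<theta> n * cos (t * u n) else 0)"
     unfolding r_def u_def by (rule summable_prime_cos_sum[OF \<sigma> \<theta>(1)])
    have "(\<Sum>n<Suc N. ?g n) \<le> suminf ?g"
    proof (rule sum_le_suminf[OF summable_diff[OF s1 s2]])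
     fix n
     have "\<theta> n * cos (t * u n) \<le> 1"
     proof -
      have "\<bar>\<theta> n * cos (t * u n)\<bar> \<le> 1 * 1" unfolding abs_mult using \<theta>(1) by (intro mult_mono) auto
      thus ?thesis by (simp add: abs_le_iff)
     qed
     hence "r n * (\<theta> n * cos (t * u n)) \<le> r n * 1" by (intro mult_left_mono) (auto simp: r_def)
     thus "0 \<le> ?g n" by (simp add: mult.assoc)
    qed simp
    also have "suminf ?g = R - D t" unfolding R_def D_def by (rule suminf_diff[OF s1 s2, symmetric])
    finally show ?thesis unfolding tail_def P_def sum_primes_upto sum_subtractf by linarith
   qed
   show ?thesis using 1 2 N unfolding B_def P_def[symmetric] by simp
  qed
  also have "exp (B - D t) = exp B * exp (- D t)" by (simp flip: exp_add)
  finally show ?thesis .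
 qed
 \<comment> \<open>Phases in units of a full turn: 0 leaves the sign of the cosine, 1/2 reverses
   it.\<close>
 define \<alpha> where "\<alpha> = (\<lambda>p. if - k * e p = 1 then 0 else 1/2 :: real)"
 \<comment> \<open>A phase error \<open>\<rho>\<close> moves the logarithm of one factor by at most
   4 pi \<rho>, since a turn is 2 pi and the Lipschitz constant is 2. Over all of \<open>P\<close>
   this adds up to at most \<open>\<epsilon>'\<close>.\<close>
 define \<rho> where "\<rho> = \<epsilon>' / (4 * pi * (real (card P) + 1))"
 have \<rho>: "\<rho> > 0" using \<epsilon>' by (simp add: \<rho>_def add_nonneg_pos)
 obtain T' where T': "T' \<ge> T0 + \<eta>" "\<forall>p\<in>P. \<exists>h::int. \<bar>T' * ln (real p) / (2 * pi) - of_int h - \<alpha> p\<bar> < \<rho>"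
  using prime_phases[OF P \<rho>, of "T0 + \<eta>" \<alpha>] by auto
 have ph: "euler_log k \<sigma> (T' + t) p \<le> factor_log k (r p) (- k * e p * cos (t * u p)) + 4 * pi * \<rho>" if p: "p \<in> P" for t p
 proof -
  obtain h :: int where h: "\<bar>T' * ln (real p) / (2 * pi) - of_int h - \<alpha> p\<bar> < \<rho>" using T'(2) p by blast
  define d where "d = T' * u p - 2 * pi * of_int h - 2 * pi * \<alpha> p"
  have "d = 2 * pi * (T' * ln (real p) / (2 * pi) - of_int h - \<alpha> p)" by (simp add: d_def u_def right_diff_distrib)
  hence d: "\<bar>d\<bar> \<le> 2 * pi * \<rho>" using h by (simp add: abs_mult)
  have ke: "- k * e p = 1 \<or> - k * e p = -1" using k e(1)[of p] by auto
  have c1: "cos (2 * pi * of_int h + (2 * pi * \<alpha> p + t * u p)) = - k * e p * cos (t * u p)"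
  proof -
   have "cos (2 * pi * of_int h + y) = cos y" for y
    using cos_int_2pin[of h] sin_int_2pin[of h] by (simp add: cos_add mult_ac)
   hence "cos (2 * pi * of_int h + (2 * pi * \<alpha> p + t * u p)) = cos (2 * pi * \<alpha> p + t * u p)" .
   also have "\<dots> = - k * e p * cos (t * u p)"
    using ke by (auto simp: \<alpha>_def cos_add)
   finally show ?thesis .
  qed
  have "(T' + t) * u p = (2 * pi * of_int h + (2 * pi * \<alpha> p + t * u p)) + d" by (simp add: d_def algebra_simps)
  hence "\<bar>cos ((T' + t) * u p) - cos (2 * pi * of_int h + (2 * pi * \<alpha> p + t * u p))\<bar> \<le> \<bar>d\<bar>"
   using abs_cos_diff_le by simp
  hence cd: "\<bar>cos ((T' + t) * u p) - (- k * e p * cos (t * u p))\<bar> \<le> 2 * pi * \<rho>" using d unfolding c1 by linarith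
  have "\<bar>- k * e p * cos (t * u p)\<bar> \<le> 1" using ke abs_cos_le_one[of "t * u p"] by auto
  hence "\<bar>factor_log k (r p) (cos ((T' + t) * u p)) - factor_log k (r p) (- k * e p * cos (t * u p))\<bar> \<le> 2 * \<bar>cos ((T' + t) * u p) - (- k * e p * cos (t * u p))\<bar>"
   by (intro factor_log_Lipschitz k rb P(2)[OF p]) auto
  hence "factor_log k (r p) (cos ((T' + t) * u p)) \<le> factor_log k (r p) (- k * e p * cos (t * u p)) + 4 * pi * \<rho>"
   using cd unfolding abs_le_iff by argo
  thus ?thesis using euler_log_eq_factor_log[OF P(2)[OF p] \<sigma>, of k "T' + t"] by (simp add: r_def u_def)
 qed
 have point: "zeta_power k \<sigma> (T' + t) \<le> exp (3 * \<epsilon>') * (\<Prod>p\<in>P. F (e p) p t)" for t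
 proof -
  have "k * ln (norm (zeta (Complex \<sigma> (T' + t)))) \<le> (\<Sum>p\<in>P. euler_log k \<sigma> (T' + t) p) + 2 * tail N"
   using zeta_tail_bound[OF \<sigma> k, of "T' + t" N] unfolding tail_def R_def r_def P_def abs_le_iff by argo
  also have "(\<Sum>p\<in>P. euler_log k \<sigma> (T' + t) p) \<le> (\<Sum>p\<in>P. factor_log k (r p) (- k * e p * cos (t * u p)) + 4 * pi * \<rho>)"
   by (intro sum_mono ph)
  also have "\<dots> = (\<Sum>p\<in>P. factor_log k (r p) (- k * e p * cos (t * u p))) + real (card P) * (4 * pi * \<rho>)"
   by (simp add: sum.distrib)
  also have "real (card P) * (4 * pi * \<rho>) \<le> \<epsilon>'"
  proof -
   have "real (card P) * (4 * pi * \<rho>) = \<epsilon>' * (real (card P) / (real (card P) + 1))" by (simp add: \<rho>_def)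
   also have "\<dots> \<le> \<epsilon>' * 1" using \<epsilon>' by (intro mult_left_mono) auto
   finally show ?thesis by simp
  qed
  finally have "k * ln (norm (zeta (Complex \<sigma> (T' + t)))) \<le> 3 * \<epsilon>' + (\<Sum>p\<in>P. factor_log k (r p) (- k * e p * cos (t * u p)))"
   using N(1) by simp
  hence "zeta_power k \<sigma> (T' + t) \<le> exp (3 * \<epsilon>' + (\<Sum>p\<in>P. factor_log k (r p) (- k * e p * cos (t * u p))))" by simp
  thus ?thesis using P(1) by (simp add: exp_add exp_sum F_def)
 qed
 have cz: "continuous_on S (zeta_power k \<sigma>)" for S
  by (intro continuous_on_exp continuous_on_ln_norm_zeta \<sigma>)
 have cD: "continuous_on {-\<eta>..\<eta>} D" unfolding D_def r_def u_def by (rule continuous_on_prime_cos_sum[OF \<sigma> \<theta>(1)])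
 define T where "T = T' - \<eta>"
 have "integral {T..T + 2 * \<eta>} (zeta_power k \<sigma>) = integral {-\<eta>..\<eta>} ((zeta_power k \<sigma>) \<circ> (+) T')"
  unfolding integral_shift_Icc_real by (simp add: T_def add.commute)
 also have "\<dots> \<le> integral {-\<eta>..\<eta>} (\<lambda>t. exp (3 * \<epsilon>') * (\<Prod>p\<in>P. F (e p) p t))"
 proof (rule integral_le)
  show "((zeta_power k \<sigma>) \<circ> (+) T') integrable_on {-\<eta>..\<eta>}"
   by (intro integrable_continuous_real continuous_on_compose cz continuous_intros)
  show "(\<lambda>t. exp (3 * \<epsilon>') * (\<Prod>p\<in>P. F (e p) p t)) integrable_on {-\<eta>..\<eta>}"
   by (intro integrable_continuous_real continuous_intros cF e(1))
 qed (use point in simp)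
 also have "\<dots> = exp (3 * \<epsilon>') * integral {-\<eta>..\<eta>} (\<lambda>t. \<Prod>p\<in>P. F (e p) p t)" by simp
 also have "\<dots> \<le> exp (3 * \<epsilon>') * integral {-\<eta>..\<eta>} (\<lambda>t. exp B * exp (- D t))"
 proof (rule mult_left_mono)
  have "integral {-\<eta>..\<eta>} (\<lambda>t. \<Prod>p\<in>P. F (e p) p t) \<le> integral {-\<eta>..\<eta>} (\<lambda>t. \<Prod>p\<in>P. (1 + \<theta> p) / 2 * F 1 p t + (1 - \<theta> p) / 2 * F (-1) p t)"
   using e(2) by simp
  also have "\<dots> \<le> integral {-\<eta>..\<eta>} (\<lambda>t. exp B * exp (- D t))"
  proof (rule integral_le)
   show "(\<lambda>t. \<Prod>p\<in>P. (1 + \<theta> p) / 2 * F 1 p t + (1 - \<theta> p) / 2 * F (-1) p t) integrable_on {-\<eta>..\<eta>}"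
    by (intro integrable_continuous_real continuous_intros cF) auto
   show "(\<lambda>t. exp B * exp (- D t)) integrable_on {-\<eta>..\<eta>}"
    by (intro integrable_continuous_real continuous_intros cD)
  qed (use mix in \<open>auto simp: abs_le_iff\<close>)
  finally show "integral {-\<eta>..\<eta>} (\<lambda>t. \<Prod>p\<in>P. F (e p) p t) \<le> integral {-\<eta>..\<eta>} (\<lambda>t. exp B * exp (- D t))" .
 qed simp
 also have "\<dots> = exp (3 * \<epsilon>' + B) * integral {-\<eta>..\<eta>} (\<lambda>t. exp (- D t))" by (simp add: exp_add)
 also have "3 * \<epsilon>' + B = corr_sum_at k \<sigma> + 21 * log_square_sum * \<eta>^2 + \<epsilon>" by (simp add: B_def \<epsilon>'_def)
 finally have "integral {T..T + 2 * \<eta>} (zeta_power k \<sigma>) \<le> exp (corr_sum_at k \<sigma> + 21 * log_square_sum * \<eta>^2 + \<epsilon>) * integral {-\<eta>..\<eta>} (\<lambda>t. exp (- D t))" .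
 moreover have "T \<ge> T0" using T'(1) by (simp add: T_def)
 ultimately show ?thesis unfolding D_def r_def u_def by blast
qed

text \<open>\<sigma> is fixed before \<open>T0\<close>, so one \<sigma> serves for arbitrarily large
  T; the liminf with the infimum over \<sigma> outside requires this order. A single index j meets
  both limits, that of \<open>corr_sum_at\<close> and that of the nearly constant prime sum.\<close>

theorem zeta_power_integral_upper:
 assumes k: "k = 1 \<or> k = -1"
 obtains C \<delta>0 where "C > 0" "\<delta>0 > 0" "\<And>\<delta> \<epsilon>. 0 < \<delta> ==> \<delta> \<le> \<delta>0 ==> \<epsilon> > 0 ==>
  \<exists>\<sigma>>1. \<forall>T0. \<exists>T\<ge>T0. integral {T..T + \<delta>} (zeta_power k \<sigma>)
   \<le> \<delta> * exp (corr_sum k - sinc_prime_sum (\<delta>/2) + C * \<delta>^2 + \<epsilon>)"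
proof -
 obtain c A where c: "0 < c" "c \<le> 1/4" and A: "A holomorphic_on ball 1 c"
  "\<And>s. s \<in> ball 1 c ==> Re s > 1 ==> prime_zeta s = - Ln (s - 1) + A s"
  "(\<lambda>n. if prime n then 1 / real n + ln (1 - 1 / real n) else 0) sums Re (A 1)"
  by (rule prime_zeta_near_1) (rule that)
 obtain C \<eta>0 where C: "C > 0" "\<eta>0 > 0" and H: "\<forall>\<eta>. 0 < \<eta> \<and> \<eta> \<le> \<eta>0 \<longrightarrow> (\<exists>\<theta>. (\<forall>n. \<bar>\<theta> n\<bar> \<le> 1) \<and> (\<forall>n. \<theta> n = 1 \<or> 1 \<le> \<eta> * ln (real n)) \<and>
  (\<forall>\<epsilon>>0. \<forall>\<^sub>F j in sequentially. integral {-\<eta>..\<eta>} (\<lambda>t. exp (- prime_cos_sum \<theta> (1 + c/4 / real (Suc j)) t))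
   \<le> 2 * \<eta> * exp (- sinc_prime_sum \<eta> + C * \<eta>^2 + \<epsilon>)))"
  by (rule nearly_constant_prime_sum[OF c A(1)]) (rule A(2), assumption, assumption, rule that)
 have L: "log_square_sum \<ge> 0" unfolding log_square_sum_def by (intro suminf_nonneg summable_log_square) auto
 show ?thesis
 proof (rule that[of "C + 21 * log_square_sum" "min (2 * \<eta>0) (2/3)"])
  show "C + 21 * log_square_sum > 0" using C L by simp
  show "min (2 * \<eta>0) (2/3) > 0" using C by simp
  fix \<delta> \<epsilon> :: real assume d: "0 < \<delta>" "\<delta> \<le> min (2 * \<eta>0) (2/3)" and \<epsilon>: "\<epsilon> > 0"
  define \<eta> where "\<eta> = \<delta>/2"
  have \<eta>: "0 < \<eta>" "\<eta> \<le> \<eta>0" "\<eta> \<le> 1/3" "2 * \<eta> = \<delta>" using d by (auto simp: \<eta>_def)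
  obtain \<theta> where \<theta>: "\<And>n. \<bar>\<theta> n\<bar> \<le> 1" "\<And>n. \<theta> n = 1 \<or> 1 \<le> \<eta> * ln (real n)"
   and ev: "\<forall>\<epsilon>>0. \<forall>\<^sub>F j in sequentially. integral {-\<eta>..\<eta>} (\<lambda>t. exp (- prime_cos_sum \<theta> (1 + c/4 / real (Suc j)) t))
   \<le> 2 * \<eta> * exp (- sinc_prime_sum \<eta> + C * \<eta>^2 + \<epsilon>)"
   using H \<eta> by blast
  define s where "s = (\<lambda>j. 1 + c/4 / real (Suc j))"
  have s1: "s j > 1" for j using c by (simp add: s_def)
  have "s \<longlonglongrightarrow> 1" unfolding s_def by real_asymp
  hence "(\<lambda>j. corr_sum_at k (s j)) \<longlonglongrightarrow> corr_sum k" by (intro tendsto_corr_sum_at k s1)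
  hence e1: "\<forall>\<^sub>F j in sequentially. corr_sum_at k (s j) < corr_sum k + \<epsilon>/3" using \<epsilon> by (intro order_tendstoD) auto
  have e2: "\<forall>\<^sub>F j in sequentially. integral {-\<eta>..\<eta>} (\<lambda>t. exp (- prime_cos_sum \<theta> (s j) t))
   \<le> 2 * \<eta> * exp (- sinc_prime_sum \<eta> + C * \<eta>^2 + \<epsilon>/3)" using ev \<epsilon> unfolding s_def by simp
  obtain j where j: "corr_sum_at k (s j) < corr_sum k + \<epsilon>/3"
   "integral {-\<eta>..\<eta>} (\<lambda>t. exp (- prime_cos_sum \<theta> (s j) t))
   \<le> 2 * \<eta> * exp (- sinc_prime_sum \<eta> + C * \<eta>^2 + \<epsilon>/3)"
   using eventually_conj[OF e1 e2] by (auto simp: eventually_sequentially)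
  have "\<exists>T\<ge>T0. integral {T..T + \<delta>} (zeta_power k (s j))
   \<le> \<delta> * exp (corr_sum k - sinc_prime_sum (\<delta>/2) + (C + 21 * log_square_sum) * \<delta>^2 + \<epsilon>)" for T0
  proof -
   obtain T where T: "T \<ge> T0" "integral {T..T + 2 * \<eta>} (zeta_power k (s j))
     \<le> exp (corr_sum_at k (s j) + 21 * log_square_sum * \<eta>^2 + \<epsilon>/3) *
    integral {-\<eta>..\<eta>} (\<lambda>t. exp (- prime_cos_sum \<theta> (s j) t))"
    using zeta_power_integral_upper_fixed[where \<theta> = \<theta>, OF k s1[of j] \<eta>(1,3) \<theta>, of "\<epsilon>/3" T0] \<epsilon> by auto
   note T(2)
   also have "exp (corr_sum_at k (s j) + 21 * log_square_sum * \<eta>^2 + \<epsilon>/3) *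
     integral {-\<eta>..\<eta>} (\<lambda>t. exp (- prime_cos_sum \<theta> (s j) t))
    \<le> exp (corr_sum_at k (s j) + 21 * log_square_sum * \<eta>^2 + \<epsilon>/3) * (2 * \<eta> * exp (- sinc_prime_sum \<eta> + C * \<eta>^2 + \<epsilon>/3))"
    by (intro mult_left_mono j) auto
   also have "\<dots> = \<delta> * exp ((corr_sum_at k (s j) + 21 * log_square_sum * \<eta>^2 + \<epsilon>/3) + (- sinc_prime_sum \<eta> + C * \<eta>^2 + \<epsilon>/3))"
    unfolding exp_add[of "corr_sum_at k (s j) + 21 * log_square_sum * \<eta>^2 + \<epsilon>/3"] \<eta>(4)[symmetric] by (simp only: mult_ac)
   also have "\<dots> \<le> \<delta> * exp (corr_sum k - sinc_prime_sum (\<delta>/2) + (C + 21 * log_square_sum) * \<delta>^2 + \<epsilon>)"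
   proof -
    have "\<eta>^2 \<le> \<delta>^2" using d by (intro power_mono) (auto simp: \<eta>_def)
    hence "(C + 21 * log_square_sum) * \<eta>^2 \<le> (C + 21 * log_square_sum) * \<delta>^2" using C L by (intro mult_left_mono) auto
    hence "(corr_sum_at k (s j) + 21 * log_square_sum * \<eta>^2 + \<epsilon>/3) + (- sinc_prime_sum \<eta> + C * \<eta>^2 + \<epsilon>/3) \<le> corr_sum k - sinc_prime_sum (\<delta>/2) + (C + 21 * log_square_sum) * \<delta>^2 + \<epsilon>"
     using j(1) unfolding \<eta>_def[symmetric] distrib_right by argo
    thus ?thesis using d by (intro mult_left_mono) auto
   qed
   finally show ?thesis using T(1) unfolding \<eta>(4) by blast
  qed
  thus "\<exists>\<sigma>>1. \<forall>T0. \<exists>T\<ge>T0. integral {T..T + \<delta>} (zeta_power k \<sigma>)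
   \<le> \<delta> * exp (corr_sum k - sinc_prime_sum (\<delta>/2) + (C + 21 * log_square_sum) * \<delta>^2 + \<epsilon>)"
   using s1[of j] by blast
 qed
qed

section \<open>The quadratic estimates\<close>

lemma norm_zeta_2: "norm (zeta (Complex 2 0)) = pi^2 / 6"
proof -
 have "1 / of_nat (Suc n) powr (Complex 2 0) = complex_of_real (1 / (real n + 1)^2)" for n
 proof -
  have "Complex 2 0 = of_nat 2" by (simp add: complex_eq_iff)
  hence "of_nat (Suc n) powr (Complex 2 0) = (of_nat (Suc n) :: complex) ^ 2" by (simp only: powr_nat' of_nat_eq_0_iff) auto
  thus ?thesis by (simp add: add.commute)
 qed
 moreover have "(\<lambda>n. complex_of_real (1 / (real n + 1)^2)) sums of_real (pi^2 / 6)"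
  using inverse_squares_sums by (intro sums_of_real) (simp add: add.commute)
 ultimately have "zeta (Complex 2 0) = of_real (pi^2 / 6)" unfolding zeta_def by (simp add: sums_iff)
 thus ?thesis by (simp only: norm_of_real) simp
qed

text \<open>1 + 1/p and 1 - 1/p multiply to 1 - p^-2, so the difference of the two sums is the
  logarithm of the Euler product at 2, where zeta has the value pi^2/6.\<close>

lemma corr_sum_1: "corr_sum 1 = corr_sum (-1) + ln (pi^2 / 6)"
proof -
 have "(\<lambda>N. \<Sum>p\<in>primes_upto N. euler_log 1 2 0 p) \<longlonglongrightarrow> ln (pi^2 / 6)"
  using ln_norm_zeta_limit[of 2 1 0] norm_zeta_2 by simp
 moreover have "(\<Sum>p\<in>primes_upto N. euler_log 1 2 0 p) = (\<Sum>p\<in>primes_upto N. prime_corr 1 p) - (\<Sum>p\<in>primes_upto N. prime_corr (-1) p)" for N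
  unfolding sum_subtractf[symmetric]
 proof (rule sum.cong)
  fix p assume "p \<in> primes_upto N"
  hence p: "prime p" by (rule prime_of_primes_upto)
  have p2: "real p \<ge> 2" using ln_prime_ge[OF p] by simp
  define q where "q = 1 / real p"
  have q: "0 < q" "q < 1" using p2 by (auto simp: q_def)
  have "real p powr (-2) = q^2" using p2 by (simp add: q_def powr_minus_divide power_divide)
  hence "euler_log 1 2 0 p = - (ln (1 - 2 * q^2 + (q^2)^2) / 2)"
   using euler_log_eq(1)[OF p, of 2 1 0] by simp
  also have "1 - 2 * q^2 + (q^2)^2 = ((1 + q) * (1 - q))^2" by (simp add: power2_eq_square algebra_simps)
  also have "ln (((1 + q) * (1 - q))^2) = 2 * (ln (1 + q) + ln (1 - q))" using q by (simp add: ln_realpow ln_mult)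
  finally show "euler_log 1 2 0 p = prime_corr 1 p - prime_corr (-1) p" by (simp add: prime_corr_def q_def add_divide_distrib)
 qed simp
 moreover have "(\<lambda>N. (\<Sum>p\<in>primes_upto N. prime_corr 1 p) - (\<Sum>p\<in>primes_upto N. prime_corr (-1) p)) \<longlonglongrightarrow> corr_sum 1 - corr_sum (-1)"
  unfolding corr_sum_def by (intro tendsto_diff sums_primes_upto summable_sums summable_prime_corr) auto
 ultimately have "corr_sum 1 - corr_sum (-1) = ln (pi^2 / 6)" by (simp add: LIMSEQ_unique)
 thus ?thesis by simp
qed

text \<open>Up to a factor exp (O(\<delta>^2)), exp (- \<open>sinc_prime_sum (\<delta>/2)\<close>)
  is \<delta>/4 times exp (- \<gamma> - \<open>corr_sum (-1)\<close>); this is the origin of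
  \<open>c\<close>. The bounds keep their exponential factors, which turn into O(\<delta>^4) on a
  bounded range of \<delta>.\<close>

lemma zeta_power_integral_estimates:
 assumes k: "k = 1 \<or> k = -1"
 defines "I \<equiv> \<lambda>\<delta> T \<sigma>. integral {T..T + \<delta>} (zeta_power k \<sigma>)"
  and "c \<equiv> exp (corr_sum k - corr_sum (-1) - euler_mascheroni) / 4"
 obtains K \<delta>0 where "K > 0" "\<delta>0 > 0"
  "\<And>\<delta> T \<sigma>. 0 < \<delta> ==> \<delta> \<le> \<delta>0 ==> \<sigma> > 1 ==> c * \<delta>^2 * exp (- (K * \<delta>^2)) \<le> I \<delta> T \<sigma>"
  "\<And>\<delta>. 0 < \<delta> ==> \<delta> \<le> \<delta>0 ==> \<exists>\<sigma>>1. \<forall>T0. \<exists>T\<ge>T0. I \<delta> T \<sigma> \<le> c * \<delta>^2 * exp (K * \<delta>^2)"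
proof -
 obtain c' A where c': "0 < c'" "c' \<le> 1/4" and A: "A holomorphic_on ball 1 c'"
  "\<And>s. s \<in> ball 1 c' ==> Re s > 1 ==> prime_zeta s = - Ln (s - 1) + A s"
  and A1: "(\<lambda>n. if prime n then 1 / real n + ln (1 - 1 / real n) else 0) sums Re (A 1)"
  by (rule prime_zeta_near_1) (rule that)
 have "(\<lambda>n. if prime n then 1 / real n + ln (1 - 1 / real n) else 0) = (\<lambda>n. if prime n then prime_corr (-1) n else 0)"
  by (simp add: fun_eq_iff prime_corr_def)
 with A1 have A1: "Re (A 1) = corr_sum (-1)" by (simp add: corr_sum_def sums_iff)
 obtain M where M: "M > 0" "\<And>\<eta>. 0 < \<eta> ==> \<eta> \<le> c'/4 ==> \<eta> \<le> 1 ==>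
  \<bar>sinc_prime_sum \<eta> - (- ln \<eta> + ln 2 + euler_mascheroni + Re (A 1))\<bar> \<le> M * \<eta>^2"
  by (rule sinc_prime_sum_asymptotics[OF c'(1) A(1)]) (rule A(2), assumption, assumption, rule that)
 obtain C \<delta>1 where C: "C > 0" "\<delta>1 > 0" and U: "\<And>\<delta> \<epsilon>. 0 < \<delta> ==> \<delta> \<le> \<delta>1 ==> \<epsilon> > 0 ==>
  \<exists>\<sigma>>1. \<forall>T0. \<exists>T\<ge>T0. integral {T..T + \<delta>} (zeta_power k \<sigma>) \<le> \<delta> * exp (corr_sum k - sinc_prime_sum (\<delta>/2) + C * \<delta>^2 + \<epsilon>)"
  by (rule zeta_power_integral_upper[OF k]) (rule that)
 have L: "log_square_sum \<ge> 0" unfolding log_square_sum_def by (intro suminf_nonneg summable_log_square) auto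
 define K where "K = M + C + 1 + log_square_sum"
 define \<delta>0 where "\<delta>0 = min \<delta>1 (min (c'/2) 1)"
 have S: "\<bar>sinc_prime_sum (\<delta>/2) - (- ln (\<delta>/2) + ln 2 + euler_mascheroni + corr_sum (-1))\<bar> \<le> M * \<delta>^2"
  if "0 < \<delta>" "\<delta> \<le> \<delta>0" for \<delta>
 proof -
  have "\<bar>sinc_prime_sum (\<delta>/2) - (- ln (\<delta>/2) + ln 2 + euler_mascheroni + corr_sum (-1))\<bar> \<le> M * (\<delta>/2)^2"
   using M(2)[of "\<delta>/2"] that unfolding A1 by (simp add: \<delta>0_def)
  also have "\<dots> \<le> M * \<delta>^2" using M that by (intro mult_left_mono power_mono) auto
  finally show ?thesis .
 qed
 have cd: "c * \<delta>^2 = \<delta> * exp (corr_sum k - (- ln (\<delta>/2) + ln 2 + euler_mascheroni + corr_sum (-1)))" if "\<delta> > 0" for \<delta>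
 proof -
  have "corr_sum k - (- ln (\<delta>/2) + ln 2 + euler_mascheroni + corr_sum (-1)) = (corr_sum k - corr_sum (-1) - euler_mascheroni) + (ln (\<delta>/2) - ln 2)" by simp
  also have "exp \<dots> = exp (corr_sum k - corr_sum (-1) - euler_mascheroni) * (\<delta>/2/2)"
   using that by (subst exp_add) (simp add: exp_diff)
  finally show ?thesis by (simp add: c_def power2_eq_square)
 qed
 show ?thesis
 proof (rule that[of K \<delta>0])
  show "K > 0" using M C L by (simp add: K_def)
  show "\<delta>0 > 0" using C c' by (simp add: \<delta>0_def)
 next
  fix \<delta> T \<sigma> :: real assume d: "0 < \<delta>" "\<delta> \<le> \<delta>0" and \<sigma>: "\<sigma> > 1"
  have "c * \<delta>^2 * exp (- (K * \<delta>^2)) = \<delta> * exp (corr_sum k - (- ln (\<delta>/2) + ln 2 + euler_mascheroni + corr_sum (-1)) + - (K * \<delta>^2))"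
   unfolding cd[OF d(1)] exp_add by simp
  also have "\<dots> \<le> \<delta> * exp (corr_sum k - sinc_prime_sum (\<delta>/2) - 2 * log_square_sum * (\<delta>/2)^2)"
  proof -
   have "2 * log_square_sum * (\<delta>/2)^2 \<le> log_square_sum * \<delta>^2" using L by (simp add: power_divide)
   moreover have "0 \<le> C * \<delta>^2" using C by simp
   moreover have "K * \<delta>^2 = M * \<delta>^2 + C * \<delta>^2 + \<delta>^2 + log_square_sum * \<delta>^2" by (simp add: K_def distrib_right)
   ultimately have "corr_sum k - (- ln (\<delta>/2) + ln 2 + euler_mascheroni + corr_sum (-1)) + - (K * \<delta>^2) \<le> corr_sum k - sinc_prime_sum (\<delta>/2) - 2 * log_square_sum * (\<delta>/2)^2"
    using S[OF d] zero_le_power2[of \<delta>] unfolding abs_le_iff by argo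
   thus ?thesis using d by (intro mult_left_mono) auto
  qed
  also have "\<dots> \<le> I \<delta> T \<sigma>" unfolding I_def by (rule zeta_power_integral_lower[OF k \<sigma> d(1)])
  finally show "c * \<delta>^2 * exp (- (K * \<delta>^2)) \<le> I \<delta> T \<sigma>" .
 next
  fix \<delta> :: real assume d: "0 < \<delta>" "\<delta> \<le> \<delta>0"
  have "\<delta> * exp (corr_sum k - sinc_prime_sum (\<delta>/2) + C * \<delta>^2 + \<delta>^2) \<le> \<delta> * exp (corr_sum k - (- ln (\<delta>/2) + ln 2 + euler_mascheroni + corr_sum (-1)) + K * \<delta>^2)"
  proof -
   have "K * \<delta>^2 = M * \<delta>^2 + C * \<delta>^2 + \<delta>^2 + log_square_sum * \<delta>^2" by (simp add: K_def distrib_right)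
   moreover have "0 \<le> log_square_sum * \<delta>^2" using L by simp
   ultimately have "corr_sum k - sinc_prime_sum (\<delta>/2) + C * \<delta>^2 + \<delta>^2 \<le> corr_sum k - (- ln (\<delta>/2) + ln 2 + euler_mascheroni + corr_sum (-1)) + K * \<delta>^2"
    using S[OF d] unfolding abs_le_iff by argo
   thus ?thesis using d by (intro mult_left_mono) auto
  qed
  also have "\<dots> = c * \<delta>^2 * exp (K * \<delta>^2)" unfolding cd[OF d(1)] exp_add by simp
  finally have le: "\<delta> * exp (corr_sum k - sinc_prime_sum (\<delta>/2) + C * \<delta>^2 + \<delta>^2) \<le> c * \<delta>^2 * exp (K * \<delta>^2)" .
  \<comment> \<open>The free \<epsilon> of the upper bound is spent as \<delta>^2.\<close>
  have "\<exists>\<sigma>>1. \<forall>T0. \<exists>T\<ge>T0. I \<delta> T \<sigma> \<le> \<delta> * exp (corr_sum k - sinc_prime_sum (\<delta>/2) + C * \<delta>^2 + \<delta>^2)"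
   unfolding I_def using d by (intro U) (auto simp: \<delta>0_def)
  thus "\<exists>\<sigma>>1. \<forall>T0. \<exists>T\<ge>T0. I \<delta> T \<sigma> \<le> c * \<delta>^2 * exp (K * \<delta>^2)" using le by (meson order_trans)
 qed
qed

lemma ereal_abs_diff_le:
 assumes "ereal l \<le> x" "x \<le> ereal h" "a - C \<le> l" "h \<le> a + C"
 shows "\<bar>x - ereal a\<bar> \<le> ereal C"
proof (cases x)
 case (real r)
 thus ?thesis using assms by (simp add: abs_le_iff)
qed (use assms in auto)

text \<open>The three quantities satisfy \<open>f1\<close> \<le> \<open>f2\<close> \<le>
  \<open>f3\<close>, so a lower bound for the first and an upper bound for the last settle all of
  them. A value reached for arbitrarily large T at a single \<sigma> bounds
  \<open>f3\<close>.\<close>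

lemma quadratic_estimates:
 fixes I :: "real \<Rightarrow> real \<Rightarrow> real \<Rightarrow> real"
 assumes pos: "c > 0" "K > 0" "\<delta>0 > 0" "B \<ge> 0"
  and nonneg: "\<And>\<delta> T \<sigma>. 0 < \<delta> ==> \<sigma> > 1 ==> 0 \<le> I \<delta> T \<sigma>"
  and lower: "\<And>\<delta> T \<sigma>. 0 < \<delta> ==> \<delta> \<le> \<delta>0 ==> \<sigma> > 1 ==> c * \<delta>^2 * exp (- (K * \<delta>^2)) \<le> I \<delta> T \<sigma>"
  and upper: "\<And>\<delta>. 0 < \<delta> ==> \<delta> \<le> \<delta>0 ==> \<exists>\<sigma>>1. \<forall>T0. \<exists>T\<ge>T0. I \<delta> T \<sigma> \<le> c * \<delta>^2 * exp (K * \<delta>^2)"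
  and crude: "\<And>\<delta> T. 0 < \<delta> ==> I \<delta> T 2 \<le> B * \<delta>"
 shows "quadratic_estimate (\<lambda>\<delta>. INF (T, \<sigma>) \<in> (UNIV :: real set) \<times> {1<..}. ereal (I \<delta> T \<sigma>)) c" (is ?A)
  "quadratic_estimate (\<lambda>\<delta>. Liminf at_top (\<lambda>T. INF \<sigma>\<in>{1<..}. ereal (I \<delta> T \<sigma>))) c" (is ?B)
  "quadratic_estimate (\<lambda>\<delta>. INF \<sigma>\<in>{1<..}. Liminf at_top (\<lambda>T. ereal (I \<delta> T \<sigma>))) c" (is ?C)
proof -
 define f1 where "f1 = (\<lambda>\<delta>. INF (T, \<sigma>) \<in> (UNIV :: real set) \<times> {1<..}. ereal (I \<delta> T \<sigma>))"
 define f2 where "f2 = (\<lambda>\<delta>. Liminf at_top (\<lambda>T. INF \<sigma>\<in>{1<..}. ereal (I \<delta> T \<sigma>)))"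
 define f3 where "f3 = (\<lambda>\<delta>. INF \<sigma>\<in>{1<..}. Liminf at_top (\<lambda>T. ereal (I \<delta> T \<sigma>)))"
 \<comment> \<open>The first summand handles the exponential factors for \<delta> \<le> \<delta>0.
   The second is for \<delta> > \<delta>0, where the trivial bounds 0 and B \<delta> suffice, since
   \<delta>^2 and \<delta> are then bounded by multiples of \<delta>^4.\<close>
 define C where "C = c * K * exp (K * \<delta>0^2) + (c / \<delta>0^2 + B / \<delta>0^3)"
 have f12: "f1 \<delta> \<le> f2 \<delta>" for \<delta>
  unfolding f2_def
 proof (intro Liminf_bounded always_eventually allI INF_greatest)
  fix T \<sigma> :: real assume "\<sigma> \<in> {1<..}"
  hence "(T, \<sigma>) \<in> UNIV \<times> {1<..}" by simp
  thus "f1 \<delta> \<le> ereal (I \<delta> T \<sigma>)" unfolding f1_def by (rule INF_lower2) simp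
 qed
 have f23: "f2 \<delta> \<le> f3 \<delta>" for \<delta>
  unfolding f3_def f2_def by (intro INF_greatest Liminf_mono always_eventually allI INF_lower) auto
 have f3: "f3 \<delta> \<le> ereal h" if "\<sigma> > 1" "\<forall>T0. \<exists>T\<ge>T0. I \<delta> T \<sigma> \<le> h" for \<delta> \<sigma> h
 proof -
  have "f3 \<delta> \<le> Liminf at_top (\<lambda>T. ereal (I \<delta> T \<sigma>))" unfolding f3_def using that by (intro INF_lower) auto
  also have "\<dots> \<le> ereal h"
  proof (rule ccontr)
   assume "\<not> Liminf at_top (\<lambda>T. ereal (I \<delta> T \<sigma>)) \<le> ereal h"
   hence "\<forall>\<^sub>F T in at_top. ereal h < ereal (I \<delta> T \<sigma>)" by (intro less_LiminfD) simp
   then obtain T0 where "\<And>T. T \<ge> T0 ==> h < I \<delta> T \<sigma>" by (auto simp: eventually_at_top_linorder)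
   thus False using that(2) by (meson not_le)
  qed
  finally show ?thesis .
 qed
 have f1: "ereal l \<le> f1 \<delta>" if "\<And>T \<sigma>. \<sigma> > 1 ==> l \<le> I \<delta> T \<sigma>" for \<delta> l
  unfolding f1_def using that by (intro INF_greatest) auto
 have E1: "exp (K * \<delta>0^2) \<ge> 1" using pos by simp
 have C0: "C \<ge> c * K * exp (K * \<delta>0^2)" "C \<ge> c / \<delta>0^2 + B / \<delta>0^3" using pos by (auto simp: C_def)
 have "\<exists>l h. ereal l \<le> f1 \<delta> \<and> f3 \<delta> \<le> ereal h \<and> c * \<delta>^2 - C * \<delta>^4 \<le> l \<and> h \<le> c * \<delta>^2 + C * \<delta>^4" if d: "\<delta> > 0" for \<delta>
 proof (cases "\<delta> \<le> \<delta>0")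
  case True
  define x where "x = K * \<delta>^2"
  have x: "0 \<le> x" "x \<le> K * \<delta>0^2" using pos d True by (auto simp: x_def intro!: power_mono)
  obtain \<sigma> where "\<sigma> > 1" "\<forall>T0. \<exists>T\<ge>T0. I \<delta> T \<sigma> \<le> c * \<delta>^2 * exp x" using upper[OF d True] unfolding x_def by blast
  hence "f3 \<delta> \<le> ereal (c * \<delta>^2 * exp x)" by (rule f3)
  moreover have "ereal (c * \<delta>^2 * exp (- x)) \<le> f1 \<delta>" unfolding x_def by (intro f1 lower d True)
  moreover have "c * \<delta>^2 * x * exp (K * \<delta>0^2) \<le> C * \<delta>^4"
  proof -
   have "c * K * exp (K * \<delta>0^2) * \<delta>^4 \<le> C * \<delta>^4" using C0 by (intro mult_right_mono) auto
   moreover have "c * \<delta>^2 * x * exp (K * \<delta>0^2) = c * K * exp (K * \<delta>0^2) * \<delta>^4" by (simp add: x_def power2_eq_square power4_eq_xxxx)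
   ultimately show ?thesis by linarith
  qed
  moreover have "c * \<delta>^2 * exp x \<le> c * \<delta>^2 + c * \<delta>^2 * x * exp (K * \<delta>0^2)"
  proof -
   have "(1 - x) * exp x \<le> exp (-x) * exp x" using exp_ge_add_one_self[of "-x"] by (intro mult_right_mono) auto
   hence "exp x \<le> 1 + x * exp x" by (simp add: algebra_simps flip: exp_add)
   also have "x * exp x \<le> x * exp (K * \<delta>0^2)" using x by (intro mult_left_mono) auto
   finally have "c * \<delta>^2 * exp x \<le> c * \<delta>^2 * (1 + x * exp (K * \<delta>0^2))" using pos by (intro mult_left_mono) auto
   thus ?thesis by (simp add: algebra_simps)
  qed
  moreover have "c * \<delta>^2 - c * \<delta>^2 * x * exp (K * \<delta>0^2) \<le> c * \<delta>^2 * exp (-x)"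
  proof -
   have "c * \<delta>^2 * (1 - x) \<le> c * \<delta>^2 * exp (-x)" using exp_ge_add_one_self[of "-x"] pos by (intro mult_left_mono) auto
   moreover have "c * \<delta>^2 * x * 1 \<le> c * \<delta>^2 * x * exp (K * \<delta>0^2)" using pos x E1 by (intro mult_left_mono) auto
   ultimately show ?thesis by (simp add: right_diff_distrib)
  qed
  ultimately show ?thesis by (intro exI[of _ "c * \<delta>^2 * exp (-x)"] exI[of _ "c * \<delta>^2 * exp x"]) auto
 next
  case False
  have "ereal 0 \<le> f1 \<delta>" by (intro f1 nonneg d)
  moreover have "f3 \<delta> \<le> ereal (B * \<delta>)" by (rule f3[of 2]) (use crude[OF d] in auto)
  moreover have "c * \<delta>^2 + B * \<delta> \<le> C * \<delta>^4"
  proof -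
   define y where "y = \<delta> / \<delta>0"
   have y: "y \<ge> 1" using False pos by (simp add: y_def)
   have "c * \<delta>^2 * 1 \<le> c * \<delta>^2 * y^2" "B * \<delta> * 1 \<le> B * \<delta> * y^3" using pos d y by (intro mult_left_mono one_le_power mult_nonneg_nonneg; simp)+
   moreover have "c * \<delta>^2 * y^2 + B * \<delta> * y^3 = (c / \<delta>0^2 + B / \<delta>0^3) * \<delta>^4"
    using pos by (simp add: y_def power_divide distrib_right power_numeral_reduce)
   moreover have "(c / \<delta>0^2 + B / \<delta>0^3) * \<delta>^4 \<le> C * \<delta>^4" using C0 by (intro mult_right_mono) auto
   ultimately show ?thesis by linarith
  qed
  moreover have "B * \<delta> \<ge> 0" "c * \<delta>^2 \<ge> 0" using pos d by auto
  ultimately show ?thesis by (intro exI[of _ 0] exI[of _ "B * \<delta>"]) auto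
 qed
 hence *: "\<bar>f \<delta> - ereal (c * \<delta>^2)\<bar> \<le> ereal (C * \<delta>^4)" if "\<delta> > 0" "f1 \<delta> \<le> f \<delta>" "f \<delta> \<le> f3 \<delta>" for f \<delta>
  using that by (meson ereal_abs_diff_le order_trans)
 have "quadratic_estimate f1 c" "quadratic_estimate f2 c" "quadratic_estimate f3 c"
  unfolding quadratic_estimate_def using * f12 f23 by (meson order_refl order_trans)+
 thus ?A ?B ?C
  unfolding f1_def f2_def f3_def by auto
qed

lemma zeta_power_quadratic_estimates:
 assumes k: "k = 1 \<or> k = -1"
  and I: "\<And>\<delta> T \<sigma>. \<sigma> > 1 ==> I \<delta> T \<sigma> = integral {T..T + \<delta>} (zeta_power k \<sigma>)"
  and c: "c = exp (corr_sum k - corr_sum (-1) - euler_mascheroni) / 4"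
 shows "quadratic_estimate (\<lambda>\<delta>. INF (T, \<sigma>) \<in> (UNIV :: real set) \<times> {1<..}. ereal (I \<delta> T \<sigma>)) c" (is ?A)
  "quadratic_estimate (\<lambda>\<delta>. Liminf at_top (\<lambda>T. INF \<sigma>\<in>{1<..}. ereal (I \<delta> T \<sigma>))) c" (is ?B)
  "quadratic_estimate (\<lambda>\<delta>. INF \<sigma>\<in>{1<..}. Liminf at_top (\<lambda>T. ereal (I \<delta> T \<sigma>))) c" (is ?C)
proof -
 obtain K \<delta>0 where K: "K > 0" "\<delta>0 > 0"
  and lower: "\<And>\<delta> T \<sigma>. 0 < \<delta> ==> \<delta> \<le> \<delta>0 ==> \<sigma> > 1 ==> c * \<delta>^2 * exp (- (K * \<delta>^2)) \<le> integral {T..T + \<delta>} (zeta_power k \<sigma>)"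
  and upper: "\<And>\<delta>. 0 < \<delta> ==> \<delta> \<le> \<delta>0 ==> \<exists>\<sigma>>1. \<forall>T0. \<exists>T\<ge>T0. integral {T..T + \<delta>} (zeta_power k \<sigma>) \<le> c * \<delta>^2 * exp (K * \<delta>^2)"
  by (rule zeta_power_integral_estimates[OF k, folded c]) (rule that)
 \<comment> \<open>With no Euler factor split off, \<open>zeta_tail_bound\<close> bounds |ln |zeta||
   by \<open>b\<close> on the line Re s = 2. This is the crude bound for large \<delta>.\<close>
 define b where "b = 2 * (\<Sum>n. if prime n then real n powr (-2) else 0)"
 have int: "(zeta_power k \<sigma>) integrable_on {T..T + \<delta>}" if "\<sigma> > 1" for \<sigma> T \<delta>
  by (intro integrable_continuous_real continuous_on_exp continuous_on_ln_norm_zeta that)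
 have c0: "c > 0" by (simp add: c)
 have nonneg: "0 \<le> I \<delta> T \<sigma>" if "0 < \<delta>" "\<sigma> > 1" for \<delta> T \<sigma>
  unfolding I[OF that(2)] by (rule Henstock_Kurzweil_Integration.integral_nonneg[OF int[OF that(2)]]) simp
 have crude: "I \<delta> T 2 \<le> exp b * \<delta>" if d: "0 < \<delta>" for \<delta> T
 proof -
  have "integral {T..T + \<delta>} (zeta_power k 2) \<le> integral {T..T + \<delta>} (\<lambda>t. exp b)"
  proof (rule integral_le[OF int integrable_const_ivl])
   fix t
   have "primes_upto 0 = {}" by (auto simp: primes_upto_def)
   thus "zeta_power k 2 t \<le> exp b"
    using zeta_tail_bound[OF _ k, of 2 t 0] by (simp add: b_def abs_le_iff)
  qed simp
  thus ?thesis using d I[of 2] by (simp add: mult.commute)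
 qed
 show ?A ?B ?C
 proof -
  have lower': "c * \<delta>^2 * exp (- (K * \<delta>^2)) \<le> I \<delta> T \<sigma>" if "0 < \<delta>" "\<delta> \<le> \<delta>0" "\<sigma> > 1" for \<delta> T \<sigma>
   using lower[OF that] I[OF that(3)] by simp
  have upper': "\<exists>\<sigma>>1. \<forall>T0. \<exists>T\<ge>T0. I \<delta> T \<sigma> \<le> c * \<delta>^2 * exp (K * \<delta>^2)" if "0 < \<delta>" "\<delta> \<le> \<delta>0" for \<delta>
  proof -
   obtain \<sigma> where s: "\<sigma> > 1" "\<forall>T0. \<exists>T\<ge>T0. integral {T..T + \<delta>} (zeta_power k \<sigma>) \<le> c * \<delta>^2 * exp (K * \<delta>^2)"
    using upper[OF \<open>0 < \<delta>\<close> \<open>\<delta> \<le> \<delta>0\<close>] by blast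
   thus ?thesis by (intro exI[of _ \<sigma>]) (simp add: I)
  qed
  note q = quadratic_estimates[where I = I and B = "exp b", OF c0 K, OF exp_ge_zero nonneg lower' upper' crude]
  show ?A ?B ?C
   by (rule q; assumption)+
 qed
qed

text \<open>With the liminf over T, the infimum over \<sigma> can be read inside or outside of it;
  both readings are asserted, next to the plain infimum, for zeta and for its inverse.\<close>

theorem theorem4:
 "quadratic_estimate
    (\<lambda>\<delta>. INF (T, \<sigma>) \<in> (UNIV :: real set) \<times> {1<..}. ereal (zeta_integral \<delta> T \<sigma>))
    (pi^2 * exp (- euler_mascheroni) / 24) \<and>
  quadratic_estimate
    (\<lambda>\<delta>. INF (T, \<sigma>) \<in> (UNIV :: real set) \<times> {1<..}. ereal (zeta_inv_integral \<delta> T \<sigma>))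
    (exp (- euler_mascheroni) / 4) \<and>
  quadratic_estimate
    (\<lambda>\<delta>. Liminf at_top (\<lambda>T. INF \<sigma>\<in>{1<..}. ereal (zeta_integral \<delta> T \<sigma>)))
    (pi^2 * exp (- euler_mascheroni) / 24) \<and>
  quadratic_estimate
    (\<lambda>\<delta>. INF \<sigma>\<in>{1<..}. Liminf at_top (\<lambda>T. ereal (zeta_integral \<delta> T \<sigma>)))
    (pi^2 * exp (- euler_mascheroni) / 24) \<and>
  quadratic_estimate
    (\<lambda>\<delta>. Liminf at_top (\<lambda>T. INF \<sigma>\<in>{1<..}. ereal (zeta_inv_integral \<delta> T \<sigma>)))
    (exp (- euler_mascheroni) / 4) \<and>
  quadratic_estimate
    (\<lambda>\<delta>. INF \<sigma>\<in>{1<..}. Liminf at_top (\<lambda>T. ereal (zeta_inv_integral \<delta> T \<sigma>)))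
    (exp (- euler_mascheroni) / 4)"
proof -
 have pos: "norm (zeta (Complex \<sigma> t)) > 0" if "\<sigma> > 1" for \<sigma> t using zeta_nonzero[of "Complex \<sigma> t"] that by simp
 have I1: "zeta_integral \<delta> T \<sigma> = integral {T..T + \<delta>} (\<lambda>t. exp (1 * ln (norm (zeta (Complex \<sigma> t)))))" if "\<sigma> > 1" for \<delta> T \<sigma>
  unfolding zeta_integral_def using pos[OF that] by simp
 have I2: "zeta_inv_integral \<delta> T \<sigma> = integral {T..T + \<delta>} (\<lambda>t. exp (-1 * ln (norm (zeta (Complex \<sigma> t)))))" if "\<sigma> > 1" for \<delta> T \<sigma>
  unfolding zeta_inv_integral_def using pos[OF that] by (simp add: exp_minus)
 have c1: "pi^2 * exp (- euler_mascheroni) / 24 = exp (corr_sum 1 - corr_sum (-1) - euler_mascheroni) / (4::real)"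
 proof -
  have "exp (corr_sum 1 - corr_sum (-1) - euler_mascheroni) = exp (ln (pi\<^sup>2 / 6) + - euler_mascheroni)" by (simp add: corr_sum_1)
  also have "\<dots> = pi\<^sup>2 / 6 * exp (- euler_mascheroni)" by (subst exp_add) simp
  finally show ?thesis by simp
 qed
 have c2: "exp (- euler_mascheroni) / 4 = exp (corr_sum (-1) - corr_sum (-1) - euler_mascheroni) / (4::real)" by simp
 have k: "(1::real) = 1 \<or> (1::real) = -1" "(-1::real) = 1 \<or> (-1::real) = -1" by auto
 show ?thesis
  by (intro conjI zeta_power_quadratic_estimates[OF k(1) I1 c1] zeta_power_quadratic_estimates[OF k(2) I2 c2])
qed

end
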